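(* Let $P$ be an $n$-dimensional nice manifold with corners, $\xi:\mathcal F(P)\to\mathbb{Z}^n$ a rational characteristic function, and $\mu:E\to P$ a topological principal $T^n$-bundle over $P$, where $E$ is a nice manifold with corners and $\mu$ preserves the face structure. Then the space $X(P,\xi,\mu)$ is a locally standard torus orbifold over $P$ with the orbit map $\pi:X(P,\xi,\mu)\to P$, $\pi([x])=\mu(x)$.
   Context: All orbifolds are smooth and effective; $T^n=(S^1)^n$. A manifold with corners of dimension $n$ is locally modelled on open subsets of $\mathbb{R}^n_{\ge0}$; codimension-one faces are facets, and $\mathcal F(P)$ is the set of facets. It is nice if every codimension-2 face is a connected component of the intersection of a unique collection of two facets (then every codimension-$k$ face is a component of the intersection of a unique set of $k$ facets). All manifolds with corners are assumed nice, orientable and smooth. A map $f$ is $\theta$-equivariant, for a homomorphism $\theta$, if $f(gx)=\theta(g)f(x)$. Notation: $M=\mathbb{Z}^n$; for a submodule $K\subseteq M$ put $K_{\mathbb R}=K\otimes_{\mathbb Z}\mathbb{R}$, $T_K=K_{\mathbb R}/K$, $\widetilde K=K_{\mathbb R}\cap M$; $\zeta_K:T_K\to T_{\widetilde K}$ is the induced surjection with kernel $\cong\widetilde K/K$, and $T_{\widetilde K}\hookrightarrow T_M\cong T^n$. Rational characteristic function: $\xi:\mathcal F(P)\to\mathbb{Z}^n$ such that $\xi(F_{i_1}),\dots,\xi(F_{i_k})$ are linearly independent whenever $F_{i_1}\cap\dots\cap F_{i_k}\ne\emptyset$. Locally standard torus orbifold: a $2n$-dimensional connected closed effective orbifold with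 underlying space $X$ and an effective $T_M$-action such that every $x\in X$ has a $T_M$-invariant neighborhood $U$, a rank $n$ submodule $N\subseteq M$, and an orbifold chart $(\widetilde U,G,\varphi)$ over $U$ with $G=\ker\zeta_N$. Here $\widetilde U$ is $\delta$-equivariantly diffeomorphic to an open set in $\mathbb{C}^n$ with the standard (coordinatewise) $T^n$-action for some isomorphism $\delta:T_N\to T^n$, and $\varphi$ is $\zeta_N$-equivariant and induces an equivariant homeomorphism $\widetilde U/G\cong U$. It is said to be over its orbit space. Construction of $X(P,\xi,\mu)$: for a codimension-$k$ face $F$ of $P$, a component of $F_{i_1}\cap\dots\cap F_{i_k}$ for unique facets $F_{i_j}$, let $K(F)=\langle\xi(F_{i_1}),\dots,\xi(F_{i_k})\rangle\subseteq\mathbb{Z}^n$ ($K(P)=0$), and let $T_F\subseteq T^n$ be the image of $T_{K(F)}\to T_{\widetilde K(F)}\hookrightarrow T^n$, a rank $k$ subtorus ($T_P=1$). Put $X(P,\xi,\mu)=E/\sim$, where $x\sim y$ iff $\mu(x)=\mu(y)$ and $x=ty$ for some $t\in T_F$, with $F$ the face containing $\mu(x)$ in its relative interior; $[x]$ denotes the class of $x$. The $T^n$-action is induced from $E$. The orbifold structure is given by the following charts. For $\mu(x)$ in the relative interior of a codimension-$k$ face $F$, take a neighborhood $U_x\cong\mathbb{R}^k_{\ge0}\times\mathbb{R}^{n-k}_{>0}$ over which $E$ is trivial and a splitting $\mathbb{Z}^n\cong\widetilde K(F)\oplus K(F)^\perp$, $K(F)^\perp=\mathbb{Z}^n/\widetilde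 K(F)$. Let $V_x=(T_{K(F)}\times T_{K(F)^\perp}\times U_x)/\sim_F$, where $(t_1,s_1,q_1)\sim_F(t_2,s_2,q_2)$ iff $q_1=q_2$, $s_1=s_2$, $t_2^{-1}t_1\in T_{K(F')}$, with $F'$ the face containing $q_1$ in its relative interior. Then $V_x\cong\mathbb{C}^k\times(\mathbb{C}^* )^{n-k}$ via polar coordinates. The chart group is $G_F=\ker\zeta_{K(F)}\cong\widetilde K(F)/K(F)$ and the chart map is induced by $\zeta_{K(F)}\times\mathrm{id}\times\mathrm{id}$.
   Formalization: P is additionally assumed compact, connected and nonempty (and n ≥ 1): a torus orbifold is by definition closed and connected with an effective action, so the claim fails otherwise, e.g. P = [0,∞) gives X = ℂ, which is not closed. *)

theory Defs
  imports "HOL-Analysis.Analysis" "HOL-Algebra.Group_Action" "HOL-Algebra.Generated_Groups"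
begin

section \<open>Quotient topologies and smooth maps\<close>

definition quotient_topology :: "'a topology \<Rightarrow> ('a \<Rightarrow> 'b) \<Rightarrow> 'b topology" where
  "quotient_topology X f =
    topology (\<lambda>U. U \<subseteq> f ` topspace X \<and> openin X {x \<in> topspace X. f x \<in> U})"

lemma openin_quotient_topology:
  "openin (quotient_topology X f) U \<longleftrightarrow>
    U \<subseteq> f ` topspace X \<and> openin X {x \<in> topspace X. f x \<in> U}"
proof -
  have "istopology (\<lambda>U. U \<subseteq> f ` topspace X \<and> openin X {x \<in> topspace X. f x \<in> U})"
    (is "istopology ?L")
    unfolding istopology_def
  proof (rule conjI; intro allI impI)
    fix S T assume S: "?L S" and T: "?L T"
    have "{x \<in> topspace X. f x \<in> S \<inter> T} =
        {x \<in> topspace X. f x \<in> S} \<inter> {x \<in> topspace X. f x \<in> T}"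
      by auto
    with S T show "?L (S \<inter> T)"
      by (auto intro: openin_Int)
  next
    fix \<K> assume K: "\<forall>S\<in>\<K>. ?L S"
    have "{x \<in> topspace X. f x \<in> \<Union>\<K>} = \<Union>((\<lambda>S. {x \<in> topspace X. f x \<in> S}) ` \<K>)"
      by auto
    with K show "?L (\<Union>\<K>)"
      by auto
  qed
  then show ?thesis
    unfolding quotient_topology_def by (subst topology_inverse') (assumption, rule refl)
qed

lemma topspace_quotient_topology: "topspace (quotient_topology X f) = f ` topspace X"
proof
  show "topspace (quotient_topology X f) \<subseteq> f ` topspace X"
    using openin_topspace [of "quotient_topology X f"] unfolding openin_quotient_topology
    by (rule conjunct1)
  have "{x \<in> topspace X. f x \<in> f ` topspace X} = topspace X"
    by auto
  then have "openin (quotient_topology X f) (f ` topspace X)"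
    by (simp add: openin_quotient_topology)
  then show "f ` topspace X \<subseteq> topspace (quotient_topology X f)"
    by (rule openin_subset)
qed

primrec C_k_on :: "nat \<Rightarrow> ('a::euclidean_space \<Rightarrow> 'b::real_normed_vector) \<Rightarrow> 'a set \<Rightarrow> bool" where
  "C_k_on 0 f S \<longleftrightarrow> continuous_on S f"
| "C_k_on (Suc k) f S \<longleftrightarrow>
    (\<forall>x\<in>S. f differentiable (at x)) \<and> (\<forall>v. C_k_on k (\<lambda>x. frechet_derivative f (at x) v) S)"

text \<open>On an arbitrary (not necessarily open) subset, smooth means: locally the restriction of a
  smooth map defined on an open set. This is the usual convention at boundary points.\<close>

definition smooth_on :: "('a::euclidean_space) set \<Rightarrow> ('a \<Rightarrow> 'b::real_normed_vector) \<Rightarrow> bool" where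
  "smooth_on A f \<longleftrightarrow>
    (\<forall>x\<in>A. \<exists>U g. open U \<and> x \<in> U \<and> (\<forall>k. C_k_on k g U) \<and> (\<forall>y \<in> A \<inter> U. g y = f y))"

definition diffeomorphism_on ::
    "('a::euclidean_space) set \<Rightarrow> ('b::euclidean_space) set \<Rightarrow> ('a \<Rightarrow> 'b) \<Rightarrow> bool" where
  "diffeomorphism_on A B f \<longleftrightarrow>
    bij_betw f A B \<and> smooth_on A f \<and> smooth_on B (the_inv_into A f)"


section \<open>Manifolds with corners\<close>

type_synonym ('p, 'n) corner_chart = "'p set \<times> ('p \<Rightarrow> real ^ 'n)"

definition orthant :: "(real ^ 'n::finite) set" where
  "orthant = {x. \<forall>i. 0 \<le> x $ i}"

definition corner_chart :: "'p topology \<Rightarrow> ('p, 'n::finite) corner_chart \<Rightarrow> bool" where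
  "corner_chart X \<kappa> \<longleftrightarrow> (case \<kappa> of (U, c) \<Rightarrow>
    openin X U \<and> openin (top_of_set orthant) (c ` U) \<and>
    homeomorphic_map (subtopology X U) (top_of_set (c ` U)) c)"

definition corner_transition_smooth ::
    "('p, 'n::finite) corner_chart \<Rightarrow> ('p, 'n) corner_chart \<Rightarrow> bool" where
  "corner_transition_smooth \<kappa> \<kappa>' \<longleftrightarrow> (case (\<kappa>, \<kappa>') of ((U, c), (V, d)) \<Rightarrow>
    smooth_on (c ` (U \<inter> V)) (\<lambda>q. d (the_inv_into U c q)))"

definition manifold_with_corners :: "'p topology \<Rightarrow> ('p, 'n::finite) corner_chart set \<Rightarrow> bool" where
  "manifold_with_corners X \<A> \<longleftrightarrow>
    Hausdorff_space X \<and> second_countable X \<and>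
    (\<forall>\<kappa>\<in>\<A>. corner_chart X \<kappa>) \<and> (\<Union>(fst ` \<A>)) = topspace X \<and>
    (\<forall>\<kappa>\<in>\<A>. \<forall>\<kappa>'\<in>\<A>. corner_transition_smooth \<kappa> \<kappa>')"

text \<open>The charts of the maximal atlas determined by the given one.\<close>

definition smooth_corner_chart ::
    "'p topology \<Rightarrow> ('p, 'n::finite) corner_chart set \<Rightarrow> ('p, 'n) corner_chart \<Rightarrow> bool" where
  "smooth_corner_chart X \<A> \<kappa> \<longleftrightarrow> corner_chart X \<kappa> \<and>
    (\<forall>\<kappa>'\<in>\<A>. corner_transition_smooth \<kappa> \<kappa>' \<and> corner_transition_smooth \<kappa>' \<kappa>)"

definition stratum :: "'p topology \<Rightarrow> ('p, 'n::finite) corner_chart set \<Rightarrow> nat \<Rightarrow> 'p set" where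
  "stratum X \<A> k = {x \<in> topspace X. \<exists>(U, c)\<in>\<A>. x \<in> U \<and> card {i. c x $ i = 0} = k}"

text \<open>The codimension-\<open>k\<close> faces are the closures of the components of the codimension-\<open>k\<close> stratum.\<close>

definition faces :: "'p topology \<Rightarrow> ('p, 'n::finite) corner_chart set \<Rightarrow> nat \<Rightarrow> 'p set set" where
  "faces X \<A> k =
    (\<lambda>S. X closure_of S) ` connected_components_of (subtopology X (stratum X \<A> k))"

abbreviation facets :: "'p topology \<Rightarrow> ('p, 'n::finite) corner_chart set \<Rightarrow> 'p set set" where
  "facets X \<A> \<equiv> faces X \<A> 1"

definition face_interior ::
    "'p topology \<Rightarrow> ('p, 'n::finite) corner_chart set \<Rightarrow> nat \<Rightarrow> 'p set \<Rightarrow> 'p set" where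
  "face_interior X \<A> k F = F \<inter> stratum X \<A> k"

definition component_of_facets ::
    "'p topology \<Rightarrow> ('p, 'n::finite) corner_chart set \<Rightarrow> nat \<Rightarrow> 'p set \<Rightarrow> 'p set set \<Rightarrow> bool" where
  "component_of_facets X \<A> k F \<G> \<longleftrightarrow>
    \<G> \<subseteq> facets X \<A> \<and> finite \<G> \<and> card \<G> = k \<and>
    F \<in> connected_components_of (subtopology X (\<Inter>\<G>))"

definition nice :: "'p topology \<Rightarrow> ('p, 'n::finite) corner_chart set \<Rightarrow> bool" where
  "nice X \<A> \<longleftrightarrow> (\<forall>F\<in>faces X \<A> 2. \<exists>!\<G>. component_of_facets X \<A> 2 F \<G>)"

text \<open>Meaningful for nice manifolds with corners, where such a collection of facets exists and is
  unique for every codimension-\<open>k\<close> face.\<close>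

definition face_facets ::
    "'p topology \<Rightarrow> ('p, 'n::finite) corner_chart set \<Rightarrow> nat \<Rightarrow> 'p set \<Rightarrow> 'p set set" where
  "face_facets X \<A> k F = (THE \<G>. component_of_facets X \<A> k F \<G>)"

text \<open>An orientation is a locally constant sign \<open>s \<kappa>\<close> on each chart domain, recording whether the
  chart preserves it. Merely asking for an atlas with positive Jacobians would be wrong here: charts
  take values in the fixed model \<open>orthant\<close>, and for instance a closed interval has no such atlas.\<close>

definition orientable :: "'p topology \<Rightarrow> ('p, 'n::finite) corner_chart set \<Rightarrow> bool" where
  "orientable X \<A> \<longleftrightarrow>
    (\<exists>s. (\<forall>\<kappa>\<in>\<A>. continuous_map (subtopology X (fst \<kappa>)) euclideanreal (s \<kappa>) \<and>
              s \<kappa> ` fst \<kappa> \<subseteq> {-1, 1}) \<and>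
         (\<forall>(U, c)\<in>\<A>. \<forall>(V, d)\<in>\<A>. \<forall>x \<in> U \<inter> V \<inter> stratum X \<A> 0.
            0 < s (U, c) x * s (V, d) x *
              det (matrix (frechet_derivative (\<lambda>q. d (the_inv_into U c q)) (at (c x))))))"


section \<open>Lattices and tori\<close>

definition additive_group :: "'a::ab_group_add set \<Rightarrow> 'a monoid" where
  "additive_group S = \<lparr>carrier = S, monoid.mult = (+), one = 0\<rparr>"

definition vec_of_int :: "int ^ 'n::finite \<Rightarrow> real ^ 'n" where
  "vec_of_int m = (\<chi> i. of_int (m $ i))"

abbreviation submodule_of_ints :: "(int ^ 'n::finite) set \<Rightarrow> bool" where
  "submodule_of_ints K \<equiv> subgroup K (additive_group UNIV)"

text \<open>\<open>K\<^sub>\<real> = K \<otimes> \<real>\<close>, realised inside \<open>\<real>\<^sup>n\<close>.\<close>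

definition real_span :: "(int ^ 'n::finite) set \<Rightarrow> (real ^ 'n) set" where
  "real_span K = span (vec_of_int ` K)"

definition lattice_rank :: "(int ^ 'n::finite) set \<Rightarrow> nat" where
  "lattice_rank K = dim (real_span K)"

definition saturation :: "(int ^ 'n::finite) set \<Rightarrow> (int ^ 'n) set" where
  "saturation K = {m. vec_of_int m \<in> real_span K}"

text \<open>\<open>T\<^sub>K = K\<^sub>\<real> / K\<close>; its elements are cosets. The torus \<open>T\<^sup>n\<close> acting on bundles and orbifolds is
  \<open>T\<^sub>M = torus UNIV\<close>.\<close>

definition torus :: "(int ^ 'n::finite) set \<Rightarrow> (real ^ 'n) set monoid" where
  "torus K = additive_group (real_span K) Mod (vec_of_int ` K)"

definition lattice_coset :: "(int ^ 'n::finite) set \<Rightarrow> real ^ 'n \<Rightarrow> (real ^ 'n) set" where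
  "lattice_coset K v = (vec_of_int ` K) #>\<^bsub>additive_group UNIV\<^esub> v"

definition torus_topology :: "(int ^ 'n::finite) set \<Rightarrow> (real ^ 'n) set topology" where
  "torus_topology K = quotient_topology (top_of_set (real_span K)) (lattice_coset K)"

text \<open>For \<open>K \<subseteq> L\<close>, the map \<open>T\<^sub>K \<rightarrow> T\<^sub>L\<close> induced by \<open>K\<^sub>\<real> \<subseteq> L\<^sub>\<real>\<close> sends the coset \<open>v + K\<close> to
  \<open>v + L = (v + K) + L\<close>.\<close>

definition torus_map :: "(int ^ 'n::finite) set \<Rightarrow> (real ^ 'n) set \<Rightarrow> (real ^ 'n) set" where
  "torus_map L S = {v + vec_of_int m | v m. v \<in> S \<and> m \<in> L}"

definition zeta :: "(int ^ 'n::finite) set \<Rightarrow> (real ^ 'n) set \<Rightarrow> (real ^ 'n) set" where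
  "zeta K = torus_map (saturation K)"

text \<open>\<open>(S\<^sup>1)\<^sup>n\<close>; the standard action on \<open>\<complex>\<^sup>n\<close> is the componentwise product \<open>s * z\<close>.\<close>

definition circle_power :: "(complex ^ 'n::finite) monoid" where
  "circle_power = \<lparr>carrier = {s. \<forall>i. norm (s $ i) = 1}, monoid.mult = (*), one = 1\<rparr>"

definition cis_vec :: "real ^ 'n::finite \<Rightarrow> complex ^ 'n" where
  "cis_vec \<theta> = (\<chi> i. cis (2 * pi * \<theta> $ i))"


section \<open>Effective orbifolds and locally standard torus orbifolds\<close>

type_synonym ('m, 'x) orbi_chart = "'m set \<times> ('m \<Rightarrow> 'm) set \<times> ('m \<Rightarrow> 'x)"

text \<open>The group of a chart is a group of self-diffeomorphisms of its domain, so it acts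
  effectively.\<close>

definition orbifold_chart :: "'x topology \<Rightarrow> ('m::euclidean_space, 'x) orbi_chart \<Rightarrow> bool" where
  "orbifold_chart X \<kappa> \<longleftrightarrow> (case \<kappa> of (V, G, \<phi>) \<Rightarrow>
    open V \<and> connected V \<and> V \<noteq> {} \<and>
    finite G \<and> subgroup G (BijGroup V) \<and> (\<forall>g\<in>G. smooth_on V g) \<and>
    openin X (\<phi> ` V) \<and> quotient_map (top_of_set V) (subtopology X (\<phi> ` V)) \<phi> \<and>
    (\<forall>u\<in>V. \<forall>v\<in>V. \<phi> u = \<phi> v \<longleftrightarrow> (\<exists>g\<in>G. g u = v)))"

definition orbifold_embedding ::
    "('m::euclidean_space, 'x) orbi_chart \<Rightarrow> ('m, 'x) orbi_chart \<Rightarrow> ('m \<Rightarrow> 'm) \<Rightarrow> bool" where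
  "orbifold_embedding \<kappa> \<kappa>' h \<longleftrightarrow> (case (\<kappa>, \<kappa>') of ((V, G, \<phi>), (W, H, \<psi>)) \<Rightarrow>
    h ` V \<subseteq> W \<and> open (h ` V) \<and> diffeomorphism_on V (h ` V) h \<and> (\<forall>v\<in>V. \<psi> (h v) = \<phi> v))"

definition orbi_chart_range :: "('m, 'x) orbi_chart \<Rightarrow> 'x set" where
  "orbi_chart_range \<kappa> = (case \<kappa> of (V, G, \<phi>) \<Rightarrow> \<phi> ` V)"

definition orbi_compatible ::
    "'x topology \<Rightarrow> ('m::euclidean_space, 'x) orbi_chart \<Rightarrow> ('m, 'x) orbi_chart \<Rightarrow> bool" where
  "orbi_compatible X \<kappa> \<kappa>' \<longleftrightarrow>
    (\<forall>x \<in> orbi_chart_range \<kappa> \<inter> orbi_chart_range \<kappa>'.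
      \<exists>\<omega> h h'. orbifold_chart X \<omega> \<and> x \<in> orbi_chart_range \<omega> \<and>
        orbi_chart_range \<omega> \<subseteq> orbi_chart_range \<kappa> \<inter> orbi_chart_range \<kappa>' \<and>
        orbifold_embedding \<omega> \<kappa> h \<and> orbifold_embedding \<omega> \<kappa>' h')"

text \<open>The dimension of the orbifold is \<open>DIM('m)\<close>; charts are modelled on open sets without
  boundary.\<close>

definition orbifold :: "'x topology \<Rightarrow> ('m::euclidean_space, 'x) orbi_chart set \<Rightarrow> bool" where
  "orbifold X \<A> \<longleftrightarrow>
    Hausdorff_space X \<and> second_countable X \<and>
    (\<forall>\<kappa>\<in>\<A>. orbifold_chart X \<kappa>) \<and> \<Union>(orbi_chart_range ` \<A>) = topspace X \<and>
    (\<forall>\<kappa>\<in>\<A>. \<forall>\<kappa>'\<in>\<A>. orbi_compatible X \<kappa> \<kappa>')"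

definition smooth_orbi_chart ::
    "'x topology \<Rightarrow> ('m::euclidean_space, 'x) orbi_chart set \<Rightarrow> ('m, 'x) orbi_chart \<Rightarrow> bool" where
  "smooth_orbi_chart X \<A> \<kappa> \<longleftrightarrow> orbifold_chart X \<kappa> \<and>
    (\<forall>\<kappa>'\<in>\<A>. orbi_compatible X \<kappa> \<kappa>')"

text \<open>Here \<open>N\<close> is the rank \<open>n\<close> submodule, \<open>\<rho>\<close> the action of \<open>T\<^sub>N\<close> on the chart domain \<open>V\<close>, and
  \<open>f\<close> the \<open>\<delta>\<close>-equivariant diffeomorphism onto an open subset \<open>W\<close> of \<open>\<complex>\<^sup>n\<close>. The chart group is
  \<open>ker \<zeta>\<^sub>N\<close>, acting through \<open>\<rho>\<close>. Note that \<open>saturation N = UNIV\<close>, as \<open>N\<close> has rank \<open>n\<close>.\<close>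

definition standard_orbi_chart ::
    "((real ^ 'n::finite) set \<Rightarrow> 'x \<Rightarrow> 'x) \<Rightarrow> (complex ^ 'n, 'x) orbi_chart \<Rightarrow> bool" where
  "standard_orbi_chart act \<kappa> \<longleftrightarrow> (case \<kappa> of (V, G, \<phi>) \<Rightarrow>
    (\<exists>(N :: (int ^ 'n) set) \<rho> \<delta> f W.
      submodule_of_ints N \<and> lattice_rank N = CARD('n) \<and>
      group_action (torus N) V \<rho> \<and>
      \<delta> \<in> iso (torus N) circle_power \<and>
      homeomorphic_map (torus_topology N) (top_of_set (carrier circle_power)) \<delta> \<and>
      open (W :: (complex ^ 'n) set) \<and> diffeomorphism_on V W f \<and>
      (\<forall>t\<in>carrier (torus N). \<forall>v\<in>V. f (\<rho> t v) = \<delta> t * f v) \<and>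
      G = \<rho> ` kernel (torus N) (torus (saturation N)) (zeta N) \<and>
      (\<forall>t\<in>carrier (torus N). \<forall>v\<in>V. \<phi> (\<rho> t v) = act (zeta N t) (\<phi> v))))"

definition locally_standard_torus_orbifold ::
    "'x topology \<Rightarrow> ((real ^ 'n::finite) set \<Rightarrow> 'x \<Rightarrow> 'x) \<Rightarrow>
      (complex ^ 'n, 'x) orbi_chart set \<Rightarrow> bool" where
  "locally_standard_torus_orbifold X act \<A> \<longleftrightarrow>
    orbifold X \<A> \<and> compact_space X \<and> connected_space X \<and> topspace X \<noteq> {} \<and>
    faithful_action (torus UNIV) (topspace X) act \<and>
    continuous_map (prod_topology (torus_topology UNIV) X) X (\<lambda>(t, x). act t x) \<and>
    (\<forall>x\<in>topspace X. \<exists>\<kappa>. smooth_orbi_chart X \<A> \<kappa> \<and> x \<in> orbi_chart_range \<kappa> \<and>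
      (\<forall>t\<in>carrier (torus UNIV). act t ` orbi_chart_range \<kappa> \<subseteq> orbi_chart_range \<kappa>) \<and>
      standard_orbi_chart act \<kappa>)"

text \<open>\<open>\<pi>\<close> induces a homeomorphism from the orbit space \<open>X / T\<^sup>n\<close> to \<open>P\<close>.\<close>

definition orbit_map ::
    "'x topology \<Rightarrow> ((real ^ 'n::finite) set \<Rightarrow> 'x \<Rightarrow> 'x) \<Rightarrow> 'p topology \<Rightarrow> ('x \<Rightarrow> 'p) \<Rightarrow> bool" where
  "orbit_map X act P \<pi> \<longleftrightarrow> quotient_map X P \<pi> \<and>
    (\<forall>x\<in>topspace X. \<forall>y\<in>topspace X.
      \<pi> x = \<pi> y \<longleftrightarrow> orbit (torus UNIV) act x = orbit (torus UNIV) act y)"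


section \<open>Characteristic data and the construction\<close>

definition rational_characteristic ::
    "'p topology \<Rightarrow> ('p, 'n::finite) corner_chart set \<Rightarrow> ('p set \<Rightarrow> int ^ 'n) \<Rightarrow> bool" where
  "rational_characteristic P \<A> \<xi> \<longleftrightarrow>
    (\<forall>\<G>. \<G> \<subseteq> facets P \<A> \<and> finite \<G> \<and> \<Inter>\<G> \<noteq> {} \<longrightarrow>
      (\<forall>a :: 'p set \<Rightarrow> int. (\<Sum>F\<in>\<G>. a F *s \<xi> F) = 0 \<longrightarrow> (\<forall>F\<in>\<G>. a F = 0)))"

definition principal_torus_bundle ::
    "'e topology \<Rightarrow> ((real ^ 'n::finite) set \<Rightarrow> 'e \<Rightarrow> 'e) \<Rightarrow> 'p topology \<Rightarrow> ('e \<Rightarrow> 'p) \<Rightarrow> bool" where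
  "principal_torus_bundle E act P \<mu> \<longleftrightarrow>
    group_action (torus UNIV) (topspace E) act \<and>
    continuous_map (prod_topology (torus_topology UNIV) E) E (\<lambda>(t, x). act t x) \<and>
    continuous_map E P \<mu> \<and>
    (\<forall>p\<in>topspace P. \<exists>U h. openin P U \<and> p \<in> U \<and>
      homeomorphic_map (prod_topology (subtopology P U) (torus_topology UNIV))
        (subtopology E {x \<in> topspace E. \<mu> x \<in> U}) h \<and>
      (\<forall>u\<in>U. \<forall>t\<in>carrier (torus UNIV). \<mu> (h (u, t)) = u \<and>
        (\<forall>s\<in>carrier (torus UNIV). h (u, s \<otimes>\<^bsub>torus UNIV\<^esub> t) = act s (h (u, t)))))"

definition preserves_faces ::
    "'e topology \<Rightarrow> ('e, 'd::finite) corner_chart set \<Rightarrow>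
      'p topology \<Rightarrow> ('p, 'n::finite) corner_chart set \<Rightarrow> ('e \<Rightarrow> 'p) \<Rightarrow> bool" where
  "preserves_faces E \<B> P \<A> \<mu> \<longleftrightarrow>
    (\<forall>k. faces E \<B> k = (\<lambda>F. {x \<in> topspace E. \<mu> x \<in> F}) ` faces P \<A> k)"

definition face_module ::
    "'p topology \<Rightarrow> ('p, 'n::finite) corner_chart set \<Rightarrow> ('p set \<Rightarrow> int ^ 'n) \<Rightarrow>
      nat \<Rightarrow> 'p set \<Rightarrow> (int ^ 'n) set" where
  "face_module P \<A> \<xi> k F = generate (additive_group UNIV) (\<xi> ` face_facets P \<A> k F)"

definition face_torus ::
    "'p topology \<Rightarrow> ('p, 'n::finite) corner_chart set \<Rightarrow> ('p set \<Rightarrow> int ^ 'n) \<Rightarrow>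
      nat \<Rightarrow> 'p set \<Rightarrow> (real ^ 'n) set set" where
  "face_torus P \<A> \<xi> k F = (let K = face_module P \<A> \<xi> k F in
    torus_map UNIV ` zeta K ` carrier (torus K))"

definition X_rel ::
    "'p topology \<Rightarrow> ('p, 'n::finite) corner_chart set \<Rightarrow> ('p set \<Rightarrow> int ^ 'n) \<Rightarrow>
      'e topology \<Rightarrow> ((real ^ 'n) set \<Rightarrow> 'e \<Rightarrow> 'e) \<Rightarrow> ('e \<Rightarrow> 'p) \<Rightarrow> ('e \<times> 'e) set" where
  "X_rel P \<A> \<xi> E act \<mu> =
    {(x, y). x \<in> topspace E \<and> y \<in> topspace E \<and> \<mu> x = \<mu> y \<and>
      (\<exists>k F t. F \<in> faces P \<A> k \<and> \<mu> x \<in> face_interior P \<A> k F \<and>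
        t \<in> face_torus P \<A> \<xi> k F \<and> x = act t y)}"

definition X_class ::
    "'p topology \<Rightarrow> ('p, 'n::finite) corner_chart set \<Rightarrow> ('p set \<Rightarrow> int ^ 'n) \<Rightarrow>
      'e topology \<Rightarrow> ((real ^ 'n) set \<Rightarrow> 'e \<Rightarrow> 'e) \<Rightarrow> ('e \<Rightarrow> 'p) \<Rightarrow> 'e \<Rightarrow> 'e set" where
  "X_class P \<A> \<xi> E act \<mu> x = X_rel P \<A> \<xi> E act \<mu> `` {x}"

definition X_space ::
    "'p topology \<Rightarrow> ('p, 'n::finite) corner_chart set \<Rightarrow> ('p set \<Rightarrow> int ^ 'n) \<Rightarrow>
      'e topology \<Rightarrow> ((real ^ 'n) set \<Rightarrow> 'e \<Rightarrow> 'e) \<Rightarrow> ('e \<Rightarrow> 'p) \<Rightarrow> 'e set topology" where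
  "X_space P \<A> \<xi> E act \<mu> = quotient_topology E (X_class P \<A> \<xi> E act \<mu>)"

text \<open>The induced action \<open>t [x] = [t x]\<close>: the class of \<open>t x\<close> is the image of the class of \<open>x\<close> under
  \<open>t\<close>.\<close>

definition X_act ::
    "'p topology \<Rightarrow> ('p, 'n::finite) corner_chart set \<Rightarrow> ('p set \<Rightarrow> int ^ 'n) \<Rightarrow>
      'e topology \<Rightarrow> ((real ^ 'n) set \<Rightarrow> 'e \<Rightarrow> 'e) \<Rightarrow> ('e \<Rightarrow> 'p) \<Rightarrow>
      (real ^ 'n) set \<Rightarrow> 'e set \<Rightarrow> 'e set" where
  "X_act P \<A> \<xi> E act \<mu> t = (\<lambda>C \<in> topspace (X_space P \<A> \<xi> E act \<mu>). act t ` C)"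

text \<open>
  The charts defining the orbifold structure, about the class of \<open>x\<close>. The chart \<open>(U, c)\<close> of \<open>P\<close> maps
  \<open>U\<close> onto the points that are nonnegative in the coordinates \<open>I\<close> and positive in the others;
  \<open>\<sigma>\<close> is the section of a trivialization of \<open>E\<close> over \<open>U\<close>; \<open>H i\<close> is the facet given by the vanishing
  of coordinate \<open>i \<in> I\<close>. The vectors \<open>b i\<close> are \<open>\<xi> (H i)\<close> for \<open>i \<in> I\<close>, which form a basis of
  \<open>K = K(F)\<close>, while for \<open>i \<notin> I\<close> they represent a basis of \<open>\<int>\<^sup>n\<close> modulo \<open>saturation K\<close>, which
  amounts to a splitting of \<open>\<int>\<^sup>n\<close> together with a basis of the complement. In these bases a point
  of \<open>T\<^sub>K \<times> T\<^sub>L \<times> U\<close>, with \<open>L\<close> the complement, has angles \<open>\<theta>\<close> and radial part \<open>q = c p\<close>, the polar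
  coordinate map to \<open>V = \<complex>\<^sup>k \<times> (\<complex>\<^sup>*)\<^sup>n\<^sup>-\<^sup>k\<close> collapses exactly the relation defining the local
  model, and \<open>\<zeta>\<^sub>K \<times> id \<times> id\<close> sends \<open>(\<theta>, q)\<close> to the class of
  \<open>(\<Sum>i. \<theta>\<^sub>i b\<^sub>i mod \<int>\<^sup>n) \<cdot> \<sigma> p\<close>.
  The polar coordinates are normalised by \<open>q\<^sub>i = \<bar>z\<^sub>i\<bar>\<^sup>2\<close>: a smooth change of coordinates of \<open>P\<close> near
  a facet has the form \<open>q\<^sub>i \<mapsto> q\<^sub>i h(q)\<close> with \<open>h\<close> positive and smooth, and it lifts to a smooth map
  \<open>z\<^sub>i \<mapsto> z\<^sub>i sqrt (h(q))\<close> with this normalisation, but in general not with \<open>q\<^sub>i = \<bar>z\<^sub>i\<bar>\<close>.\<close>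

definition X_chart ::
    "'p topology \<Rightarrow> ('p, 'n::finite) corner_chart set \<Rightarrow> ('p set \<Rightarrow> int ^ 'n) \<Rightarrow>
      'e topology \<Rightarrow> ((real ^ 'n) set \<Rightarrow> 'e \<Rightarrow> 'e) \<Rightarrow> ('e \<Rightarrow> 'p) \<Rightarrow>
      'e \<Rightarrow> (complex ^ 'n, 'e set) orbi_chart \<Rightarrow> bool" where
  "X_chart P \<A> \<xi> E act \<mu> x \<kappa> \<longleftrightarrow> (case \<kappa> of (V, G, \<phi>) \<Rightarrow>
    (\<exists>k F U c \<sigma> I H b. let K = face_module P \<A> \<xi> k F in
      F \<in> faces P \<A> k \<and> \<mu> x \<in> face_interior P \<A> k F \<and>
      smooth_corner_chart P \<A> (U, c) \<and> \<mu> x \<in> U \<and> card I = k \<and>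
      c ` U = {q. (\<forall>i\<in>I. 0 \<le> q $ i) \<and> (\<forall>i\<in>-I. 0 < q $ i)} \<and>
      continuous_map (subtopology P U) E \<sigma> \<and> (\<forall>p\<in>U. \<mu> (\<sigma> p) = p) \<and>
      bij_betw H I (face_facets P \<A> k F) \<and>
      (\<forall>i\<in>I. \<forall>p\<in>U. p \<in> H i \<longleftrightarrow> c p $ i = 0) \<and>
      (\<forall>i\<in>I. b i = \<xi> (H i)) \<and>
      (\<forall>m. \<exists>!a :: int ^ 'n. (\<forall>i\<in>I. a $ i = 0) \<and> m - (\<Sum>i\<in>-I. a $ i *s b i) \<in> saturation K) \<and>
      V = {z. \<forall>i\<in>-I. z $ i \<noteq> 0} \<and>
      G = {(\<lambda>z\<in>V. cis_vec \<theta> * z) | \<theta>. (\<forall>i\<in>-I. \<theta> $ i = 0) \<and>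
            lattice_coset K (\<Sum>i\<in>I. \<theta> $ i *\<^sub>R vec_of_int (b i))
              \<in> kernel (torus K) (torus (saturation K)) (zeta K)} \<and>
      (\<forall>\<theta>. \<forall>p\<in>U. \<phi> ((\<chi> i. of_real (sqrt (c p $ i))) * cis_vec \<theta>) =
        X_class P \<A> \<xi> E act \<mu>
          (act (lattice_coset UNIV (\<Sum>i\<in>UNIV. \<theta> $ i *\<^sub>R vec_of_int (b i))) (\<sigma> p)))))"

end

theory Submission imports Defs begin

text \<open>Over a corner chart of the base with coordinates \<open>c\<close>, the collapsed bundle is modelled by polar
  coordinates with moduli \<open>sqrt (c $ i)\<close>, where angle \<open>i\<close> moves the fibre along \<open>\<xi>\<close> of the facet
  \<open>c $ i = 0\<close>, and the chart group consists of the rotations by angles that combine to a lattice vector.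
  The bundle is only topological, so the sections underlying the charts are first deformed, by
  averaging lifts of their transition functions with a smooth partition of unity, until the
  transition lifts are smooth. Two charts are then compatible: a transition of corner charts
  multiplies each vanishing coordinate by a smooth positive function (division by a coordinate),
  hence lifts to a diffeomorphism that multiplies complex coordinates by smooth factors. On the
  remaining coordinates it changes angles by smooth functions that are well defined locally.\<close>

section \<open>Smooth maps\<close>

text \<open>Charts built on arbitrary continuous sections would not be compatible: two such sections
  differ by a merely continuous torus-valued function, which then relates the angles of the two
  charts. So the atlas does not contain every \<open>X_chart\<close>, only those over one fixed
  family of sections, which is finite by compactness of \<open>P\<close>. Niceness enters through a
  single fact: distinct vanishing coordinates of a model corner chart lie on distinct facets. Hence
  the coordinates vanishing at a point are in bijection with the facets through it, and two charts
  can be matched facet by facet, with equal vectors \<open>\<xi>\<close>. At a face with module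
  \<open>K\<close> a chart needs \<open>n\<close> lattice vectors: the characteristic vectors of its
  facets, completed by representatives of a basis of the lattice modulo the saturation of
  \<open>K\<close>. Together they generate the rank \<open>n\<close> module \<open>N\<close> that
  local standardness asks for. Lattice vectors then have integral coefficients outside
  \<open>K\<close>, so the kernel of \<open>zeta N\<close> rotates only the coordinates that vanish
  on the face and acts as the kernel of \<open>zeta K\<close> does.\<close>

lemma C_k_on_subset: "C_k_on k f S \<Longrightarrow> T \<subseteq> S \<Longrightarrow> C_k_on k f T"
  by (induction k arbitrary: f) (auto intro: continuous_on_subset)

lemma C_k_on_SucD: "C_k_on (Suc k) f S \<Longrightarrow> C_k_on k f S"
proof (induction k arbitrary: f)
  case 0
  then show ?case
    by (auto intro!: continuous_at_imp_continuous_on differentiable_imp_continuous_within)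
next
  case (Suc k)
  then show ?case
    unfolding C_k_on.simps(2)[of "Suc k"] C_k_on.simps(2)[of k f] by blast
qed

lemma C_k_on_has_derivative:
  "C_k_on (Suc k) f S \<Longrightarrow> x \<in> S \<Longrightarrow> (f has_derivative frechet_derivative f (at x)) (at x)"
  by (simp add: frechet_derivative_works)

lemma C_k_on_cong:
  assumes "open S" "\<And>x. x \<in> S \<Longrightarrow> f x = g x" "C_k_on k f S"
  shows "C_k_on k g S"
  using assms(2,3)
proof (induction k arbitrary: f g)
  case 0
  then show ?case by (simp cong: continuous_on_cong_simp)
next
  case (Suc k)
  have D: "(g has_derivative frechet_derivative f (at x)) (at x)" if "x \<in> S" for x
    using has_derivative_transform_within_open[OF C_k_on_has_derivative[OF Suc.prems(2) that] assms(1) that]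
      Suc.prems(1) by simp
  then have *: "frechet_derivative g (at x) = frechet_derivative f (at x)" if "x \<in> S" for x
    using frechet_derivative_at that by metis
  show ?case
    unfolding C_k_on.simps
  proof (intro conjI ballI allI)
    show "g differentiable at x" if "x \<in> S" for x
      using D[OF that] by (rule differentiableI)
    show "C_k_on k (\<lambda>x. frechet_derivative g (at x) v) S" for v
      by (rule Suc.IH[of "\<lambda>x. frechet_derivative f (at x) v"]) (use Suc.prems * in auto)
  qed
qed

text \<open>On an open set the derivative is unique, so a derivative given by a formula may replace
  the one that \<open>frechet_derivative\<close> picks. The closure properties below go through this
  form.\<close>

lemma C_k_on_SucI:
  assumes "open S" "\<And>x. x \<in> S \<Longrightarrow> (f has_derivative f' x) (at x)" "\<And>v. C_k_on k (\<lambda>x. f' x v) S"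
  shows "C_k_on (Suc k) f S"
  unfolding C_k_on.simps
proof (intro conjI ballI allI)
  show "f differentiable at x" if "x \<in> S" for x
    using assms(2)[OF that] by (rule differentiableI)
  show "C_k_on k (\<lambda>x. frechet_derivative f (at x) v) S" for v
    by (rule C_k_on_cong[OF assms(1) _ assms(3)]) (simp add: frechet_derivative_at[OF assms(2), symmetric])
qed

lemma C_k_on_const: "open S \<Longrightarrow> C_k_on k (\<lambda>x. c) S"
proof (induction k arbitrary: c)
  case (Suc k)
  show ?case by (rule C_k_on_SucI[where f' = "\<lambda>x v. 0"]) (simp_all add: Suc del: C_k_on.simps)
qed simp

lemma C_k_on_ident: "open S \<Longrightarrow> C_k_on k (\<lambda>x. x) S"
proof (cases k)
  case (Suc j)
  assume "open S"
  then show ?thesis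
    unfolding Suc by (intro C_k_on_SucI[where f' = "\<lambda>x v. v"] C_k_on_const) auto
qed simp

lemma C_k_on_bounded_linear:
  assumes "bounded_linear L" "open S"
  shows "C_k_on k f S \<Longrightarrow> C_k_on k (\<lambda>x. L (f x)) S"
proof (induction k arbitrary: f)
  case 0
  then show ?case
    using assms(1) by (simp add: bounded_linear.continuous_on)
next
  case (Suc k)
  show ?case
    by (rule C_k_on_SucI[OF assms(2) bounded_linear.has_derivative[OF assms(1) C_k_on_has_derivative[OF Suc.prems]]])
      (use Suc in auto)
qed

lemma C_k_on_add:
  assumes "open S"
  shows "C_k_on k f S \<Longrightarrow> C_k_on k g S \<Longrightarrow> C_k_on k (\<lambda>x. f x + g x) S"
proof (induction k arbitrary: f g)
  case 0
  then show ?case by (simp add: continuous_on_add)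
next
  case (Suc k)
  show ?case
    by (rule C_k_on_SucI[OF assms has_derivative_add[OF C_k_on_has_derivative[OF Suc.prems(1)]
              C_k_on_has_derivative[OF Suc.prems(2)]]])
      (use Suc in auto)
qed

lemma C_k_on_sum:
  assumes "open S" "\<And>i. i \<in> I \<Longrightarrow> C_k_on k (f i) S"
  shows "C_k_on k (\<lambda>x. \<Sum>i\<in>I. f i x) S"
  using assms(2) by (induction I rule: infinite_finite_induct) (simp_all add: C_k_on_const C_k_on_add assms(1) del: C_k_on.simps)

lemma C_k_on_bilinear:
  assumes "bounded_bilinear pr" "open S"
  shows "C_k_on k f S \<Longrightarrow> C_k_on k g S \<Longrightarrow> C_k_on k (\<lambda>x. pr (f x) (g x)) S"
proof (induction k arbitrary: f g)
  case 0
  then show ?case by (simp add: bounded_bilinear.continuous_on[OF assms(1)])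
next
  case (Suc k)
  show ?case
  proof (rule C_k_on_SucI[OF assms(2) bounded_bilinear.FDERIV[OF assms(1) C_k_on_has_derivative[OF Suc.prems(1)]
            C_k_on_has_derivative[OF Suc.prems(2)]]])
    show "C_k_on k (\<lambda>x. pr (f x) (frechet_derivative g (at x) v) + pr (frechet_derivative f (at x) v) (g x)) S" for v
      using Suc.prems C_k_on_SucD[OF Suc.prems(1)] C_k_on_SucD[OF Suc.prems(2)]
      by (intro C_k_on_add assms(2) Suc.IH) auto
  qed auto
qed

lemmas C_k_on_mult = C_k_on_bilinear[OF bounded_bilinear_mult]
lemmas C_k_on_scaleR = C_k_on_bilinear[OF bounded_bilinear_scaleR]

lemma C_k_on_minus: "open S \<Longrightarrow> C_k_on k f S \<Longrightarrow> C_k_on k (\<lambda>x. - f x) S"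
  by (rule C_k_on_bounded_linear[OF bounded_linear_minus[OF bounded_linear_ident]])

lemma C_k_on_compose:
  assumes S: "open S" and T: "open T" and fST: "f ` S \<subseteq> T"
  shows "C_k_on k f S \<Longrightarrow> C_k_on k g T \<Longrightarrow> C_k_on k (\<lambda>x. g (f x)) S"
proof (induction k arbitrary: g)
  case 0
  then show ?case using fST by (auto intro: continuous_on_compose2)
next
  case (Suc k)
  let ?f' = "\<lambda>x. frechet_derivative f (at x)" and ?g' = "\<lambda>y. frechet_derivative g (at y)"
  have gx: "(g has_derivative ?g' (f x)) (at (f x))" if "x \<in> S" for x
    using C_k_on_has_derivative[OF Suc.prems(2)] fST that by auto
  show ?case
  proof (rule C_k_on_SucI[OF S])
    show "((\<lambda>x. g (f x)) has_derivative (\<lambda>v. ?g' (f x) (?f' x v))) (at x)" if "x \<in> S" for x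
      using has_derivative_compose[OF C_k_on_has_derivative[OF Suc.prems(1) that] gx[OF that]] .
    fix v
    \<comment> \<open>\<open>C_k_on\<close> controls derivatives in a fixed direction only, whereas
      the direction \<open>?f' x v\<close> moves with \<open>x\<close>. Expanding it over
      \<open>Basis\<close> leaves fixed directions with scalar coefficients.\<close>
    have "C_k_on k (\<lambda>x. \<Sum>b\<in>Basis. (?f' x v \<bullet> b) *\<^sub>R ?g' (f x) b) S"
      using Suc.prems Suc.IH
      by (intro C_k_on_sum S C_k_on_scaleR C_k_on_bounded_linear[OF bounded_linear_inner_left]
          Suc.IH C_k_on_SucD[OF Suc.prems(1)]) auto
    moreover have "(\<Sum>b\<in>Basis. (?f' x v \<bullet> b) *\<^sub>R ?g' (f x) b) = ?g' (f x) (?f' x v)" if "x \<in> S" for x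
    proof -
      have l: "linear (?g' (f x))"
        using gx[OF that] has_derivative_linear by blast
      have "?g' (f x) (?f' x v) = ?g' (f x) (\<Sum>b\<in>Basis. (?f' x v \<bullet> b) *\<^sub>R b)"
        by (simp add: euclidean_representation)
      also have "\<dots> = (\<Sum>b\<in>Basis. (?f' x v \<bullet> b) *\<^sub>R ?g' (f x) b)"
        by (simp add: linear_sum[OF l] linear_scale[OF l])
      finally show ?thesis ..
    qed
    ultimately show "C_k_on k (\<lambda>x. ?g' (f x) (?f' x v)) S"
      by (rule C_k_on_cong[OF S, rotated])
  qed
qed

text \<open>The derivatives of \<open>inverse\<close>, \<open>sqrt\<close> and \<open>exp\<close>
  are expressions in the function itself, so regularity bootstraps: when \<open>step\<close> treats
  \<open>g'\<close>, it may already use that the composite with \<open>g\<close> is of class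
  \<open>k\<close>.\<close>

lemma C_k_on_field_derivative:
  fixes g :: "'b::{real_normed_field} \<Rightarrow> 'b"
  assumes S: "open S"
    and g: "\<And>y. y \<in> T \<Longrightarrow> (g has_field_derivative g' y) (at y)"
    and step: "\<And>k. C_k_on k f S \<Longrightarrow> C_k_on k (\<lambda>x. g (f x)) S \<Longrightarrow> C_k_on k (\<lambda>x. g' (f x)) S"
    and T: "f ` S \<subseteq> T"
  shows "C_k_on k f S \<Longrightarrow> C_k_on k (\<lambda>x. g (f x)) S"
proof (induction k)
  case 0
  have "continuous_on T g"
    using g by (meson DERIV_isCont continuous_at_imp_continuous_on)
  then show ?case
    using 0 T by (auto intro: continuous_on_compose2)
next
  case (Suc k)
  have f: "C_k_on k f S"
    using Suc.prems by (rule C_k_on_SucD)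
  show ?case
  proof (rule C_k_on_SucI[OF S])
    show "((\<lambda>x. g (f x)) has_derivative (\<lambda>v. g' (f x) * frechet_derivative f (at x) v)) (at x)"
      if "x \<in> S" for x
    proof -
      have "(g has_derivative (*) (g' (f x))) (at (f x))"
        using g[of "f x"] T that unfolding has_field_derivative_def by blast
      from has_derivative_compose[OF C_k_on_has_derivative[OF Suc.prems that] this] show ?thesis .
    qed
    show "C_k_on k (\<lambda>x. g' (f x) * frechet_derivative f (at x) v) S" for v
      using Suc.prems by (intro C_k_on_mult S step f Suc.IH[OF f]) auto
  qed
qed

lemma C_k_on_inverse:
  fixes f :: "'a::euclidean_space \<Rightarrow> 'b::real_normed_field"
  assumes "open S" "\<And>x. x \<in> S \<Longrightarrow> f x \<noteq> 0" "C_k_on k f S"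
  shows "C_k_on k (\<lambda>x. inverse (f x)) S"
proof (rule C_k_on_field_derivative[where f = f and g = inverse and T = "- {0}" and g' = "\<lambda>y. - (inverse y ^ Suc (Suc 0))"])
  show "C_k_on k (\<lambda>x. - (inverse (f x) ^ Suc (Suc 0))) S" if "C_k_on k (\<lambda>x. inverse (f x)) S" for k
    using C_k_on_minus[OF assms(1) C_k_on_mult[OF assms(1) that that]] by simp
qed (use assms in \<open>auto intro!: DERIV_cong[OF DERIV_inverse]\<close>)

lemma C_k_on_sqrt:
  assumes "open S" "\<And>x. x \<in> S \<Longrightarrow> 0 < f x" "C_k_on k f S"
  shows "C_k_on k (\<lambda>x. sqrt (f x)) S"
proof (rule C_k_on_field_derivative[where f = f and g = sqrt and T = "{0<..}" and g' = "\<lambda>y. inverse (sqrt y) / 2"])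
  show "C_k_on k (\<lambda>x. inverse (sqrt (f x)) / 2) S" if "C_k_on k (\<lambda>x. sqrt (f x)) S" for k
  proof -
    have "C_k_on k (\<lambda>x. inverse (sqrt (f x))) S"
      using assms(2) by (intro C_k_on_inverse assms(1) that) force
    from C_k_on_bounded_linear[OF bounded_linear_divide assms(1) this] show ?thesis .
  qed
qed (use assms in \<open>auto intro!: DERIV_real_sqrt\<close>)

lemma C_k_on_exp:
  fixes f :: "'a::euclidean_space \<Rightarrow> 'b::{real_normed_field,banach}"
  assumes "open S" "C_k_on k f S"
  shows "C_k_on k (\<lambda>x. exp (f x)) S"
  by (rule C_k_on_field_derivative[where f = f and g = exp and T = UNIV and g' = exp]) (use assms in auto)

lemma C_k_on_Ln:
  assumes "open S" "\<And>x. x \<in> S \<Longrightarrow> f x \<notin> \<real>\<^sub>\<le>\<^sub>0" "C_k_on k f S"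
  shows "C_k_on k (\<lambda>x. Ln (f x)) S"
proof (rule C_k_on_field_derivative[where f = f and g = Ln and T = "- \<real>\<^sub>\<le>\<^sub>0" and g' = inverse])
  show "C_k_on k (\<lambda>x. inverse (f x)) S" if "C_k_on k f S" for k
    using assms(2) by (intro C_k_on_inverse assms(1) that) fastforce
qed (use assms in \<open>auto intro!: has_field_derivative_Ln\<close>)

subsection \<open>A smooth bump function\<close>

text \<open>The classical flat function is the case \<open>m = 0\<close>. The powers of
  \<open>inverse x\<close> make the family closed under differentiation, so that one induction
  proves all members smooth.\<close>

definition flat_bump :: "nat \<Rightarrow> real \<Rightarrow> real" where
  "flat_bump m x = (if x > 0 then inverse x ^ m * exp (- inverse x) else 0)"

lemma flat_bump_pos: "x > 0 \<Longrightarrow> flat_bump m x > 0" and flat_bump_zero: "x \<le> 0 \<Longrightarrow> flat_bump m x = 0"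
  by (auto simp: flat_bump_def)

text \<open>On the right, \<open>t = inverse x\<close> turns this into the decay of
  \<open>t ^ m / exp t\<close> at infinity; on the left the function is zero.\<close>

lemma flat_bump_tendsto: "(flat_bump m \<longlongrightarrow> 0) (at 0)"
proof -
  have "((\<lambda>t::real. t ^ m / exp t) \<longlongrightarrow> 0) at_top"
    by (rule tendsto_power_div_exp_0)
  from filterlim_compose[OF this filterlim_inverse_at_top_right]
  have "((\<lambda>x::real. inverse x ^ m / exp (inverse x)) \<longlongrightarrow> 0) (at_right 0)" .
  moreover have "\<forall>\<^sub>F x in at_right 0. inverse x ^ m / exp (inverse x) = flat_bump m (x::real)"
    by (auto simp: eventually_at_filter flat_bump_def exp_minus divide_inverse)
  ultimately have r: "(flat_bump m \<longlongrightarrow> 0) (at_right 0)"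
    by (rule Lim_transform_eventually)
  have "\<forall>\<^sub>F x in at_left 0. 0 = flat_bump m (x::real)"
    by (auto simp: eventually_at_filter flat_bump_def)
  then have "(flat_bump m \<longlongrightarrow> 0) (at_left 0)"
    by (rule Lim_transform_eventually[OF tendsto_const])
  with r show ?thesis
    using filterlim_split_at by blast
qed

lemma flat_bump_derivative:
  "(flat_bump m has_real_derivative (flat_bump (m + 2) x - real m * flat_bump (m + 1) x)) (at x)"
proof -
  consider "x > 0" | "x < 0" | "x = 0" by linarith
  then show ?thesis
  proof cases
    case 1
    have "((\<lambda>x. inverse x ^ m * exp (- inverse x)) has_real_derivative
       (flat_bump (m + 2) x - real m * flat_bump (m + 1) x)) (at x)"
    proof (cases m)
      case 0
      with 1 show ?thesis
        by (auto intro!: derivative_eq_intros simp: flat_bump_def power2_eq_square)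
    next
      case (Suc k)
      with 1 show ?thesis
        by (auto intro!: derivative_eq_intros simp: flat_bump_def power2_eq_square algebra_simps
            split: nat.splits) (cases k; simp)
    qed
    then show ?thesis
      by (rule has_field_derivative_transform_within_open[where S = "{0<..}"])
        (use 1 in \<open>auto simp: flat_bump_def\<close>)
  next
    case 2
    have "((\<lambda>x. 0) has_real_derivative (flat_bump (m + 2) x - real m * flat_bump (m + 1) x)) (at x)"
      using 2 by (simp add: flat_bump_def)
    then show ?thesis
      by (rule has_field_derivative_transform_within_open[where S = "{..<0}"])
        (use 2 in \<open>auto simp: flat_bump_def\<close>)
  next
    case 3
    \<comment> \<open>At the origin the difference quotient of \<open>flat_bump m\<close> is
      \<open>flat_bump (Suc m)\<close>.\<close>
    have "((\<lambda>y. flat_bump (Suc m) y) \<longlongrightarrow> 0) (at 0)"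
      by (rule flat_bump_tendsto)
    then have "((\<lambda>y. (flat_bump m y - flat_bump m 0) / (y - 0)) \<longlongrightarrow> 0) (at 0)"
      by (rule Lim_transform_eventually)
        (auto simp: eventually_at_filter flat_bump_def divide_inverse)
    then show ?thesis
      using 3 by (simp add: has_field_derivative_iff flat_bump_def)
  qed
qed

lemma C_k_on_flat_bump: "C_k_on k (flat_bump m) UNIV"
proof (induction k arbitrary: m)
  case 0
  show ?case
    using flat_bump_derivative by (auto intro!: continuous_at_imp_continuous_on DERIV_isCont)
next
  case (Suc k)
  show ?case
  proof (rule C_k_on_SucI[where f' = "\<lambda>x v. (flat_bump (m + 2) x - real m * flat_bump (m + 1) x) * v"])
    show "(flat_bump m has_derivative (\<lambda>v. (flat_bump (m + 2) x - real m * flat_bump (m + 1) x) * v)) (at x)" for x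
      using flat_bump_derivative[of m x] by (simp add: has_field_derivative_def)
    have "C_k_on k (\<lambda>x. (flat_bump (m + 2) x + - (real m * flat_bump (m + 1) x)) * v) UNIV" for v
      by (intro C_k_on_mult C_k_on_add C_k_on_minus C_k_on_const Suc.IH open_UNIV)
    then show "C_k_on k (\<lambda>x. (flat_bump (m + 2) x - real m * flat_bump (m + 1) x) * v) UNIV" for v
      by simp
  qed auto
qed

lemma C_k_on_imp_continuous_on: "C_k_on k f S \<Longrightarrow> continuous_on S f"
proof (cases k)
  case (Suc j)
  assume "C_k_on k f S"
  then show ?thesis
    unfolding Suc by (auto intro!: continuous_at_imp_continuous_on differentiable_imp_continuous_within)
qed simp

section \<open>Calculus of smooth maps on arbitrary subsets\<close>

lemma smooth_onI:
  assumes "\<And>x. x \<in> A \<Longrightarrow> \<exists>U g. open U \<and> x \<in> U \<and> (\<forall>k. C_k_on k g U) \<and> (\<forall>y \<in> A \<inter> U. g y = f y)"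
  shows "smooth_on A f"
  using assms unfolding smooth_on_def by simp

lemma smooth_onE:
  assumes "smooth_on A f" "x \<in> A"
  obtains U g where "open U" "x \<in> U" "\<forall>k. C_k_on k g U" "\<forall>y \<in> A \<inter> U. g y = f y"
proof -
  obtain U g where "open U \<and> x \<in> U \<and> (\<forall>k. C_k_on k g U) \<and> (\<forall>y \<in> A \<inter> U. g y = f y)"
    using assms(1)[unfolded smooth_on_def, rule_format, OF assms(2)] by (elim exE)
  then show thesis
    by (intro that[of U g]) simp_all
qed

lemma smooth_on_subset:
  assumes "smooth_on A f" "B \<subseteq> A"
  shows "smooth_on B f"
proof (rule smooth_onI)
  fix x assume "x \<in> B"
  then have "x \<in> A" using assms(2) by blast
  then obtain U g where "open U" "x \<in> U" "\<forall>k. C_k_on k g U" "\<forall>y \<in> A \<inter> U. g y = f y"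
    by (rule smooth_onE[OF assms(1)])
  then show "\<exists>U g. open U \<and> x \<in> U \<and> (\<forall>k. C_k_on k g U) \<and> (\<forall>y \<in> B \<inter> U. g y = f y)"
    using assms(2) by (intro exI[of _ U] exI[of _ g]) auto
qed

lemma smooth_on_cong:
  assumes "smooth_on A f" "\<And>x. x \<in> A \<Longrightarrow> f x = g x"
  shows "smooth_on A g"
  using assms unfolding smooth_on_def by simp

lemma smooth_on_C_k_on: "open S \<Longrightarrow> (\<And>k. C_k_on k f S) \<Longrightarrow> A \<subseteq> S \<Longrightarrow> smooth_on A f"
  by (rule smooth_onI, rule exI[of _ S], rule exI[of _ f]) auto

lemma smooth_on_local:
  assumes "\<And>x. x \<in> A \<Longrightarrow> \<exists>U. open U \<and> x \<in> U \<and> smooth_on (A \<inter> U) f"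
  shows "smooth_on A f"
  unfolding smooth_on_def
proof
  fix x assume x: "x \<in> A"
  then obtain U where U: "open U" "x \<in> U" "smooth_on (A \<inter> U) f"
    using assms by blast
  then obtain V g where V: "open V" "x \<in> V" "\<forall>k. C_k_on k g V" "\<forall>y\<in>A \<inter> U \<inter> V. g y = f y"
    using x by (elim smooth_onE[of "A \<inter> U" f x]) auto
  show "\<exists>U g. open U \<and> x \<in> U \<and> (\<forall>k. C_k_on k g U) \<and> (\<forall>y\<in>A \<inter> U. g y = f y)"
    by (rule exI[of _ "U \<inter> V"], rule exI[of _ g]) (use U V in \<open>auto intro: C_k_on_subset[of _ _ V]\<close>)
qed

lemma smooth_on_imp_continuous_on:
  assumes "smooth_on A f"
  shows "continuous_on A f"
  unfolding continuous_on_eq_continuous_within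
proof
  fix x assume x: "x \<in> A"
  obtain U g where U: "open U" "x \<in> U" "\<forall>k. C_k_on k g U" "\<forall>y\<in>A \<inter> U. g y = f y"
    by (rule smooth_onE[OF assms x])
  have "continuous_on U g"
    using U(3) C_k_on_imp_continuous_on by blast
  then have "continuous (at x within A) g"
    using U by (simp add: continuous_on_eq_continuous_at continuous_at_imp_continuous_at_within)
  moreover have "\<forall>\<^sub>F y in at x within A. g y = f y"
    unfolding eventually_at_topological using U by auto
  ultimately show "continuous (at x within A) f"
    using U x by (simp add: continuous_within tendsto_cong)
qed

lemma smooth_on_compose:
  assumes f: "smooth_on A f" and g: "smooth_on B g" and AB: "f ` A \<subseteq> B"
  shows "smooth_on A (\<lambda>x. g (f x))"
  unfolding smooth_on_def
proof
  fix x assume x: "x \<in> A"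
  obtain U F where U: "open U" "x \<in> U" "\<forall>k. C_k_on k F U" "\<forall>y\<in>A \<inter> U. F y = f y"
    by (rule smooth_onE[OF f x])
  have "f x \<in> B" using AB x by blast
  then obtain V G where V: "open V" "f x \<in> V" "\<forall>k. C_k_on k G V" "\<forall>y\<in>B \<inter> V. G y = g y"
    by (rule smooth_onE[OF g])
  have "continuous_on U F"
    using U(3) C_k_on_imp_continuous_on by blast
  then have o: "open (U \<inter> F -` V)"
    using U V by (simp add: continuous_open_preimage)
  show "\<exists>U h. open U \<and> x \<in> U \<and> (\<forall>k. C_k_on k h U) \<and> (\<forall>y\<in>A \<inter> U. h y = g (f y))"
  proof (intro exI conjI)
    show "\<forall>k. C_k_on k (\<lambda>y. G (F y)) (U \<inter> F -` V)"
    proof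
      show "C_k_on k (\<lambda>y. G (F y)) (U \<inter> F -` V)" for k
        by (rule C_k_on_compose[where f = F and g = G, OF o V(1)])
          (use U(3) V(3) in \<open>auto intro: C_k_on_subset[of _ _ U]\<close>)
    qed
  qed (use o U V x AB in auto)
qed

lemma smooth_on_compose_C_k_on:
  assumes "smooth_on A f" "open T" "\<And>k. C_k_on k g T" "f ` A \<subseteq> T"
  shows "smooth_on A (\<lambda>x. g (f x))"
  by (rule smooth_on_compose[OF assms(1) smooth_on_C_k_on[OF assms(2,3) order_refl] assms(4)])

lemma smooth_on_const: "smooth_on A (\<lambda>x. c)"
  by (rule smooth_on_C_k_on[OF open_UNIV]) (auto intro: C_k_on_const)

lemma smooth_on_ident: "smooth_on A (\<lambda>x. x)"
  by (rule smooth_on_C_k_on[OF open_UNIV]) (auto intro: C_k_on_ident)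

lemma smooth_on_bounded_linear: "bounded_linear L \<Longrightarrow> smooth_on A f \<Longrightarrow> smooth_on A (\<lambda>x. L (f x))"
  for L :: "'b::euclidean_space \<Rightarrow> 'c::real_normed_vector"
  by (rule smooth_on_compose_C_k_on[OF _ open_UNIV])
    (auto intro: C_k_on_bounded_linear[OF _ _ C_k_on_ident] simp del: C_k_on.simps)

lemma smooth_on_bilinear:
  assumes "bounded_bilinear pr" "smooth_on A f" "smooth_on A g"
  shows "smooth_on A (\<lambda>x. pr (f x) (g x))"
  unfolding smooth_on_def
proof
  fix x assume x: "x \<in> A"
  obtain U F where U: "open U" "x \<in> U" "\<forall>k. C_k_on k F U" "\<forall>y\<in>A \<inter> U. F y = f y"
    by (rule smooth_onE[OF assms(2) x])
  obtain V G where V: "open V" "x \<in> V" "\<forall>k. C_k_on k G V" "\<forall>y\<in>A \<inter> V. G y = g y"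
    by (rule smooth_onE[OF assms(3) x])
  show "\<exists>U h. open U \<and> x \<in> U \<and> (\<forall>k. C_k_on k h U) \<and> (\<forall>y\<in>A \<inter> U. h y = pr (f y) (g y))"
  proof (intro exI conjI)
    show "\<forall>k. C_k_on k (\<lambda>y. pr (F y) (G y)) (U \<inter> V)"
      using U V by (intro allI C_k_on_bilinear[OF assms(1)])
        (auto intro: C_k_on_subset[of _ _ U] C_k_on_subset[of _ _ V])
  qed (use U V in auto)
qed

lemmas smooth_on_mult = smooth_on_bilinear[OF bounded_bilinear_mult]
lemmas smooth_on_scaleR = smooth_on_bilinear[OF bounded_bilinear_scaleR]

lemma smooth_on_add:
  assumes "smooth_on A f" "smooth_on A g"
  shows "smooth_on A (\<lambda>x. f x + g x)"
  unfolding smooth_on_def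
proof
  fix x assume x: "x \<in> A"
  obtain U F where U: "open U" "x \<in> U" "\<forall>k. C_k_on k F U" "\<forall>y\<in>A \<inter> U. F y = f y"
    by (rule smooth_onE[OF assms(1) x])
  obtain V G where V: "open V" "x \<in> V" "\<forall>k. C_k_on k G V" "\<forall>y\<in>A \<inter> V. G y = g y"
    by (rule smooth_onE[OF assms(2) x])
  show "\<exists>U h. open U \<and> x \<in> U \<and> (\<forall>k. C_k_on k h U) \<and> (\<forall>y\<in>A \<inter> U. h y = f y + g y)"
  proof (intro exI conjI)
    show "\<forall>k. C_k_on k (\<lambda>y. F y + G y) (U \<inter> V)"
      using U V by (intro allI C_k_on_add)
        (auto intro: C_k_on_subset[of _ _ U] C_k_on_subset[of _ _ V])
  qed (use U V in auto)
qed

lemma smooth_on_minus: "smooth_on A f \<Longrightarrow> smooth_on A (\<lambda>x. - f x)"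
  for f :: "'a::euclidean_space \<Rightarrow> 'b::euclidean_space"
  by (rule smooth_on_bounded_linear[OF bounded_linear_minus[OF bounded_linear_ident]])

lemma smooth_on_diff: "smooth_on A f \<Longrightarrow> smooth_on A g \<Longrightarrow> smooth_on A (\<lambda>x. f x - g x)"
  for f :: "'a::euclidean_space \<Rightarrow> 'b::euclidean_space"
  using smooth_on_add[OF _ smooth_on_minus, of A f g] by simp

lemma smooth_on_sum: "(\<And>i. i \<in> I \<Longrightarrow> smooth_on A (f i)) \<Longrightarrow> smooth_on A (\<lambda>x. \<Sum>i\<in>I. f i x)"
  by (induction I rule: infinite_finite_induct) (auto intro: smooth_on_const smooth_on_add)

lemma smooth_on_vec_nth:
  fixes f :: "'a::euclidean_space \<Rightarrow> 'b::euclidean_space ^ 'n::finite"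
  shows "smooth_on A f \<Longrightarrow> smooth_on A (\<lambda>x. f x $ i)"
  by (rule smooth_on_bounded_linear[OF bounded_linear_vec_nth])

lemma smooth_on_vec_lambda:
  fixes f :: "'a::euclidean_space \<Rightarrow> 'n::finite \<Rightarrow> 'b::euclidean_space"
  assumes "\<And>i. smooth_on A (\<lambda>x. f x i)"
  shows "smooth_on A (\<lambda>x. \<chi> i. f x i)"
proof -
  have "(\<chi> i. f x i) = (\<Sum>i\<in>UNIV. axis i (f x i))" for x
    by (simp add: vec_eq_iff sum_component axis_def if_distrib[of "\<lambda>x. x $ _"] cong: if_cong)
  moreover have "smooth_on A (\<lambda>x. \<Sum>i\<in>UNIV. axis i (f x i))"
  proof (rule smooth_on_sum, rule smooth_on_bounded_linear[OF _ assms])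
    show "bounded_linear (axis i :: 'b \<Rightarrow> 'b ^ 'n)" for i
      by (rule linear_conv_bounded_linear[THEN iffD1], rule linearI)
        (auto simp: vec_eq_iff axis_def)
  qed
  ultimately show ?thesis by simp
qed

lemma smooth_on_inverse:
  fixes f :: "'a::euclidean_space \<Rightarrow> 'b::{real_normed_field,euclidean_space}"
  assumes "smooth_on A f" "\<And>x. x \<in> A \<Longrightarrow> f x \<noteq> 0"
  shows "smooth_on A (\<lambda>x. inverse (f x))"
  by (rule smooth_on_compose_C_k_on[OF assms(1), of "- {0}"])
    (use assms(2) in \<open>auto intro!: C_k_on_inverse C_k_on_ident simp del: C_k_on.simps\<close>)

lemma smooth_on_divide:
  fixes f :: "'a::euclidean_space \<Rightarrow> 'b::{real_normed_field,euclidean_space}"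
  assumes "smooth_on A f" "smooth_on A g" "\<And>x. x \<in> A \<Longrightarrow> g x \<noteq> 0"
  shows "smooth_on A (\<lambda>x. f x / g x)"
  unfolding divide_inverse by (intro smooth_on_mult smooth_on_inverse assms)

lemma smooth_on_sqrt:
  assumes "smooth_on A f" "\<And>x. x \<in> A \<Longrightarrow> 0 < f x"
  shows "smooth_on A (\<lambda>x. sqrt (f x))"
  by (rule smooth_on_compose_C_k_on[OF assms(1), of "{0<..}"])
    (use assms(2) in \<open>auto intro!: C_k_on_sqrt C_k_on_ident simp del: C_k_on.simps\<close>)

lemma smooth_on_exp:
  fixes f :: "'a::euclidean_space \<Rightarrow> 'b::{real_normed_field,banach,euclidean_space}"
  shows "smooth_on A f \<Longrightarrow> smooth_on A (\<lambda>x. exp (f x))"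
  by (rule smooth_on_compose_C_k_on[OF _ open_UNIV])
    (auto intro!: C_k_on_exp C_k_on_ident simp del: C_k_on.simps)

lemma smooth_on_cis: "smooth_on A f \<Longrightarrow> smooth_on A (\<lambda>x. cis (f x))"
  unfolding cis_conv_exp
  by (intro smooth_on_exp smooth_on_mult smooth_on_const smooth_on_bounded_linear[OF bounded_linear_of_real])

lemma smooth_on_Ln:
  assumes "smooth_on A f" "\<And>x. x \<in> A \<Longrightarrow> f x \<notin> \<real>\<^sub>\<le>\<^sub>0"
  shows "smooth_on A (\<lambda>x. Ln (f x))"
  by (rule smooth_on_compose_C_k_on[OF assms(1), of "- \<real>\<^sub>\<le>\<^sub>0"])
    (use assms(2) in \<open>auto intro!: C_k_on_Ln C_k_on_ident simp del: C_k_on.simps\<close>)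

lemma smooth_on_flat_bump: "smooth_on A f \<Longrightarrow> smooth_on A (\<lambda>x. flat_bump m (f x))"
  by (rule smooth_on_compose_C_k_on[OF _ open_UNIV]) (auto intro: C_k_on_flat_bump simp del: C_k_on.simps)

subsection \<open>Division by a coordinate\<close>

text \<open>Runs along the segment from the projection of \<open>q\<close> to the hyperplane of
  vanishing coordinate \<open>i\<close> (at \<open>s = 0\<close>) up to \<open>q\<close> itself (at
  \<open>s = 1\<close>). For \<open>s\<close> in the unit interval it preserves the orthant.\<close>

definition shrink_coord :: "'n \<Rightarrow> real \<Rightarrow> real ^ 'n::finite \<Rightarrow> real ^ 'n" where
  "shrink_coord i s q = q - ((1 - s) * q $ i) *\<^sub>R axis i 1"

lemma shrink_coord_nth: "shrink_coord i s q $ j = (if j = i then s * q $ i else q $ j)"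
  by (simp add: shrink_coord_def axis_def algebra_simps)

lemma bounded_linear_shrink_coord: "bounded_linear (shrink_coord i s)"
  by (rule linear_conv_bounded_linear[THEN iffD1], rule linearI)
    (auto simp: vec_eq_iff shrink_coord_nth algebra_simps)

text \<open>Differentiation under the integral sign. The derivative in direction \<open>v\<close>
  consists of two integrals of the same kind, one with weight \<open>w s\<close> and, because the
  chain rule through \<open>shrink_coord\<close> produces a factor \<open>1 - s\<close>, one with
  weight \<open>w s * (1 - s)\<close>. The weight is general so that the induction on
  \<open>k\<close> closes.\<close>

lemma C_k_on_integral_shrink_coord:
  fixes f :: "real ^ 'n::finite \<Rightarrow> real"
  assumes B: "open B" "convex B"
    and AB: "\<And>s q. s \<in> {0..1} \<Longrightarrow> q \<in> B \<Longrightarrow> shrink_coord i s q \<in> B"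
  shows "continuous_on {0..1} w \<Longrightarrow> C_k_on k f B \<Longrightarrow>
    C_k_on k (\<lambda>q. integral {0..1} (\<lambda>s. w s * f (shrink_coord i s q))) B"
proof (induction k arbitrary: f w)
  case (0 f w)
  have c: "continuous_on (B \<times> {0..1}) (\<lambda>x. shrink_coord i (snd x) (fst x))"
    unfolding shrink_coord_def by (intro continuous_intros)
  have "continuous_on (B \<times> {0..1}) (\<lambda>x. w (snd x) * f (shrink_coord i (snd x) (fst x)))"
    using 0 AB by (intro continuous_on_mult continuous_on_compose2[OF _ c, of B f]
        continuous_on_compose2[of "{0..1}" w _ snd] continuous_intros) auto
  then have "continuous_on (B \<times> cbox 0 1) (\<lambda>(q, s). w s * f (shrink_coord i s q))"
    by (simp add: split_beta)
  from integral_continuous_on_param[OF this] show ?case by simp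
next
  case (Suc k f w)
  let ?D = "\<lambda>x. frechet_derivative f (at x)"
  note D = C_k_on_has_derivative[OF Suc.prems(2)]
  have lin: "linear (?D x)" if "x \<in> B" for x
    using D[OF that] has_derivative_linear by blast
  have C: "C_k_on k (\<lambda>x. ?D x v) B" for v
    using Suc.prems(2) by simp
  then have C0: "continuous_on B (\<lambda>x. ?D x v)" for v
    by (rule C_k_on_imp_continuous_on)
  have c: "continuous_on (B \<times> {0..1}) (\<lambda>x. shrink_coord i (snd x) (fst x))"
    unfolding shrink_coord_def by (intro continuous_intros)
  have csub: "(\<lambda>x. shrink_coord i (snd x) (fst x)) ` (B \<times> {0..1}) \<subseteq> B"
    using AB by auto
  have DC: "continuous_on (B \<times> {0..1}) (\<lambda>x. ?D (shrink_coord i (snd x) (fst x)) v)" for v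
    by (rule continuous_on_compose2[OF C0 c csub])
  have w: "continuous_on (B \<times> {0..1}) (\<lambda>x. w (snd x))"
    using Suc.prems(1) by (rule continuous_on_compose2) (auto intro: continuous_intros)
  have split: "?D x (shrink_coord i s v) = ?D x v - (1 - s) * v $ i * ?D x (axis i 1)" if "x \<in> B" for x s v
    unfolding shrink_coord_def using lin[OF that] by (simp add: linear_diff linear_scale)
  \<comment> \<open>The Leibniz rule takes the derivative as a bounded linear function. It is
    assembled from its values on \<open>Basis\<close>, for which joint continuity in
    \<open>(q, s)\<close> can be checked.\<close>
  define fx where "fx q s = (\<Sum>b\<in>Basis. (w s * ?D (shrink_coord i s q) (shrink_coord i s b)) *\<^sub>R blinfun_inner_left b)"
    for q s
  have fx: "blinfun_apply (fx q s) v = w s * ?D (shrink_coord i s q) (shrink_coord i s v)"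
    if "q \<in> B" "s \<in> {0..1}" for q s v
  proof -
    have l: "linear (\<lambda>v. ?D (shrink_coord i s q) (shrink_coord i s v))"
      using linear_compose[OF bounded_linear.linear[OF bounded_linear_shrink_coord] lin[OF AB[OF that(2,1)]]]
      by (simp add: o_def)
    have "?D (shrink_coord i s q) (shrink_coord i s v) =
       ?D (shrink_coord i s q) (shrink_coord i s (\<Sum>b\<in>Basis. (v \<bullet> b) *\<^sub>R b))"
      by (simp add: euclidean_representation)
    also have "\<dots> = (\<Sum>b\<in>Basis. (v \<bullet> b) *\<^sub>R ?D (shrink_coord i s q) (shrink_coord i s b))"
      by (simp add: linear_sum[OF l] linear_scale[OF l])
    finally show ?thesis
      by (simp add: fx_def blinfun.sum_left blinfun.scaleR_left sum_distrib_left mult_ac)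
  qed
  have fxc: "continuous_on (B \<times> cbox 0 1) (\<lambda>(q, s). fx q s)"
  proof -
    have "continuous_on (B \<times> {0..1}) (\<lambda>x. w (snd x) * (?D (shrink_coord i (snd x) (fst x)) b
            - (1 - snd x) * b $ i * ?D (shrink_coord i (snd x) (fst x)) (axis i 1)))" for b
      by (intro continuous_intros w DC)
    then have *: "continuous_on (B \<times> {0..1}) (\<lambda>x. w (snd x) * ?D (shrink_coord i (snd x) (fst x)) (shrink_coord i (snd x) b))" for b
      by (rule continuous_on_eq) (use split AB in auto)
    show ?thesis
      unfolding fx_def split_beta by (simp, intro continuous_intros *)
  qed
  have int: "(\<lambda>s. w s * ?D (shrink_coord i s q) v) integrable_on {0..1}"
    "(\<lambda>s. (w s * (1 - s)) * ?D (shrink_coord i s q) v) integrable_on {0..1}" if "q \<in> B" for q v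
  proof -
    have "continuous_on {0..1} (\<lambda>s. ?D (shrink_coord i s q) v)"
    proof -
      have "continuous_on {0..1} (\<lambda>s::real. (q, s))"
        by (intro continuous_intros)
      from continuous_on_compose2[OF DC[of v] this] show ?thesis
        using that by auto
    qed
    then show "(\<lambda>s. w s * ?D (shrink_coord i s q) v) integrable_on {0..1}"
    "(\<lambda>s. (w s * (1 - s)) * ?D (shrink_coord i s q) v) integrable_on {0..1}"
      using Suc.prems(1) by (auto intro!: integrable_continuous_interval continuous_intros)
  qed
  show ?case
  proof (rule C_k_on_SucI[OF B(1)])
    fix q assume q: "q \<in> B"
    have 1: "((\<lambda>q. integral (cbox 0 1) (\<lambda>s. w s * f (shrink_coord i s q))) has_derivative
       blinfun_apply (integral (cbox 0 1) (fx q))) (at q within B)"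
    proof (rule leibniz_rule[OF _ _ fxc q B(2)])
      fix q s assume qs: "q \<in> B" "s \<in> cbox 0 (1::real)"
      have "((\<lambda>q. w s * f (shrink_coord i s q)) has_derivative
         (\<lambda>v. w s * ?D (shrink_coord i s q) (shrink_coord i s v))) (at q)"
        using AB[of s q] qs
        by (intro has_derivative_mult_right has_derivative_compose[OF
              bounded_linear_imp_has_derivative[OF bounded_linear_shrink_coord] D]) auto
      moreover have "blinfun_apply (fx q s) = (\<lambda>v. w s * ?D (shrink_coord i s q) (shrink_coord i s v))"
        using fx[of q s] qs by auto
      ultimately show "((\<lambda>q. w s * f (shrink_coord i s q)) has_derivative blinfun_apply (fx q s)) (at q within B)"
        by (simp add: has_derivative_at_withinI)
    next
      fix q assume q: "q \<in> B"
      have "continuous_on B f"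
        using Suc.prems(2) by (rule C_k_on_imp_continuous_on)
      then have "continuous_on {0..1} (\<lambda>s. f (shrink_coord i s q))"
        by (rule continuous_on_compose2) (use AB q in \<open>auto simp: shrink_coord_def intro!: continuous_intros\<close>)
      then show "(\<lambda>s. w s * f (shrink_coord i s q)) integrable_on cbox 0 1"
        using Suc.prems(1) by (auto intro!: integrable_continuous_interval continuous_intros)
    qed
    have "blinfun_apply (integral (cbox 0 1) (fx q)) v =
       integral {0..1} (\<lambda>s. w s * ?D (shrink_coord i s q) v)
       - v $ i * integral {0..1} (\<lambda>s. (w s * (1 - s)) * ?D (shrink_coord i s q) (axis i 1))" for v
    proof -
      have "continuous_on (cbox 0 1) (fx q)"
      proof -
        have "continuous_on (cbox 0 1) (\<lambda>s::real. (q, s))"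
          by (intro continuous_intros)
        then have "continuous_on (cbox 0 1) (\<lambda>s. case (q, s) of (q, s) \<Rightarrow> fx q s)"
          by (rule continuous_on_compose2[OF fxc]) (use q in auto)
        then show ?thesis
          by (simp only: prod.case)
      qed
      then have "fx q integrable_on cbox 0 1"
        by (rule integrable_continuous)
      from blinfun_apply_integral[OF this]
      have "blinfun_apply (integral (cbox 0 1) (fx q)) v = integral {0..1} (\<lambda>s. blinfun_apply (fx q s) v)"
        by simp
      also have "\<dots> = integral {0..1} (\<lambda>s. w s * ?D (shrink_coord i s q) v
         - v $ i * ((w s * (1 - s)) * ?D (shrink_coord i s q) (axis i 1)))"
        by (rule integral_cong) (use fx q split AB in \<open>auto simp: algebra_simps\<close>)
      also have "\<dots> = integral {0..1} (\<lambda>s. w s * ?D (shrink_coord i s q) v)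
       - v $ i * integral {0..1} (\<lambda>s. (w s * (1 - s)) * ?D (shrink_coord i s q) (axis i 1))"
        using int[OF q] by (subst integral_diff) (simp_all add: integrable_on_mult_right)
      finally show ?thesis .
    qed
    then have 2: "blinfun_apply (integral (cbox 0 1) (fx q)) = (\<lambda>v. integral {0..1} (\<lambda>s. w s * ?D (shrink_coord i s q) v)
       - v $ i * integral {0..1} (\<lambda>s. (w s * (1 - s)) * ?D (shrink_coord i s q) (axis i 1)))"
      by blast
    show "((\<lambda>q. integral {0..1} (\<lambda>s. w s * f (shrink_coord i s q))) has_derivative
     (\<lambda>v. integral {0..1} (\<lambda>s. w s * ?D (shrink_coord i s q) v)
       - v $ i * integral {0..1} (\<lambda>s. (w s * (1 - s)) * ?D (shrink_coord i s q) (axis i 1)))) (at q)"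
      using 1[unfolded 2 at_within_open[OF q B(1)]] unfolding box_real(2) .
  next
    fix v
    have "C_k_on k (\<lambda>q. integral {0..1} (\<lambda>s. w s * ?D (shrink_coord i s q) v)
       + (- (v $ i * integral {0..1} (\<lambda>s. (w s * (1 - s)) * ?D (shrink_coord i s q) (axis i 1))))) B"
      using Suc.prems(1)
      by (intro C_k_on_add B C_k_on_minus C_k_on_mult C_k_on_const Suc.IH C continuous_intros)
    then show "C_k_on k (\<lambda>q. integral {0..1} (\<lambda>s. w s * ?D (shrink_coord i s q) v)
       - v $ i * integral {0..1} (\<lambda>s. (w s * (1 - s)) * ?D (shrink_coord i s q) (axis i 1))) B"
      by simp
  qed
qed

lemma shrink_coord_ball:
  assumes "q0 $ i = 0" "s \<in> {0..1}" "q \<in> ball q0 e"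
  shows "shrink_coord i s q \<in> ball q0 e"
proof -
  have "norm (shrink_coord i s q - q0) \<le> norm (q - q0)"
  proof (rule norm_le_componentwise_cart)
    fix j
    show "norm ((shrink_coord i s q - q0) $ j) \<le> norm ((q - q0) $ j)"
      using assms by (auto simp: shrink_coord_nth abs_mult mult_left_le_one_le)
  qed
  then show ?thesis
    using assms(3) by (simp add: dist_norm norm_minus_commute)
qed

text \<open>Hadamard's lemma: the increment of \<open>g\<close> along the shrinking segment is the
  integral of its derivative, which carries the factor \<open>q $ i\<close>; \<open>h\<close> is the
  integral of the partial derivative that remains.\<close>

lemma C_k_on_factor_coord:
  fixes g :: "real ^ 'n::finite \<Rightarrow> real"
  assumes q0: "q0 $ i = 0" and g: "\<And>k. C_k_on k g (ball q0 e)"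
  obtains h where "\<And>k. C_k_on k h (ball q0 e)"
    "\<And>q. q \<in> ball q0 e \<Longrightarrow> g q = g (shrink_coord i 0 q) + q $ i * h q"
proof
  let ?D = "\<lambda>x. frechet_derivative g (at x) (axis i 1)"
  let ?h = "\<lambda>q. integral {0..1} (\<lambda>s. 1 * ?D (shrink_coord i s q))"
  have "C_k_on k ?D (ball q0 e)" for k
    using g[of "Suc k"] by simp
  then show "C_k_on k ?h (ball q0 e)" for k
    by (intro C_k_on_integral_shrink_coord shrink_coord_ball[OF q0] continuous_intros) auto
  fix q assume q: "q \<in> ball q0 e"
  have "((\<lambda>s. g (shrink_coord i s q)) has_vector_derivative q $ i * ?D (shrink_coord i s q)) (at s within {0..1})"
    if "s \<in> {0..1}" for s
  proof -
    have "(g has_derivative frechet_derivative g (at (shrink_coord i s q))) (at (shrink_coord i s q))"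
      by (rule C_k_on_has_derivative[OF g shrink_coord_ball[OF q0 that q]])
    moreover have "((\<lambda>s. shrink_coord i s q) has_vector_derivative (q $ i) *\<^sub>R axis i 1) (at s within {0..1})"
      unfolding shrink_coord_def has_vector_derivative_def
      by (auto intro!: derivative_eq_intros simp: algebra_simps)
    ultimately have "((g \<circ> (\<lambda>s. shrink_coord i s q)) has_vector_derivative
        frechet_derivative g (at (shrink_coord i s q)) ((q $ i) *\<^sub>R axis i 1)) (at s within {0..1})"
      by (intro vector_derivative_diff_chain_within) (auto intro: has_derivative_at_withinI)
    moreover have "frechet_derivative g (at (shrink_coord i s q)) ((q $ i) *\<^sub>R axis i 1) =
        q $ i * ?D (shrink_coord i s q)"
      using linear_scale[OF has_derivative_linear[OF C_k_on_has_derivative[OF g shrink_coord_ball[OF q0 that q]]]]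
      by simp
    ultimately show ?thesis
      by (simp add: o_def)
  qed
  from fundamental_theorem_of_calculus[OF _ this]
  have "((\<lambda>s. q $ i * ?D (shrink_coord i s q)) has_integral
      (g (shrink_coord i 1 q) - g (shrink_coord i 0 q))) {0..1}"
    by simp
  from integral_unique[OF this]
  have "q $ i * ?h q = g (shrink_coord i 1 q) - g (shrink_coord i 0 q)"
    by simp
  then show "g q = g (shrink_coord i 0 q) + q $ i * ?h q"
    by (simp add: shrink_coord_def)
qed

text \<open>The local extension \<open>g\<close> of \<open>f\<close> need not vanish on the whole
  hyperplane, only where the hyperplane meets \<open>A\<close>. That is enough, because shrinking
  coordinate \<open>i\<close> of a point of the orthant to 0 stays in the orthant and in the ball,
  hence in \<open>A\<close>.\<close>

lemma factor_coord_orthant: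
  fixes f :: "real ^ 'n::finite \<Rightarrow> real"
  assumes A: "openin (top_of_set orthant) A" and f: "smooth_on A f"
    and 0: "\<And>q. q \<in> A \<Longrightarrow> q $ i = 0 \<Longrightarrow> f q = 0" and q0: "q0 \<in> A" "q0 $ i = 0"
  obtains U h where "open U" "q0 \<in> U" "smooth_on U h" "\<forall>q \<in> A \<inter> U. f q = q $ i * h q"
proof -
  obtain V g where V: "open V" "q0 \<in> V" "\<forall>k. C_k_on k g V" "\<forall>y\<in>A \<inter> V. g y = f y"
    by (rule smooth_onE[OF f q0(1)])
  obtain O' where O: "open O'" "A = orthant \<inter> O'"
    using A by (auto simp: openin_open)
  have "open (V \<inter> O')" "q0 \<in> V \<inter> O'"
    using V O q0 by auto
  then obtain e where e: "e > 0" "ball q0 e \<subseteq> V \<inter> O'"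
    using open_contains_ball by blast
  have "C_k_on k g (ball q0 e)" for k
    using V(3) e(2) C_k_on_subset[of k g V] by blast
  from C_k_on_factor_coord[OF q0(2) this] obtain h
    where h: "\<And>k. C_k_on k h (ball q0 e)"
      "\<And>q. q \<in> ball q0 e \<Longrightarrow> g q = g (shrink_coord i 0 q) + q $ i * h q"
    by blast
  show thesis
  proof (rule that)
    show "smooth_on (ball q0 e) h"
      by (rule smooth_on_C_k_on[OF open_ball h(1) order_refl])
    show "\<forall>q \<in> A \<inter> ball q0 e. f q = q $ i * h q"
    proof
    fix q assume q: "q \<in> A \<inter> ball q0 e"
    have s: "shrink_coord i 0 q \<in> ball q0 e"
      by (rule shrink_coord_ball) (use q q0 in auto)
    moreover have "shrink_coord i 0 q \<in> orthant"
      using q O by (auto simp: orthant_def shrink_coord_nth)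
    ultimately have "shrink_coord i 0 q \<in> A" "shrink_coord i 0 q \<in> V"
      using O e by auto
    then show "f q = q $ i * h q"
      using h(2)[of q] V(4) q e 0[of "shrink_coord i 0 q"] by (auto simp: shrink_coord_nth)
    qed
  qed (use e in auto)
qed

section \<open>Transitions of corner charts near the boundary\<close>

lemma orthant_ray:
  fixes q0 v :: "real ^ 'n::finite"
  assumes A: "openin (top_of_set orthant) A" and q0: "q0 \<in> A"
    and v: "\<And>i. q0 $ i = 0 \<Longrightarrow> 0 \<le> v $ i"
  shows "\<forall>\<^sub>F t in at_right 0. q0 + t *\<^sub>R v \<in> A"
proof -
  obtain O' where O: "open O'" "A = orthant \<inter> O'"
    using A by (auto simp: openin_open)
  have lim: "((\<lambda>t. q0 + t *\<^sub>R v) \<longlongrightarrow> q0 + 0 *\<^sub>R v) (at_right 0)"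
    by (intro tendsto_intros)
  have 1: "\<forall>\<^sub>F t in at_right 0. q0 + t *\<^sub>R v \<in> O'"
    using topological_tendstoD[OF lim O(1)] q0 O by simp
  have "\<forall>\<^sub>F t in at_right 0. 0 \<le> (q0 + t *\<^sub>R v) $ i" for i
  proof (cases "q0 $ i = 0")
    case True
    then show ?thesis
      using v[OF True] by (auto simp: eventually_at_filter)
  next
    case False
    then have "q0 $ i > 0"
      using q0 O by (auto simp: orthant_def less_le)
    moreover have "((\<lambda>t. (q0 + t *\<^sub>R v) $ i) \<longlongrightarrow> q0 $ i) (at_right 0)"
      using tendsto_vec_nth[OF lim, of i] by simp
    ultimately have "\<forall>\<^sub>F t in at_right 0. 0 < (q0 + t *\<^sub>R v) $ i"
      by (simp add: order_tendstoD)
    then show ?thesis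
      by eventually_elim simp
  qed
  then have "\<forall>\<^sub>F t in at_right 0. \<forall>i. 0 \<le> (q0 + t *\<^sub>R v) $ i"
    by (simp add: eventually_all_finite)
  with 1 show ?thesis
    by eventually_elim (simp add: O orthant_def)
qed

text \<open>Division by the coordinate gives factors \<open>h\<close> for \<open>\<tau>\<close> and
  \<open>h'\<close> for its inverse. Along the ray from \<open>q0\<close> in direction
  \<open>axis i 1\<close> coordinate \<open>i\<close> equals \<open>t > 0\<close> and can be
  cancelled, so \<open>h\<close> times \<open>h'\<close> is 1 there and, by continuity, at
  \<open>q0\<close>. As \<open>h\<close> is also a limit of nonnegative values, it is positive at
  \<open>q0\<close> and hence nearby.\<close>

lemma transition_factor:
  fixes \<tau> \<tau>' :: "real ^ 'n::finite \<Rightarrow> real ^ 'n"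
  assumes A: "openin (top_of_set orthant) A" and A': "openin (top_of_set orthant) A'"
    and \<tau>: "smooth_on A \<tau>" "\<tau> ` A \<subseteq> A'" and \<tau>': "smooth_on A' \<tau>'" "\<tau>' ` A' \<subseteq> A"
    and inv: "\<And>q. q \<in> A \<Longrightarrow> \<tau>' (\<tau> q) = q" "\<And>q. q \<in> A' \<Longrightarrow> \<tau> (\<tau>' q) = q"
    and zero: "\<And>q. q \<in> A \<Longrightarrow> q $ i = 0 \<longleftrightarrow> \<tau> q $ j = 0"
    and q0: "q0 \<in> A" "q0 $ i = 0"
  obtains U h where "open U" "q0 \<in> U" "smooth_on U h"
    "\<forall>q\<in>U. 0 < h q" "\<forall>q \<in> A \<inter> U. \<tau> q $ j = q $ i * h q"
proof -
  have z: "\<tau> q $ j = 0" if "q \<in> A" "q $ i = 0" for q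
    using zero that by blast
  obtain U h where h: "open U" "q0 \<in> U" "smooth_on U h" "\<forall>q \<in> A \<inter> U. \<tau> q $ j = q $ i * h q"
    by (rule factor_coord_orthant[OF A smooth_on_vec_nth[OF \<tau>(1)] z q0])
  have z': "\<tau>' q $ i = 0" if "q \<in> A'" "q $ j = 0" for q
    using zero[of "\<tau>' q"] \<tau>' inv that by auto
  have \<tau>q0: "\<tau> q0 \<in> A'" using \<tau>(2) q0(1) by blast
  obtain U' h' where h': "open U'" "\<tau> q0 \<in> U'" "smooth_on U' h'"
      "\<forall>q \<in> A' \<inter> U'. \<tau>' q $ i = q $ j * h' q"
    by (rule factor_coord_orthant[OF A' smooth_on_vec_nth[OF \<tau>'(1)] z' \<tau>q0 z[OF q0]])
  note ch = smooth_on_imp_continuous_on[OF h(3)] and ch' = smooth_on_imp_continuous_on[OF h'(3)]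
    and c\<tau> = smooth_on_imp_continuous_on[OF \<tau>(1)]
  define q where "q t = q0 + t *\<^sub>R (axis i 1 :: real ^ 'n)" for t
  have ev: "\<forall>\<^sub>F t in at_right 0. q t \<in> A"
    unfolding q_def by (rule orthant_ray[OF A q0(1)]) (simp add: axis_def)
  have q: "(q \<longlongrightarrow> q0) (at_right 0)"
    unfolding q_def by (auto intro!: tendsto_eq_intros)
  have evU: "\<forall>\<^sub>F t in at_right 0. q t \<in> U"
    using topological_tendstoD[OF q h(1,2)] .
  have \<tau>q: "((\<lambda>t. \<tau> (q t)) \<longlongrightarrow> \<tau> q0) (at_right 0)"
    by (rule continuous_on_tendsto_compose[OF c\<tau> q q0(1) ev])
  have evU': "\<forall>\<^sub>F t in at_right 0. \<tau> (q t) \<in> U'"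
    using topological_tendstoD[OF \<tau>q h'(1,2)] .
  have hq: "((\<lambda>t. h (q t)) \<longlongrightarrow> h q0) (at_right 0)"
    by (rule continuous_on_tendsto_compose[OF ch q h(2) evU])
  have h'q: "((\<lambda>t. h' (\<tau> (q t))) \<longlongrightarrow> h' (\<tau> q0)) (at_right 0)"
    by (rule continuous_on_tendsto_compose[OF ch' \<tau>q h'(2) evU'])
  have pos: "\<forall>\<^sub>F t in at_right (0::real). 0 < t"
    by (rule eventually_at_right_less)
  have "\<forall>\<^sub>F t in at_right 0. h (q t) * h' (\<tau> (q t)) = 1"
    using ev evU evU' pos
  proof eventually_elim
    case (elim t)
    have t: "q t $ i = t"
      using q0(2) by (simp add: q_def)
    have "t = \<tau> (q t) $ j * h' (\<tau> (q t))"
      using h'(4)[rule_format, of "\<tau> (q t)"] elim \<tau>(2) inv(1) t by auto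
    also have "\<dots> = t * (h (q t) * h' (\<tau> (q t)))"
      using h(4)[rule_format, of "q t"] elim t by simp
    finally show ?case
      using elim by simp
  qed
  then have "((\<lambda>t. h (q t) * h' (\<tau> (q t))) \<longlongrightarrow> 1) (at_right 0)"
    by (rule tendsto_eventually)
  from tendsto_unique[OF _ tendsto_mult[OF hq h'q] this]
  have 1: "h q0 * h' (\<tau> q0) = 1" by simp
  have "\<forall>\<^sub>F t in at_right 0. 0 \<le> h (q t)"
    using ev evU pos
  proof eventually_elim
    case (elim t)
    have t: "q t $ i = t"
      using q0(2) by (simp add: q_def)
    have "0 \<le> \<tau> (q t) $ j"
      using openin_imp_subset[OF A'] \<tau>(2) elim by (auto simp: orthant_def)
    then show ?case
      using h(4)[rule_format, of "q t"] elim t by (simp add: zero_le_mult_iff)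
  qed
  then have "0 \<le> h q0"
    using tendsto_lowerbound[OF hq] by simp
  with 1 have p: "0 < h q0"
    by (cases "h q0 = 0") auto
  show thesis
  proof (rule that)
    show "open (U \<inter> h -` {0<..})"
      using ch h(1) by (simp add: continuous_open_preimage)
    show "smooth_on (U \<inter> h -` {0<..}) h"
      by (rule smooth_on_subset[OF h(3)]) auto
  qed (use h p in auto)
qed

subsection \<open>Invariance of the corner index\<close>

text \<open>The derivative \<open>D\<close> at \<open>q0\<close> of an extension of
  \<open>\<tau>\<close> is injective and maps the tangent space of the stratum at \<open>q0\<close>
  into that of the stratum at \<open>\<tau> q0\<close>: for a tangent \<open>v\<close> both
  \<open>v\<close> and \<open>- v\<close> point into \<open>A\<close>, so a coordinate of
  \<open>\<tau>\<close> that vanishes at \<open>q0\<close> has a local minimum along this line and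
  its derivative is 0. Comparing dimensions gives the bound.\<close>

lemma transition_index_le:
  fixes \<tau> \<tau>' :: "real ^ 'n::finite \<Rightarrow> real ^ 'n"
  assumes A: "openin (top_of_set orthant) A" and A': "A' \<subseteq> orthant"
    and \<tau>: "smooth_on A \<tau>" "\<tau> ` A \<subseteq> A'" and \<tau>': "smooth_on A' \<tau>'"
    and inv: "\<And>q. q \<in> A \<Longrightarrow> \<tau>' (\<tau> q) = q" and q0: "q0 \<in> A"
  shows "card {j. \<tau> q0 $ j = 0} \<le> card {i. q0 $ i = 0}"
proof -
  obtain V g where V: "open V" "q0 \<in> V" "\<forall>k. C_k_on k g V" "\<forall>y\<in>A \<inter> V. g y = \<tau> y"
    by (rule smooth_onE[OF \<tau>(1) q0])
  have \<tau>q0: "\<tau> q0 \<in> A'" using \<tau> q0 by auto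
  obtain V' g' where V': "open V'" "\<tau> q0 \<in> V'" "\<forall>k. C_k_on k g' V'" "\<forall>y\<in>A' \<inter> V'. g' y = \<tau>' y"
    by (rule smooth_onE[OF \<tau>' \<tau>q0])
  have gq0: "g q0 = \<tau> q0" using V q0 by auto
  obtain D where D: "(g has_derivative D) (at q0)"
    using C_k_on_has_derivative[OF V(3)[rule_format] V(2)] by blast
  obtain D' where D': "(g' has_derivative D') (at (g q0))"
    using C_k_on_has_derivative[OF V'(3)[rule_format] V'(2)] gq0 by auto
  have comp: "((\<lambda>q. g' (g q)) has_derivative (\<lambda>v. D' (D v))) (at q0)"
    by (rule has_derivative_compose[OF D D'])
  have ray: "((\<lambda>t. q0 + t *\<^sub>R v) has_derivative (\<lambda>t. t *\<^sub>R v)) (at 0 within S)" for v and S :: "real set"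
    by (auto intro!: derivative_eq_intros)
  have cg: "(g \<longlongrightarrow> \<tau> q0) (at q0)"
    using has_derivative_continuous[OF D] by (simp add: isCont_def gq0)
  \<comment> \<open>The extensions invert each other only on \<open>A\<close>, which may have no
    points on one side of \<open>q0\<close>. One-sided derivatives along the rays into the orthant
    still determine \<open>D' o D\<close> on the standard basis.\<close>
  have e: "D' (D (axis i 1)) = axis i 1" for i
  proof -
    let ?r = "\<lambda>t. q0 + t *\<^sub>R (axis i 1 :: real ^ 'n)"
    have 1: "((\<lambda>t. g' (g (?r t))) has_derivative (\<lambda>t. D' (D (t *\<^sub>R axis i 1)))) (at 0 within {0..})"
      using has_derivative_compose[OF ray, where g = "\<lambda>q. g' (g q)" and g' = "\<lambda>v. D' (D v)"] comp by simp
    have rA: "\<forall>\<^sub>F t in at_right 0. ?r t \<in> A"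
      by (rule orthant_ray[OF A q0]) (simp add: axis_def)
    have r: "(?r \<longlongrightarrow> q0) (at_right 0)"
      by (auto intro!: tendsto_eq_intros)
    have rV: "\<forall>\<^sub>F t in at_right 0. ?r t \<in> V"
      using topological_tendstoD[OF r V(1,2)] .
    have "continuous_on V g"
      using V(3) C_k_on_imp_continuous_on by blast
    from continuous_on_tendsto_compose[OF this r V(2) rV]
    have "\<forall>\<^sub>F t in at_right 0. g (?r t) \<in> V'"
      by (rule topological_tendstoD) (use V' gq0 in auto)
    with rA rV have "\<forall>\<^sub>F t in at_right 0. g' (g (?r t)) = ?r t"
    proof eventually_elim
      case (elim t)
      then have "g (?r t) = \<tau> (?r t)" "\<tau> (?r t) \<in> A'"
        using V(4) \<tau>(2) by auto
      with elim show ?case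
        using V'(4) inv by auto
    qed
    then have "\<forall>\<^sub>F t in at 0 within {0..}. g' (g (?r t)) = ?r t"
      by (simp add: at_within_Ici_at_right)
    from has_derivative_transform_eventually[OF 1 this]
    have "(?r has_derivative (\<lambda>t. D' (D (t *\<^sub>R axis i 1)))) (at 0 within {0..})"
      using V(4) V'(4) inv[OF q0] q0 gq0 V'(2) V(2) \<tau>q0 by simp
    then have "(?r has_vector_derivative D' (D (axis i 1))) (at 0 within {0..})"
      using linear_scale[OF has_derivative_linear[OF D]] linear_scale[OF has_derivative_linear[OF D']]
      by (simp add: has_vector_derivative_def)
    moreover have "(?r has_vector_derivative axis i 1) (at 0 within {0..})"
      using ray[of "axis i 1" "{0..}"] by (simp add: has_vector_derivative_def)
    moreover have "at (0::real) within {0..} \<noteq> bot"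
      by (simp add: at_within_Ici_at_right)
    ultimately show ?thesis
      using vector_derivative_unique_within by blast
  qed
  have lD: "linear D" and lD': "linear D'"
    using D D' has_derivative_linear by auto
  have DD: "D' (D v) = v" for v
  proof -
    have "(\<lambda>v. D' (D v)) = (\<lambda>v. v)"
    proof (rule linear_eq_stdbasis)
      show "linear (\<lambda>v. D' (D v))"
        using linear_compose[OF lD lD'] by (simp add: o_def)
      show "D' (D b) = b" if "b \<in> Basis" for b
        using that e by (auto simp: Basis_vec_def)
    qed (simp add: linear_iff)
    then show ?thesis by meson
  qed
  define L where "L J = {v :: real ^ 'n. \<forall>i\<in>J. v $ i = 0}" for J
  have dimL: "dim (L J) = CARD('n) - card J" for J
  proof -
    have "L J = {x. \<forall>i\<in>Basis. i \<notin> (\<lambda>i. axis i 1) ` (- J) \<longrightarrow> x \<bullet> i = 0}"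
      by (auto simp: L_def Basis_vec_def axis_eq_axis inner_axis)
    moreover have "dim \<dots> = card ((\<lambda>i. axis i 1 :: real ^ 'n) ` (- J))"
      by (rule dim_substandard) (auto simp: Basis_vec_def)
    moreover have "\<dots> = card (- J)"
      by (rule card_image) (auto simp: inj_on_def axis_eq_axis)
    ultimately show ?thesis
      by (simp add: Compl_eq_Diff_UNIV card_Diff_subset)
  qed
  have "D ` L {i. q0 $ i = 0} \<subseteq> L {j. \<tau> q0 $ j = 0}"
  proof (clarsimp simp: L_def)
    fix v :: "real ^ 'n" and j assume v: "\<forall>i. q0 $ i = 0 \<longrightarrow> v $ i = 0" and j: "\<tau> q0 $ j = 0"
    let ?\<phi> = "\<lambda>t. g (q0 + t *\<^sub>R v) $ j"
    have "((\<lambda>t. g (q0 + t *\<^sub>R v)) has_derivative (\<lambda>t. D (t *\<^sub>R v))) (at 0)"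
      using has_derivative_compose[OF ray, where g = g and g' = D] D by simp
    then have "(?\<phi> has_derivative (\<lambda>t. D (t *\<^sub>R v) $ j)) (at 0)"
      by (rule bounded_linear.has_derivative[OF bounded_linear_vec_nth])
    then have \<phi>: "(?\<phi> has_real_derivative D v $ j) (at 0)"
      by (simp add: has_field_derivative_def linear_scale[OF lD] mult.commute[of _ "D v $ j"])
    have "\<forall>\<^sub>F t in at_right 0. 0 \<le> g (q0 + t *\<^sub>R w) $ j" if "w = v \<or> w = - v" for w
    proof -
      have "\<forall>\<^sub>F t in at_right 0. q0 + t *\<^sub>R w \<in> A"
        by (rule orthant_ray[OF A q0]) (use v that in auto)
      moreover have r: "((\<lambda>t. q0 + t *\<^sub>R w) \<longlongrightarrow> q0) (at_right 0)"
        by (auto intro!: tendsto_eq_intros)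
      have "\<forall>\<^sub>F t in at_right 0. q0 + t *\<^sub>R w \<in> V"
        using topological_tendstoD[OF r V(1,2)] .
      ultimately show ?thesis
      proof eventually_elim
        case (elim t)
        then have "g (q0 + t *\<^sub>R w) = \<tau> (q0 + t *\<^sub>R w)" "\<tau> (q0 + t *\<^sub>R w) \<in> A'"
          using V(4) \<tau>(2) by auto
        then show ?case
          using A' by (auto simp: orthant_def)
      qed
    qed
    from this[of v] this[of "- v"]
    obtain d1 d2 where d: "0 < d1" "0 < d2"
      "\<And>t. 0 < t \<Longrightarrow> t < d1 \<Longrightarrow> 0 \<le> g (q0 + t *\<^sub>R v) $ j"
      "\<And>t. 0 < t \<Longrightarrow> t < d2 \<Longrightarrow> 0 \<le> g (q0 + t *\<^sub>R (- v)) $ j"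
      unfolding eventually_at_right_field by auto
    have "0 \<le> ?\<phi> t" if "\<bar>t\<bar> < min d1 d2" for t
      using d(3)[of t] d(4)[of "- t"] that j gq0
      by (cases t "0::real" rule: linorder_cases) auto
    then have "D v $ j = 0"
      by (intro DERIV_local_min[OF \<phi>, of "min d1 d2"]) (use d j gq0 in auto)
    then show "D v $ j = 0" .
  qed
  moreover have "inj_on D (span (L {i. q0 $ i = 0}))"
    using DD by (metis inj_onI)
  then have "dim (D ` L {i. q0 $ i = 0}) = dim (L {i. q0 $ i = 0})"
    by (rule dim_image_eq[OF lD])
  ultimately have "CARD('n) - card {i. q0 $ i = 0} \<le> CARD('n) - card {j. \<tau> q0 $ j = 0}"
    using dim_subset dimL by metis
  moreover have "card {i. q0 $ i = 0} \<le> CARD('n)" "card {j. \<tau> q0 $ j = 0} \<le> CARD('n)"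
    by (auto intro: card_mono)
  ultimately show ?thesis by linarith
qed

subsection \<open>Smooth branches of the argument\<close>

text \<open>Angles are measured in full turns. \<open>w\<close> rotates the direction
  \<open>\<theta>\<close> to the positive real axis, so the cut of \<open>Ln\<close> lies opposite
  to \<open>\<theta>\<close> and \<open>a\<close> is the branch of the angle that stays within half
  a turn of \<open>\<theta>\<close>.\<close>

lemma smooth_angle:
  fixes \<theta> :: real
  defines "w \<equiv> \<lambda>z. z * cis (- (2 * pi * \<theta>))"
  defines "a \<equiv> \<lambda>z. \<theta> + Im (Ln (w z)) / (2 * pi)"
  shows angle_branch_smooth: "smooth_on {z. w z \<notin> \<real>\<^sub>\<le>\<^sub>0} a"
    and angle_branch: "z \<noteq> 0 \<Longrightarrow> z = of_real (norm z) * cis (2 * pi * a z)"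
    and angle_branch_cis: "r > 0 \<Longrightarrow> \<bar>t - \<theta>\<bar> < 1/2 \<Longrightarrow> a (of_real r * cis (2 * pi * t)) = t"
    and angle_branch_dom: "r > 0 \<Longrightarrow> \<bar>t - \<theta>\<bar> < 1/2 \<Longrightarrow> w (of_real r * cis (2 * pi * t)) \<notin> \<real>\<^sub>\<le>\<^sub>0"
proof -
  show "smooth_on {z. w z \<notin> \<real>\<^sub>\<le>\<^sub>0} a"
    unfolding a_def
    by (intro smooth_on_add smooth_on_const smooth_on_bounded_linear[OF bounded_linear_divide]
        smooth_on_bounded_linear[OF bounded_linear_Im] smooth_on_Ln)
      (auto simp: w_def intro!: smooth_on_mult smooth_on_const smooth_on_ident)
  show "z = of_real (norm z) * cis (2 * pi * a z)" if "z \<noteq> 0" for z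
  proof -
    have w: "w z \<noteq> 0" "norm (w z) = norm z"
      using that by (auto simp: w_def norm_mult)
    have "w z = of_real (norm (w z)) * cis (Im (Ln (w z)))"
      using w(1) exp_eq_polar[of "Ln (w z)"] by (simp add: Re_Ln)
    then have "w z * cis (2 * pi * \<theta>) = of_real (norm z) * cis (2 * pi * a z)"
      using w by (simp add: a_def cis_mult algebra_simps flip: cis_mult)
    then show ?thesis
      by (simp add: w_def mult.assoc cis_mult)
  qed
  have wr: "w (of_real r * cis (2 * pi * t)) = exp (Complex (ln r) (2 * pi * (t - \<theta>)))" if "r > 0" for r t
    using that by (simp add: w_def exp_eq_polar cis_mult algebra_simps)
  have b: "- pi < 2 * pi * (t - \<theta>)" "2 * pi * (t - \<theta>) < pi" if "\<bar>t - \<theta>\<bar> < 1/2" for t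
  proof -
    have "t - \<theta> < 1/2" "- (1/2) < t - \<theta>" using that by linarith+
    from mult_strict_left_mono[OF this(1), of "2 * pi"] mult_strict_left_mono[OF this(2), of "2 * pi"]
    show "- pi < 2 * pi * (t - \<theta>)" "2 * pi * (t - \<theta>) < pi" by auto
  qed
  show "a (of_real r * cis (2 * pi * t)) = t" if "r > 0" "\<bar>t - \<theta>\<bar> < 1/2" for r t
    unfolding a_def wr[OF that(1)] using b[OF that(2)] by (subst Ln_exp) auto
  show "w (of_real r * cis (2 * pi * t)) \<notin> \<real>\<^sub>\<le>\<^sub>0" if "r > 0" "\<bar>t - \<theta>\<bar> < 1/2" for r t
  proof
    assume "w (of_real r * cis (2 * pi * t)) \<in> \<real>\<^sub>\<le>\<^sub>0"
    then have "Im (Ln (w (of_real r * cis (2 * pi * t)))) = pi"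
    proof (subst Im_Ln_eq_pi)
      show "w (of_real r * cis (2 * pi * t)) \<noteq> 0"
        unfolding wr[OF that(1)] by simp
      with \<open>w (of_real r * cis (2 * pi * t)) \<in> \<real>\<^sub>\<le>\<^sub>0\<close>
      show "Re (w (of_real r * cis (2 * pi * t))) < 0 \<and> Im (w (of_real r * cis (2 * pi * t))) = 0"
        by (simp only: complex_nonpos_Reals_iff complex_eq_iff) (simp add: less_le)
    qed
    then show False
      unfolding wr[OF that(1)] using b[OF that(2)] by (subst (asm) Ln_exp) auto
  qed
qed

section \<open>Lattices and tori\<close>

lemma vec_of_int_simps:
  "vec_of_int (a + b) = vec_of_int a + vec_of_int b"
  "vec_of_int (a - b) = vec_of_int a - vec_of_int b"
  "vec_of_int (- a) = - vec_of_int a" "vec_of_int 0 = 0"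
  "vec_of_int (k *s a) = of_int k *\<^sub>R vec_of_int a"
  by (simp_all add: vec_of_int_def vec_eq_iff)

lemma vec_of_int_sum: "vec_of_int (\<Sum>i\<in>I. f i) = (\<Sum>i\<in>I. vec_of_int (f i))"
  by (induction I rule: infinite_finite_induct) (auto simp: vec_of_int_simps)

lemma additive_group_simps [simp]:
  "carrier (additive_group S) = S" "x \<otimes>\<^bsub>additive_group S\<^esub> y = x + y" "\<one>\<^bsub>additive_group S\<^esub> = 0"
  by (simp_all add: additive_group_def)

lemma group_additive_group: "group (additive_group UNIV)"
  by (rule groupI) (auto intro: exI[of _ "- _"] simp: add.assoc intro!: bexI[of _ "- _"])

lemma inv_additive_group: "inv\<^bsub>additive_group UNIV\<^esub> x = - x"
  by (rule group.inv_equality[OF group_additive_group]) auto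

lemma submodule_of_intsD:
  assumes "submodule_of_ints K"
  shows "0 \<in> K" "x \<in> K \<Longrightarrow> y \<in> K \<Longrightarrow> x + y \<in> K" "x \<in> K \<Longrightarrow> - x \<in> K" "x \<in> K \<Longrightarrow> y \<in> K \<Longrightarrow> x - y \<in> K"
proof -
  show 0: "0 \<in> K" "x \<in> K \<Longrightarrow> y \<in> K \<Longrightarrow> x + y \<in> K" for x y
    using subgroup.one_closed[OF assms] subgroup.m_closed[OF assms] by auto
  show m: "x \<in> K \<Longrightarrow> - x \<in> K" for x
    using subgroup.m_inv_closed[OF assms] by (simp add: inv_additive_group)
  show "x \<in> K \<Longrightarrow> y \<in> K \<Longrightarrow> x - y \<in> K"
    using 0(2)[of x "- y"] m[of y] by simp
qed

lemma submodule_of_intsI: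
  assumes "0 \<in> K" "\<And>x y. x \<in> K \<Longrightarrow> y \<in> K \<Longrightarrow> x + y \<in> K" "\<And>x. x \<in> K \<Longrightarrow> - x \<in> K"
  shows "submodule_of_ints K"
  by (rule group.subgroupI[OF group_additive_group]) (use assms in \<open>auto simp: inv_additive_group\<close>)

lemma submodule_of_ints_generate: "submodule_of_ints (generate (additive_group UNIV) A)"
  by (rule group.generate_is_subgroup[OF group_additive_group]) simp

lemma submodule_of_ints_UNIV: "submodule_of_ints UNIV"
  by (rule submodule_of_intsI) auto

lemma submodule_of_ints_scale:
  assumes K: "submodule_of_ints K" and x: "x \<in> K"
  shows "k *s x \<in> K"
proof (induction k rule: int_induct[where k = 0])
  case base
  show ?case using submodule_of_intsD(1)[OF K] by simp
next
  case (step1 i)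
  have "(i + 1) *s x = i *s x + x" by (simp add: vec_eq_iff algebra_simps)
  then show ?case using step1 submodule_of_intsD(2)[OF K] x by simp
next
  case (step2 i)
  have "(i - 1) *s x = i *s x - x" by (simp add: vec_eq_iff algebra_simps)
  then show ?case using step2 submodule_of_intsD(4)[OF K] x by simp
qed

lemma submodule_of_ints_sum:
  assumes K: "submodule_of_ints K" and f: "\<And>i. i \<in> I \<Longrightarrow> f i \<in> K"
  shows "(\<Sum>i\<in>I. a i *s f i) \<in> K"
  using f by (induction I rule: infinite_finite_induct)
    (auto intro: submodule_of_intsD[OF K] submodule_of_ints_scale[OF K])

lemma generate_eq_combinations:
  fixes b :: "'i \<Rightarrow> int ^ 'n::finite"
  assumes "finite I"
  shows "generate (additive_group UNIV) (b ` I) = range (\<lambda>a. \<Sum>i\<in>I. a i *s b i)"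
proof (intro equalityI subsetI)
  fix x assume "x \<in> generate (additive_group UNIV) (b ` I)"
  then show "x \<in> range (\<lambda>a. \<Sum>i\<in>I. a i *s b i)"
  proof induction
    case one
    show ?case by (rule range_eqI[of _ _ "\<lambda>_. 0"]) simp
  next
    case (incl h)
    then obtain j where j: "j \<in> I" "h = b j" by auto
    have "(\<Sum>i\<in>I. (if i = j then 1 else 0) *s b i) = (\<Sum>i\<in>I. if i = j then b i else 0)"
      by (rule sum.cong) auto
    then have "(\<Sum>i\<in>I. (if i = j then 1 else 0) *s b i) = b j"
      using j assms by simp
    moreover have "(\<Sum>i\<in>I. (if i = j then 1 else 0) *s b i) \<in> range (\<lambda>a. \<Sum>i\<in>I. a i *s b i)"
      by (rule rangeI)
    ultimately show ?case using j by simp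
  next
    case (inv h)
    then obtain j where j: "j \<in> I" "h = b j" by auto
    have "(\<Sum>i\<in>I. (if i = j then - 1 else 0) *s b i) = (\<Sum>i\<in>I. if i = j then - b i else 0)"
      by (rule sum.cong) (auto simp: vec_eq_iff)
    then have "(\<Sum>i\<in>I. (if i = j then - 1 else 0) *s b i) = - b j"
      using j assms by simp
    moreover have "(\<Sum>i\<in>I. (if i = j then - 1 else 0) *s b i) \<in> range (\<lambda>a. \<Sum>i\<in>I. a i *s b i)"
      by (rule rangeI)
    ultimately show ?case using j by (simp add: inv_additive_group)
  next
    case (eng x y)
    then obtain a c where "x = (\<Sum>i\<in>I. a i *s b i)" "y = (\<Sum>i\<in>I. c i *s b i)" by auto
    then have "x + y = (\<Sum>i\<in>I. (a i + c i) *s b i)"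
      by (simp add: sum.distrib vector_sadd_rdistrib)
    moreover have "(\<Sum>i\<in>I. (a i + c i) *s b i) \<in> range (\<lambda>a. \<Sum>i\<in>I. a i *s b i)"
      by (rule rangeI)
    ultimately show ?case by (simp only: additive_group_simps)
  qed
next
  fix x assume "x \<in> range (\<lambda>a. \<Sum>i\<in>I. a i *s b i)"
  then show "x \<in> generate (additive_group UNIV) (b ` I)"
    by (auto intro!: submodule_of_ints_sum submodule_of_ints_generate intro: generate.incl)
qed

lemma real_span_generate:
  fixes A :: "(int ^ 'n::finite) set"
  assumes "finite A"
  shows "real_span (generate (additive_group UNIV) A) = span (vec_of_int ` A)"
  unfolding real_span_def
proof (rule span_eq[THEN iffD2], rule conjI)
  have "vec_of_int ` generate (additive_group UNIV) A \<subseteq> span (vec_of_int ` A)"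
  proof safe
    fix x assume "x \<in> generate (additive_group UNIV) A"
    then obtain a where "x = (\<Sum>i\<in>A. a i *s i)"
      using generate_eq_combinations[OF assms, of "\<lambda>x. x"] by auto
    then show "vec_of_int x \<in> span (vec_of_int ` A)"
      by (simp add: vec_of_int_sum vec_of_int_simps) (intro span_sum span_scale span_base imageI)
  qed
  then show "vec_of_int ` generate (additive_group UNIV) A \<subseteq> span (vec_of_int ` A)" .
  show "vec_of_int ` A \<subseteq> span (vec_of_int ` generate (additive_group UNIV) A)"
    by (auto intro!: span_base generate.incl)
qed

lemma subspace_real_span: "subspace (real_span K)"
  by (simp add: real_span_def)

lemma vec_of_int_in_real_span: "m \<in> K \<Longrightarrow> vec_of_int m \<in> real_span K"
  by (simp add: real_span_def span_base)

lemma submodule_of_ints_saturation: "submodule_of_ints (saturation K)"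
  using subspace_real_span[of K]
  by (intro submodule_of_intsI)
    (auto simp: saturation_def vec_of_int_simps subspace_0 subspace_add subspace_neg)

lemma subset_saturation: "K \<subseteq> saturation K"
  by (auto simp: saturation_def vec_of_int_in_real_span)

lemma real_span_saturation: "real_span (saturation K) = real_span K"
proof -
  have "span (vec_of_int ` saturation K) = span (vec_of_int ` K)"
  proof (rule span_eq[THEN iffD2], rule conjI)
    show "vec_of_int ` saturation K \<subseteq> span (vec_of_int ` K)"
      by (auto simp: saturation_def real_span_def)
    show "vec_of_int ` K \<subseteq> span (vec_of_int ` saturation K)"
      using subset_saturation by (auto intro!: span_base)
  qed
  then show ?thesis by (simp add: real_span_def)
qed

lemma real_span_UNIV: "real_span (UNIV :: (int ^ 'n::finite) set) = UNIV"
proof -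
  have "x \<in> span (range vec_of_int)" for x :: "real ^ 'n"
  proof -
    have "axis i 1 = vec_of_int (axis i 1 :: int ^ 'n)" for i
      by (simp add: vec_of_int_def vec_eq_iff axis_def)
    then have "(\<Sum>i\<in>UNIV. x $ i *\<^sub>R axis i 1) \<in> span (range vec_of_int)"
      by (intro span_sum span_scale span_base) auto
    moreover have "(\<Sum>i\<in>UNIV. x $ i *\<^sub>R axis i 1) = x"
      using basis_expansion[of x] by (simp add: scalar_mult_eq_scaleR)
    ultimately show ?thesis by simp
  qed
  then show ?thesis by (auto simp: real_span_def)
qed

lemma lattice_coset_eq_image: "lattice_coset K v = (\<lambda>m. vec_of_int m + v) ` K"
  by (auto simp: lattice_coset_def r_coset_def)

lemma lattice_coset_eq_iff:
  assumes K: "submodule_of_ints K"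
  shows "lattice_coset K v = lattice_coset K w \<longleftrightarrow> v - w \<in> vec_of_int ` K"
proof
  assume "lattice_coset K v = lattice_coset K w"
  moreover have "v \<in> lattice_coset K v"
    unfolding lattice_coset_eq_image
    by (rule image_eqI[of _ _ 0]) (use submodule_of_intsD[OF K] in \<open>auto simp: vec_of_int_simps\<close>)
  ultimately show "v - w \<in> vec_of_int ` K"
    by (auto simp: lattice_coset_eq_image)
next
  have *: "lattice_coset K v \<subseteq> lattice_coset K w" if vw: "v - w \<in> vec_of_int ` K" for v w
  proof
    fix x assume "x \<in> lattice_coset K v"
    then obtain m where m: "m \<in> K" "x = vec_of_int m + v" by (auto simp: lattice_coset_eq_image)
    obtain l where l: "l \<in> K" "v - w = vec_of_int l" using vw by auto
    have "x = vec_of_int (m + l) + w"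
      using m l by (simp add: vec_of_int_simps algebra_simps)
    then show "x \<in> lattice_coset K w"
      using submodule_of_intsD(2)[OF K m(1) l(1)] by (auto simp: lattice_coset_eq_image)
  qed
  assume vw: "v - w \<in> vec_of_int ` K"
  then have "w - v \<in> vec_of_int ` K"
    using submodule_of_intsD(3)[OF K] by (metis (no_types, lifting) imageE image_eqI minus_diff_eq vec_of_int_simps(3))
  with * vw show "lattice_coset K v = lattice_coset K w" by blast
qed

lemma torus_carrier: "carrier (torus K) = lattice_coset K ` real_span K"
  by (auto simp: torus_def FactGroup_def RCOSETS_def lattice_coset_def r_coset_def)

lemma torus_one: "\<one>\<^bsub>torus K\<^esub> = lattice_coset K 0"
  by (simp add: torus_def FactGroup_def lattice_coset_eq_image)

lemma torus_mult:
  assumes K: "submodule_of_ints K"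
  shows "lattice_coset K v \<otimes>\<^bsub>torus K\<^esub> lattice_coset K w = lattice_coset K (v + w)"
proof -
  have "lattice_coset K v \<otimes>\<^bsub>torus K\<^esub> lattice_coset K w =
      {x + y | x y. x \<in> lattice_coset K v \<and> y \<in> lattice_coset K w}"
    by (auto simp: torus_def FactGroup_def set_mult_def)
  also have "\<dots> = lattice_coset K (v + w)"
  proof (intro equalityI subsetI)
    fix z assume "z \<in> {x + y | x y. x \<in> lattice_coset K v \<and> y \<in> lattice_coset K w}"
    then obtain m l where "m \<in> K" "l \<in> K" "z = vec_of_int (m + l) + (v + w)"
      by (auto simp: lattice_coset_eq_image vec_of_int_simps algebra_simps)
    then show "z \<in> lattice_coset K (v + w)"
      using submodule_of_intsD(2)[OF K] by (auto simp: lattice_coset_eq_image)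
  next
    fix z assume "z \<in> lattice_coset K (v + w)"
    then obtain m where "m \<in> K" "z = (vec_of_int m + v) + (vec_of_int 0 + w)"
      by (auto simp: lattice_coset_eq_image vec_of_int_simps algebra_simps)
    then show "z \<in> {x + y | x y. x \<in> lattice_coset K v \<and> y \<in> lattice_coset K w}"
      using submodule_of_intsD(1)[OF K] by (auto simp: lattice_coset_eq_image)
  qed
  finally show ?thesis .
qed

lemma group_torus:
  assumes K: "submodule_of_ints K"
  shows "group (torus K)"
proof (rule groupI)
  note s = subspace_real_span[of K]
  show "x \<otimes>\<^bsub>torus K\<^esub> y \<in> carrier (torus K)" if "x \<in> carrier (torus K)" "y \<in> carrier (torus K)" for x y
    using that subspace_add[OF s] by (auto simp: torus_carrier torus_mult[OF K])
  show "\<one>\<^bsub>torus K\<^esub> \<in> carrier (torus K)"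
    using subspace_0[OF s] by (auto simp: torus_carrier torus_one)
  show "x \<otimes>\<^bsub>torus K\<^esub> y \<otimes>\<^bsub>torus K\<^esub> z = x \<otimes>\<^bsub>torus K\<^esub> (y \<otimes>\<^bsub>torus K\<^esub> z)"
    if "x \<in> carrier (torus K)" "y \<in> carrier (torus K)" "z \<in> carrier (torus K)" for x y z
    using that by (auto simp: torus_carrier torus_mult[OF K] add.assoc)
  show "\<one>\<^bsub>torus K\<^esub> \<otimes>\<^bsub>torus K\<^esub> x = x" if "x \<in> carrier (torus K)" for x
    using that by (auto simp: torus_carrier torus_mult[OF K] torus_one)
  show "\<exists>y\<in>carrier (torus K). y \<otimes>\<^bsub>torus K\<^esub> x = \<one>\<^bsub>torus K\<^esub>" if x: "x \<in> carrier (torus K)" for x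
  proof -
    obtain v where v: "v \<in> real_span K" "x = lattice_coset K v"
      using x by (auto simp: torus_carrier)
    then have "lattice_coset K (- v) \<otimes>\<^bsub>torus K\<^esub> x = \<one>\<^bsub>torus K\<^esub>"
      by (simp add: torus_mult[OF K] torus_one)
    moreover have "lattice_coset K (- v) \<in> carrier (torus K)"
      using v subspace_neg[OF s] by (auto simp: torus_carrier)
    ultimately show ?thesis by blast
  qed
qed

lemma torus_map_coset:
  assumes L: "submodule_of_ints L" and K: "submodule_of_ints K" "K \<subseteq> L"
  shows "torus_map L (lattice_coset K v) = lattice_coset L v"
proof (intro equalityI subsetI)
  fix x assume "x \<in> torus_map L (lattice_coset K v)"
  then obtain m l where "m \<in> K" "l \<in> L" "x = vec_of_int (m + l) + v"
    by (auto simp: torus_map_def lattice_coset_eq_image vec_of_int_simps algebra_simps)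
  then show "x \<in> lattice_coset L v"
    using submodule_of_intsD(2)[OF L] K(2) by (auto simp: lattice_coset_eq_image)
next
  fix x assume "x \<in> lattice_coset L v"
  then obtain l where "l \<in> L" "x = (vec_of_int 0 + v) + vec_of_int l"
    by (auto simp: lattice_coset_eq_image vec_of_int_simps algebra_simps)
  then show "x \<in> torus_map L (lattice_coset K v)"
    using submodule_of_intsD(1)[OF K(1)] unfolding torus_map_def lattice_coset_eq_image by blast
qed

lemma zeta_coset: "submodule_of_ints K \<Longrightarrow> zeta K (lattice_coset K v) = lattice_coset (saturation K) v"
  unfolding zeta_def by (rule torus_map_coset[OF submodule_of_ints_saturation _ subset_saturation])

lemma coset_in_kernel_zeta_iff:
  assumes K: "submodule_of_ints K"
  shows "lattice_coset K v \<in> kernel (torus K) (torus (saturation K)) (zeta K) \<longleftrightarrow>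
    v \<in> vec_of_int ` saturation K"
proof
  assume "lattice_coset K v \<in> kernel (torus K) (torus (saturation K)) (zeta K)"
  then show "v \<in> vec_of_int ` saturation K"
    by (auto simp: kernel_def zeta_coset[OF K] torus_one
        lattice_coset_eq_iff[OF submodule_of_ints_saturation])
next
  assume v: "v \<in> vec_of_int ` saturation K"
  then have "v \<in> real_span K"
    by (auto simp: saturation_def)
  then show "lattice_coset K v \<in> kernel (torus K) (torus (saturation K)) (zeta K)"
    using v by (auto simp: kernel_def zeta_coset[OF K] torus_one torus_carrier
        lattice_coset_eq_iff[OF submodule_of_ints_saturation])
qed

text \<open>Both maps keep the representative of a coset; the subtorus of a face is therefore the
  image of the real span of its module.\<close>

lemma image_torus_eq:
  assumes K: "submodule_of_ints K"
  shows "torus_map UNIV ` zeta K ` carrier (torus K) = lattice_coset UNIV ` real_span K"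
  by (auto simp: torus_carrier zeta_coset[OF K] image_image
      torus_map_coset[OF submodule_of_ints_UNIV submodule_of_ints_saturation] )

lemma quotient_map_quotient_topology: "quotient_map X (quotient_topology X f) f"
proof -
  have "openin (quotient_topology X f) U \<longleftrightarrow> openin X {x \<in> topspace X. f x \<in> U}"
    if "U \<subseteq> f ` topspace X" for U
    using that by (simp add: openin_quotient_topology)
  then show ?thesis
    by (simp add: quotient_map_def topspace_quotient_topology)
qed

lemma topspace_torus_topology: "topspace (torus_topology K) = carrier (torus K)"
  by (simp add: torus_topology_def topspace_quotient_topology torus_carrier)

lemma quotient_map_lattice_coset: "quotient_map (top_of_set (real_span K)) (torus_topology K) (lattice_coset K)"
  unfolding torus_topology_def by (rule quotient_map_quotient_topology)

subsection \<open>Rational independence\<close>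

text \<open>The coefficients are real because angles are. The characteristic function only provides
  independence over the integers; \<open>lin_indepI\<close> passes from one to the other.\<close>

definition lin_indep :: "'i set \<Rightarrow> ('i \<Rightarrow> int ^ 'n::finite) \<Rightarrow> bool" where
  "lin_indep I b \<longleftrightarrow> (\<forall>r. (\<Sum>i\<in>I. r i *\<^sub>R vec_of_int (b i)) = 0 \<longrightarrow> (\<forall>i\<in>I. r i = 0))"

text \<open>Discreteness of the lattice, in the form that turns approximate relations into exact
  ones and makes continuous integral functions locally constant.\<close>

lemma norm_int_vec_less_1:
  assumes "norm (vec_of_int m) < 1"
  shows "m = 0"
proof -
  have "\<bar>m $ i\<bar> < 1" for i
  proof -
    have "\<bar>real_of_int (m $ i)\<bar> \<le> norm (vec_of_int m)"
      using component_le_norm_cart[of "vec_of_int m" i] by (simp add: vec_of_int_def)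
    then have "real_of_int \<bar>m $ i\<bar> < 1" using assms by simp
    then show ?thesis by linarith
  qed
  then show ?thesis by (auto simp: vec_eq_iff)
qed

text \<open>By simultaneous Diophantine approximation, a real relation with some coefficient equal to 1
  has integer multiples arbitrarily close to integral combinations, which therefore vanish.\<close>

lemma lin_indepI:
  fixes b :: "'i \<Rightarrow> int ^ 'n::finite"
  assumes I: "finite I" and indep: "\<And>a :: 'i \<Rightarrow> int. (\<Sum>i\<in>I. a i *s b i) = 0 \<Longrightarrow> \<forall>i\<in>I. a i = 0"
  shows "lin_indep I b"
  unfolding lin_indep_def
proof (intro allI impI ballI, rule ccontr)
  fix r :: "'i \<Rightarrow> real" and j assume r: "(\<Sum>i\<in>I. r i *\<^sub>R vec_of_int (b i)) = 0" and j: "j \<in> I" "r j \<noteq> 0"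
  define s where "s i = r i / r j" for i
  have s: "(\<Sum>i\<in>I. s i *\<^sub>R vec_of_int (b i)) = 0"
  proof -
    have "(\<Sum>i\<in>I. s i *\<^sub>R vec_of_int (b i)) = inverse (r j) *\<^sub>R (\<Sum>i\<in>I. r i *\<^sub>R vec_of_int (b i))"
      by (simp add: s_def scaleR_right.sum divide_inverse mult.commute)
    then show ?thesis using r by simp
  qed
  obtain f where f: "bij_betw f {..<card I} I"
    using I by (metis bij_betw_from_nat_into_finite)
  define C where "C = (\<Sum>i\<in>I. norm (vec_of_int (b i)))"
  \<comment> \<open>With \<open>N\<close> above the sum of the norms, coefficient errors below
    \<open>1 / N\<close> add up to a vector of norm below 1.\<close>
  obtain N :: nat where N: "C < N" "0 < N"
  proof -
    obtain N :: nat where N: "C < N" using reals_Archimedean2 by blast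
    moreover have "0 \<le> C" by (simp add: C_def sum_nonneg)
    ultimately have "0 < N" by (cases N) auto
    then show thesis using that N by blast
  qed
  obtain q p where qp: "0 < q" "\<And>i. i < card I \<Longrightarrow> \<bar>of_int q * s (f i) - of_int (p i)\<bar> < 1 / N"
    using Dirichlet_approx_simult[OF N(2), of "card I" "\<lambda>i. s (f i)"] by metis
  define a where "a i = p (inv_into {..<card I} f i)" for i
  have a: "\<bar>of_int q * s i - of_int (a i)\<bar> < 1 / N" if "i \<in> I" for i
    using qp(2)[of "inv_into {..<card I} f i"] f that
    by (metis a_def bij_betw_imp_surj_on bij_betw_inv_into_right inv_into_into lessThan_iff)
  have "vec_of_int (\<Sum>i\<in>I. a i *s b i) = (\<Sum>i\<in>I. (of_int (a i) - of_int q * s i) *\<^sub>R vec_of_int (b i))"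
    using s by (simp add: vec_of_int_sum vec_of_int_simps scaleR_diff_left sum_subtractf
        flip: scaleR_scaleR scaleR_right.sum)
  also have "norm \<dots> \<le> (\<Sum>i\<in>I. norm ((of_int (a i) - of_int q * s i) *\<^sub>R vec_of_int (b i)))"
    by (rule norm_sum)
  also have "\<dots> \<le> (\<Sum>i\<in>I. 1 / N * norm (vec_of_int (b i)))"
  proof (rule sum_mono)
    fix i assume "i \<in> I"
    then have "\<bar>of_int (a i) - of_int q * s i\<bar> \<le> 1 / N"
      using a[of i] by (simp add: abs_minus_commute)
    then show "norm ((of_int (a i) - of_int q * s i) *\<^sub>R vec_of_int (b i)) \<le> 1 / N * norm (vec_of_int (b i))"
      unfolding norm_scaleR by (rule mult_right_mono) simp
  qed
  also have "\<dots> = C / N"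
    by (simp add: C_def sum_divide_distrib)
  also have "\<dots> < 1"
    using N by simp
  finally have "(\<Sum>i\<in>I. a i *s b i) = 0"
    by (rule norm_int_vec_less_1)
  then have "a j = 0"
    using indep j by blast
  then have "\<bar>real_of_int q\<bar> < 1 / N"
    using a[OF j(1)] j by (simp add: s_def)
  also have "\<dots> \<le> 1"
    using N by simp
  finally show False
    using qp(1) by linarith
qed

lemma lin_indep_coeff_unique:
  assumes "lin_indep I b" "(\<Sum>i\<in>I. r i *\<^sub>R vec_of_int (b i)) = (\<Sum>i\<in>I. s i *\<^sub>R vec_of_int (b i))" "i \<in> I"
  shows "r i = s i"
proof -
  have "(\<Sum>i\<in>I. (r i - s i) *\<^sub>R vec_of_int (b i)) = 0"
    using assms(2) by (simp add: scaleR_diff_left sum_subtractf)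
  then show ?thesis
    using assms(1,3) unfolding lin_indep_def by fastforce
qed

lemma span_image_eq_combinations:
  assumes "finite I"
  shows "span (f ` I) = range (\<lambda>r. \<Sum>i\<in>I. r i *\<^sub>R f i)"
proof (intro equalityI span_minimal)
  show "f ` I \<subseteq> range (\<lambda>r. \<Sum>i\<in>I. r i *\<^sub>R f i)"
  proof safe
    fix j assume j: "j \<in> I"
    have "(\<Sum>i\<in>I. (if i = j then 1 else 0) *\<^sub>R f i) = f j"
      using j assms by (simp add: if_distrib[of "\<lambda>x. x *\<^sub>R _"] cong: if_cong)
    moreover have "(\<Sum>i\<in>I. (if i = j then 1 else 0) *\<^sub>R f i) \<in> range (\<lambda>r. \<Sum>i\<in>I. r i *\<^sub>R f i)"
      by (rule rangeI)
    ultimately show "f j \<in> range (\<lambda>r. \<Sum>i\<in>I. r i *\<^sub>R f i)"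
      by simp
  qed
  show "subspace (range (\<lambda>r. \<Sum>i\<in>I. r i *\<^sub>R f i))"
  proof (rule subspaceI)
    show "0 \<in> range (\<lambda>r. \<Sum>i\<in>I. r i *\<^sub>R f i)"
      by (rule range_eqI[of _ _ "\<lambda>_. 0"]) simp
    show "x + y \<in> range (\<lambda>r. \<Sum>i\<in>I. r i *\<^sub>R f i)"
      if xy: "x \<in> range (\<lambda>r. \<Sum>i\<in>I. r i *\<^sub>R f i)" "y \<in> range (\<lambda>r. \<Sum>i\<in>I. r i *\<^sub>R f i)" for x y
    proof -
      obtain r s where "x = (\<Sum>i\<in>I. r i *\<^sub>R f i)" "y = (\<Sum>i\<in>I. s i *\<^sub>R f i)" using xy by auto
      then show ?thesis
        by (intro range_eqI[of _ _ "\<lambda>i. r i + s i"]) (simp add: scaleR_add_left sum.distrib)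
    qed
    show "c *\<^sub>R x \<in> range (\<lambda>r. \<Sum>i\<in>I. r i *\<^sub>R f i)" if x: "x \<in> range (\<lambda>r. \<Sum>i\<in>I. r i *\<^sub>R f i)" for c x
    proof -
      obtain r where "x = (\<Sum>i\<in>I. r i *\<^sub>R f i)" using x by auto
      then show ?thesis
        by (intro range_eqI[of _ _ "\<lambda>i. c * r i"]) (simp add: scaleR_right.sum)
    qed
  qed
  show "range (\<lambda>r. \<Sum>i\<in>I. r i *\<^sub>R f i) \<subseteq> span (f ` I)"
    by safe (intro span_sum span_scale span_base imageI)
qed

lemma finite_bounded_int_vecs: "finite {m :: int ^ 'n::finite. norm (vec_of_int m) \<le> C}"
proof -
  let ?S = "{- \<lceil>C\<rceil>..\<lceil>C\<rceil>}"
  have "{m :: int ^ 'n. norm (vec_of_int m) \<le> C} \<subseteq> (\<lambda>f. \<chi> i. f i) ` Pi\<^sub>E UNIV (\<lambda>_. ?S)"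
  proof
    fix m :: "int ^ 'n" assume "m \<in> {m. norm (vec_of_int m) \<le> C}"
    then have m: "norm (vec_of_int m) \<le> C" by simp
    have "\<bar>real_of_int (m $ i)\<bar> \<le> C" for i
      using component_le_norm_cart[of "vec_of_int m" i] m by (simp add: vec_of_int_def)
    then have "m $ i \<in> ?S" for i
      using abs_le_iff[of "real_of_int (m $ i)" C] by (auto; linarith)
    then show "m \<in> (\<lambda>f. \<chi> i. f i) ` Pi\<^sub>E UNIV (\<lambda>_. ?S)"
      by (intro image_eqI[of _ _ "\<lambda>i. m $ i"]) auto
  qed
  then show ?thesis
    by (rule finite_subset) (auto intro!: finite_PiE)
qed

lemma lin_indep_insert:
  assumes "finite I" "lin_indep I b" "j \<notin> I" "vec_of_int e \<notin> span ((\<lambda>i. vec_of_int (b i)) ` I)"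
  shows "lin_indep (insert j I) (b(j := e))"
  unfolding lin_indep_def
proof (intro allI impI)
  fix r assume "(\<Sum>i\<in>insert j I. r i *\<^sub>R vec_of_int ((b(j := e)) i)) = 0"
  moreover have "(\<Sum>i\<in>I. r i *\<^sub>R vec_of_int ((b(j := e)) i)) = (\<Sum>i\<in>I. r i *\<^sub>R vec_of_int (b i))"
    using assms(3) by (intro sum.cong) auto
  ultimately have *: "r j *\<^sub>R vec_of_int e + (\<Sum>i\<in>I. r i *\<^sub>R vec_of_int (b i)) = 0"
    using assms(1,3) by simp
  have "r j = 0"
  proof (rule ccontr)
    assume rj: "r j \<noteq> 0"
    have "r j *\<^sub>R vec_of_int e = - (\<Sum>i\<in>I. r i *\<^sub>R vec_of_int (b i))"
      using * by (simp only: eq_neg_iff_add_eq_0)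
    then have "inverse (r j) *\<^sub>R (r j *\<^sub>R vec_of_int e) = inverse (r j) *\<^sub>R (- (\<Sum>i\<in>I. r i *\<^sub>R vec_of_int (b i)))"
      by (rule arg_cong)
    then have "vec_of_int e = (- inverse (r j)) *\<^sub>R (\<Sum>i\<in>I. r i *\<^sub>R vec_of_int (b i))"
      using rj by simp
    moreover have "\<dots> \<in> span ((\<lambda>i. vec_of_int (b i)) ` I)"
      by (intro span_scale span_sum span_base imageI)
    ultimately show False using assms(4) by simp
  qed
  moreover from this * have "\<forall>i\<in>I. r i = 0"
    using assms(2) unfolding lin_indep_def by simp
  ultimately show "\<forall>i\<in>insert j I. r i = 0" by simp
qed

text \<open>If \<open>e\<close> does not lie in the rational subspace spanned by the \<open>b i\<close>, the set of \<open>r\<close> such that some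
  lattice point lies in \<open>r e +\<close> that subspace is a discrete subgroup of the line; a lattice point
  over its least positive element splits off.\<close>

lemma lattice_split_off:
  fixes b :: "'i \<Rightarrow> int ^ 'n::finite"
  assumes I: "finite I" and e: "vec_of_int e \<notin> span ((\<lambda>i. vec_of_int (b i)) ` I)"
  obtains m0 where "vec_of_int m0 \<notin> span ((\<lambda>i. vec_of_int (b i)) ` I)"
    "\<forall>m t. vec_of_int m - t *\<^sub>R vec_of_int m0 \<in> span ((\<lambda>i. vec_of_int (b i)) ` I) \<longrightarrow> t \<in> \<int>"
proof -
  let ?S = "span ((\<lambda>i. vec_of_int (b i)) ` I)"
  define R where "R = {r. \<exists>m. vec_of_int m - r *\<^sub>R vec_of_int e \<in> ?S}"
  have uniq: "r = s" if "x - r *\<^sub>R vec_of_int e \<in> ?S" "x - s *\<^sub>R vec_of_int e \<in> ?S" for r s x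
  proof (rule ccontr)
    assume "r \<noteq> s"
    have "(s - r) *\<^sub>R vec_of_int e \<in> ?S"
      using span_diff[OF that] by (simp add: algebra_simps)
    then have "inverse (s - r) *\<^sub>R ((s - r) *\<^sub>R vec_of_int e) \<in> ?S"
      by (rule span_scale)
    then show False using e \<open>r \<noteq> s\<close> by simp
  qed
  define C where "C = (\<Sum>i\<in>I. norm (vec_of_int (b i))) + norm (vec_of_int e)"
  have "R \<inter> {0<..1} \<subseteq> (\<lambda>m. THE r. vec_of_int m - r *\<^sub>R vec_of_int e \<in> ?S) ` {m. norm (vec_of_int m) \<le> C}"
  proof
    fix r assume r: "r \<in> R \<inter> {0<..1}"
    then obtain m where m: "vec_of_int m - r *\<^sub>R vec_of_int e \<in> ?S"
      by (auto simp: R_def)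
    then obtain x where x: "vec_of_int m - r *\<^sub>R vec_of_int e = (\<Sum>i\<in>I. x i *\<^sub>R vec_of_int (b i))"
      unfolding span_image_eq_combinations[OF I] by auto
    \<comment> \<open>Removing the integral parts of the coefficients does not change
      \<open>r\<close> and brings the lattice vector into a bounded region, which contains only
      finitely many.\<close>
    define m' where "m' = m - (\<Sum>i\<in>I. \<lfloor>x i\<rfloor> *s b i)"
    have m': "vec_of_int m' = (\<Sum>i\<in>I. frac (x i) *\<^sub>R vec_of_int (b i)) + r *\<^sub>R vec_of_int e"
      using x by (simp add: m'_def vec_of_int_simps vec_of_int_sum frac_def scaleR_diff_left
          sum_subtractf algebra_simps)
    have "norm (vec_of_int m') \<le> (\<Sum>i\<in>I. norm (frac (x i) *\<^sub>R vec_of_int (b i))) + norm (r *\<^sub>R vec_of_int e)"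
      unfolding m' by (rule order_trans[OF norm_triangle_ineq]) (intro add_mono norm_sum order_refl)
    also have "\<dots> \<le> C"
      unfolding C_def using r
      by (intro add_mono sum_mono) (auto simp: frac_ge_0 frac_lt_1 less_imp_le intro!: mult_left_le_one_le)
    finally have "norm (vec_of_int m') \<le> C" .
    moreover have mS: "vec_of_int m' - r *\<^sub>R vec_of_int e \<in> ?S"
      unfolding m' add_diff_cancel_right' by (intro span_sum span_scale span_base imageI)
    then have "(THE r. vec_of_int m' - r *\<^sub>R vec_of_int e \<in> ?S) = r"
      using uniq by (intro the_equality) auto
    ultimately show "r \<in> (\<lambda>m. THE r. vec_of_int m - r *\<^sub>R vec_of_int e \<in> ?S) ` {m. norm (vec_of_int m) \<le> C}"
      by (intro image_eqI[of _ _ m']) auto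
  qed
  then have fin: "finite (R \<inter> {0<..1})"
    by (rule finite_subset) (intro finite_imageI finite_bounded_int_vecs)
  have "1 \<in> R"
    unfolding R_def by (auto intro!: exI[of _ e] span_zero)
  then have ne: "R \<inter> {0<..1} \<noteq> {}" by auto
  define r0 where "r0 = Min (R \<inter> {0<..1})"
  have r0: "r0 \<in> R" "0 < r0" "r0 \<le> 1"
    using Min_in[OF fin ne] by (auto simp: r0_def)
  have min: "r0 \<le> r" if "r \<in> R" "0 < r" for r
  proof (cases "r \<le> 1")
    case True
    then show ?thesis using that Min_le[OF fin] by (auto simp: r0_def)
  qed (use r0 in auto)
  obtain m0 where m0: "vec_of_int m0 - r0 *\<^sub>R vec_of_int e \<in> ?S"
    using r0 by (auto simp: R_def)
  show thesis
  proof (rule that; (intro allI impI)?)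
    show "vec_of_int m0 \<notin> ?S"
      using uniq[OF m0, of 0] r0 by auto
    fix m t assume m: "vec_of_int m - t *\<^sub>R vec_of_int m0 \<in> ?S"
    \<comment> \<open>Division with remainder: the remainder \<open>(t - k) * r0\<close> lies in
      \<open>R\<close> and below the least positive element \<open>r0\<close>, so it is 0.\<close>
    define k where "k = \<lfloor>t\<rfloor>"
    have "(vec_of_int m - t *\<^sub>R vec_of_int m0) + (t - of_int k) *\<^sub>R (vec_of_int m0 - r0 *\<^sub>R vec_of_int e) \<in> ?S"
      by (intro span_add m span_scale m0)
    then have "vec_of_int (m - k *s m0) - ((t - of_int k) * r0) *\<^sub>R vec_of_int e \<in> ?S"
      by (simp add: vec_of_int_simps algebra_simps)
    then have "(t - of_int k) * r0 \<in> R"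
      by (auto simp: R_def)
    moreover have "0 \<le> (t - of_int k) * r0" "(t - of_int k) * r0 < r0"
      using r0 by (auto simp: k_def mult_less_cancel_right1) linarith
    ultimately have "(t - of_int k) * r0 = 0"
      using min by fastforce
    then have "t = of_int k" using r0 by simp
    then show "t \<in> \<int>" by simp
  qed
qed

text \<open>Lattice vectors are split off one at a time until the index set is exhausted. The
  invariant says that every lattice vector in the span reached so far is an integral combination of
  the new vectors modulo the real span \<open>?T\<close> of the given ones. Working modulo
  \<open>?T\<close> is essential: the given vectors need not generate the lattice points of their
  span, and this defect becomes the chart group.\<close>

lemma lattice_basis_extend:
  fixes b :: "'n::finite \<Rightarrow> int ^ 'n" and J0 :: "'n set"
  assumes "lin_indep J0 b"
  obtains b' where "\<forall>i\<in>J0. b' i = b i" "lin_indep UNIV b'"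
    "\<And>m. \<exists>a :: int ^ 'n. (\<forall>i\<in>J0. a $ i = 0) \<and>
       vec_of_int (m - (\<Sum>i\<in>-J0. a $ i *s b' i)) \<in> span ((\<lambda>i. vec_of_int (b i)) ` J0)"
proof -
  let ?T = "span ((\<lambda>i. vec_of_int (b i)) ` J0)"
  let ?Q = "\<lambda>J b'. lin_indep J b' \<and> (\<forall>i\<in>J0. b' i = b i) \<and>
     (\<forall>m. vec_of_int m \<in> span ((\<lambda>i. vec_of_int (b' i)) ` J) \<longrightarrow>
       (\<exists>a. vec_of_int (m - (\<Sum>i\<in>J - J0. a i *s b' i)) \<in> ?T))"
  have "\<exists>b'. ?Q UNIV b'" if "J0 \<subseteq> J" "?Q J c" for J :: "'n set" and c
    using that
  proof (induction "card (- J)" arbitrary: J c)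
    case 0
    then have "- J = {}" by simp
    then have "J = UNIV" by blast
    then show ?case using 0 by blast
  next
    case (Suc k)
    then have "- J \<noteq> {}" by auto
    then obtain j where j: "j \<notin> J" by blast
    let ?S = "span ((\<lambda>i. vec_of_int (c i)) ` J)"
    have "\<exists>e. vec_of_int e \<notin> ?S"
    proof (rule ccontr)
      assume "\<nexists>e. vec_of_int e \<notin> ?S"
      then have "real_span (UNIV :: (int ^ 'n) set) \<subseteq> ?S"
        unfolding real_span_def by (intro span_minimal) auto
      then have "dim ?S = CARD('n)"
        using real_span_UNIV[where 'n = 'n] by (simp add: top.extremum_unique)
      moreover have "dim ?S \<le> card J"
        using dim_le_card'[of "(\<lambda>i. vec_of_int (c i)) ` J"] card_image_le[of J "\<lambda>i. vec_of_int (c i)"]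
        by (simp add: dim_span)
      moreover have "card J < CARD('n)"
        using j by (intro psubset_card_mono) auto
      ultimately show False by simp
    qed
    then obtain e where e: "vec_of_int e \<notin> ?S" ..
    obtain m0 where m0: "vec_of_int m0 \<notin> ?S" "\<forall>m t. vec_of_int m - t *\<^sub>R vec_of_int m0 \<in> ?S \<longrightarrow> t \<in> \<int>"
      by (rule lattice_split_off[OF finite e])
    let ?c = "c(j := m0)"
    have c_J: "(\<lambda>i. vec_of_int (?c i)) ` insert j J = insert (vec_of_int m0) ((\<lambda>i. vec_of_int (c i)) ` J)"
      using j by auto
    have "?Q (insert j J) ?c"
    proof (intro conjI allI impI)
      show "lin_indep (insert j J) ?c"
        by (rule lin_indep_insert) (use Suc j m0 in auto)
      show "\<forall>i\<in>J0. ?c i = b i"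
        using Suc j by auto
      fix m assume "vec_of_int m \<in> span ((\<lambda>i. vec_of_int (?c i)) ` insert j J)"
      then obtain t where t: "vec_of_int m - t *\<^sub>R vec_of_int m0 \<in> ?S"
        unfolding c_J by (auto simp: span_insert)
      then obtain k where k: "t = of_int k"
        using m0(2) Ints_cases by metis
      with t have "vec_of_int (m - k *s m0) \<in> ?S"
        by (simp add: vec_of_int_simps)
      then obtain a where a: "vec_of_int (m - k *s m0 - (\<Sum>i\<in>J - J0. a i *s c i)) \<in> ?T"
        using Suc.prems(2) by blast
      have "(\<Sum>i\<in>insert j J - J0. (a(j := k)) i *s ?c i) = k *s m0 + (\<Sum>i\<in>J - J0. a i *s c i)"
      proof -
        have "insert j J - J0 = insert j (J - J0)" using j Suc.prems(1) by auto
        moreover have "(\<Sum>i\<in>J - J0. (a(j := k)) i *s ?c i) = (\<Sum>i\<in>J - J0. a i *s c i)"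
          using j by (intro sum.cong) auto
        ultimately show ?thesis using j by simp
      qed
      with a show "\<exists>a. vec_of_int (m - (\<Sum>i\<in>insert j J - J0. a i *s ?c i)) \<in> ?T"
        by (metis diff_diff_eq)
    qed
    moreover have "k = card (- insert j J)"
    proof -
      have "- J = insert j (- insert j J)" using j by auto
      then have "card (- J) = Suc (card (- insert j J))"
        using card_insert_disjoint[of "- insert j J" j] by simp
      then show ?thesis using Suc.hyps by simp
    qed
    moreover have "J0 \<subseteq> insert j J" using Suc.prems by auto
    ultimately show ?case
      by (intro Suc.hyps(1))
  qed
  moreover have "?Q J0 b"
    using assms by (auto intro!: exI[of _ "\<lambda>_. 0"])
  ultimately obtain b' where b': "?Q UNIV b'"
    by blast
  show thesis
  proof (rule that[of b'])
    fix m :: "int ^ 'n"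
    have "vec_of_int m \<in> span (range (\<lambda>i. vec_of_int (b' i)))"
    proof -
      have "inj (\<lambda>r :: real ^ 'n. \<Sum>i\<in>UNIV. r $ i *\<^sub>R vec_of_int (b' i))"
        using lin_indep_coeff_unique[of UNIV b'] b' by (auto simp: inj_on_def vec_eq_iff)
      moreover have "linear (\<lambda>r :: real ^ 'n. \<Sum>i\<in>UNIV. r $ i *\<^sub>R vec_of_int (b' i))"
        by (auto intro!: linearI simp: scaleR_add_left sum.distrib scaleR_right.sum)
      ultimately have "surj (\<lambda>r :: real ^ 'n. \<Sum>i\<in>UNIV. r $ i *\<^sub>R vec_of_int (b' i))"
        by (intro linear_injective_imp_surjective) simp_all
      then obtain r :: "real ^ 'n" where "vec_of_int m = (\<Sum>i\<in>UNIV. r $ i *\<^sub>R vec_of_int (b' i))"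
        by (rule surjE)
      then show ?thesis
        by (simp only:) (intro span_sum span_scale span_base rangeI)
    qed
    then obtain a where a: "vec_of_int (m - (\<Sum>i\<in>UNIV - J0. a i *s b' i)) \<in> ?T"
      using b' by blast
    have "(\<Sum>i\<in>-J0. (\<chi> i. if i \<in> J0 then 0 else a i) $ i *s b' i) = (\<Sum>i\<in>UNIV - J0. a i *s b' i)"
      by (intro sum.cong) auto
    with a show "\<exists>a :: int ^ 'n. (\<forall>i\<in>J0. a $ i = 0) \<and> vec_of_int (m - (\<Sum>i\<in>-J0. a $ i *s b' i)) \<in> ?T"
      by (intro exI[of _ "\<chi> i. if i \<in> J0 then 0 else a i"]) simp
  qed (use b' in auto)
qed

subsection \<open>The torus of a lattice\<close>

abbreviation tor :: "real ^ 'n::finite \<Rightarrow> (real ^ 'n) set" where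
  "tor \<equiv> lattice_coset UNIV"

lemma tor_eq_iff: "tor v = tor w \<longleftrightarrow> v - w \<in> range vec_of_int"
  by (rule lattice_coset_eq_iff[OF submodule_of_ints_UNIV])

lemma tor_mult: "tor v \<otimes>\<^bsub>torus UNIV\<^esub> tor w = tor (v + w)"
  by (rule torus_mult[OF submodule_of_ints_UNIV])

lemma carrier_torus_UNIV: "carrier (torus UNIV) = range tor"
  by (simp add: torus_carrier real_span_UNIV)

lemma quotient_map_tor: "quotient_map euclidean (torus_topology UNIV) tor"
  using quotient_map_lattice_coset[of UNIV] by (simp add: real_span_UNIV)

text \<open>Converts the angles of a chart into a translation vector; \<open>coord\<close> reads the
  angles off again. \<open>b\<close> will be a basis of the real space but in general not of the
  lattice.\<close>

definition comb :: "('n::finite \<Rightarrow> int ^ 'n) \<Rightarrow> real ^ 'n \<Rightarrow> real ^ 'n" where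
  "comb b \<theta> = (\<Sum>i\<in>UNIV. \<theta> $ i *\<^sub>R vec_of_int (b i))"

definition coord :: "('n::finite \<Rightarrow> int ^ 'n) \<Rightarrow> real ^ 'n \<Rightarrow> real ^ 'n" where
  "coord b = inv_into UNIV (comb b)"

lemma linear_comb: "linear (comb b)"
  by (rule linearI) (auto simp: comb_def scaleR_add_left sum.distrib scaleR_right.sum)

lemma comb_vec_of_int: "comb b (vec_of_int a) = vec_of_int (\<Sum>i\<in>UNIV. a $ i *s b i)"
  by (simp add: comb_def vec_of_int_sum vec_of_int_simps) (simp add: vec_of_int_def)

context
  fixes b :: "'n::finite \<Rightarrow> int ^ 'n"
  assumes b: "lin_indep UNIV b"
begin

lemma inj_comb: "inj (comb b)"
  using lin_indep_coeff_unique[OF b] by (auto simp: inj_on_def vec_eq_iff comb_def)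

lemma surj_comb: "surj (comb b)"
  by (intro linear_injective_imp_surjective linear_comb inj_comb) simp_all

lemma comb_coord [simp]: "comb b (coord b v) = v"
  unfolding coord_def by (rule surj_f_inv_f[OF surj_comb])

lemma coord_comb [simp]: "coord b (comb b \<theta>) = \<theta>"
  unfolding coord_def by (rule inv_f_f[OF inj_comb])

lemma linear_coord: "linear (coord b)"
proof (rule linearI)
  show "coord b (x + y) = coord b x + coord b y" for x y
    using coord_comb[of "coord b x + coord b y"] by (simp add: linear_add[OF linear_comb])
  show "coord b (r *\<^sub>R x) = r *\<^sub>R coord b x" for r x
    using coord_comb[of "r *\<^sub>R coord b x"] by (simp add: linear_scale[OF linear_comb])
qed

lemma vec_of_int_generate: "vec_of_int ` generate (additive_group UNIV) (range b) = comb b ` range vec_of_int"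
proof -
  have "generate (additive_group UNIV) (range b) = range (\<lambda>a. \<Sum>i\<in>UNIV. a i *s b i)"
    by (rule generate_eq_combinations) simp
  also have "\<dots> = range (\<lambda>a :: int ^ 'n. \<Sum>i\<in>UNIV. a $ i *s b i)"
  proof (intro equalityI subsetI)
    fix x assume "x \<in> range (\<lambda>a. \<Sum>i\<in>UNIV. a i *s b i)"
    then obtain a where "x = (\<Sum>i\<in>UNIV. a i *s b i)" by auto
    then show "x \<in> range (\<lambda>a :: int ^ 'n. \<Sum>i\<in>UNIV. a $ i *s b i)"
      by (intro range_eqI[of _ _ "\<chi> i. a i"]) simp
  qed auto
  finally show ?thesis
    by (simp add: image_image comb_vec_of_int)
qed

lemma real_span_basis: "real_span (generate (additive_group UNIV) (range b)) = UNIV"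
proof -
  have "v \<in> span (vec_of_int ` range b)" for v
  proof -
    have "comb b (coord b v) \<in> span (vec_of_int ` range b)"
      unfolding comb_def by (intro span_sum span_scale span_base imageI rangeI)
    then show ?thesis by simp
  qed
  then show ?thesis by (auto simp: real_span_generate)
qed

end

section \<open>The torus of a full rank lattice as a product of circles\<close>

lemma cis_vec_simps:
  "cis_vec (a + b) = cis_vec a * cis_vec b" "cis_vec 0 = 1" "cis_vec a $ i = cis (2 * pi * a $ i)"
  "norm (cis_vec a $ i) = 1"
  by (simp_all add: cis_vec_def vec_eq_iff cis_mult algebra_simps)

lemma cis_2pi_eq_iff: "cis (2 * pi * x) = cis (2 * pi * y) \<longleftrightarrow> x - y \<in> \<int>"
proof
  assume "cis (2 * pi * x) = cis (2 * pi * y)"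
  then have "sin (2 * pi * x) = sin (2 * pi * y) \<and> cos (2 * pi * x) = cos (2 * pi * y)"
    by (simp add: complex_eq_iff)
  then obtain n :: int where "2 * pi * x = 2 * pi * y + 2 * pi * n"
    using sin_cos_eq_iff by blast
  then have "2 * pi * (x - y) = 2 * pi * n"
    by (simp add: algebra_simps)
  then have "x - y = of_int n" by simp
  then show "x - y \<in> \<int>" by simp
next
  assume "x - y \<in> \<int>"
  then obtain n :: int where "x = y + of_int n"
    by (metis Ints_cases add.commute diff_add_cancel)
  then show "cis (2 * pi * x) = cis (2 * pi * y)"
    by (simp add: distrib_left flip: cis_mult)
qed

lemma in_range_vec_of_int_iff: "v \<in> range vec_of_int \<longleftrightarrow> (\<forall>i. v $ i \<in> \<int>)"
proof
  assume "\<forall>i. v $ i \<in> \<int>"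
  then have "v = vec_of_int (\<chi> i. \<lfloor>v $ i\<rfloor>)"
    by (simp add: vec_eq_iff vec_of_int_def)
  then show "v \<in> range vec_of_int" by blast
qed (auto simp: vec_of_int_def)

lemma cis_vec_eq_iff: "cis_vec a = cis_vec b \<longleftrightarrow> a - b \<in> range vec_of_int"
  by (simp add: in_range_vec_of_int_iff vec_eq_iff cis_vec_simps cis_2pi_eq_iff)

lemma continuous_on_cis_vec: "continuous_on S cis_vec"
  unfolding cis_vec_def cis_conv_exp by (intro continuous_intros)

lemma cis_vec_surj:
  assumes "\<And>i. norm (s $ i) = 1"
  shows "\<exists>\<theta>. s = cis_vec \<theta>"
proof (rule exI[of _ "\<chi> i. Arg (s $ i) / (2 * pi)"])
  have "cis (Arg (s $ i)) = s $ i" for i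
    using assms[of i] rcis_cmod_Arg[of "s $ i"] by (simp add: rcis_def)
  then show "s = cis_vec (\<chi> i. Arg (s $ i) / (2 * pi))"
    by (simp add: vec_eq_iff cis_vec_simps)
qed

lemma carrier_circle_power: "carrier circle_power = range cis_vec"
proof (intro equalityI subsetI)
  fix s :: "complex ^ 'n" assume "s \<in> carrier circle_power"
  then have "\<exists>\<theta>. s = cis_vec \<theta>"
    by (intro cis_vec_surj) (simp add: circle_power_def)
  then show "s \<in> range cis_vec" by blast
qed (auto simp: circle_power_def cis_vec_simps)

text \<open>The isomorphism \<open>\<delta>\<close> of local standardness. On cosets of the lattice
  generated by \<open>b\<close> the choice of representative is immaterial, since
  \<open>coord b\<close> changes by integers.\<close>

definition torus_angle :: "('n::finite \<Rightarrow> int ^ 'n) \<Rightarrow> (real ^ 'n) set \<Rightarrow> complex ^ 'n" where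
  "torus_angle b S = cis_vec (coord b (SOME v. v \<in> S))"

context
  fixes b :: "'n::finite \<Rightarrow> int ^ 'n" and N
  assumes b: "lin_indep UNIV b" and N: "N = generate (additive_group UNIV) (range b)"
begin

lemma submodule_basis: "submodule_of_ints N"
  unfolding N by (rule submodule_of_ints_generate)

lemma coset_basis_eq_iff: "lattice_coset N v = lattice_coset N w \<longleftrightarrow> coord b v - coord b w \<in> range vec_of_int"
proof -
  have "lattice_coset N v = lattice_coset N w \<longleftrightarrow> v - w \<in> comb b ` range vec_of_int"
    using lattice_coset_eq_iff[OF submodule_basis] vec_of_int_generate[OF b] N by simp
  also have "\<dots> \<longleftrightarrow> coord b (v - w) \<in> range vec_of_int"
  proof
    assume "coord b (v - w) \<in> range vec_of_int"
    then have "comb b (coord b (v - w)) \<in> comb b ` range vec_of_int" by (rule imageI)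
    then show "v - w \<in> comb b ` range vec_of_int" by (simp only: comb_coord[OF b])
  qed (auto simp: coord_comb[OF b])
  finally show ?thesis
    by (simp add: linear_diff[OF linear_coord[OF b]])
qed

lemma torus_angle_coset: "torus_angle b (lattice_coset N v) = cis_vec (coord b v)"
proof -
  have self: "w \<in> lattice_coset N w" for w
    unfolding lattice_coset_eq_image
    by (rule image_eqI[of _ _ 0]) (use submodule_of_intsD(1)[OF submodule_basis] in \<open>auto simp: vec_of_int_simps\<close>)
  define w where "w = (SOME w. w \<in> lattice_coset N v)"
  have "w \<in> lattice_coset N v"
    unfolding w_def by (rule someI[of _ v], rule self)
  then have "w - v \<in> vec_of_int ` N"
    by (auto simp: lattice_coset_eq_image)
  then have "lattice_coset N w = lattice_coset N v"
    using lattice_coset_eq_iff[OF submodule_basis] by blast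
  then show ?thesis
    unfolding torus_angle_def w_def[symmetric] by (simp add: cis_vec_eq_iff coset_basis_eq_iff)
qed

lemma torus_carrier_basis: "carrier (torus N) = range (lattice_coset N)"
  unfolding torus_carrier N real_span_basis[OF b] ..

lemma torus_angle_iso: "torus_angle b \<in> iso (torus N) circle_power"
  unfolding iso_def hom_def bij_betw_def
proof (intro CollectI conjI)
  show "torus_angle b \<in> carrier (torus N) \<rightarrow> carrier circle_power"
    by (auto simp: torus_carrier_basis torus_angle_coset carrier_circle_power)
  show "\<forall>x\<in>carrier (torus N). \<forall>y\<in>carrier (torus N).
      torus_angle b (x \<otimes>\<^bsub>torus N\<^esub> y) = torus_angle b x \<otimes>\<^bsub>circle_power\<^esub> torus_angle b y"
    by (auto simp: torus_carrier_basis torus_mult[OF submodule_basis] torus_angle_coset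
        linear_add[OF linear_coord[OF b]] cis_vec_simps circle_power_def)
  show "inj_on (torus_angle b) (carrier (torus N))"
    by (auto simp: inj_on_def torus_carrier_basis torus_angle_coset cis_vec_eq_iff coset_basis_eq_iff)
  have "\<exists>v. cis_vec \<theta> = torus_angle b (lattice_coset N v)" for \<theta>
    by (rule exI[of _ "comb b \<theta>"]) (simp add: torus_angle_coset coord_comb[OF b])
  then show "torus_angle b ` carrier (torus N) = carrier circle_power"
    by (auto simp: torus_carrier_basis torus_angle_coset carrier_circle_power image_iff)
qed

text \<open>The image of the unit cube under \<open>comb b\<close> is compact and meets every coset:
  pass to fractional parts of the coordinates.\<close>

lemma compact_torus: "compact_space (torus_topology N)"
proof -
  have q: "quotient_map euclidean (torus_topology N) (lattice_coset N)"
    using quotient_map_lattice_coset[of N] unfolding N real_span_basis[OF b] by simp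
  have c: "continuous_map euclidean (torus_topology N) (lattice_coset N)"
    by (rule quotient_imp_continuous_map[OF q])
  have "compact (comb b ` cbox 0 1)"
    by (intro compact_continuous_image linear_continuous_on linear_conv_bounded_linear[THEN iffD1]
        linear_comb compact_cbox)
  then have "compactin euclidean (comb b ` cbox 0 1)" by simp
  from image_compactin[OF this c]
  have "compactin (torus_topology N) (lattice_coset N ` comb b ` cbox 0 1)" .
  moreover have "lattice_coset N ` comb b ` cbox 0 1 = topspace (torus_topology N)"
  proof -
    have "lattice_coset N v \<in> lattice_coset N ` comb b ` cbox 0 1" for v
    proof -
      let ?\<theta> = "\<chi> i. frac (coord b v $ i)"
      have "lattice_coset N v = lattice_coset N (comb b ?\<theta>)"
        unfolding coset_basis_eq_iff by (simp add: coord_comb[OF b] in_range_vec_of_int_iff frac_def)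
      moreover have "?\<theta> \<in> cbox 0 1"
        by (simp add: mem_box_cart frac_ge_0 frac_lt_1 less_imp_le)
      ultimately show ?thesis by blast
    qed
    then show ?thesis
      by (auto simp: topspace_torus_topology torus_carrier_basis)
  qed
  ultimately show ?thesis by (simp add: compact_space_def)
qed

text \<open>A continuous bijection from a compact space to a Hausdorff space; continuity is checked
  before passing to the quotient.\<close>

lemma torus_angle_homeomorphic: "homeomorphic_map (torus_topology N) (top_of_set (carrier circle_power)) (torus_angle b)"
proof (rule continuous_imp_homeomorphic_map[OF _ compact_torus])
  have q: "quotient_map euclidean (torus_topology N) (lattice_coset N)"
    using quotient_map_lattice_coset[of N] unfolding N real_span_basis[OF b] by simp
  have "continuous_on UNIV (\<lambda>v. cis_vec (coord b v))"
    by (rule continuous_on_compose2[OF continuous_on_cis_vec[of UNIV]])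
      (auto intro: linear_continuous_on linear_conv_bounded_linear[THEN iffD1] linear_coord[OF b])
  then have "continuous_map euclidean (top_of_set (carrier circle_power)) (torus_angle b \<circ> lattice_coset N)"
    by (auto simp: o_def torus_angle_coset carrier_circle_power continuous_map_in_subtopology)
  then show "continuous_map (torus_topology N) (top_of_set (carrier circle_power)) (torus_angle b)"
    by (rule continuous_compose_quotient_map[OF q])
  show "torus_angle b ` topspace (torus_topology N) = topspace (top_of_set (carrier circle_power))"
    using torus_angle_iso by (simp add: topspace_torus_topology iso_def bij_betw_def)
  show "inj_on (torus_angle b) (topspace (torus_topology N))"
    using torus_angle_iso by (simp add: topspace_torus_topology iso_def bij_betw_def)
qed (simp add: Hausdorff_space_subtopology)

end

subsection \<open>The standard torus\<close>

definition std_basis :: "'n::finite \<Rightarrow> int ^ 'n" where "std_basis i = axis i 1"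

lemma sum_std_basis: "(\<Sum>i\<in>UNIV. a $ i *s std_basis i) = a"
  unfolding std_basis_def by (rule basis_expansion)

lemma comb_std_basis: "comb std_basis v = v" for v :: "real ^ 'n::finite"
proof -
  have "vec_of_int (std_basis i) = axis i 1" for i :: 'n
    by (simp add: std_basis_def vec_of_int_def vec_eq_iff axis_def)
  then show ?thesis
    using basis_expansion[of v] by (simp add: comb_def scalar_mult_eq_scaleR)
qed

lemma lin_indep_std_basis: "lin_indep UNIV std_basis"
  unfolding lin_indep_def
proof (intro allI impI)
  fix r assume "(\<Sum>i\<in>UNIV. r i *\<^sub>R vec_of_int (std_basis i)) = (0 :: real ^ 'n)"
  then have "(\<chi> i. r i) = 0"
    using comb_std_basis[of "\<chi> i. r i"] by (simp add: comb_def)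
  then show "\<forall>i\<in>UNIV. r i = 0" by (simp add: vec_eq_iff)
qed

lemma generate_std_basis: "UNIV = generate (additive_group UNIV) (range (std_basis :: 'n::finite \<Rightarrow> int ^ 'n))"
proof -
  have "x \<in> range (\<lambda>a. \<Sum>i\<in>UNIV. a i *s std_basis i)" for x :: "int ^ 'n"
    by (rule range_eqI[of _ _ "\<lambda>i. x $ i"]) (simp add: sum_std_basis)
  then show ?thesis by (auto simp: generate_eq_combinations)
qed

lemma coord_std_basis: "coord std_basis v = v"
  using coord_comb[OF lin_indep_std_basis, of v] by (simp add: comb_std_basis)

lemma torus_angle_tor: "torus_angle std_basis (tor v) = cis_vec v"
  using torus_angle_coset[OF lin_indep_std_basis generate_std_basis] by (simp add: coord_std_basis)

lemma torus_angle_std_homeomorphic: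
  "homeomorphic_map (torus_topology UNIV) (top_of_set (carrier circle_power)) (torus_angle std_basis)"
  by (rule torus_angle_homeomorphic[OF lin_indep_std_basis generate_std_basis])

lemma compact_space_torus_topology_UNIV: "compact_space (torus_topology UNIV)"
  by (rule compact_torus[OF lin_indep_std_basis generate_std_basis])

lemma Hausdorff_space_torus_topology_UNIV: "Hausdorff_space (torus_topology (UNIV :: (int ^ 'n::finite) set))"
proof -
  have "torus_topology (UNIV :: (int ^ 'n) set) homeomorphic_space
      top_of_set (carrier (circle_power :: (complex ^ 'n) monoid))"
    by (rule homeomorphic_map_imp_homeomorphic_space[OF torus_angle_std_homeomorphic])
  then show ?thesis
    using homeomorphic_Hausdorff_space Hausdorff_space_subtopology Hausdorff_space_euclidean by blast
qed

text \<open>Branches of the angle, centred at a representative \<open>v\<close> of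
  \<open>t x\<close>, are applied to the circle coordinates of \<open>t\<close>. \<open>N\<close> is
  the set where no coordinate meets its branch cut.\<close>

lemma torus_lift_local:
  fixes t :: "'a \<Rightarrow> (real ^ 'n::finite) set"
  assumes t: "continuous_map (subtopology X W) (torus_topology UNIV) t" and W: "openin X W" "x \<in> W"
  obtains N a where "openin X N" "x \<in> N" "N \<subseteq> W" "continuous_map (subtopology X N) euclidean a"
    "\<forall>y\<in>N. t y = tor (a y)"
proof -
  have Wt: "topspace (subtopology X W) = W"
    using openin_subset[OF W(1)] by auto
  have tW: "t y \<in> range tor" if "y \<in> W" for y
    using continuous_map_image_subset_topspace[OF t] that Wt
    by (auto simp: topspace_torus_topology carrier_torus_UNIV)
  then obtain v where v: "t x = tor v" using W(2) by blast
  let ?s = "\<lambda>y. torus_angle std_basis (t y)"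
  have s: "continuous_map (subtopology X W) euclidean ?s"
    using continuous_map_compose[OF t homeomorphic_imp_continuous_map[OF torus_angle_std_homeomorphic]]
    by (simp add: o_def continuous_map_in_subtopology)
  let ?w = "\<lambda>i z. z * cis (- (2 * pi * v $ i))"
  let ?O = "{s :: complex ^ 'n. \<forall>i. ?w i (s $ i) \<notin> \<real>\<^sub>\<le>\<^sub>0}"
  define a where "a y = (\<chi> i. v $ i + Im (Ln (?w i (?s y $ i))) / (2 * pi))" for y
  have "open {z. ?w i z \<notin> \<real>\<^sub>\<le>\<^sub>0}" for i
  proof -
    have "open ((?w i) -` (- \<real>\<^sub>\<le>\<^sub>0))"
      by (rule continuous_open_vimage) (auto intro!: continuous_intros simp: open_Compl)
    then show ?thesis by (simp add: vimage_def)
  qed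
  then have "open (\<Inter>i. (\<lambda>s :: complex ^ 'n. s $ i) -` {z. ?w i z \<notin> \<real>\<^sub>\<le>\<^sub>0})"
    by (intro open_INT ballI finite continuous_open_vimage) (auto intro!: continuous_intros)
  moreover have "(\<Inter>i. (\<lambda>s :: complex ^ 'n. s $ i) -` {z. ?w i z \<notin> \<real>\<^sub>\<le>\<^sub>0}) = ?O"
    by auto
  ultimately have O: "open ?O" by simp
  define N where "N = {y \<in> W. ?s y \<in> ?O}"
  have "openin (subtopology X W) {y \<in> topspace (subtopology X W). ?s y \<in> ?O}"
    using s O unfolding continuous_map_def by auto
  then have oN: "openin X N"
    unfolding Wt N_def using openin_trans_full W(1) by blast
  have NW: "N \<subseteq> W" by (auto simp: N_def)
  show thesis
  proof (rule that[OF oN _ NW])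
    have "?w i (?s x $ i) \<notin> \<real>\<^sub>\<le>\<^sub>0" for i
      using angle_branch_dom[of 1 "v $ i" "v $ i"] by (simp add: v torus_angle_tor cis_vec_simps)
    then show "x \<in> N" using W(2) by (simp add: N_def)
    have sN: "continuous_map (subtopology X N) (top_of_set ?O) ?s"
      using continuous_map_from_subtopology_mono[OF s NW] openin_subset[OF oN]
      by (auto simp: continuous_map_in_subtopology N_def)
    have "continuous_on ?O (\<lambda>s. \<chi> i. v $ i + Im (Ln (?w i (s $ i))) / (2 * pi))"
    proof (intro continuous_on_vec_lambda)
      fix i
      show "continuous_on ?O (\<lambda>s. v $ i + Im (Ln (?w i (s $ i))) / (2 * pi))"
        by (rule continuous_on_compose2[OF smooth_on_imp_continuous_on[OF angle_branch_smooth[of "v $ i"]], of _ "\<lambda>s. s $ i"])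
          (auto intro!: continuous_intros)
    qed
    then have "continuous_map (top_of_set ?O) euclidean (\<lambda>s. \<chi> i. v $ i + Im (Ln (?w i (s $ i))) / (2 * pi))"
      by simp
    from continuous_map_compose[OF sN this]
    show "continuous_map (subtopology X N) euclidean a"
      by (simp add: o_def a_def[abs_def])
    show "\<forall>y\<in>N. t y = tor (a y)"
    proof
      fix y assume y: "y \<in> N"
      then obtain u where u: "t y = tor u" using tW NW by blast
      have "cis_vec (a y) = cis_vec u"
      proof -
        have "?s y $ i = cis (2 * pi * a y $ i)" for i
          using angle_branch[of "?s y $ i" "v $ i"] by (simp add: u torus_angle_tor cis_vec_simps a_def)
        then show ?thesis
          by (simp add: u torus_angle_tor vec_eq_iff cis_vec_simps)
      qed
      then have "u - a y \<in> range vec_of_int"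
        using cis_vec_eq_iff by metis
      then show "t y = tor (a y)"
        by (simp add: u tor_eq_iff)
    qed
  qed
qed

section \<open>Manifolds with corners\<close>

definition model_corner :: "'n set \<Rightarrow> (real ^ 'n::finite) set" where
  "model_corner I = {q. (\<forall>i\<in>I. 0 \<le> q $ i) \<and> (\<forall>i\<in>-I. 0 < q $ i)}"

lemma model_corner_subset_orthant: "model_corner I \<subseteq> orthant"
proof
  fix q assume q: "q \<in> model_corner I"
  have "0 \<le> q $ i" for i
    using q by (cases "i \<in> I") (auto simp: model_corner_def less_imp_le)
  then show "q \<in> orthant" by (simp add: orthant_def)
qed

lemma open_positive_coords: "open {q :: real ^ 'n::finite. \<forall>i\<in>J. 0 < q $ i}"
proof -
  have "{q :: real ^ 'n. \<forall>i\<in>J. 0 < q $ i} = (\<Inter>i\<in>J. {q. 0 < q $ i})" by auto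
  then show ?thesis
    by (auto intro!: open_INT open_Collect_less continuous_intros)
qed

lemma openin_model_corner: "openin (top_of_set orthant) (model_corner I)"
proof -
  have "model_corner I = orthant \<inter> {q. \<forall>i\<in>-I. 0 < q $ i}"
    using model_corner_subset_orthant by (auto simp: model_corner_def orthant_def)
  then show ?thesis
    using openin_open_Int[OF open_positive_coords] by simp
qed

locale corner_manifold =
  fixes P :: "'p topology" and \<A> :: "('p, 'n::finite) corner_chart set"
  assumes mwc: "manifold_with_corners P \<A>"
begin

lemma Hausdorff: "Hausdorff_space P" and second_countable: "second_countable P"
  and atlas_covers: "\<Union>(fst ` \<A>) = topspace P"
  using mwc by (simp_all only: manifold_with_corners_def)

lemma atlas_chart: "\<kappa> \<in> \<A> \<Longrightarrow> smooth_corner_chart P \<A> \<kappa>"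
  using mwc by (simp add: manifold_with_corners_def smooth_corner_chart_def)

lemma smooth_chartD:
  assumes "smooth_corner_chart P \<A> (U, c)"
  shows "openin P U" "openin (top_of_set orthant) (c ` U)" "U \<subseteq> topspace P" "inj_on c U"
    "homeomorphic_map (subtopology P U) (top_of_set (c ` U)) c"
    "continuous_map (subtopology P U) euclidean c"
    "continuous_map (top_of_set (c ` U)) (subtopology P U) (the_inv_into U c)"
    "topspace (subtopology P U) = U"
proof -
  show 1: "openin P U" "openin (top_of_set orthant) (c ` U)"
    and h: "homeomorphic_map (subtopology P U) (top_of_set (c ` U)) c"
    using assms unfolding smooth_corner_chart_def corner_chart_def by auto
  show 2: "U \<subseteq> topspace P"
    using openin_subset[OF 1(1)] .
  then show 3: "topspace (subtopology P U) = U"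
    by auto
  show inj: "inj_on c U"
    using homeomorphic_imp_injective_map[OF h] 3 by simp
  show "continuous_map (subtopology P U) euclidean c"
    using homeomorphic_imp_continuous_map[OF h] continuous_map_in_subtopology by blast
  obtain g where g: "homeomorphic_maps (subtopology P U) (top_of_set (c ` U)) c g"
    using h unfolding homeomorphic_map_maps by blast
  have eq: "the_inv_into U c q = g q" if q: "q \<in> c ` U" for q
  proof -
    obtain x where x: "x \<in> U" "q = c x" using q by auto
    have "g (c x) = x" using g x 3 unfolding homeomorphic_maps_def by auto
    then show ?thesis using the_inv_into_f_f[OF inj x(1)] x by simp
  qed
  have "continuous_map (top_of_set (c ` U)) (subtopology P U) g"
    using g unfolding homeomorphic_maps_def by blast
  then show "continuous_map (top_of_set (c ` U)) (subtopology P U) (the_inv_into U c)"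
    by (rule continuous_map_eq) (simp add: eq)
qed

lemma smooth_chart_open_image:
  assumes "smooth_corner_chart P \<A> (U, c)" "openin P W" "W \<subseteq> U"
  shows "openin (top_of_set orthant) (c ` W)"
proof -
  have "openin (subtopology P U) W"
    using assms(2,3) openin_subtopology_Int2[of P W U] by (simp add: inf_absorb2)
  then have "openin (top_of_set (c ` U)) (c ` W)"
    using homeomorphic_imp_open_map[OF smooth_chartD(5)[OF assms(1)]] unfolding open_map_def by blast
  then show ?thesis
    using smooth_chartD(2)[OF assms(1)] openin_trans by blast
qed

lemma smooth_chart_open_preimage:
  assumes "smooth_corner_chart P \<A> (U, c)" "open O'"
  shows "openin P {x \<in> U. c x \<in> O'}"
proof -
  have "openin (subtopology P U) {x \<in> topspace (subtopology P U). c x \<in> O'}"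
    using smooth_chartD(6)[OF assms(1)] assms(2) unfolding continuous_map_def by auto
  then show ?thesis
    unfolding smooth_chartD(8)[OF assms(1)] openin_open_subtopology[OF smooth_chartD(1)[OF assms(1)]] by simp
qed

lemma smooth_chart_openE:
  assumes "smooth_corner_chart P \<A> (U, c)" "openin P W" "W \<subseteq> U" "x \<in> W"
  obtains O' where "open O'" "c x \<in> O'" "\<forall>y\<in>U. c y \<in> O' \<longrightarrow> y \<in> W"
proof -
  obtain O' where O: "open O'" "c ` W = orthant \<inter> O'"
    using smooth_chart_open_image[OF assms(1-3)] by (auto simp: openin_open)
  show thesis
  proof (rule that[OF O(1)])
    show "c x \<in> O'" using O assms(4) by blast
    show "\<forall>y\<in>U. c y \<in> O' \<longrightarrow> y \<in> W"
    proof (intro ballI impI)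
      fix y assume y: "y \<in> U" "c y \<in> O'"
      have "c y \<in> orthant"
        using y(1) openin_imp_subset[OF smooth_chartD(2)[OF assms(1)]] by blast
      then have "c y \<in> c ` W" using O y by simp
      then obtain z where z: "z \<in> W" "c y = c z" by auto
      then have "y = z"
        using inj_onD[OF smooth_chartD(4)[OF assms(1)]] y(1) assms(3) by blast
      then show "y \<in> W" using z by simp
    qed
  qed
qed

lemma inv_chart: "smooth_corner_chart P \<A> (U, c) \<Longrightarrow> x \<in> U \<Longrightarrow> the_inv_into U c (c x) = x"
  by (rule the_inv_into_f_f[OF smooth_chartD(4)])

text \<open>Charts of the maximal atlas are only known to be compatible with the members of
  \<open>\<A>\<close>. Near each point the transition factors through one of these.\<close>

lemma smooth_transition:
  assumes U: "smooth_corner_chart P \<A> (U, c)" and V: "smooth_corner_chart P \<A> (V, d)"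
  shows "smooth_on (c ` (U \<inter> V)) (\<lambda>q. d (the_inv_into U c q))"
proof (rule smooth_on_local)
  fix q assume "q \<in> c ` (U \<inter> V)"
  then obtain x where x: "x \<in> U" "x \<in> V" "q = c x" by auto
  then obtain \<kappa> where "\<kappa> \<in> \<A>" "x \<in> fst \<kappa>"
    using atlas_covers smooth_chartD(3)[OF U] by blast
  then obtain W e where W: "(W, e) \<in> \<A>" "x \<in> W" by (cases \<kappa>) auto
  note We = atlas_chart[OF W(1)]
  have UW: "smooth_on (c ` (U \<inter> W)) (\<lambda>q. e (the_inv_into U c q))"
    using U W(1) unfolding smooth_corner_chart_def corner_transition_smooth_def by auto
  have WV: "smooth_on (e ` (W \<inter> V)) (\<lambda>q. d (the_inv_into W e q))"
    using V W(1) unfolding smooth_corner_chart_def corner_transition_smooth_def by auto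
  have "openin P (U \<inter> W)"
    using smooth_chartD(1)[OF U] smooth_chartD(1)[OF We] by blast
  then obtain O' where O: "open O'" "c x \<in> O'" "\<forall>y\<in>U. c y \<in> O' \<longrightarrow> y \<in> U \<inter> W"
    by (rule smooth_chart_openE[OF U]) (use x W in auto)
  have "smooth_on (c ` (U \<inter> V) \<inter> O') (\<lambda>q. d (the_inv_into W e (e (the_inv_into U c q))))"
  proof (rule smooth_on_compose[OF smooth_on_subset[OF UW] WV])
    show "c ` (U \<inter> V) \<inter> O' \<subseteq> c ` (U \<inter> W)" using O by auto
    show "(\<lambda>q. e (the_inv_into U c q)) ` (c ` (U \<inter> V) \<inter> O') \<subseteq> e ` (W \<inter> V)"
      using O(3) inv_chart[OF U] by auto
  qed
  then have "smooth_on (c ` (U \<inter> V) \<inter> O') (\<lambda>q. d (the_inv_into U c q))"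
    by (rule smooth_on_cong) (use O(3) inv_chart[OF U] inv_chart[OF We] in auto)
  then show "\<exists>O'. open O' \<and> q \<in> O' \<and> smooth_on (c ` (U \<inter> V) \<inter> O') (\<lambda>q. d (the_inv_into U c q))"
    using O x by blast
qed

lemma corner_index_unique:
  assumes U: "smooth_corner_chart P \<A> (U, c)" and V: "smooth_corner_chart P \<A> (V, d)"
    and x: "x \<in> U" "x \<in> V"
  shows "card {i. c x $ i = 0} = card {i. d x $ i = 0}"
proof -
  have le: "card {i. d x $ i = 0} \<le> card {i. c x $ i = 0}"
    if U: "smooth_corner_chart P \<A> (U, c)" and V: "smooth_corner_chart P \<A> (V, d)"
      and x: "x \<in> U" "x \<in> V" for U V c d
  proof -
    have o: "openin P (U \<inter> V)"
      using smooth_chartD(1)[OF U] smooth_chartD(1)[OF V] by blast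
    have "card {j. d (the_inv_into U c (c x)) $ j = 0} \<le> card {i. c x $ i = 0}"
    proof (rule transition_index_le[where A' = "d ` (U \<inter> V)" and \<tau>' = "\<lambda>q. c (the_inv_into V d q)"])
      show "openin (top_of_set orthant) (c ` (U \<inter> V))"
        by (rule smooth_chart_open_image[OF U o]) auto
      show "d ` (U \<inter> V) \<subseteq> orthant"
        using openin_imp_subset[OF smooth_chart_open_image[OF V o]] by auto
      show "smooth_on (c ` (U \<inter> V)) (\<lambda>q. d (the_inv_into U c q))"
        by (rule smooth_transition[OF U V])
      show "smooth_on (d ` (U \<inter> V)) (\<lambda>q. c (the_inv_into V d q))"
        using smooth_transition[OF V U] by (simp add: Int_commute)
    qed (use x inv_chart[OF U] inv_chart[OF V] in auto)
    then show ?thesis using inv_chart[OF U x(1)] by simp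
  qed
  show ?thesis
    using le[OF U V x] le[OF V U x(2,1)] by simp
qed

lemma atlas_chart_at:
  assumes "x \<in> topspace P"
  obtains U c where "smooth_corner_chart P \<A> (U, c)" "x \<in> U" "(U, c) \<in> \<A>"
proof -
  obtain \<kappa> where "\<kappa> \<in> \<A>" "x \<in> fst \<kappa>"
    using atlas_covers assms by blast
  then show thesis
    using that[of "fst \<kappa>" "snd \<kappa>"] atlas_chart by simp
qed

lemma in_stratum_iff:
  assumes U: "smooth_corner_chart P \<A> (U, c)" and x: "x \<in> U"
  shows "x \<in> stratum P \<A> k \<longleftrightarrow> card {i. c x $ i = 0} = k"
proof
  assume "x \<in> stratum P \<A> k"
  then obtain V d where "(V, d) \<in> \<A>" "x \<in> V" "card {i. d x $ i = 0} = k"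
    unfolding stratum_def by auto
  then show "card {i. c x $ i = 0} = k"
    using corner_index_unique[OF U atlas_chart x] by auto
next
  assume k: "card {i. c x $ i = 0} = k"
  have xP: "x \<in> topspace P"
    using x smooth_chartD(3)[OF U] by blast
  then obtain V d where V: "smooth_corner_chart P \<A> (V, d)" "x \<in> V" "(V, d) \<in> \<A>"
    by (rule atlas_chart_at)
  then have "card {i. d x $ i = 0} = k"
    using corner_index_unique[OF U V(1) x V(2)] k by simp
  then show "x \<in> stratum P \<A> k"
    unfolding stratum_def using V xP by auto
qed

subsection \<open>Model charts\<close>

definition model_chart :: "'p set \<Rightarrow> ('p \<Rightarrow> real ^ 'n) \<Rightarrow> 'n set \<Rightarrow> bool" where
  "model_chart U c I \<longleftrightarrow> smooth_corner_chart P \<A> (U, c) \<and> c ` U = model_corner I"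

lemma reparam_smooth_chart:
  assumes V: "smooth_corner_chart P \<A> (V, d)" and U: "openin P U" "U \<subseteq> V"
    and \<psi>: "smooth_on (d ` U) \<psi>" "smooth_on M \<psi>'" "\<psi> ` d ` U = M" "\<And>q. q \<in> d ` U \<Longrightarrow> \<psi>' (\<psi> q) = q"
    and M: "openin (top_of_set orthant) M"
  shows "smooth_corner_chart P \<A> (U, \<lambda>x. \<psi> (d x))"
proof -
  have top: "topspace (subtopology P U) = U"
    using openin_subset[OF U(1)] by auto
  have img: "(\<lambda>x. \<psi> (d x)) ` U = M"
    using \<psi>(3) by auto
  have inj: "inj_on (\<lambda>x. \<psi> (d x)) U"
  proof (rule inj_onI)
    fix x y assume xy: "x \<in> U" "y \<in> U" "\<psi> (d x) = \<psi> (d y)"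
    have "d x = \<psi>' (\<psi> (d x))" by (rule \<psi>(4)[OF imageI[OF xy(1)], symmetric])
    also have "\<dots> = d y" unfolding xy(3) by (rule \<psi>(4)[OF imageI[OF xy(2)]])
    finally show "x = y"
      by (rule inj_onD[OF smooth_chartD(4)[OF V]]) (use xy U(2) in auto)
  qed
  have inv: "the_inv_into U (\<lambda>x. \<psi> (d x)) q = the_inv_into V d (\<psi>' q)" if q: "q \<in> M" for q
  proof -
    obtain x where x: "x \<in> U" "q = \<psi> (d x)" using q img by auto
    have "the_inv_into U (\<lambda>x. \<psi> (d x)) q = x"
      using the_inv_into_f_f[OF inj x(1)] x(2) by simp
    moreover have "\<psi>' q = d x"
      unfolding x(2) by (rule \<psi>(4)[OF imageI[OF x(1)]])
    moreover have "the_inv_into V d (d x) = x"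
      by (rule inv_chart[OF V]) (use x(1) U(2) in auto)
    ultimately show ?thesis by simp
  qed
  have maps: "homeomorphic_maps (subtopology P U) (top_of_set M) (\<lambda>x. \<psi> (d x)) (\<lambda>q. the_inv_into V d (\<psi>' q))"
    unfolding homeomorphic_maps_def
  proof (intro conjI)
    have dU: "continuous_map (subtopology P U) (top_of_set (d ` U)) d"
      using continuous_map_from_subtopology_mono[OF smooth_chartD(6)[OF V] U(2)] top
      by (auto simp: continuous_map_in_subtopology)
    have "continuous_map (top_of_set (d ` U)) (top_of_set M) \<psi>"
      using smooth_on_imp_continuous_on[OF \<psi>(1)] \<psi>(3) by auto
    from continuous_map_compose[OF dU this]
    show "continuous_map (subtopology P U) (top_of_set M) (\<lambda>x. \<psi> (d x))"
      by (simp add: o_def)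
    have "\<psi>' ` M \<subseteq> d ` U"
      using \<psi>(3,4) by force
    then have "continuous_map (top_of_set M) (top_of_set (d ` V)) \<psi>'"
      using smooth_on_imp_continuous_on[OF \<psi>(2)] U(2) by auto
    from continuous_map_compose[OF this smooth_chartD(7)[OF V]]
    have "continuous_map (top_of_set M) P (\<lambda>q. the_inv_into V d (\<psi>' q))"
      by (simp add: o_def continuous_map_in_subtopology)
    moreover have "the_inv_into V d (\<psi>' q) \<in> U" if "q \<in> M" for q
      using that \<psi>(3,4) inv_chart[OF V] U(2) by force
    ultimately show "continuous_map (top_of_set M) (subtopology P U) (\<lambda>q. the_inv_into V d (\<psi>' q))"
      by (auto simp: continuous_map_in_subtopology)
    show "\<forall>x\<in>topspace (subtopology P U). the_inv_into V d (\<psi>' (\<psi> (d x))) = x"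
      using top \<psi>(4) inv_chart[OF V] U(2) by auto
    show "\<forall>y\<in>topspace (top_of_set M). \<psi> (d (the_inv_into V d (\<psi>' y))) = y"
    proof
      fix q assume "q \<in> topspace (top_of_set M)"
      then obtain x where x: "x \<in> U" "q = \<psi> (d x)" using img by auto
      then show "\<psi> (d (the_inv_into V d (\<psi>' q))) = q"
        using \<psi>(4) inv_chart[OF V] U(2) by auto
    qed
  qed
  show ?thesis
    unfolding smooth_corner_chart_def
  proof (intro conjI ballI)
    show "corner_chart P (U, \<lambda>x. \<psi> (d x))"
      unfolding corner_chart_def using U(1) M img homeomorphic_maps_imp_map[OF maps] by simp
    fix \<kappa> assume "\<kappa> \<in> \<A>"
    moreover obtain W e where We: "\<kappa> = (W, e)" by (cases \<kappa>)
    ultimately have W: "smooth_corner_chart P \<A> (W, e)" using atlas_chart by simp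
    have "smooth_on ((\<lambda>x. \<psi> (d x)) ` (U \<inter> W)) (\<lambda>q. e (the_inv_into V d (\<psi>' q)))"
    proof (rule smooth_on_compose[OF smooth_on_subset[OF \<psi>(2)] smooth_transition[OF V W]])
      show "(\<lambda>x. \<psi> (d x)) ` (U \<inter> W) \<subseteq> M" using img by auto
      show "\<psi>' ` (\<lambda>x. \<psi> (d x)) ` (U \<inter> W) \<subseteq> d ` (V \<inter> W)" using \<psi>(4) U(2) by auto
    qed
    then have "smooth_on ((\<lambda>x. \<psi> (d x)) ` (U \<inter> W)) (\<lambda>q. e (the_inv_into U (\<lambda>x. \<psi> (d x)) q))"
      by (rule smooth_on_cong) (use inv img in auto)
    then show "corner_transition_smooth (U, \<lambda>x. \<psi> (d x)) \<kappa>"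
      by (simp add: corner_transition_smooth_def We)
    have "smooth_on (e ` (W \<inter> U)) (\<lambda>q. \<psi> (d (the_inv_into W e q)))"
    proof (rule smooth_on_compose[OF smooth_on_subset[OF smooth_transition[OF W V]] \<psi>(1)])
      show "e ` (W \<inter> U) \<subseteq> e ` (W \<inter> V)" using U(2) by auto
      show "(\<lambda>q. d (the_inv_into W e q)) ` e ` (W \<inter> U) \<subseteq> d ` U" using inv_chart[OF W] by auto
    qed
    then show "corner_transition_smooth \<kappa> (U, \<lambda>x. \<psi> (d x))"
      by (simp add: corner_transition_smooth_def We)
  qed
qed

text \<open>A small box about \<open>d p\<close> in the orthant is a product of intervals
  \<open>[0, b i)\<close> for the coordinates vanishing at \<open>p\<close> and
  \<open>(a i, b i)\<close> for the others. The Moebius map \<open>(q - a) / (b - q)\<close> in each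
  coordinate takes them onto the half-lines from 0, with and without the endpoint, and fixes which
  coordinates vanish at \<open>p\<close>.\<close>

lemma model_chart_at:
  assumes N: "openin P N" and p: "p \<in> N"
  obtains U c where "model_chart U c {i. c p $ i = 0}" "p \<in> U" "U \<subseteq> N"
proof -
  have "p \<in> topspace P" using openin_subset[OF N] p by blast
  then obtain V d where V: "smooth_corner_chart P \<A> (V, d)" "p \<in> V"
    by (rule atlas_chart_at)
  define I where "I = {i. d p $ i = 0}"
  have "openin P (V \<inter> N)" using smooth_chartD(1)[OF V(1)] N by blast
  then have O: "openin (top_of_set orthant) (d ` (V \<inter> N))"
    by (rule smooth_chart_open_image[OF V(1)]) auto
  obtain O2 where O2: "open O2" "d ` (V \<inter> N) = orthant \<inter> O2"
    using O by (auto simp: openin_open)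
  have "d p \<in> O2" using O2 V(2) p by blast
  then obtain r where r: "r > 0" "ball (d p) r \<subseteq> O2"
    using O2(1) open_contains_ball by blast
  have dp: "d p $ i \<ge> 0" for i
    using O2 V(2) p by (auto simp: orthant_def)
  \<comment> \<open>The bound \<open>r / CARD('n')\<close> keeps the box inside the ball of radius
    \<open>r\<close>, by the estimate of the norm by the sum of the coordinates; the bounds
    \<open>d p $ i\<close> keep the lower ends of the remaining sides nonnegative.\<close>
  define e where "e = Min (insert (r / CARD('n)) ((\<lambda>i. d p $ i) ` (- I)))"
  have e: "0 < e" "e \<le> r / CARD('n)" "\<And>i. i \<notin> I \<Longrightarrow> e \<le> d p $ i"
  proof -
    have "0 < x" if "x \<in> insert (r / CARD('n)) ((\<lambda>i. d p $ i) ` (- I))" for x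
      using that r dp by (auto simp: I_def less_le)
    then show "0 < e" unfolding e_def by (subst Min_gr_iff) auto
  qed (auto simp: e_def)
  define D where "D = {q \<in> orthant. \<forall>i. \<bar>q $ i - d p $ i\<bar> < e}"
  have DO: "D \<subseteq> d ` (V \<inter> N)"
  proof
    fix q assume q: "q \<in> D"
    have "norm (q - d p) \<le> (\<Sum>i\<in>UNIV. \<bar>(q - d p) $ i\<bar>)"
      by (rule norm_le_l1_cart)
    also have "\<dots> < (\<Sum>i\<in>(UNIV :: 'n set). e)"
      using q by (intro sum_strict_mono) (auto simp: D_def)
    also have "\<dots> \<le> r"
      using e(2) by (simp add: field_simps)
    finally show "q \<in> d ` (V \<inter> N)"
      using r(2) q O2(2) by (auto simp: D_def dist_norm norm_minus_commute)
  qed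
  define a where "a i = (if i \<in> I then 0 else d p $ i - e)" for i
  define b where "b i = d p $ i + e" for i
  define \<psi> where "\<psi> q = (\<chi> i. (q $ i - a i) / (b i - q $ i))" for q :: "real ^ 'n"
  define \<psi>' where "\<psi>' s = (\<chi> i. (a i + b i * s $ i) / (1 + s $ i))" for s :: "real ^ 'n"
  have ab: "a i < b i" for i
    using e(1) dp[of i] by (simp add: a_def b_def add_nonneg_pos)
  have D: "q \<in> D \<longleftrightarrow> (\<forall>i\<in>I. 0 \<le> q $ i) \<and> (\<forall>i\<in>-I. a i < q $ i) \<and> (\<forall>i. q $ i < b i)" for q
  proof -
    have "(0 \<le> q $ i \<and> \<bar>q $ i - d p $ i\<bar> < e) \<longleftrightarrow>
       (i \<in> I \<longrightarrow> 0 \<le> q $ i) \<and> (i \<notin> I \<longrightarrow> a i < q $ i) \<and> q $ i < b i" for i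
      using e(1) e(3)[of i] by (auto simp: a_def b_def I_def abs_less_iff)
    moreover have "q \<in> D \<longleftrightarrow> (\<forall>i. 0 \<le> q $ i \<and> \<bar>q $ i - d p $ i\<bar> < e)"
      by (auto simp: D_def orthant_def)
    ultimately show ?thesis by auto
  qed
  have Db: "b i - q $ i > 0" if "q \<in> D" for q i
    using D[of q] that by simp
  have \<psi>'\<psi>: "\<psi>' (\<psi> q) = q" if "q \<in> D" for q
  proof -
    have "(a i + b i * ((q $ i - a i) / (b i - q $ i))) / (1 + (q $ i - a i) / (b i - q $ i)) = q $ i" for i
    proof -
      have "b i - q $ i \<noteq> 0" "b i - a i \<noteq> 0" using Db[OF that, of i] ab[of i] by simp_all
      then show ?thesis
        by (simp add: divide_simps) (simp add: algebra_simps)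
    qed
    then show ?thesis by (simp add: \<psi>_def \<psi>'_def vec_eq_iff)
  qed
  have \<psi>D: "\<psi> q \<in> model_corner I" if q: "q \<in> D" for q
    unfolding model_corner_def
  proof (intro CollectI conjI ballI)
    show "0 \<le> \<psi> q $ i" if "i \<in> I" for i
    proof -
      have "0 \<le> q $ i - a i" using that D[of q] q by (simp add: a_def)
      then show ?thesis using Db[OF q, of i] by (simp add: \<psi>_def)
    qed
    show "0 < \<psi> q $ i" if "i \<in> - I" for i
    proof -
      have "0 < q $ i - a i" using that D[of q] q by simp
      then show ?thesis using Db[OF q, of i] by (simp add: \<psi>_def)
    qed
  qed
  have \<psi>'M: "\<psi>' s \<in> D" "\<psi> (\<psi>' s) = s" if s: "s \<in> model_corner I" for s
  proof -
    have s0: "0 \<le> s $ i" for i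
      using s model_corner_subset_orthant by (auto simp: orthant_def)
    have 1: "0 < 1 + s $ i" for i
      using s0[of i] by simp
    have eq: "b i - \<psi>' s $ i = (b i - a i) / (1 + s $ i)" "\<psi>' s $ i - a i = (b i - a i) * s $ i / (1 + s $ i)" for i
      using 1[of i] by (simp_all add: \<psi>'_def diff_divide_eq_iff divide_diff_eq_iff less_imp_neq[symmetric])
        (simp_all add: algebra_simps)
    have "\<psi>' s $ i < b i" for i
      using eq(1)[of i] 1[of i] ab[of i] divide_pos_pos[of "b i - a i" "1 + s $ i"] by linarith
    moreover have "0 \<le> \<psi>' s $ i" if "i \<in> I" for i
    proof -
      have "0 \<le> (b i - a i) * s $ i / (1 + s $ i)"
        using 1[of i] s0[of i] ab[of i] by simp
      then show ?thesis using eq(2)[of i] that by (simp add: a_def)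
    qed
    moreover have "a i < \<psi>' s $ i" if "i \<notin> I" for i
    proof -
      have "0 < s $ i" using s that by (auto simp: model_corner_def)
      then have "0 < (b i - a i) * s $ i / (1 + s $ i)"
        using 1[of i] ab[of i] by simp
      then show ?thesis using eq(2)[of i] by simp
    qed
    ultimately show "\<psi>' s \<in> D" using D by auto
    have "(\<psi>' s $ i - a i) / (b i - \<psi>' s $ i) = s $ i" for i
      unfolding eq using 1[of i] ab[of i] by simp
    then show "\<psi> (\<psi>' s) = s" by (simp add: \<psi>_def vec_eq_iff)
  qed
  have \<psi>_img: "\<psi> ` D = model_corner I"
    using \<psi>D \<psi>'M by force
  define U where "U = {x \<in> V. d x \<in> D}"
  have dU: "d ` U = D"
    using DO by (auto simp: U_def)
  have UVN: "U \<subseteq> V \<inter> N"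
  proof
    fix x assume x: "x \<in> U"
    then have "d x \<in> d ` (V \<inter> N)" using DO by (auto simp: U_def)
    then show "x \<in> V \<inter> N"
      using smooth_chartD(4)[OF V(1)] x by (auto simp: U_def inj_on_def)
  qed
  have oU: "openin P U"
  proof -
    let ?B = "{q. \<forall>i. \<bar>q $ i - d p $ i\<bar> < e}"
    have "?B = (\<Inter>i. {q. \<bar>q $ i - d p $ i\<bar> < e})" by auto
    then have "open ?B"
      by (auto intro!: open_INT open_Collect_less continuous_intros)
    from smooth_chart_open_preimage[OF V(1) this]
    have "openin P {x \<in> V. d x \<in> ?B}" .
    moreover have "d x \<in> orthant" if "x \<in> V" for x
      using that openin_imp_subset[OF smooth_chartD(2)[OF V(1)]] by blast
    then have "{x \<in> V. d x \<in> ?B} = U" by (auto simp: U_def D_def)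
    ultimately show ?thesis by simp
  qed
  have sm: "smooth_corner_chart P \<A> (U, \<lambda>x. \<psi> (d x))"
  proof (rule reparam_smooth_chart[OF V(1) oU _ _ _ _ _ openin_model_corner[of I]])
    show "U \<subseteq> V" using UVN by auto
    show "smooth_on (d ` U) \<psi>"
      unfolding \<psi>_def dU
    proof (intro smooth_on_vec_lambda smooth_on_divide smooth_on_diff smooth_on_const smooth_on_vec_nth smooth_on_ident)
      show "b i - q $ i \<noteq> 0" if "q \<in> D" for q i
        using Db[OF that, of i] by simp
    qed
    show "smooth_on (model_corner I) \<psi>'"
      unfolding \<psi>'_def
    proof (intro smooth_on_vec_lambda smooth_on_divide smooth_on_add smooth_on_mult smooth_on_const smooth_on_vec_nth smooth_on_ident)
      fix i and s :: "real ^ 'n" assume "s \<in> model_corner I"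
      then have "0 \<le> s $ i" using model_corner_subset_orthant by (auto simp: orthant_def)
      then show "1 + s $ i \<noteq> 0" by simp
    qed
    show "\<psi> ` d ` U = model_corner I" using \<psi>_img dU by simp
    show "\<psi>' (\<psi> q) = q" if "q \<in> d ` U" for q using \<psi>'\<psi> that dU by simp
  qed
  have pU: "p \<in> U"
    using V(2) e(1) dp by (auto simp: U_def D_def orthant_def)
  have I: "{i. \<psi> (d p) $ i = 0} = I"
    using e(1) by (auto simp: \<psi>_def a_def b_def I_def)
  show thesis
  proof (rule that)
    have "(\<lambda>x. \<psi> (d x)) ` U = model_corner I" using \<psi>_img dU by auto
    then show "model_chart U (\<lambda>x. \<psi> (d x)) {i. \<psi> (d p) $ i = 0}"
      unfolding I model_chart_def using sm by simp
  qed (use pU UVN in auto)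
qed

end

subsection \<open>Faces and facets\<close>

lemma closure_of_meetsE:
  assumes "x \<in> X closure_of S" "openin X W" "x \<in> W"
  obtains y where "y \<in> S" "y \<in> W"
proof -
  have "\<forall>T. x \<in> T \<and> openin X T \<longrightarrow> (\<exists>y. y \<in> S \<and> y \<in> T)"
    using assms(1) unfolding in_closure_of by (rule conjunct2)
  from spec[OF this, of W] show thesis
    using assms(2,3) that by auto
qed

context corner_manifold
begin

definition piece :: "'p set \<Rightarrow> ('p \<Rightarrow> real ^ 'n) \<Rightarrow> 'n set \<Rightarrow> 'p set" where
  "piece U c J = {x \<in> U. {i. c x $ i = 0} = J}"

definition facets_at :: "'p \<Rightarrow> 'p set set" where
  "facets_at p = {F \<in> facets P \<A>. p \<in> F}"

abbreviation stratum_component :: "nat \<Rightarrow> 'p set \<Rightarrow> bool" where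
  "stratum_component k S \<equiv> S \<in> connected_components_of (subtopology P (stratum P \<A> k))"

lemma model_chartD:
  assumes "model_chart U c I"
  shows "smooth_corner_chart P \<A> (U, c)" "c ` U = model_corner I" "x \<in> U \<Longrightarrow> {i. c x $ i = 0} \<subseteq> I"
    "x \<in> U \<Longrightarrow> 0 \<le> c x $ i"
proof -
  show 1: "smooth_corner_chart P \<A> (U, c)" "c ` U = model_corner I"
    using assms by (simp_all add: model_chart_def)
  show "{i. c x $ i = 0} \<subseteq> I" "0 \<le> c x $ i" if "x \<in> U" for x
  proof -
    have "c x \<in> model_corner I" using 1(2) that by blast
    then have "\<forall>i\<in>-I. 0 < c x $ i" "c x \<in> orthant"
      using model_corner_subset_orthant[of I] by (auto simp: model_corner_def)
    then show "{i. c x $ i = 0} \<subseteq> I" "0 \<le> c x $ i"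
      by (force, simp add: orthant_def)
  qed
qed

lemma piece_subset_stratum:
  assumes "smooth_corner_chart P \<A> (U, c)"
  shows "piece U c J \<subseteq> stratum P \<A> (card J)"
proof
  fix x assume "x \<in> piece U c J"
  then have "x \<in> U" "{i. c x $ i = 0} = J" by (auto simp: piece_def)
  then show "x \<in> stratum P \<A> (card J)" using in_stratum_iff[OF assms] by simp
qed

lemma connectedin_piece:
  assumes U: "model_chart U c I" and J: "J \<subseteq> I"
  shows "connectedin P (piece U c J)"
proof -
  let ?Q = "{q :: real ^ 'n. (\<forall>i\<in>J. q $ i = 0) \<and> (\<forall>i\<in>-J. 0 < q $ i)}"
  note Us = model_chartD[OF U]
  have "convex ?Q"
  proof (rule convexI)
    fix x y :: "real ^ 'n" and u v :: real
    assume x: "x \<in> ?Q" and y: "y \<in> ?Q" and uv: "0 \<le> u" "0 \<le> v" "u + v = 1"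
    have "0 < u * x $ i + v * y $ i" if i: "i \<in> - J" for i
    proof (cases "u = 0")
      case True
      then show ?thesis using y i uv by simp
    next
      case False
      have "0 < x $ i" "0 < y $ i" using x y i by auto
      then show ?thesis using False uv by (intro add_pos_nonneg) auto
    qed
    then show "u *\<^sub>R x + v *\<^sub>R y \<in> ?Q" using x y by simp
  qed
  then have "connected ?Q" by (rule convex_connected)
  moreover have QU: "?Q \<subseteq> c ` U"
  proof
    fix q assume q: "q \<in> ?Q"
    have "0 \<le> q $ i" for i using q by (cases "i \<in> J") (auto simp: less_imp_le)
    then show "q \<in> c ` U" using q J unfolding Us(2) model_corner_def by auto
  qed
  ultimately have "connectedin (top_of_set (c ` U)) ?Q"
    by (simp add: connectedin_subtopology connectedin_iff_connected)
  from connectedin_continuous_map_image[OF smooth_chartD(7)[OF Us(1)] this]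
  have "connectedin P (the_inv_into U c ` ?Q)"
    by (simp add: connectedin_subtopology)
  moreover have "the_inv_into U c ` ?Q = piece U c J"
  proof (intro equalityI subsetI)
    fix x assume "x \<in> the_inv_into U c ` ?Q"
    then obtain q where q: "q \<in> ?Q" "x = the_inv_into U c q" by blast
    then obtain y where y: "y \<in> U" "q = c y" using QU by blast
    then have "x = y" using q inv_chart[OF Us(1)] by simp
    moreover have "c y $ i = 0 \<longleftrightarrow> i \<in> J" for i
    proof (cases "i \<in> J")
      case False
      then have "0 < c y $ i" using q(1) unfolding y(2) by blast
      then show ?thesis using False by simp
    qed (use q(1) y(2) in simp)
    then have "{i. c y $ i = 0} = J" by simp
    ultimately show "x \<in> piece U c J" using y by (simp add: piece_def)
  next
    fix x assume x: "x \<in> piece U c J"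
    then have xU: "x \<in> U" "{i. c x $ i = 0} = J" by (auto simp: piece_def)
    have "c x \<in> ?Q"
      using xU model_chartD(4)[OF U xU(1)] by (auto simp: less_le)
    then show "x \<in> the_inv_into U c ` ?Q"
      by (rule image_eqI[rotated]) (simp add: inv_chart[OF Us(1) xU(1)])
  qed
  ultimately show ?thesis by simp
qed

lemma piece_nonempty:
  assumes U: "model_chart U c I" and J: "J \<subseteq> I"
  obtains x where "x \<in> piece U c J"
proof -
  have "(\<chi> i. if i \<in> J then 0 else 1) \<in> model_corner I"
    using J by (auto simp: model_corner_def)
  then have "(\<chi> i. if i \<in> J then 0 else 1) \<in> c ` U"
    by (simp only: model_chartD(2)[OF U])
  then obtain x where "x \<in> U" "c x = (\<chi> i. if i \<in> J then 0 else 1)"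
    by (elim imageE) simp
  then show thesis by (intro that[of x]) (simp add: piece_def)
qed

text \<open>A short step in the direction that is 1 outside \<open>J\<close> and 0 on
  \<open>J\<close> makes every coordinate outside \<open>J\<close> positive and keeps those in
  \<open>J\<close> at 0.\<close>

lemma piece_dense:
  assumes U: "smooth_corner_chart P \<A> (U, c)" and x: "x \<in> U" "\<forall>i\<in>J. c x $ i = 0"
    and W: "openin P W" "x \<in> W"
  obtains y where "y \<in> W" "y \<in> piece U c J"
proof -
  let ?v = "(\<chi> i. if i \<in> J then 0 else 1) :: real ^ 'n"
  have "openin P (W \<inter> U)" using W(1) smooth_chartD(1)[OF U] by (rule openin_Int)
  then have o: "openin (top_of_set orthant) (c ` (W \<inter> U))"
    by (rule smooth_chart_open_image[OF U]) simp
  have "\<forall>\<^sub>F t in at_right 0. c x + t *\<^sub>R ?v \<in> c ` (W \<inter> U)"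
    by (rule orthant_ray[OF o]) (use x W in auto)
  moreover have "\<forall>\<^sub>F t in at_right (0::real). 0 < t"
    by (rule eventually_at_right_less)
  ultimately have "\<forall>\<^sub>F t in at_right 0. c x + t *\<^sub>R ?v \<in> c ` (W \<inter> U) \<and> 0 < t"
    by (rule eventually_conj)
  from eventually_happens'[OF trivial_limit_at_right_real this]
  obtain t where t: "c x + t *\<^sub>R ?v \<in> c ` (W \<inter> U)" "0 < t"
    by (elim exE conjE)
  then obtain y where y: "y \<in> W" "y \<in> U" "c y = c x + t *\<^sub>R ?v" by auto
  have "c x $ i \<ge> 0" for i
    using x(1) openin_imp_subset[OF smooth_chartD(2)[OF U]] by (auto simp: orthant_def)
  then have "c y $ i = 0 \<longleftrightarrow> i \<in> J" for i
    using x(2) t(2) unfolding y(3) by (auto simp: add_nonneg_eq_0_iff)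
  then show thesis using that y by (auto simp: piece_def)
qed

lemma in_closure_piece:
  assumes U: "smooth_corner_chart P \<A> (U, c)" and x: "x \<in> U" "\<forall>i\<in>J. c x $ i = 0" and S: "piece U c J \<subseteq> S"
  shows "x \<in> P closure_of S"
  unfolding in_closure_of
proof (intro conjI allI impI)
  show "x \<in> topspace P" using x(1) smooth_chartD(3)[OF U] by blast
  fix T assume "x \<in> T \<and> openin P T"
  then have T: "openin P T" "x \<in> T" by simp_all
  obtain y where "y \<in> T" "y \<in> piece U c J"
    by (rule piece_dense[OF U x T])
  then show "\<exists>y. y \<in> S \<and> y \<in> T" using S by blast
qed

lemma component_subset:
  assumes "stratum_component k S"
  shows "S \<subseteq> stratum P \<A> k" "S \<subseteq> topspace P" "connectedin P S" "S \<noteq> {}"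
proof -
  show "S \<subseteq> stratum P \<A> k" "S \<subseteq> topspace P"
    using connected_components_of_subset[OF assms] by auto
  show "connectedin P S"
    using connectedin_connected_components_of[OF assms] by (simp add: connectedin_subtopology)
  show "S \<noteq> {}"
    by (rule nonempty_connected_components_of[OF assms])
qed

lemma component_absorbs_piece:
  assumes S: "stratum_component k S" and U: "model_chart U c I" "J \<subseteq> I" "card J = k"
    and ne: "x \<in> piece U c J" "x \<in> S"
  shows "piece U c J \<subseteq> S"
proof (rule connected_components_of_maximal[OF S])
  show "connectedin (subtopology P (stratum P \<A> k)) (piece U c J)"
    using connectedin_piece[OF U(1,2)] piece_subset_stratum[OF model_chartD(1)[OF U(1)], of J] U(3)
    by (simp add: connectedin_subtopology)
  show "\<not> disjnt S (piece U c J)"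
    using ne by (auto simp: disjnt_def)
qed

lemma component_eqI:
  assumes "stratum_component k S" "stratum_component k T" "x \<in> S" "x \<in> T"
  shows "S = T"
  using connected_components_of_overlap[OF assms(1,2)] assms(3,4) by auto

lemma component_at:
  assumes "x \<in> stratum P \<A> k"
  obtains S where "stratum_component k S" "x \<in> S"
proof -
  have "x \<in> topspace (subtopology P (stratum P \<A> k))"
    using assms by (auto simp: stratum_def)
  then have "x \<in> \<Union>(connected_components_of (subtopology P (stratum P \<A> k)))"
    by (simp only: Union_connected_components_of)
  then show thesis using that by blast
qed

text \<open>Components are closed in their stratum, so the closure in \<open>P\<close> adds only
  points of other strata. A face therefore determines the component it came from.\<close>

lemma closure_component_Int_stratum:
  assumes S: "stratum_component k S" and x: "x \<in> P closure_of S" "x \<in> stratum P \<A> k"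
  shows "x \<in> S"
proof -
  have "(subtopology P (stratum P \<A> k)) closure_of S = S"
    using closedin_connected_components_of[OF S] by (simp add: closure_of_eq)
  moreover have "stratum P \<A> k \<inter> S = S"
    using component_subset(1)[OF S] by blast
  ultimately show ?thesis
    using x unfolding closure_of_subtopology by (metis IntI)
qed

text \<open>Near \<open>x\<close> the coordinates that are nonzero at \<open>x\<close> stay
  positive. The one coordinate vanishing at a nearby point of the codimension-one stratum must
  therefore vanish at \<open>x\<close> already.\<close>

lemma closure_meets_piece:
  assumes U: "smooth_corner_chart P \<A> (U, c)" and x: "x \<in> U" "x \<in> P closure_of S" and S: "S \<subseteq> stratum P \<A> 1"
  obtains i y where "c x $ i = 0" "y \<in> S" "y \<in> piece U c {i}"
proof -
  let ?J = "{i. c x $ i \<noteq> 0}"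
  have orth: "c y $ i \<ge> 0" if "y \<in> U" for y i
    using that openin_imp_subset[OF smooth_chartD(2)[OF U]] by (auto simp: orthant_def)
  have "openin P {y \<in> U. c y \<in> {q. \<forall>i\<in>?J. 0 < q $ i}}"
    by (rule smooth_chart_open_preimage[OF U open_positive_coords])
  moreover have "x \<in> {y \<in> U. c y \<in> {q. \<forall>i\<in>?J. 0 < q $ i}}"
    using x orth by (auto simp: less_le)
  ultimately obtain y where "y \<in> S" "y \<in> {y \<in> U. c y \<in> {q. \<forall>i\<in>?J. 0 < q $ i}}"
    by (rule closure_of_meetsE[OF x(2)])
  then have y: "y \<in> S" "y \<in> U" "\<forall>i\<in>?J. 0 < c y $ i" by simp_all
  have "card {i. c y $ i = 0} = 1"
    using in_stratum_iff[OF U y(2), of 1] S y(1) by blast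
  then obtain i where i: "{i. c y $ i = 0} = {i}"
    by (rule card_1_singletonE)
  then have "c y $ i = 0" by blast
  then have "c x $ i = 0" using y(3) by (auto simp: less_le)
  then show thesis using that y i by (simp add: piece_def)
qed

text \<open>Suppose one facet contained two sheets of a chart. Take a point \<open>y\<close> where
  exactly these two coordinates vanish: every facet through \<open>y\<close> would be the closure of
  \<open>S\<close>. Niceness makes the codimension-two face through \<open>y\<close> a component of
  the intersection of two facets, which is impossible with a single one available.\<close>

lemma sheets_distinct:
  assumes nice: "nice P \<A>" and U: "model_chart U c I" and ij: "i \<in> I" "j \<in> I" "i \<noteq> j"
    and S: "stratum_component 1 S" "piece U c {i} \<subseteq> S" "piece U c {j} \<subseteq> S"
  shows False
proof -
  note Us = model_chartD[OF U]
  obtain y where y: "y \<in> piece U c {i, j}"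
    by (rule piece_nonempty[OF U, of "{i, j}"]) (use ij in auto)
  then have yU: "y \<in> U" "{k. c y $ k = 0} = {i, j}" by (auto simp: piece_def)
  have "y \<in> stratum P \<A> 2"
    using in_stratum_iff[OF Us(1) yU(1)] yU(2) ij(3) by simp
  then obtain T where T: "stratum_component 2 T" "y \<in> T"
    by (rule component_at)
  let ?F = "P closure_of T"
  have "?F \<in> faces P \<A> 2" using T unfolding faces_def by blast
  then obtain \<G> where "component_of_facets P \<A> 2 ?F \<G>"
    using nice unfolding nice_def by blast
  then have G: "\<G> \<subseteq> facets P \<A>" "card \<G> = 2" "?F \<in> connected_components_of (subtopology P (\<Inter>\<G>))"
    unfolding component_of_facets_def by auto
  have "y \<in> ?F"
    using T(2) component_subset(2)[OF T(1)] closure_of_subset by blast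
  then have yG: "y \<in> \<Inter>\<G>"
    using connected_components_of_subset[OF G(3)] by auto
  have eq: "F = P closure_of S" if F: "F \<in> \<G>" for F
  proof -
    obtain S' where S': "stratum_component 1 S'" "F = P closure_of S'"
      using F G(1) unfolding faces_def by blast
    have "y \<in> P closure_of S'" using yG F S'(2) by blast
    then obtain k z where k: "c y $ k = 0" "z \<in> S'" "z \<in> piece U c {k}"
      by (rule closure_meets_piece[OF Us(1) yU(1) _ component_subset(1)[OF S'(1)]])
    then have "k = i \<or> k = j" using yU(2) by blast
    then have "z \<in> S" using k(3) S(2,3) by blast
    then show ?thesis
      using component_eqI[OF S'(1) S(1) k(2)] S'(2) by simp
  qed
  then have "\<G> \<subseteq> {P closure_of S}" by blast
  then have "card \<G> \<le> card {P closure_of S}" by (rule card_mono[rotated]) simp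
  then show False using G(2) by simp
qed

text \<open>\<open>H i\<close> is the closure of the stratum component containing the sheet of
  coordinate \<open>i\<close>. It may leave the chart, but by \<open>sheets_distinct\<close> it
  cannot return along another sheet, so within the chart it is exactly the zero set of coordinate
  \<open>i\<close>.\<close>

lemma model_chart_facets:
  assumes nice: "nice P \<A>" and U: "model_chart U c I"
  obtains H where "inj_on H I" "\<forall>i\<in>I. \<forall>p\<in>U. p \<in> H i \<longleftrightarrow> c p $ i = 0"
    "\<forall>p\<in>U. facets_at p = H ` {i. c p $ i = 0}"
proof -
  note Us = model_chartD[OF U]
  have "\<exists>S. stratum_component 1 S \<and> piece U c {i} \<subseteq> S" if i: "i \<in> I" for i
  proof -
    obtain y where y: "y \<in> piece U c {i}"
      by (rule piece_nonempty[OF U, of "{i}"]) (use i in auto)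
    then have "y \<in> stratum P \<A> 1"
      using piece_subset_stratum[OF Us(1), of "{i}"] by auto
    then obtain S where S: "stratum_component 1 S" "y \<in> S"
      by (rule component_at)
    have "piece U c {i} \<subseteq> S"
      by (rule component_absorbs_piece[OF S(1) U _ _ y S(2)]) (use i in auto)
    with S show ?thesis by blast
  qed
  then have "\<forall>i\<in>I. \<exists>S. stratum_component 1 S \<and> piece U c {i} \<subseteq> S" by blast
  from bchoice[OF this] obtain S
    where S': "\<forall>i\<in>I. stratum_component 1 (S i) \<and> piece U c {i} \<subseteq> S i" ..
  have S: "stratum_component 1 (S i)" "piece U c {i} \<subseteq> S i" if "i \<in> I" for i
    using S' that by simp_all
  define H where "H i = P closure_of (S i)" for i
  have S_eq: "T = S i" if "stratum_component 1 T" "y \<in> T" "y \<in> piece U c {i}" "i \<in> I" for T y i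
    using component_eqI[OF that(1) S(1)[OF that(4)] that(2)] S(2)[OF that(4)] that(3) by blast
  have mem: "p \<in> H i \<longleftrightarrow> c p $ i = 0" if ip: "i \<in> I" "p \<in> U" for i p
  proof
    assume "p \<in> H i"
    then obtain k y where k: "c p $ k = 0" "y \<in> S i" "y \<in> piece U c {k}"
      unfolding H_def by (rule closure_meets_piece[OF Us(1) ip(2) _ component_subset(1)[OF S(1)[OF ip(1)]]])
    have kI: "k \<in> I" using Us(3)[OF ip(2)] k(1) by blast
    have "S i = S k"
      by (rule S_eq[OF S(1)[OF ip(1)] k(2,3) kI])
    then have "k = i"
      using sheets_distinct[OF nice U ip(1) kI _ S(1)[OF ip(1)] S(2)[OF ip(1)]] S(2)[OF kI] by auto
    then show "c p $ i = 0" using k(1) by simp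
  next
    assume "c p $ i = 0"
    then show "p \<in> H i"
      unfolding H_def by (intro in_closure_piece[OF Us(1) ip(2) _ S(2)[OF ip(1)]]) simp
  qed
  show thesis
  proof (rule that)
    show "inj_on H I"
    proof (rule inj_onI)
      fix i j assume ij: "i \<in> I" "j \<in> I" "H i = H j"
      obtain y where "y \<in> piece U c {i}"
        by (rule piece_nonempty[OF U, of "{i}"]) (use ij in auto)
      then have y: "y \<in> U" "{k. c y $ k = 0} = {i}" by (auto simp: piece_def)
      then have "c y $ i = 0" by blast
      then have "c y $ j = 0" using mem[OF ij(1) y(1)] mem[OF ij(2) y(1)] ij(3) by simp
      then have "j \<in> {k. c y $ k = 0}" by simp
      then show "i = j" unfolding y(2) by simp
    qed
    show "\<forall>i\<in>I. \<forall>p\<in>U. p \<in> H i \<longleftrightarrow> c p $ i = 0" using mem by blast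
    show "\<forall>p\<in>U. facets_at p = H ` {i. c p $ i = 0}"
    proof
      fix p assume p: "p \<in> U"
      show "facets_at p = H ` {i. c p $ i = 0}"
      proof (intro equalityI subsetI)
        fix F assume "F \<in> facets_at p"
        then obtain T where T: "stratum_component 1 T" "F = P closure_of T" "p \<in> P closure_of T"
          unfolding facets_at_def faces_def by blast
        obtain k y where k: "c p $ k = 0" "y \<in> T" "y \<in> piece U c {k}"
          using T(3) by (rule closure_meets_piece[OF Us(1) p _ component_subset(1)[OF T(1)]])
        have kI: "k \<in> I" using Us(3)[OF p] k(1) by blast
        have "F = H k"
          unfolding H_def T(2) S_eq[OF T(1) k(2,3) kI] ..
        then show "F \<in> H ` {i. c p $ i = 0}" using k(1) by simp
      next
        fix F assume "F \<in> H ` {i. c p $ i = 0}"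
        then obtain i where i: "c p $ i = 0" "F = H i" by blast
        have iI: "i \<in> I" using Us(3)[OF p] i(1) by blast
        have "F \<in> facets P \<A>"
          unfolding faces_def i(2) H_def using S(1)[OF iI] by (rule imageI)
        then show "F \<in> facets_at p"
          using mem[OF iI p] i by (simp add: facets_at_def)
      qed
    qed
  qed
qed

section \<open>The facets through a point and the facets of a face\<close>

lemma finite_facets_at:
  assumes nice: "nice P \<A>" and p: "p \<in> stratum P \<A> k"
  shows "finite (facets_at p)" "card (facets_at p) = k"
proof -
  have pt: "p \<in> topspace P" using p by (simp add: stratum_def)
  obtain U c where U: "model_chart U c {i. c p $ i = 0}" "p \<in> U" "U \<subseteq> topspace P"
    by (rule model_chart_at[OF openin_topspace pt])
  let ?I = "{i. c p $ i = 0}"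
  obtain H where H: "inj_on H ?I" "\<forall>i\<in>?I. \<forall>p\<in>U. p \<in> H i \<longleftrightarrow> c p $ i = 0"
      "\<forall>p\<in>U. facets_at p = H ` {i. c p $ i = 0}"
    by (rule model_chart_facets[OF nice U(1)])
  show "finite (facets_at p)" using H(3) U(2) by simp
  have "card (facets_at p) = card {i. c p $ i = 0}"
    using H(3) U(2) card_image[OF H(1)] by simp
  then show "card (facets_at p) = k"
    using in_stratum_iff[OF model_chartD(1)[OF U(1)] U(2)] p by simp
qed

lemma closedin_facet: "F \<in> facets P \<A> \<Longrightarrow> closedin P F"
  by (auto simp: faces_def)

text \<open>A facet meets the connected set \<open>S\<close> in a clopen subset. It is closed since
  facets are. It is open since, in a model chart centred at \<open>y\<close>, a nearby point of the
  same stratum has equally many vanishing coordinates among those vanishing at \<open>y\<close>,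
  hence the same ones and the same facets.\<close>

lemma facets_at_component:
  assumes nice: "nice P \<A>" and S: "stratum_component k S" and ps: "p \<in> S" "s \<in> S"
  shows "facets_at s = facets_at p"
proof -
  have sub: "S \<subseteq> F" if F: "F \<in> facets P \<A>" "x \<in> F" "x \<in> S" for F x
  proof -
    let ?Y = "subtopology P S"
    have top: "topspace ?Y = S" using component_subset(2)[OF S] by auto
    have "closedin ?Y (F \<inter> S)"
      using closedin_facet[OF F(1)] by (auto simp: closedin_subtopology)
    moreover have "openin ?Y (F \<inter> S)"
      unfolding openin_subopen[of ?Y "F \<inter> S"]
    proof
      fix y assume y: "y \<in> F \<inter> S"
      then have yt: "y \<in> topspace P" using component_subset(2)[OF S] by blast
      obtain U c where U: "model_chart U c {i. c y $ i = 0}" "y \<in> U" "U \<subseteq> topspace P"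
        by (rule model_chart_at[OF openin_topspace yt])
      note Us = model_chartD[OF U(1)]
      let ?I = "{i. c y $ i = 0}"
      obtain H where "inj_on H ?I" "\<forall>i\<in>?I. \<forall>p\<in>U. p \<in> H i \<longleftrightarrow> c p $ i = 0"
          and H: "\<forall>p\<in>U. facets_at p = H ` {i. c p $ i = 0}"
        by (rule model_chart_facets[OF nice U(1)])
      have "U \<inter> S \<subseteq> F"
      proof
        fix z assume z: "z \<in> U \<inter> S"
        have "card {i. c z $ i = 0} = k" "card {i. c y $ i = 0} = k"
          using in_stratum_iff[OF Us(1)] component_subset(1)[OF S] z y U(2) by blast+
        then have "{i. c z $ i = 0} = {i. c y $ i = 0}"
          using Us(3)[of z] z by (intro card_subset_eq) auto
        then have "facets_at z = facets_at y" using H z U(2) by simp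
        then show "z \<in> F" using F(1) y by (auto simp: facets_at_def)
      qed
      moreover have "openin ?Y (U \<inter> S)"
        by (rule openin_subtopology_Int[OF smooth_chartD(1)[OF Us(1)]])
      ultimately show "\<exists>T. openin ?Y T \<and> y \<in> T \<and> T \<subseteq> F \<inter> S"
        using y U(2) by blast
    qed
    moreover have "connected_space ?Y"
      using component_subset(3)[OF S] by (simp add: connectedin_def)
    ultimately have "F \<inter> S = {} \<or> F \<inter> S = S"
      unfolding connected_space_clopen_in top by blast
    then show ?thesis using F by blast
  qed
  show ?thesis
    unfolding facets_at_def using sub[of _ s] sub[of _ p] ps by auto
qed

text \<open>This extends niceness from codimension two to all codimensions. Uniqueness is a count:
  the collection lies in \<open>facets_at p\<close>, which has just \<open>k\<close> elements. For
  existence \<open>F\<close> is shown to be clopen in the intersection of these facets: in a chart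
  the intersection is the common zero set of \<open>k\<close> coordinates, and that set lies in the
  closure of a piece contained in \<open>S\<close>.\<close>

lemma component_of_facets_iff:
  assumes nice: "nice P \<A>" and F: "F \<in> faces P \<A> k" and p: "p \<in> face_interior P \<A> k F"
  shows "component_of_facets P \<A> k F \<G> \<longleftrightarrow> \<G> = facets_at p"
proof -
  have pst: "p \<in> stratum P \<A> k" "p \<in> F" using p by (auto simp: face_interior_def)
  obtain S where S: "stratum_component k S" "F = P closure_of S"
    using F unfolding faces_def by blast
  have pS: "p \<in> S"
    using closure_component_Int_stratum[OF S(1)] pst S(2) by simp
  note fin = finite_facets_at[OF nice pst(1)]
  show ?thesis
  proof
    assume "component_of_facets P \<A> k F \<G>"
    then have G: "\<G> \<subseteq> facets P \<A>" "card \<G> = k" "F \<in> connected_components_of (subtopology P (\<Inter>\<G>))"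
      unfolding component_of_facets_def by auto
    have "p \<in> \<Inter>\<G>"
      using connected_components_of_subset[OF G(3)] pst(2) by auto
    then have "\<G> \<subseteq> facets_at p" using G(1) by (auto simp: facets_at_def)
    then show "\<G> = facets_at p"
      using fin G(2) by (intro card_subset_eq) auto
  next
    assume G: "\<G> = facets_at p"
    let ?Y = "subtopology P (\<Inter>\<G>)"
    have SG: "S \<subseteq> \<Inter>\<G>"
    proof
      fix s assume "s \<in> S"
      then have "facets_at s = \<G>" using facets_at_component[OF nice S(1) pS] G by simp
      then show "s \<in> \<Inter>\<G>" by (auto simp: facets_at_def)
    qed
    have Gf: "\<G> \<subseteq> facets P \<A>" using G by (auto simp: facets_at_def)
    have FG: "F \<subseteq> \<Inter>\<G>"
    proof
      fix y assume y: "y \<in> F"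
      have "y \<in> G'" if G': "G' \<in> \<G>" for G'
      proof -
        have "P closure_of S \<subseteq> G'"
          by (rule closure_of_minimal) (use SG G' Gf closedin_facet in auto)
        then show ?thesis using y S(2) by blast
      qed
      then show "y \<in> \<Inter>\<G>" by blast
    qed
    have Fc: "closedin P F" using S(2) by simp
    then have Ft: "F \<subseteq> topspace P" by (rule closedin_subset)
    have cF: "connectedin ?Y F"
      using connectedin_closure_of[OF component_subset(3)[OF S(1)]] FG S(2)
      by (simp add: connectedin_subtopology)
    have clF: "closedin ?Y F"
      unfolding closedin_subtopology using Fc FG by blast
    have opF: "openin ?Y F"
      unfolding openin_subopen[of ?Y F]
    proof
      fix y assume y: "y \<in> F"
      then have yt: "y \<in> topspace P" using Ft by blast
      obtain U c where U: "model_chart U c {i. c y $ i = 0}" "y \<in> U" "U \<subseteq> topspace P"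
        by (rule model_chart_at[OF openin_topspace yt])
      define I where "I = {i. c y $ i = 0}"
      note UI = U(1)[folded I_def]
      note Us = model_chartD[OF UI]
      obtain H where H: "inj_on H I" "\<forall>i\<in>I. \<forall>p\<in>U. p \<in> H i \<longleftrightarrow> c p $ i = 0"
          "\<forall>p\<in>U. facets_at p = H ` {i. c p $ i = 0}"
        by (rule model_chart_facets[OF nice UI])
      obtain s where s: "s \<in> S" "s \<in> U"
        by (rule closure_of_meetsE[OF y[unfolded S(2)] smooth_chartD(1)[OF Us(1)] U(2)])
      define J where "J = {i. c s $ i = 0}"
      have JI: "J \<subseteq> I" using Us(3)[OF s(2)] by (simp add: J_def)
      have HJ: "\<G> = H ` J"
        using facets_at_component[OF nice S(1) pS s(1)] H(3) s(2) G by (simp add: J_def)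
      have cJ: "card J = k"
        using in_stratum_iff[OF Us(1) s(2)] component_subset(1)[OF S(1)] s(1) by (auto simp: J_def)
      have pS': "piece U c J \<subseteq> S"
        by (rule component_absorbs_piece[OF S(1) UI JI cJ, of s]) (use s in \<open>auto simp: piece_def J_def\<close>)
      have "U \<inter> \<Inter>\<G> \<subseteq> F"
      proof
        fix x assume x: "x \<in> U \<inter> \<Inter>\<G>"
        then have "\<forall>i\<in>J. c x $ i = 0" using H(2) HJ JI by auto
        then show "x \<in> F"
          unfolding S(2) using x by (intro in_closure_piece[OF Us(1) _ _ pS']) auto
      qed
      moreover have "openin ?Y (U \<inter> \<Inter>\<G>)"
        by (rule openin_subtopology_Int[OF smooth_chartD(1)[OF Us(1)]])
      ultimately show "\<exists>T. openin ?Y T \<and> y \<in> T \<and> T \<subseteq> F"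
        using y U(2) FG by blast
    qed
    have "p \<in> topspace ?Y" using pst(2) FG Ft by auto
    then have "p \<in> \<Union>(connected_components_of ?Y)" by (simp only: Union_connected_components_of)
    then obtain C where C: "C \<in> connected_components_of ?Y" "p \<in> C" by blast
    have "F \<subseteq> C"
      by (rule connected_components_of_maximal[OF C(1) cF]) (use C pst in \<open>auto simp: disjnt_def\<close>)
    moreover have "C \<subseteq> F"
      using connectedin_clopen_cases[OF connectedin_connected_components_of[OF C(1)] clF opF] C(2) pst(2)
      by (auto simp: disjnt_def)
    ultimately have "F \<in> connected_components_of ?Y" using C(1) by simp
    then show "component_of_facets P \<A> k F \<G>"
      unfolding component_of_facets_def using Gf fin G by simp
  qed
qed

lemma face_facets_eq:
  assumes "nice P \<A>" "F \<in> faces P \<A> k" "p \<in> face_interior P \<A> k F"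
  shows "face_facets P \<A> k F = facets_at p"
  unfolding face_facets_def component_of_facets_iff[OF assms] by (rule the_equality) auto

lemma face_at:
  assumes p: "p \<in> stratum P \<A> k"
  obtains F where "F \<in> faces P \<A> k" "p \<in> face_interior P \<A> k F"
proof -
  obtain S where S: "stratum_component k S" "p \<in> S"
    using p by (rule component_at)
  have "p \<in> P closure_of S"
    using S(2) component_subset(2)[OF S(1)] closure_of_subset by blast
  then show thesis
    using that[of "P closure_of S"] S p unfolding faces_def face_interior_def by blast
qed

lemma stratum_covers:
  assumes "p \<in> topspace P"
  obtains k where "p \<in> stratum P \<A> k"
proof -
  obtain U c where "smooth_corner_chart P \<A> (U, c)" "p \<in> U" "(U, c) \<in> \<A>"
    using assms by (rule atlas_chart_at)
  then show thesis using that in_stratum_iff by blast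
qed

subsection \<open>Smooth functions and bump functions\<close>

definition psmooth :: "'p set \<Rightarrow> ('p \<Rightarrow> 'b::euclidean_space) \<Rightarrow> bool" where
  "psmooth W f \<longleftrightarrow> (\<forall>U c. smooth_corner_chart P \<A> (U, c) \<longrightarrow>
     smooth_on (c ` (U \<inter> W)) (\<lambda>q. f (the_inv_into U c q)))"

lemma psmoothD: "psmooth W f \<Longrightarrow> smooth_corner_chart P \<A> (U, c) \<Longrightarrow> smooth_on (c ` (U \<inter> W)) (\<lambda>q. f (the_inv_into U c q))"
  by (simp add: psmooth_def)

lemma psmooth_subset:
  assumes "psmooth W f" "V \<subseteq> W"
  shows "psmooth V f"
  unfolding psmooth_def
proof (intro allI impI)
  fix U c assume "smooth_corner_chart P \<A> (U, c)"
  then have "smooth_on (c ` (U \<inter> W)) (\<lambda>q. f (the_inv_into U c q))" by (rule psmoothD[OF assms(1)])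
  then show "smooth_on (c ` (U \<inter> V)) (\<lambda>q. f (the_inv_into U c q))"
    by (rule smooth_on_subset) (use assms(2) in auto)
qed

lemma psmooth_cong:
  assumes "psmooth W f" "\<And>x. x \<in> W \<Longrightarrow> f x = g x"
  shows "psmooth W g"
  unfolding psmooth_def
proof (intro allI impI)
  fix U c assume U: "smooth_corner_chart P \<A> (U, c)"
  then have "smooth_on (c ` (U \<inter> W)) (\<lambda>q. f (the_inv_into U c q))" by (rule psmoothD[OF assms(1)])
  then show "smooth_on (c ` (U \<inter> W)) (\<lambda>q. g (the_inv_into U c q))"
    by (rule smooth_on_cong) (use assms(2) inv_chart[OF U] in auto)
qed

text \<open>One chart about each point suffices, because all transitions are smooth.\<close>

lemma psmooth_chartI:
  assumes "\<And>x. x \<in> W \<Longrightarrow> \<exists>U c N. smooth_corner_chart P \<A> (U, c) \<and> openin P N \<and> x \<in> N \<and> N \<subseteq> U \<and>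
      smooth_on (c ` (N \<inter> W)) (\<lambda>q. f (the_inv_into U c q))"
  shows "psmooth W f"
  unfolding psmooth_def
proof (intro allI impI smooth_on_local)
  fix V d q assume V: "smooth_corner_chart P \<A> (V, d)" and "q \<in> d ` (V \<inter> W)"
  then obtain x where x: "x \<in> V" "x \<in> W" "q = d x" by auto
  obtain U c N where U: "smooth_corner_chart P \<A> (U, c)" "openin P N" "x \<in> N" "N \<subseteq> U"
      "smooth_on (c ` (N \<inter> W)) (\<lambda>q. f (the_inv_into U c q))"
    using assms[OF x(2)] by (elim exE conjE)
  have "openin P (V \<inter> N)" using smooth_chartD(1)[OF V] U(2) by (rule openin_Int)
  then obtain O' where O: "open O'" "d x \<in> O'" "\<forall>y\<in>V. d y \<in> O' \<longrightarrow> y \<in> V \<inter> N"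
    by (rule smooth_chart_openE[OF V]) (use x U in auto)
  have "smooth_on (d ` (V \<inter> W) \<inter> O') (\<lambda>q. f (the_inv_into U c (c (the_inv_into V d q))))"
  proof (rule smooth_on_compose[OF smooth_on_subset[OF smooth_transition[OF V U(1)]] U(5)])
    show "d ` (V \<inter> W) \<inter> O' \<subseteq> d ` (V \<inter> U)" using O(3) U(4) by auto
    show "(\<lambda>q. c (the_inv_into V d q)) ` (d ` (V \<inter> W) \<inter> O') \<subseteq> c ` (N \<inter> W)"
      using O(3) inv_chart[OF V] by auto
  qed
  then have "smooth_on (d ` (V \<inter> W) \<inter> O') (\<lambda>q. f (the_inv_into V d q))"
    by (rule smooth_on_cong) (use O(3) inv_chart[OF V] inv_chart[OF U(1)] U(4) in auto)
  then show "\<exists>O'. open O' \<and> q \<in> O' \<and> smooth_on (d ` (V \<inter> W) \<inter> O') (\<lambda>q. f (the_inv_into V d q))"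
    using O(1,2) x(3) by (intro exI[of _ O']) simp
qed

lemma psmooth_local:
  assumes W: "W \<subseteq> topspace P" and f: "\<And>x. x \<in> W \<Longrightarrow> \<exists>N. openin P N \<and> x \<in> N \<and> psmooth (N \<inter> W) f"
  shows "psmooth W f"
proof (rule psmooth_chartI)
  fix x assume x: "x \<in> W"
  obtain N where N: "openin P N" "x \<in> N" "psmooth (N \<inter> W) f"
    using f[OF x] by (elim exE conjE)
  have "x \<in> topspace P" using x W by blast
  then obtain U c where U: "smooth_corner_chart P \<A> (U, c)" "x \<in> U" "(U, c) \<in> \<A>"
    by (rule atlas_chart_at)
  have "smooth_on (c ` ((U \<inter> N) \<inter> W)) (\<lambda>q. f (the_inv_into U c q))"
    using psmoothD[OF N(3) U(1)] by (simp add: Int_assoc)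
  moreover have "openin P (U \<inter> N)" using smooth_chartD(1)[OF U(1)] N(1) by (rule openin_Int)
  ultimately show "\<exists>U c N. smooth_corner_chart P \<A> (U, c) \<and> openin P N \<and> x \<in> N \<and> N \<subseteq> U \<and>
      smooth_on (c ` (N \<inter> W)) (\<lambda>q. f (the_inv_into U c q))"
    using U N(2) by (intro exI[of _ U] exI[of _ c] exI[of _ "U \<inter> N"]) simp
qed

lemma psmooth_chart: "smooth_corner_chart P \<A> (U, c) \<Longrightarrow> psmooth U c"
  unfolding psmooth_def using smooth_transition by (simp add: Int_commute)

lemma psmooth_const: "psmooth W (\<lambda>x. k)"
  by (simp add: psmooth_def smooth_on_const)

lemma psmooth_minus: "psmooth W f \<Longrightarrow> psmooth W (\<lambda>x. - f x)"
  by (simp add: psmooth_def smooth_on_minus)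

lemma psmooth_sum: "(\<And>i. i \<in> I \<Longrightarrow> psmooth W (f i)) \<Longrightarrow> psmooth W (\<lambda>x. \<Sum>i\<in>I. f i x)"
  by (simp add: psmooth_def smooth_on_sum)

lemma psmooth_scaleR: "psmooth W f \<Longrightarrow> psmooth W g \<Longrightarrow> psmooth W (\<lambda>x. f x *\<^sub>R g x)"
  by (simp add: psmooth_def smooth_on_scaleR)

lemma psmooth_inverse:
  fixes f :: "'p \<Rightarrow> real"
  assumes "psmooth W f" "\<And>x. x \<in> W \<Longrightarrow> f x \<noteq> 0"
  shows "psmooth W (\<lambda>x. inverse (f x))"
  unfolding psmooth_def
proof (intro allI impI smooth_on_inverse)
  fix U c q assume U: "smooth_corner_chart P \<A> (U, c)"
  then show "smooth_on (c ` (U \<inter> W)) (\<lambda>q. f (the_inv_into U c q))" by (rule psmoothD[OF assms(1)])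
  assume "q \<in> c ` (U \<inter> W)"
  then show "f (the_inv_into U c q) \<noteq> 0" using assms(2) inv_chart[OF U] by auto
qed

text \<open>A flat bump in the squared distance to \<open>c p\<close>, extended by zero outside the
  chart. The extension is smooth because its support lies in \<open>C\<close>, the compact preimage
  of a closed ball: as \<open>P\<close> is Hausdorff, \<open>C\<close> is closed in \<open>P\<close>
  and not merely in \<open>U\<close>.\<close>

lemma bump_function:
  assumes N: "openin P N" and p: "p \<in> N"
  obtains b :: "'p \<Rightarrow> real" and C where "psmooth (topspace P) b" "\<forall>x. 0 \<le> b x" "0 < b p"
    "closedin P C" "C \<subseteq> N" "\<forall>x. x \<notin> C \<longrightarrow> b x = 0"
proof -
  obtain U c where U: "model_chart U c {i. c p $ i = 0}" "p \<in> U" "U \<subseteq> N"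
    using N p by (rule model_chart_at)
  note Us = model_chartD(1)[OF U(1)]
  obtain O' where O: "open O'" "c ` U = orthant \<inter> O'"
    using smooth_chartD(2)[OF Us] by (auto simp: openin_open)
  have cpO: "c p \<in> O'" using O(2) U(2) by blast
  obtain r where r: "r > 0" "cball (c p) r \<subseteq> O'"
    using open_contains_cball_eq[OF O(1)] cpO by blast
  define f where "f q = flat_bump 0 (r\<^sup>2 - (q - c p) \<bullet> (q - c p))" for q
  define b where "b x = (if x \<in> U then f (c x) else 0)" for x
  define C where "C = {x \<in> U. c x \<in> cball (c p) r}"
  have fpos: "0 \<le> f q" for q
    using flat_bump_pos[of "r\<^sup>2 - (q - c p) \<bullet> (q - c p)" 0] flat_bump_zero[of "r\<^sup>2 - (q - c p) \<bullet> (q - c p)" 0]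
    unfolding f_def by linarith
  have f0: "f q = 0" if "q \<notin> cball (c p) r" for q
  proof -
    have "r < norm (q - c p)" using that by (simp add: dist_norm norm_minus_commute)
    then have "r\<^sup>2 \<le> (norm (q - c p))\<^sup>2" using r(1) by (intro power_mono) auto
    then show ?thesis unfolding f_def by (intro flat_bump_zero) (simp add: power2_norm_eq_inner)
  qed
  have "closed (orthant :: (real ^ 'n) set)"
  proof -
    have eq: "(orthant :: (real ^ 'n) set) = (\<Inter>i. {x. 0 \<le> x $ i})" by (auto simp: orthant_def)
    show ?thesis unfolding eq by (intro closed_INT ballI closed_Collect_le continuous_intros)
  qed
  then have "compact (orthant \<inter> cball (c p) r)"
    by (intro closed_Int_compact) auto
  moreover have sub: "orthant \<inter> cball (c p) r \<subseteq> c ` U" using r(2) O(2) by blast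
  ultimately have "compactin (top_of_set (c ` U)) (orthant \<inter> cball (c p) r)"
    by (simp add: compactin_subtopology)
  from image_compactin[OF this smooth_chartD(7)[OF Us]]
  have "compactin P (the_inv_into U c ` (orthant \<inter> cball (c p) r))"
    by (simp add: compactin_subtopology)
  moreover have "the_inv_into U c ` (orthant \<inter> cball (c p) r) = C"
  proof (intro equalityI subsetI)
    fix x assume "x \<in> the_inv_into U c ` (orthant \<inter> cball (c p) r)"
    then obtain q where q: "q \<in> orthant \<inter> cball (c p) r" "x = the_inv_into U c q" by blast
    then obtain y where y: "y \<in> U" "q = c y" using sub by blast
    then show "x \<in> C" using q inv_chart[OF Us y(1)] by (simp add: C_def)
  next
    fix x assume x: "x \<in> C"
    then have xU: "x \<in> U" by (simp add: C_def)
    have "c x \<in> orthant \<inter> cball (c p) r" using x O(2) by (auto simp: C_def)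
    then show "x \<in> the_inv_into U c ` (orthant \<inter> cball (c p) r)"
      by (rule image_eqI[rotated]) (simp add: inv_chart[OF Us xU])
  qed
  ultimately have closed: "closedin P C"
    using compactin_imp_closedin[OF Hausdorff] by simp
  have b0: "b x = 0" if "x \<notin> C" for x
    using f0[of "c x"] that unfolding b_def C_def by (cases "x \<in> U") simp_all
  have smf: "smooth_on A f" for A
    unfolding f_def
    by (intro smooth_on_flat_bump smooth_on_diff smooth_on_const smooth_on_ident
        smooth_on_bilinear[OF bounded_bilinear_inner])
  show thesis
  proof (rule that)
    show "psmooth (topspace P) b"
    proof (rule psmooth_local[OF order_refl])
      fix x assume x: "x \<in> topspace P"
      show "\<exists>N. openin P N \<and> x \<in> N \<and> psmooth (N \<inter> topspace P) b"
      proof (cases "x \<in> U")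
        case True
        have "psmooth U (\<lambda>x. f (c x))"
          unfolding psmooth_def
        proof (intro allI impI)
          fix V d assume V: "smooth_corner_chart P \<A> (V, d)"
          show "smooth_on (d ` (V \<inter> U)) (\<lambda>q. f (c (the_inv_into V d q)))"
            by (rule smooth_on_compose[OF psmoothD[OF psmooth_chart[OF Us] V] smf subset_UNIV])
        qed
        then have "psmooth U b" by (rule psmooth_cong) (simp add: b_def)
        then have "psmooth (U \<inter> topspace P) b" by (rule psmooth_subset) auto
        then show ?thesis using smooth_chartD(1)[OF Us] True by (intro exI[of _ U]) simp
      next
        case False
        then have xC: "x \<notin> C" by (simp add: C_def)
        have "psmooth ((topspace P - C) \<inter> topspace P) b"
          by (rule psmooth_cong[OF psmooth_const[of _ 0]]) (use b0 in auto)
        moreover have "openin P (topspace P - C)" using closed by blast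
        ultimately show ?thesis using x xC by (intro exI[of _ "topspace P - C"]) simp
      qed
    qed
    show "\<forall>x. 0 \<le> b x" using fpos by (simp add: b_def)
    show "0 < b p" using U(2) r(1) by (simp add: b_def f_def flat_bump_pos)
    show "C \<subseteq> N" using U(3) by (auto simp: C_def)
  qed (use closed b0 in auto)
qed

end

section \<open>Principal torus bundles\<close>

lemma continuous_map_local:
  assumes "\<And>x. x \<in> topspace X \<Longrightarrow> \<exists>U. openin X U \<and> x \<in> U \<and> continuous_map (subtopology X U) Y f"
  shows "continuous_map X Y f"
proof -
  obtain U where U: "\<And>x. x \<in> topspace X \<Longrightarrow> openin X (U x) \<and> x \<in> U x \<and> continuous_map (subtopology X (U x)) Y f"
    using assms by metis
  show ?thesis
  proof (rule pasting_lemma[where I = "topspace X" and T = U and f = "\<lambda>_. f"])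
    show "\<exists>j. j \<in> topspace X \<and> x \<in> U j \<and> f x = f x" if "x \<in> topspace X" for x
      using U[OF that] that by blast
  qed (use U in auto)
qed

locale torus_bundle =
  fixes P :: "'p topology" and E :: "'e topology"
    and act :: "(real ^ 'n::finite) set \<Rightarrow> 'e \<Rightarrow> 'e" and \<mu> :: "'e \<Rightarrow> 'p"
  assumes principal: "principal_torus_bundle E act P \<mu>"
begin

lemma group_act: "group_action (torus UNIV) (topspace E) act"
  and continuous_act: "continuous_map (prod_topology (torus_topology UNIV) E) E (\<lambda>(t, x). act t x)"
  and continuous_\<mu>: "continuous_map E P \<mu>"
  using principal by (simp_all add: principal_torus_bundle_def)

lemma trivialization:
  assumes "p \<in> topspace P"
  obtains U h where "openin P U" "p \<in> U"
    "homeomorphic_map (prod_topology (subtopology P U) (torus_topology UNIV))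
        (subtopology E {x \<in> topspace E. \<mu> x \<in> U}) h"
    "\<forall>u\<in>U. \<forall>t\<in>carrier (torus UNIV). \<mu> (h (u, t)) = u \<and>
        (\<forall>s\<in>carrier (torus UNIV). h (u, s \<otimes>\<^bsub>torus UNIV\<^esub> t) = act s (h (u, t)))"
proof -
  have "\<exists>U h. openin P U \<and> p \<in> U \<and>
      homeomorphic_map (prod_topology (subtopology P U) (torus_topology UNIV))
        (subtopology E {x \<in> topspace E. \<mu> x \<in> U}) h \<and>
      (\<forall>u\<in>U. \<forall>t\<in>carrier (torus UNIV). \<mu> (h (u, t)) = u \<and>
        (\<forall>s\<in>carrier (torus UNIV). h (u, s \<otimes>\<^bsub>torus UNIV\<^esub> t) = act s (h (u, t))))"
    using principal assms by (simp only: principal_torus_bundle_def)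
  then show thesis using that by (elim exE conjE)
qed

lemma tor_carrier [simp]: "tor v \<in> carrier (torus UNIV)"
  by (simp add: carrier_torus_UNIV)

lemma act_closed [simp]: "x \<in> topspace E \<Longrightarrow> act (tor v) x \<in> topspace E"
  using group_action.element_image[OF group_act, of "tor v" x] by simp

lemma act_add: "x \<in> topspace E \<Longrightarrow> act (tor (v + w)) x = act (tor v) (act (tor w) x)"
  using group_action.composition_rule[OF group_act, of x "tor v" "tor w"] by (simp add: tor_mult)

lemma act_zero [simp]: "x \<in> topspace E \<Longrightarrow> act (tor 0) x = x"
  using group_action.id_eq_one[OF group_act] by (metis restrict_apply torus_one)

lemma act_minus_cancel: "x \<in> topspace E \<Longrightarrow> act (tor (- v)) (act (tor v) x) = x"
  by (simp flip: act_add)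

lemma \<mu>_closed: "x \<in> topspace E \<Longrightarrow> \<mu> x \<in> topspace P"
  using continuous_map_image_subset_topspace[OF continuous_\<mu>] by blast

section \<open>Sections and angle coordinates of the bundle\<close>

definition section_on :: "'p set \<Rightarrow> ('p \<Rightarrow> 'e) \<Rightarrow> bool" where
  "section_on U \<sigma> \<longleftrightarrow> openin P U \<and> continuous_map (subtopology P U) E \<sigma> \<and> (\<forall>p\<in>U. \<mu> (\<sigma> p) = p)"

lemma section_onD:
  assumes "section_on U \<sigma>"
  shows "openin P U" "continuous_map (subtopology P U) E \<sigma>" "p \<in> U \<Longrightarrow> \<mu> (\<sigma> p) = p"
    "p \<in> U \<Longrightarrow> \<sigma> p \<in> topspace E" "U \<subseteq> topspace P"
proof -
  show *: "openin P U" "continuous_map (subtopology P U) E \<sigma>" "p \<in> U \<Longrightarrow> \<mu> (\<sigma> p) = p" for p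
    using assms by (simp_all add: section_on_def)
  show U: "U \<subseteq> topspace P" by (rule openin_subset[OF *(1)])
  show "p \<in> U \<Longrightarrow> \<sigma> p \<in> topspace E" for p
    using continuous_map_image_subset_topspace[OF *(2)] U by auto
qed

lemma section_on_subset:
  assumes "section_on U \<sigma>" "openin P V" "V \<subseteq> U"
  shows "section_on V \<sigma>"
  unfolding section_on_def
  using section_onD[OF assms(1)] assms(2,3) continuous_map_from_subtopology_mono by blast

lemma continuous_act_compose:
  assumes "continuous_map X (torus_topology UNIV) t" "continuous_map X E f"
  shows "continuous_map X E (\<lambda>x. act (t x) (f x))"
proof -
  have "continuous_map X (prod_topology (torus_topology UNIV) E) (\<lambda>x. (t x, f x))"
    using assms by (simp add: continuous_map_pairwise o_def)
  from continuous_map_compose[OF this continuous_act] show ?thesis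
    by (simp add: o_def)
qed

lemma continuous_act_tor:
  assumes "continuous_map X euclidean a" "continuous_map X E f"
  shows "continuous_map X E (\<lambda>x. act (tor (a x)) (f x))"
proof (rule continuous_act_compose[OF _ assms(2)])
  show "continuous_map X (torus_topology UNIV) (\<lambda>x. tor (a x))"
    using continuous_map_compose[OF assms(1) quotient_imp_continuous_map[OF quotient_map_tor]]
    by (simp add: o_def)
qed

text \<open>The section is the trivialization evaluated at the neutral element, and
  \<open>\<tau>\<close> is the torus component of the inverse trivialization. Later arguments work
  with sections.\<close>

lemma trivialization_section:
  assumes "p \<in> topspace P"
  obtains U \<sigma> \<tau> where "p \<in> U" "section_on U \<sigma>"
    "continuous_map (subtopology E {x \<in> topspace E. \<mu> x \<in> U}) (torus_topology UNIV) \<tau>"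
    "\<forall>x\<in>topspace E. \<mu> x \<in> U \<longrightarrow> \<tau> x \<in> carrier (torus UNIV) \<and> x = act (\<tau> x) (\<sigma> (\<mu> x))"
    "\<forall>u\<in>U. \<forall>t\<in>carrier (torus UNIV). \<mu> (act t (\<sigma> u)) = u \<and> \<tau> (act t (\<sigma> u)) = t"
proof -
  obtain U h where U: "openin P U" "p \<in> U"
    and h: "homeomorphic_map (prod_topology (subtopology P U) (torus_topology UNIV))
        (subtopology E {x \<in> topspace E. \<mu> x \<in> U}) h"
    and eq: "\<forall>u\<in>U. \<forall>t\<in>carrier (torus UNIV). \<mu> (h (u, t)) = u \<and>
        (\<forall>s\<in>carrier (torus UNIV). h (u, s \<otimes>\<^bsub>torus UNIV\<^esub> t) = act s (h (u, t)))"
    using assms by (rule trivialization)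
  let ?X = "prod_topology (subtopology P U) (torus_topology (UNIV :: (int ^ 'n) set))"
  let ?Y = "subtopology E {x \<in> topspace E. \<mu> x \<in> U}"
  have topX: "topspace ?X = U \<times> carrier (torus UNIV)"
    using openin_subset[OF U(1)] by (auto simp: topspace_torus_topology)
  have topY: "topspace ?Y = {x \<in> topspace E. \<mu> x \<in> U}" by auto
  obtain g where g: "homeomorphic_maps ?X ?Y h g"
    using h unfolding homeomorphic_map_maps by (elim exE)
  then have ch: "continuous_map ?X ?Y h" and cg: "continuous_map ?Y ?X g"
    and gh: "\<And>u t. u \<in> U \<Longrightarrow> t \<in> carrier (torus UNIV) \<Longrightarrow> g (h (u, t)) = (u, t)"
    and hg: "\<And>x. x \<in> topspace E \<Longrightarrow> \<mu> x \<in> U \<Longrightarrow> h (g x) = x"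
    unfolding homeomorphic_maps_def topX topY by auto
  define one where "one = tor (0 :: real ^ 'n)"
  have one: "one \<in> carrier (torus UNIV)" "one = \<one>\<^bsub>torus UNIV\<^esub>"
    by (simp_all add: one_def torus_one)
  note grp = group_torus[OF submodule_of_ints_UNIV]
  define \<sigma> where "\<sigma> u = h (u, one)" for u
  have act: "act t (\<sigma> u) = h (u, t)" if ut: "u \<in> U" "t \<in> carrier (torus UNIV)" for u t
  proof -
    have "h (u, t \<otimes>\<^bsub>torus UNIV\<^esub> one) = act t (h (u, one))"
      using eq ut one(1) by blast
    then show ?thesis
      using monoid.r_one[OF group.is_monoid[OF grp] ut(2)] by (simp add: \<sigma>_def one(2))
  qed
  have gx: "g x = (\<mu> x, snd (g x))" "snd (g x) \<in> carrier (torus UNIV)"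
    if x: "x \<in> topspace E" "\<mu> x \<in> U" for x
  proof -
    have "g x \<in> U \<times> carrier (torus UNIV)"
      using continuous_map_image_subset_topspace[OF cg] x topX by auto
    then obtain u t where ut: "u \<in> U" "t \<in> carrier (torus UNIV)" "g x = (u, t)" by auto
    have "\<mu> x = u" using hg[OF x] eq ut by force
    then show "g x = (\<mu> x, snd (g x))" "snd (g x) \<in> carrier (torus UNIV)" using ut by simp_all
  qed
  show thesis
  proof (rule that[of U \<sigma> "\<lambda>x. snd (g x)"])
    have "continuous_map (subtopology P U) ?X (\<lambda>u. (u, one))"
      using one(1) by (simp add: continuous_map_pairwise o_def topspace_torus_topology)
    from continuous_map_compose[OF this ch]
    have "continuous_map (subtopology P U) ?Y \<sigma>"
      by (simp add: o_def \<sigma>_def[abs_def])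
    then have "continuous_map (subtopology P U) E \<sigma>"
      by (simp add: continuous_map_in_subtopology)
    moreover have "\<forall>p\<in>U. \<mu> (\<sigma> p) = p" using eq one(1) by (simp add: \<sigma>_def)
    ultimately show "section_on U \<sigma>" using U(1) by (simp add: section_on_def)
    show "continuous_map ?Y (torus_topology UNIV) (\<lambda>x. snd (g x))"
      using continuous_map_compose[OF cg continuous_map_snd] by (simp add: o_def)
    show "\<forall>x\<in>topspace E. \<mu> x \<in> U \<longrightarrow> snd (g x) \<in> carrier (torus UNIV) \<and> x = act (snd (g x)) (\<sigma> (\<mu> x))"
    proof (intro ballI impI conjI)
      fix x assume x: "x \<in> topspace E" "\<mu> x \<in> U"
      show "snd (g x) \<in> carrier (torus UNIV)" by (rule gx(2)[OF x])
      have "act (snd (g x)) (\<sigma> (\<mu> x)) = h (\<mu> x, snd (g x))"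
        by (rule act[OF x(2) gx(2)[OF x]])
      also have "\<dots> = x" using gx(1)[OF x] hg[OF x] by simp
      finally show "x = act (snd (g x)) (\<sigma> (\<mu> x))" by simp
    qed
    show "\<forall>u\<in>U. \<forall>t\<in>carrier (torus UNIV). \<mu> (act t (\<sigma> u)) = u \<and> snd (g (act t (\<sigma> u))) = t"
      using act gh eq by simp
  qed (rule U(2))
qed

lemma \<mu>_act [simp]: "x \<in> topspace E \<Longrightarrow> \<mu> (act (tor v) x) = \<mu> x"
proof -
  assume x: "x \<in> topspace E"
  obtain U \<sigma> \<tau> where U: "\<mu> x \<in> U" "section_on U \<sigma>"
    "\<forall>x\<in>topspace E. \<mu> x \<in> U \<longrightarrow> \<tau> x \<in> carrier (torus UNIV) \<and> x = act (\<tau> x) (\<sigma> (\<mu> x))"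
    "\<forall>u\<in>U. \<forall>t\<in>carrier (torus UNIV). \<mu> (act t (\<sigma> u)) = u \<and> \<tau> (act t (\<sigma> u)) = t"
    using \<mu>_closed[OF x] by (rule trivialization_section)
  obtain w where w: "\<tau> x = tor w" using U(1,3) x by (auto simp: carrier_torus_UNIV)
  have xw: "x = act (tor w) (\<sigma> (\<mu> x))" using U(1,3) x w by metis
  have "act (tor v) x = act (tor (v + w)) (\<sigma> (\<mu> x))"
    using act_add[OF section_onD(4)[OF U(2,1)]] xw by metis
  then show ?thesis using U(1,4) tor_carrier by metis
qed

text \<open>Freeness is inherited from the trivializations, in which the action is translation of
  the torus factor and is detected by \<open>\<tau>\<close>.\<close>

lemma act_free:
  assumes x: "x \<in> topspace E" and eq: "act (tor v) x = act (tor w) x"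
  shows "tor v = tor w"
proof -
  obtain U \<sigma> \<tau> where U: "\<mu> x \<in> U" "section_on U \<sigma>"
    "\<forall>x\<in>topspace E. \<mu> x \<in> U \<longrightarrow> \<tau> x \<in> carrier (torus UNIV) \<and> x = act (\<tau> x) (\<sigma> (\<mu> x))"
    "\<forall>u\<in>U. \<forall>t\<in>carrier (torus UNIV). \<mu> (act t (\<sigma> u)) = u \<and> \<tau> (act t (\<sigma> u)) = t"
    using \<mu>_closed[OF x] by (rule trivialization_section)
  obtain u where u: "\<tau> x = tor u" using U(1,3) x by (auto simp: carrier_torus_UNIV)
  have xu: "x = act (tor u) (\<sigma> (\<mu> x))" using U(1,3) x u by metis
  have a: "act (tor r) x = act (tor (r + u)) (\<sigma> (\<mu> x))" for r
    using act_add[OF section_onD(4)[OF U(2,1)]] xu by metis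
  have "\<tau> (act (tor r) x) = tor (r + u)" for r
    unfolding a using U(1,4) tor_carrier by blast
  then have "tor (v + u) = tor (w + u)" using eq by metis
  then show ?thesis by (simp add: tor_eq_iff)
qed

lemma act_free_iff:
  assumes "x \<in> topspace E"
  shows "act (tor v) x = act (tor w) x \<longleftrightarrow> v - w \<in> range vec_of_int"
proof
  assume "act (tor v) x = act (tor w) x"
  from act_free[OF assms this] show "v - w \<in> range vec_of_int" by (simp add: tor_eq_iff)
next
  assume "v - w \<in> range vec_of_int"
  then have "tor v = tor w" by (simp add: tor_eq_iff)
  then show "act (tor v) x = act (tor w) x" by simp
qed

text \<open>The section \<open>\<sigma>\<close> may be unrelated to the trivialization at hand. Both
  \<open>y\<close> and \<open>\<sigma> (\<mu> y)\<close> are given torus coordinates there; the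
  difference of local lifts of these two coordinates is the wanted \<open>a\<close>.\<close>

lemma local_coordinate:
  assumes \<sigma>: "section_on V \<sigma>" and x: "x \<in> topspace E" "\<mu> x \<in> V"
  obtains N a where "openin E N" "x \<in> N" "N \<subseteq> {x \<in> topspace E. \<mu> x \<in> V}"
    "continuous_map (subtopology E N) euclidean a" "\<forall>y\<in>N. y = act (tor (a y)) (\<sigma> (\<mu> y))"
proof -
  obtain U s \<tau> where U: "\<mu> x \<in> U" "section_on U s"
    "continuous_map (subtopology E {x \<in> topspace E. \<mu> x \<in> U}) (torus_topology UNIV) \<tau>"
    "\<forall>x\<in>topspace E. \<mu> x \<in> U \<longrightarrow> \<tau> x \<in> carrier (torus UNIV) \<and> x = act (\<tau> x) (s (\<mu> x))"
    using \<mu>_closed[OF x(1)] by (rule trivialization_section)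
  note oU = section_onD(1)[OF U(2)] and oV = section_onD(1)[OF \<sigma>]
  have oEU: "openin E {x \<in> topspace E. \<mu> x \<in> U}"
    by (rule openin_continuous_map_preimage[OF continuous_\<mu> oU])
  have xEU: "x \<in> {x \<in> topspace E. \<mu> x \<in> U}" using x U(1) by simp
  obtain N1 a1 where N1: "openin E N1" "x \<in> N1" "N1 \<subseteq> {x \<in> topspace E. \<mu> x \<in> U}"
    "continuous_map (subtopology E N1) euclidean a1" "\<forall>y\<in>N1. \<tau> y = tor (a1 y)"
    using U(3) oEU xEU by (rule torus_lift_local)
  let ?W = "U \<inter> V"
  have oW: "openin P ?W" using oU oV by (rule openin_Int)
  have topW: "topspace (subtopology P ?W) = ?W" using openin_subset[OF oW] by auto
  have "continuous_map (subtopology P ?W) (subtopology E {x \<in> topspace E. \<mu> x \<in> U}) \<sigma>"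
    unfolding continuous_map_in_subtopology
    using continuous_map_from_subtopology_mono[OF section_onD(2)[OF \<sigma>], of ?W] topW
      section_onD(3,4)[OF \<sigma>] by auto
  from continuous_map_compose[OF this U(3)]
  have "continuous_map (subtopology P ?W) (torus_topology UNIV) (\<lambda>p. \<tau> (\<sigma> p))"
    by (simp add: o_def)
  moreover have "\<mu> x \<in> ?W" using x(2) U(1) by simp
  ultimately obtain N2 a2 where N2: "openin P N2" "\<mu> x \<in> N2" "N2 \<subseteq> ?W"
    "continuous_map (subtopology P N2) euclidean a2" "\<forall>p\<in>N2. \<tau> (\<sigma> p) = tor (a2 p)"
    using torus_lift_local[OF _ oW] by metis
  let ?N = "N1 \<inter> {x \<in> topspace E. \<mu> x \<in> N2}"
  have oN: "openin E ?N"
    using N1(1) openin_continuous_map_preimage[OF continuous_\<mu> N2(1)] by (rule openin_Int)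
  show thesis
  proof (rule that[OF oN])
    show "x \<in> ?N" using N1(2) N2(2) x by simp
    show "?N \<subseteq> {x \<in> topspace E. \<mu> x \<in> V}" using N2(3) by auto
    have top: "topspace (subtopology E ?N) = ?N" using openin_subset[OF oN] by auto
    have c1: "continuous_map (subtopology E ?N) euclidean a1"
      by (rule continuous_map_from_subtopology_mono[OF N1(4)]) simp
    have "continuous_map (subtopology E ?N) (subtopology P N2) \<mu>"
      unfolding continuous_map_in_subtopology
      using continuous_map_from_subtopology[OF continuous_\<mu>, of ?N] top by auto
    from continuous_map_compose[OF this N2(4)]
    have c2: "continuous_map (subtopology E ?N) euclidean (\<lambda>y. a2 (\<mu> y))" by (simp add: o_def)
    show "continuous_map (subtopology E ?N) euclidean (\<lambda>y. a1 y - a2 (\<mu> y))"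
      using c1 c2 by (rule continuous_map_diff)
    show "\<forall>y\<in>?N. y = act (tor (a1 y - a2 (\<mu> y))) (\<sigma> (\<mu> y))"
    proof
      fix y assume y: "y \<in> ?N"
      then have yE: "y \<in> topspace E" "\<mu> y \<in> N2" "y \<in> N1" by simp_all
      then have yU: "\<mu> y \<in> U" "\<mu> y \<in> V" using N2(3) by auto
      note sE = section_onD(4)[OF U(2) yU(1)] and \<sigma>E = section_onD(3,4)[OF \<sigma> yU(2)]
      have "\<sigma> (\<mu> y) = act (\<tau> (\<sigma> (\<mu> y))) (s (\<mu> (\<sigma> (\<mu> y))))"
        using U(4) \<sigma>E yU by auto
      then have 1: "\<sigma> (\<mu> y) = act (tor (a2 (\<mu> y))) (s (\<mu> y))"
        using \<sigma>E(1) N2(5) yE(2) by simp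
      have "y = act (\<tau> y) (s (\<mu> y))" using U(4) yE yU by blast
      then have "y = act (tor (a1 y)) (s (\<mu> y))" using N1(5) yE by simp
      also have "\<dots> = act (tor (a1 y - a2 (\<mu> y))) (act (tor (a2 (\<mu> y))) (s (\<mu> y)))"
        using act_add[OF sE, of "a1 y - a2 (\<mu> y)" "a2 (\<mu> y)"] by simp
      finally show "y = act (tor (a1 y - a2 (\<mu> y))) (\<sigma> (\<mu> y))" using 1 by simp
    qed
  qed
qed

lemma act_transitive:
  assumes "x \<in> topspace E" "y \<in> topspace E" "\<mu> x = \<mu> y"
  obtains v where "y = act (tor v) x"
proof -
  obtain U \<sigma> \<tau> where U: "\<mu> x \<in> U" "section_on U \<sigma>"
    using \<mu>_closed[OF assms(1)] by (rule trivialization_section)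
  obtain N a where "x \<in> N" "\<forall>y\<in>N. y = act (tor (a y)) (\<sigma> (\<mu> y))"
    using U(2) assms(1) U(1) by (rule local_coordinate)
  then have x: "x = act (tor (a x)) (\<sigma> (\<mu> x))" by blast
  have yU: "\<mu> y \<in> U" using U(1) assms(3) by simp
  obtain M c where "y \<in> M" "\<forall>y\<in>M. y = act (tor (c y)) (\<sigma> (\<mu> y))"
    using U(2) assms(2) yU by (rule local_coordinate)
  then have y: "y = act (tor (c y)) (\<sigma> (\<mu> x))" using assms(3) by simp
  note s = section_onD(4)[OF U(2,1)]
  have "act (tor (- a x)) x = \<sigma> (\<mu> x)"
    using x act_minus_cancel[OF s, of "a x"] by simp
  then have "y = act (tor (c y)) (act (tor (- a x)) x)" using y by simp
  also have "\<dots> = act (tor (c y + - a x)) x" by (rule act_add[OF assms(1), symmetric])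
  finally show thesis by (rule that)
qed

lemma section_transition:
  assumes \<sigma>: "section_on V \<sigma>" and \<sigma>': "section_on V' \<sigma>'" and p: "p \<in> V" "p \<in> V'"
  obtains N a where "openin P N" "p \<in> N" "N \<subseteq> V \<inter> V'" "continuous_map (subtopology P N) euclidean a"
    "\<forall>y\<in>N. \<sigma>' y = act (tor (a y)) (\<sigma> y)"
proof -
  have "\<mu> (\<sigma>' p) \<in> V" using section_onD(3)[OF \<sigma>' p(2)] p(1) by simp
  then obtain M a where M: "openin E M" "\<sigma>' p \<in> M" "M \<subseteq> {x \<in> topspace E. \<mu> x \<in> V}"
    "continuous_map (subtopology E M) euclidean a" "\<forall>y\<in>M. y = act (tor (a y)) (\<sigma> (\<mu> y))"
    by (rule local_coordinate[OF \<sigma> section_onD(4)[OF \<sigma>' p(2)]])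
  have oV': "openin P V'" by (rule section_onD(1)[OF \<sigma>'])
  have topV': "topspace (subtopology P V') = V'" using openin_subset[OF oV'] by auto
  have "openin (subtopology P V') {y \<in> topspace (subtopology P V'). \<sigma>' y \<in> M}"
    by (rule openin_continuous_map_preimage[OF section_onD(2)[OF \<sigma>'] M(1)])
  then have "openin (subtopology P V') {y \<in> V'. \<sigma>' y \<in> M}" by (simp only: topV')
  then have oN: "openin P {y \<in> V'. \<sigma>' y \<in> M}" (is "openin P ?N")
    by (simp only: openin_open_subtopology[OF oV'])
  show thesis
  proof (rule that[OF oN])
    show "p \<in> ?N" using p M by simp
    show "?N \<subseteq> V \<inter> V'" using M(3) section_onD(3)[OF \<sigma>'] by auto
    have topN: "topspace (subtopology P ?N) = ?N" using openin_subset[OF oN] by auto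
    have "continuous_map (subtopology P ?N) (subtopology E M) \<sigma>'"
      unfolding continuous_map_in_subtopology
      using continuous_map_from_subtopology_mono[OF section_onD(2)[OF \<sigma>'], of ?N] topN by auto
    from continuous_map_compose[OF this M(4)]
    show "continuous_map (subtopology P ?N) euclidean (\<lambda>y. a (\<sigma>' y))" by (simp add: o_def)
    show "\<forall>y\<in>?N. \<sigma>' y = act (tor (a (\<sigma>' y))) (\<sigma> y)"
    proof
      fix y assume y: "y \<in> ?N"
      then have "\<mu> (\<sigma>' y) = y" using section_onD(3)[OF \<sigma>'] by simp
      moreover have "\<sigma>' y = act (tor (a (\<sigma>' y))) (\<sigma> (\<mu> (\<sigma>' y)))" using y M(5) by blast
      ultimately show "\<sigma>' y = act (tor (a (\<sigma>' y))) (\<sigma> y)" by simp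
    qed
  qed
qed

end

section \<open>Smoothing a principal torus bundle\<close>

lemma finite_subcover_indexed:
  assumes X: "compact_space X" and U: "\<And>x. x \<in> topspace X \<Longrightarrow> openin X (U x) \<and> x \<in> U x"
  obtains A where "finite A" "A \<subseteq> topspace X" "topspace X \<subseteq> (\<Union>a\<in>A. U a)"
proof -
  have "\<forall>V\<in>U ` topspace X. openin X V" using U by simp
  moreover have "topspace X \<subseteq> \<Union>(U ` topspace X)" using U by auto
  ultimately obtain \<F> where F: "finite \<F>" "\<F> \<subseteq> U ` topspace X" "topspace X \<subseteq> \<Union>\<F>"
    using X unfolding compact_space_alt by meson
  obtain A where "A \<subseteq> topspace X" "finite A" "\<F> = U ` A"
    using finite_subset_image[OF F(1,2)] by auto
  then show thesis using that[of A] F(3) by simp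
qed

lemma regular_neighbourhood:
  assumes "regular_space X" "openin X W" "x \<in> W"
  shows "\<exists>U V. openin X U \<and> closedin X V \<and> x \<in> U \<and> U \<subseteq> V \<and> V \<subseteq> W"
  using assms unfolding neighbourhood_base_of_closedin[symmetric] neighbourhood_base_of by simp

lemma (in corner_manifold) psmooth_continuous:
  assumes W: "openin P W" and f: "psmooth W f"
  shows "continuous_map (subtopology P W) euclidean f"
proof (rule continuous_map_local)
  fix x assume x: "x \<in> topspace (subtopology P W)"
  then have xP: "x \<in> topspace P" by simp
  then obtain U c where U: "smooth_corner_chart P \<A> (U, c)" "x \<in> U" "(U, c) \<in> \<A>"
    by (rule atlas_chart_at)
  note oU = smooth_chartD(1)[OF U(1)]
  let ?N = "U \<inter> W"
  have oN: "openin P ?N" using oU W by (rule openin_Int)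
  have topN: "topspace (subtopology P ?N) = ?N" using openin_subset[OF oN] by auto
  have "continuous_map (subtopology P ?N) (top_of_set (c ` ?N)) c"
    unfolding continuous_map_in_subtopology
    using continuous_map_from_subtopology_mono[OF smooth_chartD(6)[OF U(1)], of ?N] topN by auto
  moreover have "continuous_map (top_of_set (c ` ?N)) euclidean (\<lambda>q. f (the_inv_into U c q))"
    using smooth_on_imp_continuous_on[OF psmoothD[OF f U(1)]] by simp
  ultimately have "continuous_map (subtopology P ?N) euclidean ((\<lambda>q. f (the_inv_into U c q)) \<circ> c)"
    by (rule continuous_map_compose)
  then have "continuous_map (subtopology P ?N) euclidean f"
    by (rule continuous_map_eq) (use topN inv_chart[OF U(1)] in auto)
  then have "continuous_map (subtopology (subtopology P W) ?N) euclidean f"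
    by (simp add: subtopology_subtopology inf.absorb2 Int_commute)
  moreover have "openin (subtopology P W) ?N"
    using openin_subtopology_Int[OF oU, of W] .
  ultimately show "\<exists>U. openin (subtopology P W) U \<and> x \<in> U \<and> continuous_map (subtopology (subtopology P W) U) euclidean f"
    using U(2) x by (intro exI[of _ ?N]) simp
qed

locale compact_torus_bundle = corner_manifold P \<A> + torus_bundle P E act \<mu>
  for P :: "'p topology" and \<A> :: "('p, 'n::finite) corner_chart set"
    and E :: "'e topology" and act :: "(real ^ 'n) set \<Rightarrow> 'e \<Rightarrow> 'e" and \<mu> :: "'e \<Rightarrow> 'p" +
  assumes compact: "compact_space P"
begin

lemma regular: "regular_space P"
  using compact Hausdorff by (rule compact_Hausdorff_imp_regular_space)

definition lift_on :: "'p set \<Rightarrow> ('p \<Rightarrow> 'e) \<Rightarrow> ('p \<Rightarrow> 'e) \<Rightarrow> ('p \<Rightarrow> real ^ 'n) \<Rightarrow> bool" where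
  "lift_on N s t a \<longleftrightarrow> continuous_map (subtopology P N) euclidean a \<and> (\<forall>y\<in>N. t y = act (tor (a y)) (s y))"

lemma lift_on_subset: "lift_on N s t a \<Longrightarrow> M \<subseteq> N \<Longrightarrow> lift_on M s t a"
  unfolding lift_on_def using continuous_map_from_subtopology_mono by blast

text \<open>Transition functions have real lifts only near each point, but averaging needs, for each
  pair of overlapping sets, a lift over all of \<open>N x\<close>, not just over the overlap. A
  finite shrunken cover is chosen, and each \<open>N x\<close> is made so small that, for every one
  of the finitely many sections, it either misses the shrunken domain or carries a lift to that
  section.\<close>

lemma liftable_cover:
  obtains N s where "\<And>x. x \<in> topspace P \<Longrightarrow> openin P (N x) \<and> x \<in> N x \<and> section_on (N x) (s x)"
    "\<And>x y. x \<in> topspace P \<Longrightarrow> y \<in> topspace P \<Longrightarrow> N x \<inter> N y \<noteq> {} \<Longrightarrow> \<exists>a. lift_on (N x) (s x) (s y) a"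
proof -
  have "\<exists>W s W' C. section_on W s \<and> openin P W' \<and> closedin P C \<and> x \<in> W' \<and> W' \<subseteq> C \<and> C \<subseteq> W"
    if x: "x \<in> topspace P" for x
  proof -
    obtain W s \<tau> where W: "x \<in> W" "section_on W s"
      using x by (rule trivialization_section)
    from regular_neighbourhood[OF regular section_onD(1)[OF W(2)] W(1)]
    obtain W' C where "openin P W'" "closedin P C" "x \<in> W'" "W' \<subseteq> C" "C \<subseteq> W"
      by (elim exE conjE)
    with W(2) show ?thesis by (intro exI[of _ W] exI[of _ s] exI[of _ W'] exI[of _ C]) simp
  qed
  then have "\<forall>x\<in>topspace P. \<exists>D. section_on (fst D) (fst (snd D)) \<and> openin P (fst (snd (snd D))) \<and>
      closedin P (snd (snd (snd D))) \<and> x \<in> fst (snd (snd D)) \<and>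
      fst (snd (snd D)) \<subseteq> snd (snd (snd D)) \<and> snd (snd (snd D)) \<subseteq> fst D"
    by (simp add: split_paired_Ex)
  from bchoice[OF this] obtain D where D: "\<forall>x\<in>topspace P. section_on (fst (D x)) (fst (snd (D x))) \<and>
      openin P (fst (snd (snd (D x)))) \<and>
      closedin P (snd (snd (snd (D x)))) \<and> x \<in> fst (snd (snd (D x))) \<and>
      fst (snd (snd (D x))) \<subseteq> snd (snd (snd (D x))) \<and> snd (snd (snd (D x))) \<subseteq> fst (D x)" ..
  define W where "W x = fst (D x)" for x
  define t where "t x = fst (snd (D x))" for x
  define W' where "W' x = fst (snd (snd (D x)))" for x
  define C where "C x = snd (snd (snd (D x)))" for x
  have W: "section_on (W x) (t x)" "openin P (W' x)" "closedin P (C x)" "x \<in> W' x" "W' x \<subseteq> C x" "C x \<subseteq> W x"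
    if "x \<in> topspace P" for x
    using D that by (simp_all add: W_def t_def W'_def C_def)
  obtain A where A: "finite A" "A \<subseteq> topspace P" "topspace P \<subseteq> (\<Union>a\<in>A. W' a)"
    by (rule finite_subcover_indexed[OF compact, of W']) (use W(2,4) in auto)
  \<comment> \<open>The alternative refers to the shrunken set \<open>W' \<beta>\<close>: a point
    outside the closed set \<open>C \<beta>\<close> has a neighbourhood missing
    \<open>W' \<beta>\<close>, while a point of \<open>C \<beta>\<close> lies in
    \<open>W \<beta>\<close>, where a lift exists.\<close>
  define Q where "Q \<alpha> \<beta> N \<longleftrightarrow> N \<inter> W' \<beta> = {} \<or> (\<exists>a. lift_on N (t \<alpha>) (t \<beta>) a)" for \<alpha> \<beta> N
  have Q_mono: "Q \<alpha> \<beta> M" if "Q \<alpha> \<beta> N" "M \<subseteq> N" for \<alpha> \<beta> M N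
    using that(1) unfolding Q_def
  proof (elim disjE exE)
    fix a assume "lift_on N (t \<alpha>) (t \<beta>) a"
    then have "lift_on M (t \<alpha>) (t \<beta>) a" using that(2) by (rule lift_on_subset)
    then show "M \<inter> W' \<beta> = {} \<or> (\<exists>a. lift_on M (t \<alpha>) (t \<beta>) a)" by blast
  qed (use that(2) in blast)
  have "\<exists>N. \<exists>\<alpha>\<in>A. openin P N \<and> x \<in> N \<and> N \<subseteq> W' \<alpha> \<and> (\<forall>\<beta>\<in>A. Q \<alpha> \<beta> N)" if x: "x \<in> topspace P" for x
  proof -
    obtain \<alpha> where \<alpha>: "\<alpha> \<in> A" "x \<in> W' \<alpha>" using A(3) x by blast
    then have \<alpha>P: "\<alpha> \<in> topspace P" using A(2) by blast
    have xW: "x \<in> W \<alpha>" using W(5,6)[OF \<alpha>P] \<alpha>(2) by blast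
    have "\<exists>N. openin P N \<and> x \<in> N \<and> Q \<alpha> \<beta> N" if \<beta>: "\<beta> \<in> A" for \<beta>
    proof -
      have \<beta>P: "\<beta> \<in> topspace P" using \<beta> A(2) by blast
      show ?thesis
      proof (cases "x \<in> C \<beta>")
        case True
        then have x\<beta>: "x \<in> W \<beta>" using W(6)[OF \<beta>P] by blast
        obtain N a where N: "openin P N" "x \<in> N" "N \<subseteq> W \<alpha> \<inter> W \<beta>" "continuous_map (subtopology P N) euclidean a"
          "\<forall>y\<in>N. t \<beta> y = act (tor (a y)) (t \<alpha> y)"
          by (rule section_transition[OF W(1)[OF \<alpha>P] W(1)[OF \<beta>P] xW x\<beta>])
        then have "lift_on N (t \<alpha>) (t \<beta>) a" by (simp add: lift_on_def)
        then have "Q \<alpha> \<beta> N" unfolding Q_def by blast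
        with N show ?thesis by (intro exI[of _ N]) simp
      next
        case False
        have "Q \<alpha> \<beta> (topspace P - C \<beta>)" using W(5)[OF \<beta>P] by (auto simp: Q_def)
        moreover have "openin P (topspace P - C \<beta>)" using W(3)[OF \<beta>P] by (simp add: closedin_def)
        ultimately show ?thesis using x False by (intro exI[of _ "topspace P - C \<beta>"]) simp
      qed
    qed
    then have "\<forall>\<beta>\<in>A. \<exists>N. openin P N \<and> x \<in> N \<and> Q \<alpha> \<beta> N" by simp
    from bchoice[OF this] obtain M where M: "\<forall>\<beta>\<in>A. openin P (M \<beta>) \<and> x \<in> M \<beta> \<and> Q \<alpha> \<beta> (M \<beta>)" ..
    let ?N = "W' \<alpha> \<inter> \<Inter>(M ` A)"
    have "openin P (\<Inter>(M ` A))"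
      using A(1) \<alpha>(1) M by (intro openin_Inter) auto
    then have "openin P ?N" using W(2)[OF \<alpha>P] by (intro openin_Int)
    moreover have "x \<in> ?N" using \<alpha>(2) M by simp
    moreover have "Q \<alpha> \<beta> ?N" if "\<beta> \<in> A" for \<beta>
      by (rule Q_mono[of \<alpha> \<beta> "M \<beta>"]) (use M that in auto)
    ultimately show ?thesis
      using \<alpha>(1) by (intro exI[of _ ?N] bexI[of _ \<alpha>]) auto
  qed
  then have "\<forall>x\<in>topspace P. \<exists>N\<alpha>. snd N\<alpha> \<in> A \<and> openin P (fst N\<alpha>) \<and> x \<in> fst N\<alpha> \<and> fst N\<alpha> \<subseteq> W' (snd N\<alpha>) \<and>
      (\<forall>\<beta>\<in>A. Q (snd N\<alpha>) \<beta> (fst N\<alpha>))"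
    by (simp add: split_paired_Ex) blast
  from bchoice[OF this] obtain f where f: "\<forall>x\<in>topspace P. snd (f x) \<in> A \<and> openin P (fst (f x)) \<and>
      x \<in> fst (f x) \<and> fst (f x) \<subseteq> W' (snd (f x)) \<and> (\<forall>\<beta>\<in>A. Q (snd (f x)) \<beta> (fst (f x)))" ..
  define N where "N x = fst (f x)" for x
  define \<alpha> where "\<alpha> x = snd (f x)" for x
  have N: "\<alpha> x \<in> A" "openin P (N x)" "x \<in> N x" "N x \<subseteq> W' (\<alpha> x)" "\<And>\<beta>. \<beta> \<in> A \<Longrightarrow> Q (\<alpha> x) \<beta> (N x)"
    if "x \<in> topspace P" for x
    using f that by (simp_all add: N_def \<alpha>_def)
  show thesis
  proof (rule that[of N "\<lambda>x. t (\<alpha> x)"])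
    fix x assume x: "x \<in> topspace P"
    have \<alpha>P: "\<alpha> x \<in> topspace P" using N(1)[OF x] A(2) by blast
    have "N x \<subseteq> W (\<alpha> x)" using N(4)[OF x] W(5,6)[OF \<alpha>P] by blast
    then have "section_on (N x) (t (\<alpha> x))"
      by (rule section_on_subset[OF W(1)[OF \<alpha>P] N(2)[OF x]])
    then show "openin P (N x) \<and> x \<in> N x \<and> section_on (N x) (t (\<alpha> x))"
      using N(2,3)[OF x] by simp
    fix y assume y: "y \<in> topspace P" and ne: "N x \<inter> N y \<noteq> {}"
    have "N x \<inter> W' (\<alpha> y) \<noteq> {}" using ne N(4)[OF y] by blast
    then show "\<exists>a. lift_on (N x) (t (\<alpha> x)) (t (\<alpha> y)) a"
      using N(5)[OF x N(1)[OF y]] unfolding Q_def by simp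
  qed
qed

text \<open>Bump functions supported in the given sets are divided by their sum. Finitely many of
  them are taken such that at each point of the compact space one is positive.\<close>

lemma smooth_partition:
  assumes N: "\<And>x. x \<in> topspace P \<Longrightarrow> openin P (N x) \<and> x \<in> N x"
  obtains Q and \<rho> :: "'p \<Rightarrow> 'p \<Rightarrow> real" where "finite Q" "Q \<subseteq> topspace P"
    "\<forall>q\<in>Q. psmooth (topspace P) (\<rho> q)" "\<forall>q\<in>Q. \<forall>y. y \<notin> N q \<longrightarrow> \<rho> q y = 0"
    "\<forall>y\<in>topspace P. (\<Sum>q\<in>Q. \<rho> q y) = 1"
proof -
  have "\<exists>b :: 'p \<Rightarrow> real. psmooth (topspace P) b \<and> (\<forall>y. 0 \<le> b y) \<and> 0 < b x \<and> (\<forall>y. y \<notin> N x \<longrightarrow> b y = 0)"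
    if x: "x \<in> topspace P" for x
  proof -
    obtain b :: "'p \<Rightarrow> real" and C where "psmooth (topspace P) b" "\<forall>x. 0 \<le> b x" "0 < b x"
      "closedin P C" "C \<subseteq> N x" "\<forall>x. x \<notin> C \<longrightarrow> b x = 0"
      by (rule bump_function[of "N x" x]) (use N[OF x] in simp_all)
    then show ?thesis by (intro exI[of _ b]) auto
  qed
  then have "\<forall>x\<in>topspace P. \<exists>b :: 'p \<Rightarrow> real. psmooth (topspace P) b \<and> (\<forall>y. 0 \<le> b y) \<and> 0 < b x \<and>
      (\<forall>y. y \<notin> N x \<longrightarrow> b y = 0)" by simp
  from bchoice[OF this] obtain b :: "'p \<Rightarrow> 'p \<Rightarrow> real"
    where b: "\<forall>x\<in>topspace P. psmooth (topspace P) (b x) \<and> (\<forall>y. 0 \<le> b x y) \<and> 0 < b x x \<and>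
      (\<forall>y. y \<notin> N x \<longrightarrow> b x y = 0)" ..
  have "openin P {y \<in> topspace P. b x y \<in> {0<..}}" if "x \<in> topspace P" for x
    by (rule openin_continuous_map_preimage[of P euclidean])
      (use psmooth_continuous[OF openin_topspace] b that in auto)
  then obtain Q where Q: "finite Q" "Q \<subseteq> topspace P" "topspace P \<subseteq> (\<Union>q\<in>Q. {y \<in> topspace P. b q y \<in> {0<..}})"
    using finite_subcover_indexed[OF compact, of "\<lambda>x. {y \<in> topspace P. b x y \<in> {0<..}}"] b by auto
  have bQ: "psmooth (topspace P) (b q)" "0 \<le> b q y" "y \<notin> N q \<Longrightarrow> b q y = 0" if "q \<in> Q" for q y
    using b Q(2) that by auto
  define B where "B y = (\<Sum>q\<in>Q. b q y)" for y
  have Bpos: "0 < B y" if y: "y \<in> topspace P" for y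
  proof -
    obtain q where q: "q \<in> Q" "0 < b q y" using Q(3) y by auto
    show ?thesis unfolding B_def
      by (rule sum_pos2[OF Q(1), of q "\<lambda>q. b q y"]) (use bQ(2) q in simp_all)
  qed
  define \<rho> where "\<rho> q y = inverse (B y) *\<^sub>R b q y" for q y
  show thesis
  proof (rule that[OF Q(1,2)])
    have "psmooth (topspace P) B"
      unfolding B_def[abs_def] using bQ(1) by (rule psmooth_sum)
    then have iB: "psmooth (topspace P) (\<lambda>y. inverse (B y))"
      by (rule psmooth_inverse) (use Bpos in force)
    show "\<forall>q\<in>Q. psmooth (topspace P) (\<rho> q)"
      unfolding \<rho>_def[abs_def] using psmooth_scaleR[OF iB bQ(1)] by simp
    show "\<forall>q\<in>Q. \<forall>y. y \<notin> N q \<longrightarrow> \<rho> q y = 0" using bQ(3) by (simp add: \<rho>_def)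
    show "\<forall>y\<in>topspace P. (\<Sum>q\<in>Q. \<rho> q y) = 1"
    proof
      fix y assume "y \<in> topspace P"
      then have "B y \<noteq> 0" using Bpos[of y] by simp
      moreover have "(\<Sum>q\<in>Q. \<rho> q y) = inverse (B y) * B y"
        by (simp add: \<rho>_def B_def sum_distrib_left)
      ultimately show "(\<Sum>q\<in>Q. \<rho> q y) = 1" by simp
    qed
  qed
qed

text \<open>With transition lifts \<open>a q r\<close> and a smooth partition of unity \<open>\<rho>\<close>, the sections moved by
  \<open>\<Sum>r. \<rho> r (a q r)\<close> have transition lifts \<open>\<Sum>k. \<rho> k (a q r + a r k - a q k)\<close>, where the
  coefficients of the \<open>\<rho> k\<close> are integral, hence locally constant.\<close>

lemma smooth_sections:
  obtains \<S> :: "('p set \<times> ('p \<Rightarrow> 'e)) set" where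
    "\<forall>(N, \<sigma>)\<in>\<S>. section_on N \<sigma>" "\<forall>p\<in>topspace P. \<exists>(N, \<sigma>)\<in>\<S>. p \<in> N"
    "\<forall>(N, \<sigma>)\<in>\<S>. \<forall>(N', \<sigma>')\<in>\<S>. \<forall>p\<in>N \<inter> N'. \<exists>W u. openin P W \<and> p \<in> W \<and> W \<subseteq> N \<inter> N' \<and> psmooth W u \<and>
       (\<forall>y\<in>W. \<sigma>' y = act (tor (u y)) (\<sigma> y))"
proof -
  obtain N s where N: "\<And>x. x \<in> topspace P \<Longrightarrow> openin P (N x) \<and> x \<in> N x \<and> section_on (N x) (s x)"
    and lift: "\<And>x y. x \<in> topspace P \<Longrightarrow> y \<in> topspace P \<Longrightarrow> N x \<inter> N y \<noteq> {} \<Longrightarrow> \<exists>a. lift_on (N x) (s x) (s y) a"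
    by (rule liftable_cover) blast
  have N1: "openin P (N x) \<and> x \<in> N x" if "x \<in> topspace P" for x using N[OF that] by simp
  obtain Q and \<rho> :: "'p \<Rightarrow> 'p \<Rightarrow> real" where Q: "finite Q" "Q \<subseteq> topspace P"
    "\<forall>q\<in>Q. psmooth (topspace P) (\<rho> q)" "\<forall>q\<in>Q. \<forall>y. y \<notin> N q \<longrightarrow> \<rho> q y = 0"
    "\<forall>y\<in>topspace P. (\<Sum>q\<in>Q. \<rho> q y) = 1"
    using N1 by (rule smooth_partition)
  have sec: "section_on (N q) (s q)" if "q \<in> Q" for q using N Q(2) that by blast
  \<comment> \<open>For disjoint \<open>N q\<close> and \<open>N r\<close> this is an arbitrary
    function. It only occurs multiplied by \<open>\<rho> r\<close>, which vanishes on
    \<open>N q\<close> in that case.\<close>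
  define a where "a q r = (SOME a. lift_on (N q) (s q) (s r) a)" for q r
  have a: "lift_on (N q) (s q) (s r) (a q r)" if "q \<in> Q" "r \<in> Q" "N q \<inter> N r \<noteq> {}" for q r
    unfolding a_def using subsetD[OF Q(2) that(1)] subsetD[OF Q(2) that(2)] that(3)
    by (intro someI_ex[OF lift])
  have \<rho>0: "\<rho> r y = 0" if "q \<in> Q" "r \<in> Q" "N q \<inter> N r = {}" "y \<in> N q" for q r y
  proof -
    have "y \<notin> N r" using that(3,4) by blast
    then show ?thesis using Q(4) that(2) by simp
  qed
  define h where "h q y = (\<Sum>r\<in>Q. \<rho> r y *\<^sub>R a q r y)" for q y
  define \<sigma> where "\<sigma> q y = act (tor (h q y)) (s q y)" for q y
  have hc: "continuous_map (subtopology P (N q)) euclidean (h q)" if q: "q \<in> Q" for q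
  proof -
    have top: "topspace (subtopology P (N q)) = N q"
      using section_onD(5)[OF sec[OF q]] by auto
    have "continuous_map (subtopology P (N q)) euclidean (\<lambda>y. \<rho> r y *\<^sub>R a q r y)" if r: "r \<in> Q" for r
    proof (cases "N q \<inter> N r = {}")
      case True
      have "continuous_map (subtopology P (N q)) euclidean (\<lambda>y. 0 :: real ^ 'n)" by simp
      then show ?thesis
        by (rule continuous_map_eq) (use \<rho>0[OF q r True] top in auto)
    next
      case False
      have "continuous_map (subtopology P (topspace P)) euclidean (\<rho> r)"
        by (rule psmooth_continuous[OF openin_topspace]) (use Q(3) r in blast)
      then have "continuous_map (subtopology P (N q)) euclidean (\<rho> r)"
        by (simp add: continuous_map_from_subtopology)
      moreover have "continuous_map (subtopology P (N q)) euclidean (a q r)"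
        using a[OF q r False] by (simp add: lift_on_def)
      ultimately have "continuous_map (subtopology P (N q)) (prod_topology euclidean euclidean) (\<lambda>y. (\<rho> r y, a q r y))"
        by (simp only: continuous_map_paired)
      moreover have "continuous_map (prod_topology euclidean euclidean) euclidean (\<lambda>z. fst z *\<^sub>R snd z :: real ^ 'n)"
        by (simp add: continuous_intros)
      ultimately have "continuous_map (subtopology P (N q)) euclidean ((\<lambda>z. fst z *\<^sub>R snd z) \<circ> (\<lambda>y. (\<rho> r y, a q r y)))"
        by (rule continuous_map_compose)
      then show ?thesis by (simp add: o_def)
    qed
    then show ?thesis
      unfolding h_def[abs_def] by (intro continuous_map_sum Q(1))
  qed
  have sec\<sigma>: "section_on (N q) (\<sigma> q)" if q: "q \<in> Q" for q
    unfolding section_on_def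
  proof (intro conjI ballI)
    note sq = section_onD[OF sec[OF q]]
    show "openin P (N q)" by (rule sq(1))
    show "continuous_map (subtopology P (N q)) E (\<sigma> q)"
      unfolding \<sigma>_def[abs_def] by (rule continuous_act_tor[OF hc[OF q] sq(2)])
    show "\<mu> (\<sigma> q p) = p" if "p \<in> N q" for p
      using sq(3,4)[OF that] by (simp add: \<sigma>_def)
  qed
  have trans: "\<exists>W u. openin P W \<and> p \<in> W \<and> W \<subseteq> N q \<inter> N r \<and> psmooth W u \<and>
       (\<forall>y\<in>W. \<sigma> r y = act (tor (u y)) (\<sigma> q y))" if q: "q \<in> Q" and r: "r \<in> Q" and p: "p \<in> N q \<inter> N r" for q r p
  proof -
    let ?M = "N q \<inter> N r"
    have oM: "openin P ?M"
      using section_onD(1)[OF sec[OF q]] section_onD(1)[OF sec[OF r]] by (rule openin_Int)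
    have MP: "?M \<subseteq> topspace P" by (rule openin_subset[OF oM])
    have topM: "topspace (subtopology P ?M) = ?M" using MP by auto
    have qr: "N q \<inter> N r \<noteq> {}" using p by blast
    define n where "n k y = a q r y + a r k y - a q k y" for k y
    \<comment> \<open>The indices for which all three lifts in \<open>n k\<close> are genuine. For
      any other \<open>k\<close> the weight \<open>\<rho> k\<close> vanishes on the overlap
      \<open>?M\<close>.\<close>
    define K where "K = {k \<in> Q. N q \<inter> N k \<noteq> {} \<and> N r \<inter> N k \<noteq> {}}"
    have n_int: "n k y \<in> range vec_of_int" if k: "k \<in> K" and y: "y \<in> ?M" for k y
    proof -
      have kQ: "k \<in> Q" "N q \<inter> N k \<noteq> {}" "N r \<inter> N k \<noteq> {}" using k by (auto simp: K_def)
      have yE: "s q y \<in> topspace E" using section_onD(4)[OF sec[OF q]] y by blast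
      have 1: "s r y = act (tor (a q r y)) (s q y)" using a[OF q r qr] y by (simp add: lift_on_def)
      have 2: "s k y = act (tor (a r k y)) (s r y)" using a[OF r kQ(1,3)] y by (simp add: lift_on_def)
      have 3: "s k y = act (tor (a q k y)) (s q y)" using a[OF q kQ(1,2)] y by (simp add: lift_on_def)
      have "act (tor (a r k y + a q r y)) (s q y) = act (tor (a q k y)) (s q y)"
        using 1 2 3 act_add[OF yE, of "a r k y" "a q r y"] by simp
      then have "a r k y + a q r y - a q k y \<in> range vec_of_int"
        by (simp only: act_free_iff[OF yE])
      then show ?thesis by (simp add: n_def add.commute)
    qed
    have nc: "continuous_map (subtopology P ?M) euclidean (n k)" if k: "k \<in> K" for k
    proof -
      have kQ: "k \<in> Q" "N q \<inter> N k \<noteq> {}" "N r \<inter> N k \<noteq> {}" using k by (auto simp: K_def)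
      have "continuous_map (subtopology P ?M) euclidean (a q r)"
        using lift_on_subset[OF a[OF q r qr], of ?M] by (simp add: lift_on_def)
      moreover have "continuous_map (subtopology P ?M) euclidean (a r k)"
        using lift_on_subset[OF a[OF r kQ(1,3)], of ?M] by (simp add: lift_on_def)
      moreover have "continuous_map (subtopology P ?M) euclidean (a q k)"
        using lift_on_subset[OF a[OF q kQ(1,2)], of ?M] by (simp add: lift_on_def)
      ultimately show ?thesis
        unfolding n_def[abs_def] by (intro continuous_map_diff continuous_map_add)
    qed
    \<comment> \<open>Two lattice vectors at distance below 1 coincide, so on \<open>W\<close> each
      integral function \<open>n k\<close> equals its value at \<open>p\<close>.\<close>
    define W where "W = ?M \<inter> \<Inter>((\<lambda>k. {y \<in> ?M. n k y \<in> ball (n k p) 1}) ` K)"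
    have oWk: "openin P {y \<in> ?M. n k y \<in> ball (n k p) 1}" if k: "k \<in> K" for k
    proof -
      have "openin (subtopology P ?M) {y \<in> topspace (subtopology P ?M). n k y \<in> ball (n k p) 1}"
        by (rule openin_continuous_map_preimage[OF nc[OF k]]) simp
      then have "openin (subtopology P ?M) {y \<in> ?M. n k y \<in> ball (n k p) 1}"
        by (simp only: topM)
      then show ?thesis by (simp only: openin_open_subtopology[OF oM])
    qed
    have oW: "openin P W"
    proof (cases "K = {}")
      case True
      then show ?thesis using oM by (simp add: W_def)
    next
      case False
      have "finite K" using Q(1) by (simp add: K_def)
      then have "openin P (\<Inter>((\<lambda>k. {y \<in> ?M. n k y \<in> ball (n k p) 1}) ` K))"
        using False oWk by (intro openin_Inter) auto
      then show ?thesis unfolding W_def by (rule openin_Int[OF oM])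
    qed
    have n_const: "n k y = n k p" if k: "k \<in> K" and y: "y \<in> W" for k y
    proof -
      have yM: "y \<in> ?M" "dist (n k p) (n k y) < 1" using y k by (auto simp: W_def)
      obtain m l where ml: "n k y = vec_of_int m" "n k p = vec_of_int l"
        using n_int[OF k yM(1)] n_int[OF k p] by auto
      then have "norm (vec_of_int (l - m)) < 1"
        using yM(2) by (simp add: dist_norm vec_of_int_simps)
      then have "l - m = 0" by (rule norm_int_vec_less_1)
      then show ?thesis using ml by simp
    qed
    define u where "u y = (\<Sum>k\<in>K. \<rho> k y *\<^sub>R n k p)" for y
    have WM: "W \<subseteq> ?M" by (auto simp: W_def)
    have "psmooth W u"
      unfolding u_def[abs_def]
    proof (intro psmooth_sum psmooth_scaleR psmooth_const)
      fix k assume "k \<in> K"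
      then have "psmooth (topspace P) (\<rho> k)" using Q(3) by (simp add: K_def)
      then show "psmooth W (\<rho> k)" by (rule psmooth_subset) (use WM MP in blast)
    qed
    moreover have "\<sigma> r y = act (tor (u y)) (\<sigma> q y)" if y: "y \<in> W" for y
    proof -
      have yM: "y \<in> N q" "y \<in> N r" using y WM by auto
      have yP: "y \<in> topspace P" using yM MP by blast
      have yE: "s q y \<in> topspace E" using section_onD(4)[OF sec[OF q] yM(1)] .
      have "u y = (\<Sum>k\<in>K. \<rho> k y *\<^sub>R n k y)"
        unfolding u_def using n_const y by (intro sum.cong) simp_all
      also have "\<dots> = (\<Sum>k\<in>Q. \<rho> k y *\<^sub>R n k y)"
      proof (rule sum.mono_neutral_left[OF Q(1)])
        show "\<forall>i\<in>Q - K. \<rho> i y *\<^sub>R n i y = 0"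
        proof
          fix k assume k: "k \<in> Q - K"
          then have "N q \<inter> N k = {} \<or> N r \<inter> N k = {}" by (auto simp: K_def)
          then have "\<rho> k y = 0" using \<rho>0[of q k y] \<rho>0[of r k y] q r k yM by auto
          then show "\<rho> k y *\<^sub>R n k y = 0" by simp
        qed
      qed (simp add: K_def)
      also have "\<dots> = (\<Sum>k\<in>Q. \<rho> k y *\<^sub>R a q r y) + (\<Sum>k\<in>Q. \<rho> k y *\<^sub>R a r k y) - (\<Sum>k\<in>Q. \<rho> k y *\<^sub>R a q k y)"
        by (simp add: n_def scaleR_diff_right scaleR_add_right sum.distrib sum_subtractf)
      also have "(\<Sum>k\<in>Q. \<rho> k y *\<^sub>R a q r y) = a q r y"
        using Q(5) yP by (simp flip: scaleR_left.sum)
      finally have u: "u y = a q r y + h r y - h q y" by (simp add: h_def)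
      have "\<sigma> r y = act (tor (h r y)) (act (tor (a q r y)) (s q y))"
        using a[OF q r qr] yM by (simp add: \<sigma>_def lift_on_def)
      also have "\<dots> = act (tor (h r y + a q r y)) (s q y)"
        by (rule act_add[OF yE, symmetric])
      also have "h r y + a q r y = u y + h q y" by (simp add: u)
      also have "act (tor (u y + h q y)) (s q y) = act (tor (u y)) (\<sigma> q y)"
        unfolding \<sigma>_def by (rule act_add[OF yE])
      finally show ?thesis .
    qed
    moreover have "p \<in> W" using p by (auto simp: W_def)
    ultimately show ?thesis
      using oW WM by (intro exI[of _ W] exI[of _ u]) simp
  qed
  show thesis
  proof (rule that[of "(\<lambda>q. (N q, \<sigma> q)) ` Q"])
    show "\<forall>(N, \<sigma>)\<in>(\<lambda>q. (N q, \<sigma> q)) ` Q. section_on N \<sigma>" using sec\<sigma> by simp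
    show "\<forall>p\<in>topspace P. \<exists>(N, \<sigma>)\<in>(\<lambda>q. (N q, \<sigma> q)) ` Q. p \<in> N"
    proof
      fix p assume p: "p \<in> topspace P"
      have "\<exists>q\<in>Q. \<rho> q p \<noteq> 0"
      proof (rule ccontr)
        assume "\<not> (\<exists>q\<in>Q. \<rho> q p \<noteq> 0)"
        then have "(\<Sum>q\<in>Q. \<rho> q p) = 0" by simp
        then show False using Q(5) p by simp
      qed
      then obtain q where "q \<in> Q" "p \<in> N q" using Q(4) by blast
      then show "\<exists>(N, \<sigma>)\<in>(\<lambda>q. (N q, \<sigma> q)) ` Q. p \<in> N" by auto
    qed
    show "\<forall>(M, \<tau>)\<in>(\<lambda>q. (N q, \<sigma> q)) ` Q. \<forall>(M', \<tau>')\<in>(\<lambda>q. (N q, \<sigma> q)) ` Q. \<forall>p\<in>M \<inter> M'.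
       \<exists>W u. openin P W \<and> p \<in> W \<and> W \<subseteq> M \<inter> M' \<and> psmooth W u \<and> (\<forall>y\<in>W. \<tau>' y = act (tor (u y)) (\<tau> y))"
      using trans by simp
  qed
qed

end

section \<open>Collapsing subtori of a torus bundle\<close>

lemma group_actionI:
  assumes G: "group G"
    and closed: "\<And>g x. g \<in> carrier G \<Longrightarrow> x \<in> S \<Longrightarrow> f g x \<in> S"
    and mult: "\<And>g h x. g \<in> carrier G \<Longrightarrow> h \<in> carrier G \<Longrightarrow> x \<in> S \<Longrightarrow> f (g \<otimes>\<^bsub>G\<^esub> h) x = f g (f h x)"
    and one: "\<And>x. x \<in> S \<Longrightarrow> f \<one>\<^bsub>G\<^esub> x = x"
  shows "group_action G S (\<lambda>g. restrict (f g) S)"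
proof -
  have inv: "f (inv\<^bsub>G\<^esub> g) (f g x) = x" "f g (f (inv\<^bsub>G\<^esub> g) x) = x" if g: "g \<in> carrier G" "x \<in> S" for g x
    using mult[OF group.inv_closed[OF G g(1)] g(1,2)] mult[OF g(1) group.inv_closed[OF G g(1)] g(2)]
      one[OF g(2)] group.l_inv[OF G g(1)] group.r_inv[OF G g(1)] by simp_all
  have bij: "restrict (f g) S \<in> Bij S" if g: "g \<in> carrier G" for g
  proof -
    have "bij_betw (f g) S S"
      by (rule bij_betw_byWitness[where f' = "f (inv\<^bsub>G\<^esub> g)"])
        (use inv g closed group.inv_closed[OF G g] in auto)
    then have "bij_betw (restrict (f g) S) S S"
      by (rule bij_betw_cong[THEN iffD1, rotated]) simp
    then show ?thesis by (simp add: Bij_def)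
  qed
  have "restrict (f (g \<otimes>\<^bsub>G\<^esub> h)) S = restrict (f g) S \<otimes>\<^bsub>BijGroup S\<^esub> restrict (f h) S"
    if g: "g \<in> carrier G" and h: "h \<in> carrier G" for g h
  proof -
    have "restrict (f g) S \<otimes>\<^bsub>BijGroup S\<^esub> restrict (f h) S = compose S (restrict (f g) S) (restrict (f h) S)"
      using bij[OF g] bij[OF h] by (simp add: BijGroup_def)
    also have "\<dots> = restrict (f (g \<otimes>\<^bsub>G\<^esub> h)) S"
      using mult[OF g h] closed[OF h] by (auto simp: compose_def fun_eq_iff restrict_def)
    finally show ?thesis ..
  qed
  then have "(\<lambda>g. restrict (f g) S) \<in> hom G (BijGroup S)"
    unfolding hom_def using bij by (auto simp: BijGroup_def)
  then show ?thesis
    unfolding group_action_def group_hom_def group_hom_axioms_def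
    using G group_BijGroup by blast
qed

text \<open>The collapse is formulated for a general family of subspaces: \<open>S p\<close> is the
  Lie algebra of the subgroup collapsed over \<open>p\<close>. The action, the orbit map,
  connectedness and compactness are treated at this level; how \<open>S\<close> varies with
  \<open>p\<close> is seen only by the charts.\<close>

locale torus_quotient = torus_bundle P E act \<mu>
  for P :: "'p topology" and E :: "'e topology"
    and act :: "(real ^ 'n::finite) set \<Rightarrow> 'e \<Rightarrow> 'e" and \<mu> :: "'e \<Rightarrow> 'p" +
  fixes S :: "'p \<Rightarrow> (real ^ 'n) set"
  assumes subspace_S: "p \<in> topspace P \<Longrightarrow> subspace (S p)"
begin

definition cls :: "'e \<Rightarrow> 'e set" where
  "cls x = (\<lambda>v. act (tor v) x) ` S (\<mu> x)"

definition X :: "'e set topology" where "X = quotient_topology E cls"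

definition Xact :: "(real ^ 'n) set \<Rightarrow> 'e set \<Rightarrow> 'e set" where
  "Xact t = (\<lambda>C\<in>topspace X. act t ` C)"

definition \<pi> :: "'e set \<Rightarrow> 'p" where "\<pi> C = \<mu> (SOME x. x \<in> C)"

lemma topspace_X: "topspace X = cls ` topspace E"
  by (simp add: X_def topspace_quotient_topology)

lemma quotient_map_cls: "quotient_map E X cls"
  unfolding X_def by (rule quotient_map_quotient_topology)

lemma subspace_S_at: "x \<in> topspace E \<Longrightarrow> subspace (S (\<mu> x))"
  by (rule subspace_S[OF \<mu>_closed])

lemma in_cls: "x \<in> topspace E \<Longrightarrow> x \<in> cls x"
  unfolding cls_def using subspace_0[OF subspace_S_at] by (intro image_eqI[of _ _ 0]) simp_all

lemma cls_eq_iff: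
  assumes x: "x \<in> topspace E" and y: "y \<in> topspace E"
  shows "cls x = cls y \<longleftrightarrow> (\<exists>v\<in>S (\<mu> x). y = act (tor v) x)"
proof
  assume "cls x = cls y"
  then have "y \<in> cls x" using in_cls[OF y] by simp
  then show "\<exists>v\<in>S (\<mu> x). y = act (tor v) x" by (auto simp: cls_def)
next
  assume "\<exists>v\<in>S (\<mu> x). y = act (tor v) x"
  then obtain v where v: "v \<in> S (\<mu> x)" "y = act (tor v) x" ..
  note s = subspace_S_at[OF x]
  have \<mu>: "\<mu> y = \<mu> x" using v(2) x by simp
  have "cls y = (\<lambda>w. act (tor (w + v)) x) ` S (\<mu> x)"
    unfolding cls_def \<mu> using v(2) act_add[OF x] by simp
  also have "\<dots> = cls x"
    unfolding cls_def
  proof (intro equalityI subsetI)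
    fix z assume "z \<in> (\<lambda>w. act (tor (w + v)) x) ` S (\<mu> x)"
    then show "z \<in> (\<lambda>w. act (tor w) x) ` S (\<mu> x)" using subspace_add[OF s _ v(1)] by blast
  next
    fix z assume "z \<in> (\<lambda>w. act (tor w) x) ` S (\<mu> x)"
    then obtain w where w: "w \<in> S (\<mu> x)" "z = act (tor w) x" by blast
    then show "z \<in> (\<lambda>w. act (tor (w + v)) x) ` S (\<mu> x)"
      using subspace_diff[OF s w(1) v(1)] by (intro image_eqI[of _ _ "w - v"]) simp_all
  qed
  finally show "cls x = cls y" ..
qed

lemma \<pi>_cls: "x \<in> topspace E \<Longrightarrow> \<pi> (cls x) = \<mu> x"
proof -
  assume x: "x \<in> topspace E"
  have "(SOME y. y \<in> cls x) \<in> cls x" by (rule someI[of _ x]) (rule in_cls[OF x])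
  then show ?thesis unfolding \<pi>_def using x by (auto simp: cls_def)
qed

lemma Xact_cls: "x \<in> topspace E \<Longrightarrow> Xact (tor v) (cls x) = cls (act (tor v) x)"
proof -
  assume x: "x \<in> topspace E"
  have "act (tor v) (act (tor w) x) = act (tor w) (act (tor v) x)" for w
    by (simp add: x add.commute flip: act_add)
  then have "act (tor v) ` cls x = cls (act (tor v) x)"
    using x by (simp add: cls_def image_image)
  then show ?thesis using x by (simp add: Xact_def topspace_X)
qed

section \<open>The induced action, the orbit map, connectedness and compactness\<close>

lemma group_action_X: "group_action (torus UNIV) (topspace X) Xact"
proof -
  have Xact_eq: "Xact = (\<lambda>t. restrict (\<lambda>C. act t ` C) (topspace X))"
    by (simp add: Xact_def fun_eq_iff)
  have img: "act (tor v) ` cls x = cls (act (tor v) x)" if "x \<in> topspace E" for v x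
    using Xact_cls[OF that, of v] that by (simp add: Xact_def topspace_X)
  show ?thesis
    unfolding Xact_eq
  proof (rule group_actionI[OF group_torus[OF submodule_of_ints_UNIV]])
    show "act t ` C \<in> topspace X" if "t \<in> carrier (torus UNIV)" "C \<in> topspace X" for t C
      using that by (auto simp: carrier_torus_UNIV topspace_X img)
    show "act (s \<otimes>\<^bsub>torus UNIV\<^esub> t) ` C = act s ` act t ` C"
      if stC: "s \<in> carrier (torus UNIV)" "t \<in> carrier (torus UNIV)" "C \<in> topspace X" for s t C
    proof -
      obtain v w x where vw: "s = tor v" "t = tor w" and x: "x \<in> topspace E" "C = cls x"
        using stC[unfolded carrier_torus_UNIV topspace_X] by (elim imageE)
      have "act s ` act t ` C = cls (act (tor v) (act (tor w) x))"
        unfolding vw x(2) img[OF x(1)] by (rule img[OF act_closed[OF x(1)]])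
      also have "\<dots> = cls (act (tor (v + w)) x)" by (simp only: act_add[OF x(1)])
      also have "\<dots> = act (s \<otimes>\<^bsub>torus UNIV\<^esub> t) ` C" by (simp only: vw tor_mult x(2) img[OF x(1)])
      finally show ?thesis by simp
    qed
    show "act \<one>\<^bsub>torus UNIV\<^esub> ` C = C" if C: "C \<in> topspace X" for C
    proof -
      obtain x where x: "x \<in> topspace E" "C = cls x"
        using C[unfolded topspace_X] by (elim imageE)
      show ?thesis unfolding x(2) torus_one img[OF x(1)] using x(1) by simp
    qed
  qed
qed

lemma faithful_action_X:
  assumes p: "p \<in> topspace P" "S p = {0}"
  shows "faithful_action (torus UNIV) (topspace X) Xact"
proof -
  obtain U \<sigma> \<tau> where U: "p \<in> U" "section_on U \<sigma>"
    using p(1) by (rule trivialization_section)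
  let ?x = "\<sigma> p"
  have x: "?x \<in> topspace E" "\<mu> ?x = p" using section_onD(3,4)[OF U(2,1)] by auto
  have "inj_on Xact (carrier (torus UNIV))"
  proof (rule inj_onI)
    fix s t assume "s \<in> carrier (torus UNIV)" "t \<in> carrier (torus UNIV)" and eq: "Xact s = Xact t"
    then obtain v w where vw: "s = tor v" "t = tor w" by (auto simp: carrier_torus_UNIV)
    have "cls (act (tor v) ?x) = cls (act (tor w) ?x)"
      using Xact_cls[OF x(1)] eq vw by metis
    then have "act (tor w) ?x = act (tor v) ?x"
      using cls_eq_iff[of "act (tor v) ?x" "act (tor w) ?x"] x p(2) by simp
    from act_free[OF x(1) this] show "s = t" using vw by simp
  qed
  then show ?thesis
    using group_action_X by (simp add: faithful_action_def faithful_action_axioms_def)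
qed

text \<open>The torus is compact Hausdorff, hence locally compact, so its product with the quotient
  map \<open>cls\<close> is again a quotient map and continuity can be tested on the bundle.\<close>

lemma continuous_Xact: "continuous_map (prod_topology (torus_topology UNIV) X) X (\<lambda>(t, x). Xact t x)"
proof -
  let ?T = "torus_topology (UNIV :: (int ^ 'n) set)"
  have q: "quotient_map (prod_topology ?T E) (prod_topology ?T X) (\<lambda>(t, x). (t, cls x))"
  proof (rule quotient_map_prod_right[OF _ _ quotient_map_cls])
    show "locally_compact_space ?T"
      by (rule compact_imp_locally_compact_space[OF compact_space_torus_topology_UNIV])
    show "Hausdorff_space ?T \<or> regular_space ?T"
      using Hausdorff_space_torus_topology_UNIV by blast
  qed
  have "continuous_map (prod_topology ?T E) X (cls \<circ> (\<lambda>(t, x). act t x))"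
    by (rule continuous_map_compose[OF continuous_act quotient_imp_continuous_map[OF quotient_map_cls]])
  then have "continuous_map (prod_topology ?T E) X ((\<lambda>(t, x). Xact t x) \<circ> (\<lambda>(t, x). (t, cls x)))"
    by (rule continuous_map_eq) (auto simp: topspace_torus_topology carrier_torus_UNIV Xact_cls)
  then show ?thesis by (rule continuous_compose_quotient_map[OF q])
qed

text \<open>Local sections are the reason: the part of \<open>V\<close> over the domain of a section
  is the preimage under the section of an open subset of \<open>E\<close>.\<close>

lemma quotient_map_\<mu>: "quotient_map E P \<mu>"
  unfolding quotient_map_def
proof (intro conjI allI impI)
  have "p \<in> \<mu> ` topspace E" if p: "p \<in> topspace P" for p
  proof -
    obtain U \<sigma> \<tau> where U: "p \<in> U" "section_on U \<sigma>"
      using p by (rule trivialization_section)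
    then show ?thesis using section_onD(3,4)[OF U(2,1)] by (intro image_eqI[of _ _ "\<sigma> p"]) simp_all
  qed
  then show "\<mu> ` topspace E = topspace P" using \<mu>_closed by blast
  fix V assume V: "V \<subseteq> topspace P"
  show "openin E {x \<in> topspace E. \<mu> x \<in> V} = openin P V"
  proof
    assume o: "openin E {x \<in> topspace E. \<mu> x \<in> V}"
    show "openin P V"
      unfolding openin_subopen[of P V]
    proof
      fix p assume p: "p \<in> V"
      then have "p \<in> topspace P" using V by blast
      then obtain U \<sigma> \<tau> where U: "p \<in> U" "section_on U \<sigma>"
        by (rule trivialization_section)
      note s = section_onD[OF U(2)]
      have topU: "topspace (subtopology P U) = U" using s(5) by auto
      have "openin (subtopology P U) {u \<in> topspace (subtopology P U). \<sigma> u \<in> {x \<in> topspace E. \<mu> x \<in> V}}"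
        by (rule openin_continuous_map_preimage[OF s(2) o])
      moreover have "{u \<in> topspace (subtopology P U). \<sigma> u \<in> {x \<in> topspace E. \<mu> x \<in> V}} = U \<inter> V"
        unfolding topU using s(3,4) by auto
      ultimately have "openin P (U \<inter> V)"
        by (simp add: openin_open_subtopology[OF s(1)])
      then show "\<exists>T. openin P T \<and> p \<in> T \<and> T \<subseteq> V" using p U(1) by (intro exI[of _ "U \<inter> V"]) simp
    qed
  qed (rule openin_continuous_map_preimage[OF continuous_\<mu>])
qed

lemma continuous_\<pi>: "continuous_map X P \<pi>"
proof (rule continuous_compose_quotient_map[OF quotient_map_cls])
  show "continuous_map E P (\<pi> \<circ> cls)"
    by (rule continuous_map_eq[OF continuous_\<mu>]) (simp add: \<pi>_cls)
qed

lemma quotient_map_\<pi>: "quotient_map X P \<pi>"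
proof (rule quotient_map_from_composition[OF quotient_imp_continuous_map[OF quotient_map_cls] continuous_\<pi>])
  show "quotient_map E P (\<pi> \<circ> cls)"
    by (rule quotient_map_eq[OF quotient_map_\<mu>]) (simp add: \<pi>_cls)
qed

lemma orbit_map_\<pi>: "orbit_map X Xact P \<pi>"
  unfolding orbit_map_def
proof (intro conjI ballI quotient_map_\<pi>)
  fix C D assume "C \<in> topspace X" "D \<in> topspace X"
  then obtain x y where x: "x \<in> topspace E" "C = cls x" and y: "y \<in> topspace E" "D = cls y"
    by (auto simp: topspace_X)
  have orb: "orbit (torus UNIV) Xact (cls z) = (\<lambda>v. cls (act (tor v) z)) ` UNIV" if "z \<in> topspace E" for z
  proof -
    have "orbit (torus UNIV) Xact (cls z) = (\<lambda>t. Xact t (cls z)) ` carrier (torus UNIV)"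
      by (auto simp: orbit_def)
    also have "\<dots> = (\<lambda>v. Xact (tor v) (cls z)) ` UNIV"
      by (simp add: carrier_torus_UNIV image_image)
    finally show ?thesis by (simp only: Xact_cls[OF that])
  qed
  show "\<pi> C = \<pi> D \<longleftrightarrow> orbit (torus UNIV) Xact C = orbit (torus UNIV) Xact D"
  proof
    assume "\<pi> C = \<pi> D"
    then have "\<mu> x = \<mu> y" using x y by (simp add: \<pi>_cls)
    then obtain v where v: "y = act (tor v) x" by (rule act_transitive[OF x(1) y(1)])
    have "(\<lambda>w. cls (act (tor w) y)) ` UNIV = (\<lambda>w. cls (act (tor w) x)) ` UNIV"
    proof (intro equalityI subsetI)
      fix z assume "z \<in> (\<lambda>w. cls (act (tor w) y)) ` UNIV"
      then obtain w where "z = cls (act (tor w) y)" by blast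
      then have "z = cls (act (tor (w + v)) x)" using v act_add[OF x(1)] by simp
      then show "z \<in> (\<lambda>w. cls (act (tor w) x)) ` UNIV" by blast
    next
      fix z assume "z \<in> (\<lambda>w. cls (act (tor w) x)) ` UNIV"
      then obtain w where "z = cls (act (tor w) x)" by blast
      then have "z = cls (act (tor (w - v)) y)" using v act_add[OF x(1), of "w - v" v] by simp
      then show "z \<in> (\<lambda>w. cls (act (tor w) y)) ` UNIV" by blast
    qed
    then show "orbit (torus UNIV) Xact C = orbit (torus UNIV) Xact D"
      using orb x y by simp
  next
    assume eq: "orbit (torus UNIV) Xact C = orbit (torus UNIV) Xact D"
    have "cls (act (tor 0) y) \<in> orbit (torus UNIV) Xact D"
      unfolding y(2) orb[OF y(1)] by blast
    then obtain v where "cls (act (tor 0) y) = cls (act (tor v) x)"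
      unfolding eq[symmetric] x(2) orb[OF x(1)] by blast
    then have "\<pi> (cls y) = \<pi> (cls (act (tor v) x))" using y(1) by simp
    then show "\<pi> C = \<pi> D" using x y by (simp add: \<pi>_cls)
  qed
qed

text \<open>A quotient map with connected fibres onto a connected space; the fibres are orbits, that
  is, continuous images of the real vector space.\<close>

lemma connected_space_X:
  assumes "connected_space P"
  shows "connected_space X"
proof (rule connected_space_monotone_quotient_map_preimage[OF _ quotient_map_\<pi> assms])
  show "monotone_map X P \<pi>"
    unfolding monotone_map_def
  proof (intro conjI ballI)
    show "\<pi> ` topspace X \<subseteq> topspace P" by (rule continuous_map_image_subset_topspace[OF continuous_\<pi>])
    fix p assume p: "p \<in> topspace P"
    obtain U \<sigma> \<tau> where U: "p \<in> U" "section_on U \<sigma>"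
      using p by (rule trivialization_section)
    let ?x = "\<sigma> p"
    have x: "?x \<in> topspace E" "\<mu> ?x = p" using section_onD(3,4)[OF U(2,1)] by auto
    have "continuous_map euclidean E (\<lambda>v. act (tor v) ?x)"
      by (rule continuous_act_tor) (simp_all add: x)
    from continuous_map_compose[OF this quotient_imp_continuous_map[OF quotient_map_cls]]
    have "continuous_map euclidean X (\<lambda>v. cls (act (tor v) ?x))" by (simp add: o_def)
    from connectedin_continuous_map_image[OF this, of UNIV]
    have "connectedin X (range (\<lambda>v. cls (act (tor v) ?x)))" by (simp add: connected_UNIV)
    moreover have "range (\<lambda>v. cls (act (tor v) ?x)) = {C \<in> topspace X. \<pi> C = p}"
    proof (intro equalityI subsetI)
      fix C assume "C \<in> range (\<lambda>v. cls (act (tor v) ?x))"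
      then show "C \<in> {C \<in> topspace X. \<pi> C = p}" using x by (auto simp: topspace_X \<pi>_cls)
    next
      fix C assume "C \<in> {C \<in> topspace X. \<pi> C = p}"
      then obtain y where y: "y \<in> topspace E" "C = cls y" "\<mu> y = p" by (auto simp: topspace_X \<pi>_cls)
      have "\<mu> ?x = \<mu> y" using x y by simp
      then obtain v where "y = act (tor v) ?x" by (rule act_transitive[OF x(1) y(1)])
      then show "C \<in> range (\<lambda>v. cls (act (tor v) ?x))" using y by blast
    qed
    ultimately show "connectedin X {C \<in> topspace X. \<pi> C = p}" by simp
  qed
qed

text \<open>\<open>E\<close> itself is compact. Over a closed set \<open>C\<close> in the domain of
  a section it is covered by the image of \<open>C\<close> times a cube, since angles may be reduced
  to fractional parts, and finitely many such pieces suffice by compactness of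
  \<open>P\<close>.\<close>

lemma compact_space_X:
  assumes P: "compact_space P" "regular_space P"
  shows "compact_space X"
proof -
  have "\<exists>U K. openin P U \<and> p \<in> U \<and> compactin E K \<and> (\<forall>x\<in>topspace E. \<mu> x \<in> U \<longrightarrow> x \<in> K)" if p: "p \<in> topspace P" for p
  proof -
    obtain V \<sigma> \<tau> where V: "p \<in> V" "section_on V \<sigma>"
      using p by (rule trivialization_section)
    note s = section_onD[OF V(2)]
    have "\<exists>U C. openin P U \<and> closedin P C \<and> p \<in> U \<and> U \<subseteq> C \<and> C \<subseteq> V"
      using P(2) s(1) V(1) unfolding neighbourhood_base_of_closedin[symmetric] neighbourhood_base_of by simp
    then obtain U C where U: "openin P U" "closedin P C" "p \<in> U" "U \<subseteq> C" "C \<subseteq> V" by (elim exE conjE)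
    let ?B = "cbox 0 1 :: (real ^ 'n) set"
    let ?f = "\<lambda>(q, v). act (tor v) (\<sigma> q)"
    have "compactin P C" using P(1) U(2) by (rule closedin_compact_space)
    then have "compactin (subtopology P V) C" using U(5) by (simp add: compactin_subtopology)
    then have cc: "compactin (prod_topology (subtopology P V) euclidean) (C \<times> ?B)"
      by (simp add: compactin_Times)
    have "continuous_map (prod_topology (subtopology P V) euclidean) E (\<lambda>z. act (tor (snd z)) (\<sigma> (fst z)))"
      using continuous_map_compose[OF continuous_map_fst s(2)]
      by (intro continuous_act_tor continuous_map_snd) (simp add: o_def)
    then have cf: "continuous_map (prod_topology (subtopology P V) euclidean) E ?f"
      by (simp add: split_def)
    have "compactin E (?f ` (C \<times> ?B))" by (rule image_compactin[OF cc cf])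
    moreover have "x \<in> ?f ` (C \<times> ?B)" if x: "x \<in> topspace E" "\<mu> x \<in> U" for x
    proof -
      have xC: "\<mu> x \<in> C" "\<mu> x \<in> V" using U x by auto
      note sx = s(3,4)[OF xC(2)]
      have "\<mu> (\<sigma> (\<mu> x)) = \<mu> x" using sx by simp
      then obtain v where v: "x = act (tor v) (\<sigma> (\<mu> x))" by (rule act_transitive[OF sx(2) x(1)])
      let ?w = "\<chi> i. frac (v $ i)"
      have "tor v = tor ?w"
        unfolding tor_eq_iff in_range_vec_of_int_iff by (simp add: frac_def)
      then have "x = ?f (\<mu> x, ?w)" using v by simp
      moreover have "(\<mu> x, ?w) \<in> C \<times> ?B"
        using xC by (simp add: mem_box_cart frac_ge_0 frac_lt_1 less_imp_le)
      ultimately show ?thesis by (rule image_eqI)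
    qed
    ultimately show ?thesis using U by (intro exI[of _ U] exI[of _ "?f ` (C \<times> ?B)"]) simp
  qed
  then have "\<forall>p\<in>topspace P. \<exists>UK. openin P (fst UK) \<and> p \<in> fst UK \<and> compactin E (snd UK) \<and>
      (\<forall>x\<in>topspace E. \<mu> x \<in> fst UK \<longrightarrow> x \<in> snd UK)"
    by (simp add: split_paired_Ex)
  from bchoice[OF this] obtain UK where UK: "\<forall>p\<in>topspace P. openin P (fst (UK p)) \<and> p \<in> fst (UK p) \<and>
      compactin E (snd (UK p)) \<and> (\<forall>x\<in>topspace E. \<mu> x \<in> fst (UK p) \<longrightarrow> x \<in> snd (UK p))" ..
  have "\<forall>V\<in>(\<lambda>p. fst (UK p)) ` topspace P. openin P V" using UK by simp
  moreover have "topspace P \<subseteq> \<Union>((\<lambda>p. fst (UK p)) ` topspace P)" using UK by auto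
  ultimately obtain \<F> where F: "finite \<F>" "\<F> \<subseteq> (\<lambda>p. fst (UK p)) ` topspace P" "topspace P \<subseteq> \<Union>\<F>"
    using P(1) unfolding compact_space_alt by meson
  obtain A where A: "A \<subseteq> topspace P" "finite A" "\<F> = (\<lambda>p. fst (UK p)) ` A"
    using finite_subset_image[OF F(1,2)] by auto
  have "compactin E (\<Union>((\<lambda>p. snd (UK p)) ` A))"
    using A(1,2) UK by (intro compactin_Union) auto
  moreover have "topspace E \<subseteq> \<Union>((\<lambda>p. snd (UK p)) ` A)"
  proof
    fix x assume x: "x \<in> topspace E"
    then obtain p where p: "p \<in> A" "\<mu> x \<in> fst (UK p)" using F(3) A(3) \<mu>_closed[OF x] by auto
    then have "x \<in> snd (UK p)" using UK A(1) x by blast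
    then show "x \<in> \<Union>((\<lambda>p. snd (UK p)) ` A)" using p(1) by blast
  qed
  moreover have "\<Union>((\<lambda>p. snd (UK p)) ` A) \<subseteq> topspace E"
    by (rule compactin_subset_topspace[OF calculation(1)])
  ultimately have "compact_space E"
    unfolding compact_space_def by (metis subset_antisym)
  then have "compactin X (cls ` topspace E)"
    using quotient_imp_continuous_map[OF quotient_map_cls] unfolding compact_space_def
    by (rule image_compactin)
  then show ?thesis by (simp add: compact_space_def topspace_X)
qed

end

section \<open>Orbifold charts\<close>

lemma orbifold_chartD:
  assumes "orbifold_chart X (V, G, \<phi>)"
  shows "open V" "connected V" "V \<noteq> {}" "finite G" "subgroup G (BijGroup V)" "g \<in> G \<Longrightarrow> smooth_on V g"
    "openin X (\<phi> ` V)" "quotient_map (top_of_set V) (subtopology X (\<phi> ` V)) \<phi>"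
    "u \<in> V \<Longrightarrow> v \<in> V \<Longrightarrow> \<phi> u = \<phi> v \<longleftrightarrow> (\<exists>g\<in>G. g u = v)"
  using assms by (simp_all add: orbifold_chart_def)

lemma orbifold_chart_group:
  assumes "orbifold_chart X (V, G, \<phi>)"
  shows "g \<in> G \<Longrightarrow> bij_betw g V V" "g \<in> G \<Longrightarrow> u \<in> V \<Longrightarrow> g u \<in> V"
    "g \<in> G \<Longrightarrow> u \<in> V \<Longrightarrow> \<phi> (g u) = \<phi> u" "\<exists>h\<in>G. \<forall>u\<in>V. h u = u"
proof -
  note sub = orbifold_chartD(5)[OF assms]
  show b: "bij_betw g V V" if "g \<in> G" for g
    using subgroup.subset[OF sub] that by (auto simp: BijGroup_def Bij_def)
  show V: "g u \<in> V" if "g \<in> G" "u \<in> V" for g u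
    using bij_betwE[OF b[OF that(1)]] that(2) by blast
  show "\<phi> (g u) = \<phi> u" if "g \<in> G" "u \<in> V"
    using orbifold_chartD(9)[OF assms that(2) V[OF that]] that(1) by auto
  have "\<one>\<^bsub>BijGroup V\<^esub> \<in> G" by (rule subgroup.one_closed[OF sub])
  then show "\<exists>h\<in>G. \<forall>u\<in>V. h u = u"
    by (intro bexI[of _ "\<one>\<^bsub>BijGroup V\<^esub>"]) (simp_all add: BijGroup_def)
qed

text \<open>For openness of \<open>\<phi>\<close>: the saturation of an open set \<open>B\<close> is
  the union over the chart group of the preimages of \<open>B\<close>, which are open.\<close>

lemma orbifold_chart_maps:
  assumes ch: "orbifold_chart X (V, G, \<phi>)"
  shows "continuous_map (top_of_set V) X \<phi>" "open B \<Longrightarrow> B \<subseteq> V \<Longrightarrow> openin X (\<phi> ` B)"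
proof -
  note o = orbifold_chartD[OF ch] and g = orbifold_chart_group[OF ch]
  show "continuous_map (top_of_set V) X \<phi>"
    using quotient_imp_continuous_map[OF o(8)] by (simp add: continuous_map_in_subtopology)
  assume B: "open B" "B \<subseteq> V"
  have "{v \<in> V. \<phi> v \<in> \<phi> ` B} = (\<Union>h\<in>G. {v \<in> V. h v \<in> B})"
  proof (intro equalityI subsetI)
    fix v assume "v \<in> {v \<in> V. \<phi> v \<in> \<phi> ` B}"
    then obtain w where w: "v \<in> V" "w \<in> B" "\<phi> v = \<phi> w" by auto
    then show "v \<in> (\<Union>h\<in>G. {v \<in> V. h v \<in> B})"
      using o(9)[OF w(1), of w] B(2) by auto
  next
    fix v assume "v \<in> (\<Union>h\<in>G. {v \<in> V. h v \<in> B})"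
    then obtain h where "h \<in> G" "v \<in> V" "h v \<in> B" by auto
    then show "v \<in> {v \<in> V. \<phi> v \<in> \<phi> ` B}"
      using g(3)[of h v] by (auto intro: image_eqI[of _ _ "h v"])
  qed
  moreover have "open {v \<in> V. h v \<in> B}" if h: "h \<in> G" for h
    using continuous_open_preimage[OF smooth_on_imp_continuous_on[OF o(6)[OF h]] o(1) B(1)]
    by (simp add: vimage_def Int_def)
  then have "open (\<Union>h\<in>G. {v \<in> V. h v \<in> B})" by (rule open_UN[OF ballI])
  ultimately have ov: "open {v \<in> V. \<phi> v \<in> \<phi> ` B}" by simp
  then have "openin (top_of_set V) {v \<in> topspace (top_of_set V). \<phi> v \<in> \<phi> ` B}"
    using o(1) by (simp add: openin_open_eq)
  moreover have "\<forall>W\<subseteq>topspace (subtopology X (\<phi> ` V)).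
      openin (top_of_set V) {v \<in> topspace (top_of_set V). \<phi> v \<in> W} = openin (subtopology X (\<phi> ` V)) W"
    using o(8) unfolding quotient_map_def by (rule conjunct2)
  moreover have "\<phi> ` B \<subseteq> topspace (subtopology X (\<phi> ` V))"
    using openin_subset[OF o(7)] B(2) by auto
  ultimately have "openin (subtopology X (\<phi> ` V)) (\<phi> ` B)"
    by simp
  then show "openin X (\<phi> ` B)"
    by (simp add: openin_open_subtopology[OF o(7)])
qed

text \<open>The charts in question have rotations as their group. Isometry makes balls about a point
  invariant under its stabilizer and lets one radius serve for all elements of the finite
  group.\<close>

definition isometric_chart :: "('m::euclidean_space, 'x) orbi_chart \<Rightarrow> bool" where
  "isometric_chart \<kappa> \<longleftrightarrow> (case \<kappa> of (V, G, \<phi>) \<Rightarrow> \<forall>g\<in>G. \<forall>u\<in>V. \<forall>v\<in>V. dist (g u) (g v) = dist u v)"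

text \<open>The radius is at most half the distance from \<open>v\<close> to every point of the
  finite orbit of \<open>u\<close>. If the images of the two balls met, a group element would carry
  a point near \<open>u\<close> to one near \<open>v\<close>, and by isometry \<open>u\<close>
  itself closer to \<open>v\<close> than that.\<close>

lemma isometric_chart_separates:
  assumes X: "orbifold_chart X (V, G, \<phi>)" and iso: "isometric_chart (V, G, \<phi>)"
    and uv: "u \<in> V" "v \<in> V" "\<phi> u \<noteq> \<phi> v"
  obtains A B where "openin X A" "openin X B" "\<phi> u \<in> A" "\<phi> v \<in> B" "A \<inter> B = {}"
proof -
  note o = orbifold_chartD[OF X] and g = orbifold_chart_group[OF X]
  have d: "0 < dist (h u) v" if "h \<in> G" for h
    using o(9)[OF uv(1,2)] uv(3) that by auto
  obtain r1 where r1: "0 < r1" "ball u r1 \<subseteq> V" using o(1) uv(1) open_contains_ball by blast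
  obtain r2 where r2: "0 < r2" "ball v r2 \<subseteq> V" using o(1) uv(2) open_contains_ball by blast
  define D where "D = insert r1 (insert r2 ((\<lambda>h. dist (h u) v / 2) ` G))"
  define r where "r = Min D"
  have D: "finite D" "D \<noteq> {}" using o(4) by (simp_all add: D_def)
  have "0 < x" if "x \<in> D" for x using that r1 r2 d by (auto simp: D_def)
  then have "0 < r" unfolding r_def using Min_in[OF D] by simp
  have rle: "r \<le> r1" "r \<le> r2" "\<And>h. h \<in> G \<Longrightarrow> 2 * r \<le> dist (h u) v"
  proof -
    show "r \<le> r1" "r \<le> r2" unfolding r_def by (rule Min_le[OF D(1)], simp add: D_def)+
    fix h assume "h \<in> G"
    then have "r \<le> dist (h u) v / 2" unfolding r_def by (intro Min_le[OF D(1)]) (simp add: D_def)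
    then show "2 * r \<le> dist (h u) v" by simp
  qed
  have sub: "ball u r \<subseteq> V" "ball v r \<subseteq> V"
    using r1(2) r2(2) subset_ball[OF rle(1), of u] subset_ball[OF rle(2), of v] by blast+
  show thesis
  proof (rule that)
    show "openin X (\<phi> ` ball u r)" "openin X (\<phi> ` ball v r)"
      by (rule orbifold_chart_maps(2)[OF X open_ball], rule sub)+
    show "\<phi> u \<in> \<phi> ` ball u r" "\<phi> v \<in> \<phi> ` ball v r" using \<open>0 < r\<close> by simp_all
    show "\<phi> ` ball u r \<inter> \<phi> ` ball v r = {}"
    proof (rule ccontr)
      assume "\<phi> ` ball u r \<inter> \<phi> ` ball v r \<noteq> {}"
      then obtain a b where ab: "a \<in> ball u r" "b \<in> ball v r" "\<phi> a = \<phi> b" by auto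
      have aV: "a \<in> V" "b \<in> V" using ab sub by auto
      obtain h where h: "h \<in> G" "h a = b" using o(9)[OF aV] ab(3) by auto
      have "dist (h u) v \<le> dist (h u) (h a) + dist b v" using dist_triangle[of "h u" v b] h(2) by simp
      also have "dist (h u) (h a) = dist u a"
        using iso h(1) uv(1) aV(1) by (simp add: isometric_chart_def)
      finally have "dist (h u) v < 2 * r" using ab by (simp add: dist_commute)
      then show False using rle(3)[OF h(1)] by simp
    qed
  qed
qed

text \<open>The radius is at most half of every nonzero displacement of \<open>z\<close>. Then an
  element moving \<open>z\<close> sends the ball off itself, while the elements fixing
  \<open>z\<close> preserve it; their restrictions form the group of the smaller chart.\<close>

lemma stabilizer_chart:
  assumes X: "orbifold_chart X (V, G, \<phi>)" and iso: "isometric_chart (V, G, \<phi>)"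
    and z: "z \<in> V" and e: "0 < e"
  obtains r G' where "0 < r" "r \<le> e" "ball z r \<subseteq> V" "orbifold_chart X (ball z r, G', \<phi>)"
proof -
  note o = orbifold_chartD[OF X] and g = orbifold_chart_group[OF X]
  note sub = o(5)
  obtain r1 where r1: "0 < r1" "ball z r1 \<subseteq> V" using o(1) z open_contains_ball by blast
  define D where "D = insert e (insert r1 ((\<lambda>h. dist (h z) z / 2) ` {h \<in> G. h z \<noteq> z}))"
  define r where "r = Min D"
  have D: "finite D" "D \<noteq> {}" using o(4) by (simp_all add: D_def)
  have "0 < x" if "x \<in> D" for x using that r1 e by (auto simp: D_def)
  then have r0: "0 < r" unfolding r_def using Min_in[OF D] by simp
  have rle: "r \<le> e" "r \<le> r1" "\<And>h. h \<in> G \<Longrightarrow> h z \<noteq> z \<Longrightarrow> 2 * r \<le> dist (h z) z"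
  proof -
    show "r \<le> e" "r \<le> r1" unfolding r_def by (rule Min_le[OF D(1)], simp add: D_def)+
    fix h assume "h \<in> G" "h z \<noteq> z"
    then have "r \<le> dist (h z) z / 2" unfolding r_def by (intro Min_le[OF D(1)]) (simp add: D_def)
    then show "2 * r \<le> dist (h z) z" by simp
  qed
  let ?B = "ball z r"
  have BV: "?B \<subseteq> V" using r1(2) subset_ball[OF rle(2), of z] by blast
  have idist: "dist (h u) (h v) = dist u v" if "h \<in> G" "u \<in> V" "v \<in> V" for h u v
    using iso that by (simp add: isometric_chart_def)
  let ?GV = "BijGroup V\<lparr>carrier := G\<rparr>"
  have grp: "group ?GV" by (rule subgroup.subgroup_is_group[OF sub group_BijGroup])
  have mult: "(h \<otimes>\<^bsub>?GV\<^esub> k) u = h (k u)" if "h \<in> G" "k \<in> G" "u \<in> V" for h k u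
  proof -
    have "h \<in> Bij V" "k \<in> Bij V" using subgroup.subset[OF sub] that by (auto simp: BijGroup_def)
    then show ?thesis using that(3) by (simp add: BijGroup_def compose_def)
  qed
  have one: "\<one>\<^bsub>?GV\<^esub> u = u" if "u \<in> V" for u using that by (simp add: BijGroup_def)
  have "group_action ?GV V (\<lambda>h. restrict h V)"
    by (rule group_actionI[OF grp]) (use g(2) mult one in auto)
  from group_action.stabilizer_subgroup[OF this z]
  have st: "subgroup (stabilizer ?GV (\<lambda>h. restrict h V) z) ?GV" .
  define H where "H = {h \<in> G. h z = z}"
  have "stabilizer ?GV (\<lambda>h. restrict h V) z = H"
    using z by (auto simp: stabilizer_def H_def)
  with st have subH: "subgroup H ?GV" by simp
  let ?GH = "?GV\<lparr>carrier := H\<rparr>"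
  have grpH: "group ?GH" by (rule subgroup.subgroup_is_group[OF subH grp])
  have HB: "h u \<in> ?B" if "h \<in> H" "u \<in> ?B" for h u
    using idist[of h z u] that z BV by (auto simp: H_def)
  have "group_action ?GH ?B (\<lambda>h. restrict h ?B)"
  proof (rule group_actionI[OF grpH])
    show "h u \<in> ?B" if "h \<in> carrier ?GH" "u \<in> ?B" for h u using HB that by simp
    show "(h \<otimes>\<^bsub>?GH\<^esub> k) u = h (k u)" if "h \<in> carrier ?GH" "k \<in> carrier ?GH" "u \<in> ?B" for h k u
      using mult[of h k u] that BV by (auto simp: H_def)
    show "\<one>\<^bsub>?GH\<^esub> u = u" if "u \<in> ?B" for u using one[of u] that BV by auto
  qed
  then have "group_hom ?GH (BijGroup ?B) (\<lambda>h. restrict h ?B)" by (simp add: group_action_def)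
  from group_hom.img_is_subgroup[OF this]
  have subG': "subgroup ((\<lambda>h. restrict h ?B) ` H) (BijGroup ?B)" by simp
  let ?G' = "(\<lambda>h. restrict h ?B) ` H"
  have "orbifold_chart X (?B, ?G', \<phi>)"
    unfolding orbifold_chart_def prod.case
  proof (intro conjI ballI)
    show "finite ?G'" using o(4) by (simp add: H_def)
    show "subgroup ?G' (BijGroup ?B)" by (rule subG')
    show "smooth_on ?B h" if h: "h \<in> ?G'" for h
    proof -
      obtain k where k: "k \<in> H" "h = restrict k ?B" using h by auto
      then have "smooth_on V k" using o(6) by (simp add: H_def)
      then have "smooth_on ?B k" by (rule smooth_on_subset[OF _ BV])
      then show ?thesis by (rule smooth_on_cong) (simp add: k(2))
    qed
    show op: "openin X (\<phi> ` ?B)" by (rule orbifold_chart_maps(2)[OF X open_ball BV])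
    show "quotient_map (top_of_set ?B) (subtopology X (\<phi> ` ?B)) \<phi>"
    proof (rule continuous_open_imp_quotient_map)
      show "continuous_map (top_of_set ?B) (subtopology X (\<phi> ` ?B)) \<phi>"
        using continuous_map_from_subtopology_mono[OF orbifold_chart_maps(1)[OF X] BV]
        by (simp add: continuous_map_in_subtopology)
      show "open_map (top_of_set ?B) (subtopology X (\<phi> ` ?B)) \<phi>"
        unfolding open_map_def
      proof (intro allI impI)
        fix O' assume "openin (top_of_set ?B) O'"
        then have O: "open O'" "O' \<subseteq> ?B" by (simp_all add: openin_open_eq)
        then have "openin X (\<phi> ` O')" using BV by (intro orbifold_chart_maps(2)[OF X]) auto
        then show "openin (subtopology X (\<phi> ` ?B)) (\<phi> ` O')"
          using O(2) by (simp add: openin_open_subtopology[OF op] image_mono)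
      qed
      show "\<phi> ` topspace (top_of_set ?B) = topspace (subtopology X (\<phi> ` ?B))"
        using openin_subset[OF op] by auto
    qed
    fix u v assume uv: "u \<in> ?B" "v \<in> ?B"
    then have uV: "u \<in> V" "v \<in> V" using BV by auto
    show "\<phi> u = \<phi> v \<longleftrightarrow> (\<exists>h\<in>?G'. h u = v)"
    proof
      assume "\<phi> u = \<phi> v"
      then obtain h where h: "h \<in> G" "h u = v" using o(9)[OF uV] by auto
      have "h z = z"
      proof (rule ccontr)
        assume ne: "h z \<noteq> z"
        have "dist (h z) z \<le> dist (h z) (h u) + dist v z" using dist_triangle[of "h z" z v] h(2) by simp
        also have "dist (h z) (h u) = dist z u" by (rule idist[OF h(1) z uV(1)])
        finally have "dist (h z) z < 2 * r" using uv by (simp add: dist_commute)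
        then show False using rle(3)[OF h(1) ne] by simp
      qed
      then have "h \<in> H" using h(1) by (simp add: H_def)
      then show "\<exists>h\<in>?G'. h u = v" using h(2) uv(1) by (intro bexI[of _ "restrict h ?B"]) simp_all
    next
      assume "\<exists>h\<in>?G'. h u = v"
      then obtain h where h: "h \<in> H" "restrict h ?B u = v" by auto
      then have "h \<in> G" "h u = v" using uv(1) by (simp_all add: H_def)
      then show "\<phi> u = \<phi> v" using g(3)[of h u] uV(1) by simp
    qed
  qed (use r0 in simp_all)
  then show thesis using that r0 rle(1) BV by blast
qed

lemma second_countable_from_charts:
  fixes \<K> :: "('m::euclidean_space, 'x) orbi_chart set"
  assumes fin: "finite \<K>" and K: "\<And>\<kappa>. \<kappa> \<in> \<K> \<Longrightarrow> orbifold_chart X \<kappa>"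
    and cov: "topspace X \<subseteq> \<Union>(orbi_chart_range ` \<K>)"
  shows "second_countable X"
proof -
  obtain B :: "'m set set" where B: "countable B" "topological_basis B"
    using ex_countable_basis by blast
  define \<B> where "\<B> = (\<Union>\<kappa>\<in>\<K>. (\<lambda>A. snd (snd \<kappa>) ` (A \<inter> fst \<kappa>)) ` B)"
  have "countable \<B>"
    unfolding \<B>_def using countable_finite[OF fin] B(1) by (intro countable_UN countable_image)
  moreover have "openin X W" if W: "W \<in> \<B>" for W
  proof -
    obtain \<kappa> A where k: "\<kappa> \<in> \<K>" "A \<in> B" "W = snd (snd \<kappa>) ` (A \<inter> fst \<kappa>)"
      using W unfolding \<B>_def by (elim UN_E imageE)
    obtain V G \<phi> where \<kappa>: "\<kappa> = (V, G, \<phi>)" by (cases \<kappa>)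
    note ch = K[OF k(1), unfolded \<kappa>]
    have "open (A \<inter> V)" using topological_basis_open[OF B(2) k(2)] orbifold_chartD(1)[OF ch] by (rule open_Int)
    then show ?thesis using orbifold_chart_maps(2)[OF ch, of "A \<inter> V"] k(3) \<kappa> by simp
  qed
  moreover have "\<exists>W\<in>\<B>. x \<in> W \<and> W \<subseteq> U" if U: "openin X U" "x \<in> U" for U x
  proof -
    have "x \<in> topspace X" using openin_subset[OF U(1)] U(2) by blast
    then obtain \<kappa> where k: "\<kappa> \<in> \<K>" "x \<in> orbi_chart_range \<kappa>" using cov by blast
    obtain V G \<phi> where \<kappa>: "\<kappa> = (V, G, \<phi>)" by (cases \<kappa>)
    note ch = K[OF k(1), unfolded \<kappa>]
    obtain v where v: "v \<in> V" "x = \<phi> v" using k(2) \<kappa> by (auto simp: orbi_chart_range_def)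
    have "openin (top_of_set V) {v \<in> topspace (top_of_set V). \<phi> v \<in> U}"
      by (rule openin_continuous_map_preimage[OF orbifold_chart_maps(1)[OF ch] U(1)])
    then have "open {v \<in> V. \<phi> v \<in> U}"
      using orbifold_chartD(1)[OF ch] by (simp add: openin_open_eq)
    moreover have "v \<in> {v \<in> V. \<phi> v \<in> U}" using v U(2) by simp
    ultimately obtain A where A: "A \<in> B" "v \<in> A" "A \<subseteq> {v \<in> V. \<phi> v \<in> U}"
      by (rule topological_basisE[OF B(2)])
    show ?thesis
    proof (rule bexI[of _ "\<phi> ` (A \<inter> V)"])
      show "x \<in> \<phi> ` (A \<inter> V) \<and> \<phi> ` (A \<inter> V) \<subseteq> U" using A v by auto
      show "\<phi> ` (A \<inter> V) \<in> \<B>" unfolding \<B>_def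
        by (rule UN_I[OF k(1)], rule image_eqI[OF _ A(1)]) (simp add: \<kappa>)
    qed
  qed
  ultimately show ?thesis unfolding second_countable_def by blast
qed

subsection \<open>Polar coordinates\<close>

definition polar :: "real ^ 'n::finite \<Rightarrow> real ^ 'n \<Rightarrow> complex ^ 'n" where
  "polar q \<theta> = (\<chi> i. of_real (sqrt (q $ i))) * cis_vec \<theta>"

definition sqn :: "complex ^ 'n::finite \<Rightarrow> real ^ 'n" where
  "sqn z = (\<chi> i. (norm (z $ i))\<^sup>2)"

definition angle_of :: "complex ^ 'n::finite \<Rightarrow> real ^ 'n" where
  "angle_of z = (\<chi> i. Arg (z $ i) / (2 * pi))"

definition model_domain :: "'n set \<Rightarrow> (complex ^ 'n::finite) set" where
  "model_domain I = {z. \<forall>i\<in>-I. z $ i \<noteq> 0}"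

lemma polar_nth: "polar q \<theta> $ i = of_real (sqrt (q $ i)) * cis (2 * pi * \<theta> $ i)"
  by (simp add: polar_def cis_vec_simps)

lemma sqn_nth: "sqn z $ i = (norm (z $ i))\<^sup>2"
  by (simp add: sqn_def)

lemma sqn_polar: "q \<in> orthant \<Longrightarrow> sqn (polar q \<theta>) = q"
  by (simp add: vec_eq_iff sqn_nth polar_nth norm_mult orthant_def)

lemma polar_sqn: "polar (sqn z) (angle_of z) = z"
proof -
  have "polar (sqn z) (angle_of z) $ i = z $ i" for i
    using rcis_cmod_Arg[of "z $ i"] by (simp add: polar_nth sqn_nth angle_of_def rcis_def)
  then show ?thesis by (simp add: vec_eq_iff)
qed

lemma sqn_orthant: "sqn z \<in> orthant"
  by (simp add: orthant_def sqn_nth)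

lemma sqn_eq_0_iff: "sqn z $ i = 0 \<longleftrightarrow> z $ i = 0"
  by (simp add: sqn_nth)

lemma polar_eq_iff:
  assumes "q \<in> orthant"
  shows "polar q \<theta> = polar q \<theta>' \<longleftrightarrow> (\<forall>i. q $ i \<noteq> 0 \<longrightarrow> \<theta> $ i - \<theta>' $ i \<in> \<int>)"
proof -
  have "polar q \<theta> $ i = polar q \<theta>' $ i \<longleftrightarrow> (q $ i \<noteq> 0 \<longrightarrow> \<theta> $ i - \<theta>' $ i \<in> \<int>)" for i
    by (auto simp: polar_nth cis_2pi_eq_iff)
  then show ?thesis by (simp add: vec_eq_iff)
qed

lemma cis_vec_mult_polar: "cis_vec \<psi> * polar q \<theta> = polar q (\<psi> + \<theta>)"
  by (simp add: vec_eq_iff polar_nth cis_vec_simps distrib_left mult.left_commute flip: cis_mult)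

lemma norm_cis_vec_mult: "norm (cis_vec \<psi> * z) = norm z"
  by (simp add: norm_vec_def norm_mult cis_vec_simps)

lemma sqn_model_iff: "sqn z \<in> model_corner I \<longleftrightarrow> z \<in> model_domain I"
  by (simp add: model_corner_def model_domain_def sqn_nth)

lemma polar_model_domain: "q \<in> model_corner I \<Longrightarrow> polar q \<theta> \<in> model_domain I"
  using sqn_model_iff[of "polar q \<theta>" I] sqn_polar[of q \<theta>] model_corner_subset_orthant[of I] by auto

lemma continuous_on_sqn: "continuous_on A sqn"
  unfolding sqn_def by (intro continuous_on_vec_lambda continuous_intros)

lemma continuous_on_polar: "continuous_on A (\<lambda>x. polar (fst x) (snd x))"
  unfolding polar_def cis_vec_def times_vec_def vec_lambda_beta cis_conv_exp
  by (intro continuous_on_vec_lambda continuous_intros)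

lemma open_model_domain: "open (model_domain I)"
proof -
  have "model_domain I = (\<Inter>i\<in>-I. {z. z $ i \<noteq> 0})" by (auto simp: model_domain_def)
  then show ?thesis by (auto intro!: open_INT open_Collect_neq continuous_intros)
qed

lemma model_domain_nonempty: "model_domain I \<noteq> {}"
proof -
  have "(1 :: complex ^ 'a) \<in> model_domain I" by (simp add: model_domain_def)
  then show ?thesis by blast
qed

lemma convex_model_corner: "convex (model_corner I)"
proof (rule convexI)
  fix x y :: "real ^ 'a" and u v :: real
  assume x: "x \<in> model_corner I" and y: "y \<in> model_corner I" and uv: "0 \<le> u" "0 \<le> v" "u + v = 1"
  have "0 < u * x $ i + v * y $ i" if i: "i \<in> - I" for i
  proof (cases "u = 0")
    case True
    then show ?thesis using y i uv by (simp add: model_corner_def)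
  next
    case False
    have "0 < x $ i" "0 < y $ i" using x y i by (auto simp: model_corner_def)
    then show ?thesis using False uv by (intro add_pos_nonneg) auto
  qed
  then show "u *\<^sub>R x + v *\<^sub>R y \<in> model_corner I" using x y uv by (simp add: model_corner_def)
qed

lemma connected_model_domain: "connected (model_domain I)"
proof -
  have "connected (model_corner I \<times> (UNIV :: (real ^ 'a) set))"
    by (intro convex_connected convex_Times convex_model_corner convex_UNIV)
  then have "connected ((\<lambda>x. polar (fst x) (snd x)) ` (model_corner I \<times> UNIV))"
    by (rule connected_continuous_image[OF continuous_on_polar])
  moreover have "(\<lambda>x. polar (fst x) (snd x)) ` (model_corner I \<times> UNIV) = model_domain I"
  proof (intro equalityI subsetI)
    fix z assume "z \<in> (\<lambda>x. polar (fst x) (snd x)) ` (model_corner I \<times> UNIV)"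
    then show "z \<in> model_domain I" by (auto simp: polar_model_domain)
  next
    fix z assume "z \<in> model_domain I"
    then have "sqn z \<in> model_corner I" by (simp add: sqn_model_iff)
    then show "z \<in> (\<lambda>x. polar (fst x) (snd x)) ` (model_corner I \<times> UNIV)"
      by (intro image_eqI[of _ _ "(sqn z, angle_of z)"]) (simp_all add: polar_sqn)
  qed
  ultimately show ?thesis by simp
qed

lemma smooth_on_cis_vec_mult: "smooth_on A (\<lambda>z. cis_vec \<psi> * z)"
proof -
  have "smooth_on A (\<lambda>z :: complex ^ 'a. \<chi> i. cis_vec \<psi> $ i * z $ i)"
    by (intro smooth_on_vec_lambda smooth_on_mult smooth_on_const smooth_on_vec_nth smooth_on_ident)
  then show ?thesis by (simp add: times_vec_def)
qed

section \<open>Charts of the collapsed bundle\<close>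

text \<open>\<open>S_eq\<close> says that the directions collapsed over \<open>p\<close> are those
  of the coordinates vanishing at \<open>p\<close>. \<open>split\<close> says that a lattice vector
  has integral coefficients outside \<open>I\<close>, so that only the angles of the coordinates in
  \<open>I\<close> can give nontrivial elements of the chart group.\<close>

locale quotient_chart = corner_manifold P \<A> + torus_quotient P E act \<mu> S
  for P :: "'p topology" and \<A> :: "('p, 'n::finite) corner_chart set"
    and E :: "'e topology" and act :: "(real ^ 'n) set \<Rightarrow> 'e \<Rightarrow> 'e" and \<mu> :: "'e \<Rightarrow> 'p"
    and S :: "'p \<Rightarrow> (real ^ 'n) set" +
  fixes U :: "'p set" and c :: "'p \<Rightarrow> real ^ 'n" and I :: "'n set" and \<sigma> :: "'p \<Rightarrow> 'e"
    and b :: "'n \<Rightarrow> int ^ 'n"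
  assumes chart: "model_chart U c I" and sec: "section_on U \<sigma>"
    and S_eq: "p \<in> U \<Longrightarrow> S p = comb b ` {\<theta>. \<forall>i. \<theta> $ i \<noteq> 0 \<longrightarrow> c p $ i = 0}"
    and indep: "lin_indep UNIV b"
    and split: "comb b \<theta> \<in> range vec_of_int \<Longrightarrow> i \<notin> I \<Longrightarrow> \<theta> $ i \<in> \<int>"
begin

abbreviation "V \<equiv> model_domain I"
abbreviation "ci \<equiv> the_inv_into U c"

definition F :: "'p \<Rightarrow> real ^ 'n \<Rightarrow> 'e set" where
  "F p \<theta> = cls (act (tor (comb b \<theta>)) (\<sigma> p))"

text \<open>\<open>angle_of\<close> jumps along a cut and carries no information where a coordinate
  vanishes. \<open>\<phi>_polar\<close> shows that any other choice of angles gives the same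
  class.\<close>

definition \<phi> :: "complex ^ 'n \<Rightarrow> 'e set" where
  "\<phi> z = F (ci (sqn z)) (angle_of z)"

definition chart_group :: "(complex ^ 'n \<Rightarrow> complex ^ 'n) set" where
  "chart_group = {(\<lambda>z\<in>V. cis_vec \<psi> * z) |\<psi>. (\<forall>i\<in>-I. \<psi> $ i = 0) \<and> comb b \<psi> \<in> range vec_of_int}"

lemmas smooth_chart = model_chartD(1)[OF chart] and image_chart = model_chartD(2)[OF chart]

lemma c_orthant: "p \<in> U \<Longrightarrow> c p \<in> orthant" and c_model: "p \<in> U \<Longrightarrow> c p \<in> model_corner I"
  using image_chart model_corner_subset_orthant[of I] by auto

lemma ci_c: "p \<in> U \<Longrightarrow> ci (c p) = p"
  by (rule inv_chart[OF smooth_chart])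

lemma c_ci: "q \<in> model_corner I \<Longrightarrow> c (ci q) = q" and ci_in: "q \<in> model_corner I \<Longrightarrow> ci q \<in> U"
proof -
  assume "q \<in> model_corner I"
  then obtain p where "p \<in> U" "q = c p" using image_chart by auto
  then show "c (ci q) = q" "ci q \<in> U" by (simp_all add: ci_c)
qed

lemma \<sigma>_simps: "p \<in> U \<Longrightarrow> \<sigma> p \<in> topspace E" "p \<in> U \<Longrightarrow> \<mu> (\<sigma> p) = p"
  using section_onD(3,4)[OF sec] by simp_all

lemma V_cases:
  assumes "z \<in> V"
  obtains p \<theta> where "p \<in> U" "z = polar (c p) \<theta>"
proof (rule that[of "ci (sqn z)" "angle_of z"])
  have "sqn z \<in> model_corner I" using assms by (simp add: sqn_model_iff)
  then show "ci (sqn z) \<in> U" "z = polar (c (ci (sqn z))) (angle_of z)"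
    by (simp_all add: ci_in c_ci polar_sqn)
qed

lemma polar_in_V: "p \<in> U \<Longrightarrow> polar (c p) \<theta> \<in> V"
  by (rule polar_model_domain[OF c_model])

text \<open>\<open>\<eta>\<close> is the part of the angle difference absorbed by the collapsed
  directions over \<open>p\<close>; what remains must be a lattice translation, because the action
  on the bundle is free modulo the lattice.\<close>

lemma F_eq_iff:
  assumes p: "p \<in> U" and p': "p' \<in> U"
  shows "F p \<theta> = F p' \<theta>' \<longleftrightarrow> p = p' \<and>
    (\<exists>\<eta>. (\<forall>i. \<eta> $ i \<noteq> 0 \<longrightarrow> c p $ i = 0) \<and> comb b (\<theta>' - \<theta> - \<eta>) \<in> range vec_of_int)"
proof -
  note s = \<sigma>_simps[OF p] and s' = \<sigma>_simps[OF p']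
  have *: "F p \<theta> = F p \<theta>' \<longleftrightarrow> (\<exists>\<eta>. (\<forall>i. \<eta> $ i \<noteq> 0 \<longrightarrow> c p $ i = 0) \<and> comb b (\<theta>' - \<theta> - \<eta>) \<in> range vec_of_int)"
  proof -
    have "F p \<theta> = F p \<theta>' \<longleftrightarrow> (\<exists>v\<in>S p. act (tor (comb b \<theta>')) (\<sigma> p) = act (tor v) (act (tor (comb b \<theta>)) (\<sigma> p)))"
      unfolding F_def using s by (subst cls_eq_iff) simp_all
    also have "\<dots> \<longleftrightarrow> (\<exists>v\<in>S p. comb b \<theta>' - (v + comb b \<theta>) \<in> range vec_of_int)"
      using s by (simp only: act_add[symmetric] act_free_iff)
    also have "\<dots> \<longleftrightarrow> (\<exists>\<eta>. (\<forall>i. \<eta> $ i \<noteq> 0 \<longrightarrow> c p $ i = 0) \<and> comb b \<theta>' - (comb b \<eta> + comb b \<theta>) \<in> range vec_of_int)"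
      unfolding S_eq[OF p] by (simp add: Bex_def image_iff) blast
    also have "\<dots> \<longleftrightarrow> (\<exists>\<eta>. (\<forall>i. \<eta> $ i \<noteq> 0 \<longrightarrow> c p $ i = 0) \<and> comb b (\<theta>' - \<theta> - \<eta>) \<in> range vec_of_int)"
    proof -
      have "comb b (\<theta>' - \<theta> - \<eta>) = comb b \<theta>' - (comb b \<eta> + comb b \<theta>)" for \<eta>
        unfolding linear_diff[OF linear_comb] by (simp only: diff_diff_eq add.commute)
      then show ?thesis by (simp only:)
    qed
    finally show ?thesis .
  qed
  show ?thesis
  proof (cases "p = p'")
    case False
    have "\<pi> (F p \<theta>) = p" "\<pi> (F p' \<theta>') = p'" using s s' by (simp_all add: F_def \<pi>_cls)
    then have "F p \<theta> \<noteq> F p' \<theta>'" using False by auto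
    then show ?thesis using False by simp
  qed (use * in simp)
qed

lemma comb_int: "v \<in> range vec_of_int \<Longrightarrow> comb b v \<in> range vec_of_int"
  by (auto simp: comb_vec_of_int)

lemma F_cong_polar:
  assumes p: "p \<in> U" and eq: "polar (c p) \<theta> = polar (c p) \<theta>'"
  shows "F p \<theta> = F p \<theta>'"
proof -
  have int: "c p $ i \<noteq> 0 \<Longrightarrow> \<theta> $ i - \<theta>' $ i \<in> \<int>" for i
    using eq unfolding polar_eq_iff[OF c_orthant[OF p]] by blast
  let ?\<eta> = "\<chi> i. if c p $ i = 0 then \<theta>' $ i - \<theta> $ i else 0"
  have "(\<theta>' - \<theta> - ?\<eta>) $ i \<in> \<int>" for i
    using Ints_minus[OF int[of i]] by simp
  then have "comb b (\<theta>' - \<theta> - ?\<eta>) \<in> range vec_of_int"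
    by (intro comb_int) (simp add: in_range_vec_of_int_iff)
  then show ?thesis
    unfolding F_eq_iff[OF p p] by (intro conjI refl exI[of _ ?\<eta>]) simp_all
qed

lemma \<phi>_polar: "p \<in> U \<Longrightarrow> \<phi> (polar (c p) \<theta>) = F p \<theta>"
proof -
  assume p: "p \<in> U"
  let ?z = "polar (c p) \<theta>"
  have sq: "sqn ?z = c p" by (rule sqn_polar[OF c_orthant[OF p]])
  have "\<phi> ?z = F p (angle_of ?z)" unfolding \<phi>_def sq ci_c[OF p] ..
  also have "\<dots> = F p \<theta>"
    by (rule F_cong_polar[OF p]) (use polar_sqn[of ?z] sq in simp)
  finally show ?thesis .
qed

lemma \<phi>_image: "\<phi> ` V = {C \<in> topspace X. \<pi> C \<in> U}"
proof (intro equalityI subsetI)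
  fix C assume "C \<in> \<phi> ` V"
  then obtain z where "z \<in> V" "C = \<phi> z" by blast
  then obtain p \<theta> where p: "p \<in> U" "C = F p \<theta>" by (elim V_cases) (simp add: \<phi>_polar)
  then show "C \<in> {C \<in> topspace X. \<pi> C \<in> U}"
    using \<sigma>_simps[OF p(1)] by (simp add: F_def topspace_X \<pi>_cls)
next
  fix C assume "C \<in> {C \<in> topspace X. \<pi> C \<in> U}"
  then obtain x where x: "x \<in> topspace E" "C = cls x" "\<mu> x \<in> U" by (auto simp: topspace_X \<pi>_cls)
  note s = \<sigma>_simps[OF x(3)]
  obtain v where "x = act (tor v) (\<sigma> (\<mu> x))"
    by (rule act_transitive[OF s(1) x(1) s(2)])
  then have "C = F (\<mu> x) (coord b v)" using x(2) by (simp add: F_def comb_coord[OF indep])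
  then have "C = \<phi> (polar (c (\<mu> x)) (coord b v))" by (simp add: \<phi>_polar[OF x(3)])
  then show "C \<in> \<phi> ` V" using polar_in_V[OF x(3)] by (rule image_eqI)
qed

lemma openin_\<phi>_image: "openin X (\<phi> ` V)"
  unfolding \<phi>_image by (rule openin_continuous_map_preimage[OF continuous_\<pi> section_onD(1)[OF sec]])

section \<open>The chart group and the fibres of the chart map\<close>

lemma chart_group_elem:
  assumes "g \<in> chart_group"
  obtains \<psi> where "g = (\<lambda>z\<in>V. cis_vec \<psi> * z)" "\<forall>i\<in>-I. \<psi> $ i = 0" "comb b \<psi> \<in> range vec_of_int"
  using assms unfolding chart_group_def by blast

text \<open>After subtracting the collapsed part \<open>\<eta>\<close>, the angle difference
  represents a lattice vector, so by \<open>split\<close> its entries outside \<open>I\<close> are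
  integers. Replacing them by 0 changes the translation by a lattice vector and the rotation not at
  all, and leaves an element of \<open>chart_group\<close>.\<close>

lemma \<phi>_eq_iff:
  assumes u: "u \<in> V" and v: "v \<in> V"
  shows "\<phi> u = \<phi> v \<longleftrightarrow> (\<exists>g\<in>chart_group. g u = v)"
proof
  assume eq: "\<phi> u = \<phi> v"
  obtain p \<theta> where p: "p \<in> U" "u = polar (c p) \<theta>" using u by (rule V_cases)
  obtain p' \<theta>' where p': "p' \<in> U" "v = polar (c p') \<theta>'" using v by (rule V_cases)
  have "F p \<theta> = F p' \<theta>'" using eq p p' by (simp add: \<phi>_polar)
  then obtain \<eta> where \<eta>: "p = p'" "\<forall>i. \<eta> $ i \<noteq> 0 \<longrightarrow> c p $ i = 0" "comb b (\<theta>' - \<theta> - \<eta>) \<in> range vec_of_int"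
    unfolding F_eq_iff[OF p(1) p'(1)] by blast
  let ?\<kappa> = "\<theta>' - \<theta> - \<eta>"
  let ?\<psi> = "\<chi> i. if i \<in> I then ?\<kappa> $ i else 0"
  have int: "(?\<kappa> - ?\<psi>) $ i \<in> \<int>" for i
    using split[OF \<eta>(3), of i] by simp
  then have "comb b (?\<kappa> - ?\<psi>) \<in> range vec_of_int"
    by (intro comb_int) (simp add: in_range_vec_of_int_iff)
  then have "comb b ?\<kappa> - comb b ?\<psi> \<in> range vec_of_int" by (simp only: linear_diff[OF linear_comb])
  then obtain m l where "comb b ?\<kappa> - comb b ?\<psi> = vec_of_int m" "comb b ?\<kappa> = vec_of_int l"
    using \<eta>(3) by (elim imageE)
  then have "comb b ?\<psi> = vec_of_int (l - m)" by (simp add: vec_of_int_simps algebra_simps)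
  then have g: "(\<lambda>z\<in>V. cis_vec ?\<psi> * z) \<in> chart_group"
    unfolding chart_group_def by (intro CollectI exI[of _ ?\<psi>]) simp
  have "cis_vec ?\<psi> * u = polar (c p) (?\<psi> + \<theta>)" by (simp only: p(2) cis_vec_mult_polar)
  also have "\<dots> = polar (c p) \<theta>'"
    unfolding polar_eq_iff[OF c_orthant[OF p(1)]]
  proof (intro allI impI)
    fix i assume i: "c p $ i \<noteq> 0"
    then have "\<eta> $ i = 0" using \<eta>(2) by blast
    then have e: "(?\<psi> + \<theta>) $ i - \<theta>' $ i = - ((?\<kappa> - ?\<psi>) $ i)" by simp
    show "(?\<psi> + \<theta>) $ i - \<theta>' $ i \<in> \<int>" unfolding e by (rule Ints_minus[OF int])
  qed
  also have "\<dots> = v" using p' \<eta>(1) by simp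
  finally show "\<exists>g\<in>chart_group. g u = v" using g u by (intro bexI[of _ "\<lambda>z\<in>V. cis_vec ?\<psi> * z"]) simp_all
next
  assume "\<exists>g\<in>chart_group. g u = v"
  then obtain g where g: "g \<in> chart_group" "g u = v" by blast
  obtain \<psi> where \<psi>: "g = (\<lambda>z\<in>V. cis_vec \<psi> * z)" "comb b \<psi> \<in> range vec_of_int"
    using g(1) by (rule chart_group_elem)
  obtain p \<theta> where p: "p \<in> U" "u = polar (c p) \<theta>" using u by (rule V_cases)
  have "v = polar (c p) (\<psi> + \<theta>)" using g(2) \<psi>(1) u p(2) by (simp add: cis_vec_mult_polar)
  moreover have "F p \<theta> = F p (\<psi> + \<theta>)"
    unfolding F_eq_iff[OF p(1) p(1)] using \<psi>(2) by (intro conjI refl exI[of _ 0]) simp_all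
  ultimately show "\<phi> u = \<phi> v" using p by (simp add: \<phi>_polar)
qed

text \<open>A rotation depends only on the fractional parts of its angles, and these combine to a
  lattice vector of norm at most the sum of the norms of the \<open>b i\<close>.\<close>

lemma finite_chart_group: "finite chart_group"
proof -
  define C where "C = (\<Sum>i\<in>UNIV. norm (vec_of_int (b i)))"
  let ?\<Theta> = "(\<lambda>m. coord b (vec_of_int m)) ` {m. norm (vec_of_int m) \<le> C}"
  have "chart_group \<subseteq> (\<lambda>\<psi>. (\<lambda>z\<in>V. cis_vec \<psi> * z)) ` ?\<Theta>"
  proof
    fix g assume "g \<in> chart_group"
    then obtain \<psi> where \<psi>: "g = (\<lambda>z\<in>V. cis_vec \<psi> * z)" "comb b \<psi> \<in> range vec_of_int"
      by (rule chart_group_elem)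
    let ?\<psi> = "\<chi> i. frac (\<psi> $ i)"
    have fl: "\<psi> - ?\<psi> \<in> range vec_of_int" by (simp add: in_range_vec_of_int_iff frac_def)
    then have ce: "cis_vec \<psi> = cis_vec ?\<psi>" by (simp only: cis_vec_eq_iff)
    have "comb b (\<psi> - ?\<psi>) \<in> range vec_of_int" by (rule comb_int[OF fl])
    then have "comb b \<psi> - comb b ?\<psi> \<in> range vec_of_int" by (simp only: linear_diff[OF linear_comb])
    then obtain m l where "comb b \<psi> - comb b ?\<psi> = vec_of_int m" "comb b \<psi> = vec_of_int l"
      using \<psi>(2) by (elim imageE)
    then have k: "comb b ?\<psi> = vec_of_int (l - m)" by (simp add: vec_of_int_simps algebra_simps)
    have "norm (comb b ?\<psi>) \<le> (\<Sum>i\<in>UNIV. norm (frac (\<psi> $ i) *\<^sub>R vec_of_int (b i)))"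
      unfolding comb_def by (rule order_trans[OF norm_sum]) simp
    also have "\<dots> \<le> C"
      unfolding C_def by (intro sum_mono) (auto simp: frac_ge_0 frac_lt_1 less_imp_le intro!: mult_left_le_one_le)
    finally have "norm (vec_of_int (l - m)) \<le> C" using k by simp
    moreover have "?\<psi> = coord b (vec_of_int (l - m))" unfolding k[symmetric] by (simp add: coord_comb[OF indep])
    ultimately have "?\<psi> \<in> ?\<Theta>" by (intro image_eqI[of _ _ "l - m"]) simp_all
    then show "g \<in> (\<lambda>\<psi>. (\<lambda>z\<in>V. cis_vec \<psi> * z)) ` ?\<Theta>"
      using \<psi>(1) ce by (intro image_eqI[of _ _ ?\<psi>]) simp_all
  qed
  then show ?thesis by (rule finite_subset) (intro finite_imageI finite_bounded_int_vecs)
qed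

lemma isometric_\<phi>: "isometric_chart (V, chart_group, \<phi>)"
  unfolding isometric_chart_def prod.case
proof (intro ballI)
  fix g u v assume g: "g \<in> chart_group" and uv: "u \<in> V" "v \<in> V"
  obtain \<psi> where "g = (\<lambda>z\<in>V. cis_vec \<psi> * z)" using g by (rule chart_group_elem)
  then have "g u - g v = cis_vec \<psi> * (u - v)" using uv by (simp add: vec_eq_iff algebra_simps)
  then show "dist (g u) (g v) = dist u v" by (simp add: dist_norm norm_cis_vec_mult)
qed

subsection \<open>The torus action on a chart\<close>

text \<open>The rank \<open>n\<close> submodule of local standardness. For a chart at a face it
  contains the module of the face, generated by the \<open>b i\<close> with \<open>i\<close> in
  \<open>I\<close>, together with the chosen representatives of a complementary basis.\<close>

definition N :: "(int ^ 'n) set" where "N = generate (additive_group UNIV) (range b)"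

definition \<rho> :: "(real ^ 'n) set \<Rightarrow> complex ^ 'n \<Rightarrow> complex ^ 'n" where
  "\<rho> t = (\<lambda>z\<in>V. torus_angle b t * z)"

lemmas N_basis = indep N_def

lemma submodule_N: "submodule_of_ints N"
  by (rule submodule_basis[OF N_basis])

lemma real_span_N: "real_span N = UNIV"
  unfolding N_def by (rule real_span_basis[OF indep])

lemma saturation_N: "saturation N = UNIV"
  by (simp add: saturation_def real_span_N)

lemma zeta_N: "zeta N (lattice_coset N v) = tor v"
  using zeta_coset[OF submodule_N] by (simp add: saturation_N)

lemma cis_vec_mult_in_V: "z \<in> V \<Longrightarrow> cis_vec \<psi> * z \<in> V"
  by (simp add: model_domain_def cis_vec_simps)

lemma group_action_\<rho>: "group_action (torus N) V \<rho>"
proof -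
  have "group_action (torus N) V (\<lambda>t. restrict (\<lambda>z. torus_angle b t * z) V)"
  proof (rule group_actionI[OF group_torus[OF submodule_N]])
    show "torus_angle b t * z \<in> V" if "t \<in> carrier (torus N)" "z \<in> V" for t z
      using that by (auto simp: torus_carrier_basis[OF N_basis] torus_angle_coset[OF N_basis] cis_vec_mult_in_V)
    show "torus_angle b (s \<otimes>\<^bsub>torus N\<^esub> t) * z = torus_angle b s * (torus_angle b t * z)"
      if "s \<in> carrier (torus N)" "t \<in> carrier (torus N)" "z \<in> V" for s t z
      using that by (auto simp: torus_carrier_basis[OF N_basis] torus_angle_coset[OF N_basis]
          torus_mult[OF submodule_N] linear_add[OF linear_coord[OF indep]] cis_vec_simps mult.assoc)
    show "torus_angle b \<one>\<^bsub>torus N\<^esub> * z = z" if "z \<in> V" for z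
      by (simp add: torus_one torus_angle_coset[OF N_basis] linear_0[OF linear_coord[OF indep]] cis_vec_simps)
  qed
  then show ?thesis by (simp add: \<rho>_def[abs_def])
qed

text \<open>A kernel element is the coset of a lattice vector. By \<open>split\<close> its
  coordinates with respect to \<open>b\<close> outside \<open>I\<close> are integers, which rotate
  by full turns and may be dropped. So enlarging the face module by a complement does not enlarge
  the group.\<close>

lemma chart_group_eq_kernel: "chart_group = \<rho> ` kernel (torus N) (torus (saturation N)) (zeta N)"
proof (intro equalityI subsetI)
  fix g assume "g \<in> chart_group"
  then obtain \<psi> where \<psi>: "g = (\<lambda>z\<in>V. cis_vec \<psi> * z)" "comb b \<psi> \<in> range vec_of_int"
    by (rule chart_group_elem)
  have "lattice_coset N (comb b \<psi>) \<in> kernel (torus N) (torus (saturation N)) (zeta N)"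
    using \<psi>(2) by (simp only: coset_in_kernel_zeta_iff[OF submodule_N]) (simp only: saturation_N)
  moreover have "g = \<rho> (lattice_coset N (comb b \<psi>))"
    by (simp add: \<rho>_def \<psi>(1) torus_angle_coset[OF N_basis] coord_comb[OF indep])
  ultimately show "g \<in> \<rho> ` kernel (torus N) (torus (saturation N)) (zeta N)" by (rule image_eqI[rotated])
next
  fix g assume "g \<in> \<rho> ` kernel (torus N) (torus (saturation N)) (zeta N)"
  then obtain t where t: "t \<in> kernel (torus N) (torus (saturation N)) (zeta N)" "g = \<rho> t" by blast
  then have "t \<in> carrier (torus N)" by (simp add: kernel_def)
  then obtain v where v: "t = lattice_coset N v" by (auto simp: torus_carrier_basis[OF N_basis])
  have vi: "v \<in> range vec_of_int"
    using t(1) unfolding v coset_in_kernel_zeta_iff[OF submodule_N] by (simp only: saturation_N)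
  let ?\<kappa> = "coord b v"
  let ?\<psi> = "\<chi> i. if i \<in> I then ?\<kappa> $ i else 0"
  have \<kappa>: "comb b ?\<kappa> \<in> range vec_of_int" using vi by (simp add: comb_coord[OF indep])
  have int: "?\<kappa> - ?\<psi> \<in> range vec_of_int"
    using split[OF \<kappa>] by (simp add: in_range_vec_of_int_iff)
  have "comb b ?\<kappa> - comb b ?\<psi> \<in> range vec_of_int"
    using comb_int[OF int] by (simp only: linear_diff[OF linear_comb])
  then obtain m l where "comb b ?\<kappa> - comb b ?\<psi> = vec_of_int m" "comb b ?\<kappa> = vec_of_int l"
    using \<kappa> by (elim imageE)
  then have "comb b ?\<psi> = vec_of_int (l - m)" by (simp add: vec_of_int_simps algebra_simps)
  then have "(\<lambda>z\<in>V. cis_vec ?\<psi> * z) \<in> chart_group"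
    unfolding chart_group_def by (intro CollectI exI[of _ ?\<psi>]) simp
  moreover have "g = (\<lambda>z\<in>V. cis_vec ?\<psi> * z)"
  proof -
    have "cis_vec ?\<kappa> = cis_vec ?\<psi>" using int by (simp only: cis_vec_eq_iff)
    then show ?thesis by (simp add: t(2) v \<rho>_def torus_angle_coset[OF N_basis])
  qed
  ultimately show "g \<in> chart_group" by simp
qed

text \<open>The image of the kernel of \<open>zeta N\<close> under the homomorphism
  \<open>\<rho>\<close> into the bijections of the chart domain.\<close>

lemma subgroup_chart_group: "subgroup chart_group (BijGroup V)"
proof -
  have "zeta N \<in> hom (torus N) (torus (saturation N))"
  proof (rule homI)
    note sat = submodule_of_ints_saturation[of N]
    show "zeta N t \<in> carrier (torus (saturation N))" if "t \<in> carrier (torus N)" for t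
      using that by (auto simp: torus_carrier_basis[OF N_basis] zeta_coset[OF submodule_N] torus_carrier
          real_span_saturation real_span_N)
    show "zeta N (s \<otimes>\<^bsub>torus N\<^esub> t) = zeta N s \<otimes>\<^bsub>torus (saturation N)\<^esub> zeta N t"
      if "s \<in> carrier (torus N)" "t \<in> carrier (torus N)" for s t
      using that by (auto simp: torus_carrier_basis[OF N_basis] zeta_coset[OF submodule_N]
          torus_mult[OF submodule_N] torus_mult[OF sat])
  qed
  then have "group_hom (torus N) (torus (saturation N)) (zeta N)"
    using group_torus[OF submodule_N] group_torus[OF submodule_of_ints_saturation]
    by (simp add: group_hom_def group_hom_axioms_def)
  from group_hom.subgroup_kernel[OF this]
  have "subgroup (kernel (torus N) (torus (saturation N)) (zeta N)) (torus N)" .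
  then show ?thesis
    unfolding chart_group_eq_kernel
    using group_action_\<rho> group_hom.subgroup_img_is_subgroup by (simp add: group_action_def) blast
qed

lemma \<phi>_\<rho>:
  assumes "z \<in> V"
  shows "\<phi> (\<rho> (lattice_coset N v) z) = Xact (tor v) (\<phi> z)"
proof -
  obtain p \<theta> where p: "p \<in> U" "z = polar (c p) \<theta>" using assms by (rule V_cases)
  note s = \<sigma>_simps[OF p(1)]
  have "\<rho> (lattice_coset N v) z = polar (c p) (coord b v + \<theta>)"
    using assms p(2) by (simp add: \<rho>_def torus_angle_coset[OF N_basis] cis_vec_mult_polar)
  then have "\<phi> (\<rho> (lattice_coset N v) z) = F p (coord b v + \<theta>)" by (simp add: \<phi>_polar[OF p(1)])
  also have "\<dots> = cls (act (tor v) (act (tor (comb b \<theta>)) (\<sigma> p)))"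
    by (simp add: F_def linear_add[OF linear_comb] comb_coord[OF indep] act_add s)
  also have "\<dots> = Xact (tor v) (F p \<theta>)" using s by (simp add: F_def Xact_cls)
  finally show ?thesis by (simp add: p \<phi>_polar)
qed

subsection \<open>The chart map is a quotient map\<close>

lemma continuous_F: "continuous_map (prod_topology (top_of_set (model_corner I)) euclidean) X (\<lambda>(q, \<theta>). F (ci q) \<theta>)"
proof -
  let ?T = "prod_topology (top_of_set (model_corner I)) (euclidean :: (real ^ 'n) topology)"
  have "continuous_map (top_of_set (model_corner I)) (subtopology P U) ci"
    using smooth_chartD(7)[OF smooth_chart] by (simp add: image_chart)
  from continuous_map_compose[OF this section_onD(2)[OF sec]]
  have "continuous_map (top_of_set (model_corner I)) E (\<sigma> \<circ> ci)" .
  from continuous_map_compose[OF continuous_map_fst this]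
  have 1: "continuous_map ?T E (\<lambda>x. \<sigma> (ci (fst x)))" by (simp add: o_def)
  have "continuous_map euclidean euclidean (comb b)"
    by (simp add: linear_continuous_on linear_conv_bounded_linear[THEN iffD1] linear_comb)
  from continuous_map_compose[OF continuous_map_snd this]
  have 2: "continuous_map ?T euclidean (\<lambda>x. comb b (snd x))" by (simp add: o_def)
  have "continuous_map ?T X (cls \<circ> (\<lambda>x. act (tor (comb b (snd x))) (\<sigma> (ci (fst x)))))"
    by (rule continuous_map_compose[OF continuous_act_tor[OF 2 1] quotient_imp_continuous_map[OF quotient_map_cls]])
  then show ?thesis by (simp add: F_def[abs_def] o_def split_def)
qed

text \<open>Continuity at points with vanishing coordinates, where no continuous choice of angles exists,
  follows because angles can be taken in a compact cube.\<close>

lemma continuous_\<phi>: "continuous_map (top_of_set V) X \<phi>"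
  unfolding continuous_map_closedin
proof (intro conjI allI impI)
  show "\<phi> \<in> topspace (top_of_set V) \<rightarrow> topspace X"
  proof (rule funcsetI)
    fix z assume "z \<in> topspace (top_of_set V)"
    then have "\<phi> z \<in> \<phi> ` V" by simp
    then show "\<phi> z \<in> topspace X" by (rule subsetD[OF openin_subset[OF openin_\<phi>_image]])
  qed
  fix C assume C: "closedin X C"
  let ?T = "{z \<in> V. \<phi> z \<in> C}"
  have prod: "prod_topology (top_of_set (model_corner I)) (euclidean :: (real ^ 'n) topology) =
      top_of_set (model_corner I \<times> UNIV)"
    using prod_topology_subtopology(1)[of euclidean "model_corner I" "euclidean :: (real ^ 'n) topology"] by simp
  \<comment> \<open>The preimage of \<open>C\<close> in polar coordinates is closed because
    \<open>F\<close> is continuous in radius and angle together. Along a sequence in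
    \<open>?T\<close> normalised angles subconverge, and the limit of the pairs lies in this
    preimage.\<close>
  let ?K = "{x \<in> model_corner I \<times> UNIV. (\<lambda>(q, \<theta>). F (ci q) \<theta>) x \<in> C}"
  have "closedin (top_of_set (model_corner I \<times> (UNIV :: (real ^ 'n) set))) ?K"
    using closedin_continuous_map_preimage[OF continuous_F C] unfolding prod by simp
  then obtain K where K: "closed K" "?K = (model_corner I \<times> UNIV) \<inter> K"
    unfolding closedin_closed by (elim exE conjE)
  have "V \<inter> closure ?T \<subseteq> ?T"
  proof
    fix z assume z: "z \<in> V \<inter> closure ?T"
    then have "\<exists>f. (\<forall>n. f n \<in> ?T) \<and> f \<longlonglongrightarrow> z" by (simp only: closure_sequential Int_iff)
    then obtain f where f: "\<forall>n. f n \<in> ?T" "f \<longlonglongrightarrow> z" by (elim exE conjE)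
    define \<theta> where "\<theta> n = (\<chi> i. frac (angle_of (f n) $ i))" for n
    have "\<theta> n \<in> cbox 0 1" for n
      by (simp add: \<theta>_def mem_box_cart frac_ge_0 frac_lt_1 less_imp_le)
    then have \<theta>: "\<forall>n. \<theta> n \<in> cbox 0 1" by blast
    have "seq_compact (cbox 0 1 :: (real ^ 'n) set)"
      by (rule compact_imp_seq_compact[OF compact_cbox])
    then obtain l r where lr: "l \<in> cbox 0 1" "strict_mono r" "(\<theta> \<circ> r) \<longlonglongrightarrow> l"
      by (rule seq_compactE[OF _ \<theta>])
    have fr: "(\<lambda>n. f (r n)) \<longlonglongrightarrow> z"
      using LIMSEQ_subseq_LIMSEQ[OF f(2) lr(2)] by (simp add: o_def)
    have sqr: "(\<lambda>n. sqn (f (r n))) \<longlonglongrightarrow> sqn z"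
      by (rule continuous_on_tendsto_compose[OF continuous_on_sqn[of UNIV] fr]) simp_all
    have lim: "(\<lambda>n. (sqn (f (r n)), \<theta> (r n))) \<longlonglongrightarrow> (sqn z, l)"
      using sqr lr(3) by (intro tendsto_Pair) (simp_all add: o_def)
    have pol: "polar (sqn (f n)) (\<theta> n) = f n" for n
    proof -
      have "polar (sqn (f n)) (\<theta> n) = polar (sqn (f n)) (angle_of (f n))"
        unfolding polar_eq_iff[OF sqn_orthant] by (simp add: \<theta>_def frac_def)
      then show ?thesis by (simp add: polar_sqn)
    qed
    have mem: "sqn w \<in> model_corner I" if "w \<in> V" for w using that by (simp add: sqn_model_iff)
    have \<phi>_eq: "\<phi> (polar (sqn w) \<kappa>) = F (ci (sqn w)) \<kappa>" if "w \<in> V" for w \<kappa>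
      using \<phi>_polar[OF ci_in[OF mem[OF that]]] by (simp add: c_ci[OF mem[OF that]])
    have "(sqn (f (r n)), \<theta> (r n)) \<in> K" for n
    proof -
      have fn: "f (r n) \<in> V" "\<phi> (f (r n)) \<in> C" using f(1) by auto
      have "F (ci (sqn (f (r n)))) (\<theta> (r n)) \<in> C"
        using \<phi>_eq[OF fn(1), of "\<theta> (r n)"] fn(2) by (simp add: pol)
      then have "(sqn (f (r n)), \<theta> (r n)) \<in> ?K" using mem[OF fn(1)] by simp
      then show ?thesis unfolding K(2) by simp
    qed
    then have "(sqn z, l) \<in> K" by (intro closed_sequentially[OF K(1) _ lim])
    moreover have "sqn z \<in> model_corner I" using z by (simp add: sqn_model_iff)
    ultimately have "(sqn z, l) \<in> ?K" unfolding K(2) by simp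
    then have Fz: "F (ci (sqn z)) l \<in> C" by simp
    have "(\<lambda>n. polar (sqn (f (r n))) (\<theta> (r n))) \<longlonglongrightarrow> polar (sqn z) l"
      using continuous_on_tendsto_compose[OF continuous_on_polar[of UNIV] lim] by simp
    then have "polar (sqn z) l = z"
      unfolding pol by (rule LIMSEQ_unique[OF _ fr])
    then have "\<phi> z \<in> C" using \<phi>_eq[of z l] Fz z by simp
    then show "z \<in> ?T" using z by simp
  qed
  then have "?T = V \<inter> closure ?T" using closure_subset[of ?T] by blast
  then have "closedin (top_of_set V) ?T"
    unfolding closedin_closed by (intro exI[of _ "closure ?T"]) simp
  then show "closedin (top_of_set V) {z \<in> topspace (top_of_set V). \<phi> z \<in> C}" by simp
qed

text \<open>Openness is tested in \<open>E\<close>. Local angle coordinates give a continuous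
  \<open>\<Psi>\<close> into the chart domain with \<open>\<phi> (\<Psi> y) = cls y\<close>. It
  meets the fibre of \<open>z\<close>, though perhaps not \<open>z\<close> itself; a rotation from
  the chart group moves \<open>\<Psi> x\<close> to \<open>z\<close>, and by continuity the rotated
  \<open>\<Psi> y\<close> stays in \<open>O'\<close> for \<open>y\<close> near
  \<open>x\<close>.\<close>

lemma open_map_\<phi>: "open_map (top_of_set V) X \<phi>"
  unfolding open_map_def
proof (intro allI impI)
  fix O' assume "openin (top_of_set V) O'"
  then have O: "open O'" "O' \<subseteq> V" using open_model_domain[of I] by (simp_all add: openin_open_eq)
  have "\<phi> ` O' \<subseteq> \<phi> ` V" by (rule image_mono[OF O(2)])
  also have "\<phi> ` V \<subseteq> cls ` topspace E" unfolding topspace_X[symmetric] by (rule openin_subset[OF openin_\<phi>_image])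
  finally have OX: "\<phi> ` O' \<subseteq> cls ` topspace E" .
  have "openin E {x \<in> topspace E. cls x \<in> \<phi> ` O'}"
    unfolding openin_subopen[of E "{x \<in> topspace E. cls x \<in> \<phi> ` O'}"]
  proof
    fix x assume x: "x \<in> {x \<in> topspace E. cls x \<in> \<phi> ` O'}"
    then obtain z where z: "z \<in> O'" "cls x = \<phi> z" by auto
    have xE: "x \<in> topspace E" using x by simp
    have "\<phi> z \<in> \<phi> ` V" using z(1) O(2) by blast
    then have "\<pi> (cls x) \<in> U" unfolding \<phi>_image z(2)[symmetric] by simp
    then have xU: "\<mu> x \<in> U" using xE by (simp add: \<pi>_cls)
    obtain M a where M: "openin E M" "x \<in> M" "M \<subseteq> {x \<in> topspace E. \<mu> x \<in> U}"
      "continuous_map (subtopology E M) euclidean a" "\<forall>y\<in>M. y = act (tor (a y)) (\<sigma> (\<mu> y))"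
      using sec xE xU by (rule local_coordinate)
    define \<Psi> where "\<Psi> y = polar (c (\<mu> y)) (coord b (a y))" for y
    have \<Psi>V: "\<Psi> y \<in> V" if "y \<in> M" for y
      using that M(3) by (auto simp: \<Psi>_def intro: polar_in_V)
    have \<phi>\<Psi>: "\<phi> (\<Psi> y) = cls y" if y: "y \<in> M" for y
    proof -
      have "\<mu> y \<in> U" using y M(3) by blast
      then have "\<phi> (\<Psi> y) = cls (act (tor (a y)) (\<sigma> (\<mu> y)))"
        by (simp add: \<Psi>_def \<phi>_polar F_def comb_coord[OF indep])
      then show ?thesis using M(5) y by simp
    qed
    have topM: "topspace (subtopology E M) = M" using openin_subset[OF M(1)] by auto
    have "continuous_map (subtopology E M) (subtopology P U) \<mu>"
      unfolding continuous_map_in_subtopology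
      using continuous_map_from_subtopology[OF continuous_\<mu>, of M] topM M(3) by auto
    from continuous_map_compose[OF this smooth_chartD(6)[OF smooth_chart]]
    have 1: "continuous_map (subtopology E M) euclidean (\<lambda>y. c (\<mu> y))" by (simp add: o_def)
    have "continuous_map euclidean euclidean (coord b)"
      by (simp add: linear_continuous_on linear_conv_bounded_linear[THEN iffD1] linear_coord[OF indep])
    from continuous_map_compose[OF M(4) this]
    have 2: "continuous_map (subtopology E M) euclidean (\<lambda>y. coord b (a y))" by (simp add: o_def)
    have "continuous_map (subtopology E M) (prod_topology euclidean euclidean) (\<lambda>y. (c (\<mu> y), coord b (a y)))"
      using 1 2 by (simp only: continuous_map_paired)
    moreover have "continuous_map (prod_topology euclidean euclidean) euclidean
        (\<lambda>x :: (real ^ 'n) \<times> (real ^ 'n). polar (fst x) (snd x))"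
      using continuous_on_polar by simp
    ultimately have "continuous_map (subtopology E M) euclidean ((\<lambda>x. polar (fst x) (snd x)) \<circ> (\<lambda>y. (c (\<mu> y), coord b (a y))))"
      by (rule continuous_map_compose)
    then have \<Psi>c: "continuous_map (subtopology E M) euclidean \<Psi>" by (simp add: o_def \<Psi>_def[abs_def])
    have "\<phi> (\<Psi> x) = \<phi> z" using \<phi>\<Psi>[OF M(2)] z(2) by simp
    then obtain g where g: "g \<in> chart_group" "g (\<Psi> x) = z"
      using \<phi>_eq_iff[OF \<Psi>V[OF M(2)], of z] z(1) O(2) by blast
    obtain \<psi> where \<psi>: "g = (\<lambda>z\<in>V. cis_vec \<psi> * z)" using g(1) by (rule chart_group_elem)
    have oO: "open {w. cis_vec \<psi> * w \<in> O'}"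
      using continuous_open_vimage[OF O(1), of "\<lambda>w. cis_vec \<psi> * w"]
        smooth_on_imp_continuous_on[OF smooth_on_cis_vec_mult[of UNIV \<psi>]]
      by (simp add: vimage_def continuous_on_eq_continuous_at)
    let ?N = "{y \<in> M. \<Psi> y \<in> {w. cis_vec \<psi> * w \<in> O'}}"
    have "openin (subtopology E M) {y \<in> topspace (subtopology E M). \<Psi> y \<in> {w. cis_vec \<psi> * w \<in> O'}}"
      by (rule openin_continuous_map_preimage[OF \<Psi>c]) (use oO in simp)
    then have "openin (subtopology E M) ?N" by (simp only: topM)
    then have oN: "openin E ?N" by (simp only: openin_open_subtopology[OF M(1)])
    have "x \<in> ?N" using g(2) \<psi> \<Psi>V[OF M(2)] M(2) z(1) by simp
    moreover have "?N \<subseteq> {x \<in> topspace E. cls x \<in> \<phi> ` O'}"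
    proof
      fix y assume y: "y \<in> ?N"
      then have yM: "y \<in> M" "cis_vec \<psi> * \<Psi> y \<in> O'" by simp_all
      have "g (\<Psi> y) = cis_vec \<psi> * \<Psi> y" using \<psi> \<Psi>V[OF yM(1)] by simp
      then have "\<phi> (\<Psi> y) = \<phi> (cis_vec \<psi> * \<Psi> y)"
        using \<phi>_eq_iff[OF \<Psi>V[OF yM(1)] cis_vec_mult_in_V[OF \<Psi>V[OF yM(1)]]] g(1) by blast
      then have "cls y \<in> \<phi> ` O'" using \<phi>\<Psi>[OF yM(1)] yM(2) by (intro image_eqI[of _ _ "cis_vec \<psi> * \<Psi> y"]) simp_all
      then show "y \<in> {x \<in> topspace E. cls x \<in> \<phi> ` O'}" using yM(1) M(3) by blast
    qed
    ultimately show "\<exists>T. openin E T \<and> x \<in> T \<and> T \<subseteq> {x \<in> topspace E. cls x \<in> \<phi> ` O'}"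
      using oN by (intro exI[of _ ?N]) simp
  qed
  then show "openin X (\<phi> ` O')"
    unfolding X_def openin_quotient_topology using OX by simp
qed

lemma orbifold_chart_\<phi>: "orbifold_chart X (V, chart_group, \<phi>)"
  unfolding orbifold_chart_def prod.case
proof (intro conjI ballI)
  show "smooth_on V g" if g: "g \<in> chart_group" for g
  proof -
    obtain \<psi> where \<psi>: "g = (\<lambda>z\<in>V. cis_vec \<psi> * z)" using g by (rule chart_group_elem)
    show ?thesis
      by (rule smooth_on_cong[OF smooth_on_cis_vec_mult[of V \<psi>]]) (simp add: \<psi>)
  qed
  show "quotient_map (top_of_set V) (subtopology X (\<phi> ` V)) \<phi>"
  proof (rule continuous_open_imp_quotient_map)
    show "continuous_map (top_of_set V) (subtopology X (\<phi> ` V)) \<phi>"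
      using continuous_\<phi> by (simp add: continuous_map_in_subtopology)
    show "open_map (top_of_set V) (subtopology X (\<phi> ` V)) \<phi>"
      unfolding open_map_def
    proof (intro allI impI)
      fix O' assume O: "openin (top_of_set V) O'"
      then have "openin X (\<phi> ` O')" using open_map_\<phi> unfolding open_map_def by simp
      moreover have "O' \<subseteq> V" using openin_subset[OF O] by simp
      ultimately show "openin (subtopology X (\<phi> ` V)) (\<phi> ` O')"
        by (simp add: openin_open_subtopology[OF openin_\<phi>_image] image_mono)
    qed
    show "\<phi> ` topspace (top_of_set V) = topspace (subtopology X (\<phi> ` V))"
      using openin_subset[OF openin_\<phi>_image] by auto
  qed
  show "\<phi> u = \<phi> v \<longleftrightarrow> (\<exists>g\<in>chart_group. g u = v)" if "u \<in> V" "v \<in> V" for u v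
    by (rule \<phi>_eq_iff[OF that])
qed (simp_all add: open_model_domain connected_model_domain model_domain_nonempty finite_chart_group
    subgroup_chart_group openin_\<phi>_image)

text \<open>The chart domain is already an open subset of complex space on which the torus acts by
  coordinatewise rotation, so the equivariant diffeomorphism is the identity.\<close>

lemma standard_\<phi>: "standard_orbi_chart Xact (V, chart_group, \<phi>)"
  unfolding standard_orbi_chart_def prod.case
proof (intro exI conjI ballI)
  show "submodule_of_ints N" by (rule submodule_N)
  show "lattice_rank N = CARD('n)" by (simp add: lattice_rank_def real_span_N)
  show "group_action (torus N) V \<rho>" by (rule group_action_\<rho>)
  show "torus_angle b \<in> iso (torus N) circle_power" by (rule torus_angle_iso[OF N_basis])
  show "homeomorphic_map (torus_topology N) (top_of_set (carrier circle_power)) (torus_angle b)"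
    by (rule torus_angle_homeomorphic[OF N_basis])
  show "open V" by (rule open_model_domain)
  have "the_inv_into V (\<lambda>x. x) z = z" if "z \<in> V" for z
    using the_inv_into_f_f[of "\<lambda>x. x" V z] that by simp
  then have "smooth_on V (the_inv_into V (\<lambda>x. x))"
    by (intro smooth_on_cong[OF smooth_on_ident[of V]]) simp
  then show "diffeomorphism_on V V (\<lambda>x. x)"
    by (simp add: diffeomorphism_on_def smooth_on_ident bij_betw_def)
  show "\<rho> t z = torus_angle b t * z" if "t \<in> carrier (torus N)" "z \<in> V" for t z
    using that by (simp add: \<rho>_def)
  show "chart_group = \<rho> ` kernel (torus N) (torus (saturation N)) (zeta N)"
    by (rule chart_group_eq_kernel)
  show "\<phi> (\<rho> t z) = Xact (zeta N t) (\<phi> z)" if t: "t \<in> carrier (torus N)" and z: "z \<in> V" for t z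
  proof -
    obtain v where v: "t = lattice_coset N v" using t by (auto simp: torus_carrier_basis[OF N_basis])
    show ?thesis unfolding v zeta_N by (rule \<phi>_\<rho>[OF z])
  qed
qed

lemma invariant_\<phi>: "Xact (tor v) ` \<phi> ` V \<subseteq> \<phi> ` V"
proof safe
  fix z assume z: "z \<in> V"
  have "\<rho> (lattice_coset N v) z \<in> V"
    using z by (simp add: \<rho>_def torus_angle_coset[OF N_basis] cis_vec_mult_in_V)
  then show "Xact (tor v) (\<phi> z) \<in> \<phi> ` V" unfolding \<phi>_\<rho>[OF z, symmetric] by (rule imageI)
qed

end

section \<open>Compatibility of charts\<close>

text \<open>Two charts near a common base point \<open>p0\<close>. The coordinates vanishing at \<open>p0\<close> correspond under
  \<open>m\<close>, with equal lattice vectors and with ratios \<open>r\<close> that are smooth and positive; \<open>u\<close> is a lift of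
  the transition function between the sections.\<close>

locale quotient_chart_pair =
  A: quotient_chart P \<A> E act \<mu> S U c I \<sigma> b + B: quotient_chart P \<A> E act \<mu> S U' c' I' \<sigma>' b'
  for P :: "'p topology" and \<A> :: "('p, 'n::finite) corner_chart set"
    and E :: "'e topology" and act :: "(real ^ 'n) set \<Rightarrow> 'e \<Rightarrow> 'e" and \<mu> :: "'e \<Rightarrow> 'p"
    and S :: "'p \<Rightarrow> (real ^ 'n) set" and U c I \<sigma> b U' c' I' \<sigma>' b' +
  fixes W :: "'p set" and u :: "'p \<Rightarrow> real ^ 'n" and J J' :: "'n set" and m m' :: "'n \<Rightarrow> 'n"
    and r :: "'n \<Rightarrow> 'p \<Rightarrow> real"
  assumes W: "openin P W" "W \<subseteq> U" "W \<subseteq> U'"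
    and u: "A.psmooth W u" "y \<in> W \<Longrightarrow> \<sigma>' y = act (tor (u y)) (\<sigma> y)"
    and J: "y \<in> W \<Longrightarrow> i \<notin> J \<Longrightarrow> c y $ i \<noteq> 0" and J': "y \<in> W \<Longrightarrow> j \<notin> J' \<Longrightarrow> c' y $ j \<noteq> 0"
    and m: "i \<in> J \<Longrightarrow> m i \<in> J'" "i \<in> J \<Longrightarrow> m' (m i) = i" "j \<in> J' \<Longrightarrow> m' j \<in> J" "j \<in> J' \<Longrightarrow> m (m' j) = j"
    and b: "i \<in> J \<Longrightarrow> b' (m i) = b i"
    and r: "i \<in> J \<Longrightarrow> A.psmooth W (r i)" "i \<in> J \<Longrightarrow> y \<in> W \<Longrightarrow> 0 < r i y"
      "i \<in> J \<Longrightarrow> y \<in> W \<Longrightarrow> c' y $ m i = r i y * c y $ i"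
begin

text \<open>With the two charts exchanged, the lift changes sign and the ratios are inverted. The
  inverse of the map \<open>h\<close> below is thus itself a map of the same form.\<close>

lemma swap: "quotient_chart_pair P \<A> E act \<mu> S U' c' I' \<sigma>' b' U c I \<sigma> b W (\<lambda>y. - u y) J' J m' m
    (\<lambda>j y. inverse (r (m' j) y))"
proof unfold_locales
  show "\<sigma> y = act (tor (- u y)) (\<sigma>' y)" if y: "y \<in> W" for y
    using A.act_minus_cancel[of "\<sigma> y" "u y"] A.\<sigma>_simps(1)[of y] u(2)[OF y] W(2) y by auto
  show "A.psmooth W (\<lambda>y. - u y)" by (rule A.psmooth_minus[OF u(1)])
  show "A.psmooth W (\<lambda>y. inverse (r (m' j) y))" if "j \<in> J'" for j
    by (rule A.psmooth_inverse[OF r(1)[OF m(3)[OF that]]]) (use r(2)[OF m(3)[OF that]] in force)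
  show "0 < inverse (r (m' j) y)" if "j \<in> J'" "y \<in> W" for j y
    using r(2)[OF m(3)] that by simp
  show "c y $ m' j = inverse (r (m' j) y) * c' y $ j" if "j \<in> J'" "y \<in> W" for j y
    using r(2,3)[OF m(3)[OF that(1)] that(2)] m(4)[OF that(1)] by simp
  show "b (m' j) = b' j" if "j \<in> J'" for j
    using b[OF m(3)[OF that]] m(4)[OF that] by simp
qed (use W J J' m in auto)

section \<open>The lift of a chart transition to the complex coordinates\<close>

definition arg :: "real ^ 'n \<Rightarrow> 'n \<Rightarrow> complex ^ 'n \<Rightarrow> real" where
  "arg \<theta>0 i z = \<theta>0 $ i + Im (Ln (z $ i * cis (- (2 * pi * \<theta>0 $ i)))) / (2 * pi)"

text \<open>Branch cuts are avoided only for coordinates outside \<open>J\<close>, which are nonzero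
  over \<open>W\<close>. Nothing is asked of the angles in \<open>J\<close>, whose coordinates may
  vanish.\<close>

definition dom :: "real ^ 'n \<Rightarrow> (complex ^ 'n) set" where
  "dom \<theta>0 = {z. sqn z \<in> c ` W \<and> (\<forall>i\<in>-J. z $ i * cis (- (2 * pi * \<theta>0 $ i)) \<notin> \<real>\<^sub>\<le>\<^sub>0)}"

definition base :: "complex ^ 'n \<Rightarrow> 'p" where
  "base z = A.ci (sqn z)"

definition free_angles :: "real ^ 'n \<Rightarrow> complex ^ 'n \<Rightarrow> real ^ 'n" where
  "free_angles \<theta>0 z = (\<chi> i. if i \<in> J then 0 else arg \<theta>0 i z)"

text \<open>The translation given by the free angles, corrected by \<open>u\<close>, is expanded in
  the other basis. Its components in \<open>J'\<close> need not vanish: the change of basis and of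
  section may also rotate the matched coordinates.\<close>

definition w :: "real ^ 'n \<Rightarrow> complex ^ 'n \<Rightarrow> real ^ 'n" where
  "w \<theta>0 z = coord b' (comb b (free_angles \<theta>0 z) - u (base z))"

text \<open>For a coordinate in \<open>J'\<close> no angle of \<open>z\<close> is taken; the matched
  coordinate itself is multiplied by a factor, which keeps the formula smooth where it vanishes. The
  square root appears since \<open>r\<close> is a ratio of squared moduli. The other coordinates are
  rebuilt from modulus and angle.\<close>

definition h :: "real ^ 'n \<Rightarrow> complex ^ 'n \<Rightarrow> complex ^ 'n" where
  "h \<theta>0 z = (\<chi> j. (if j \<in> J' then z $ m' j * of_real (sqrt (r (m' j) (base z)))
      else of_real (sqrt (c' (base z) $ j))) * cis (2 * pi * w \<theta>0 z $ j))"

lemma base_simps: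
  assumes "z \<in> dom \<theta>0"
  shows "base z \<in> W" "base z \<in> U" "base z \<in> U'" "c (base z) = sqn z" "z \<in> A.V"
proof -
  obtain y where y: "y \<in> W" "sqn z = c y" using assms by (auto simp: dom_def)
  have yU: "y \<in> U" using y(1) W(2) by blast
  have "base z = y" by (simp add: base_def y(2) A.ci_c[OF yU])
  then show "base z \<in> W" "base z \<in> U" "base z \<in> U'" "c (base z) = sqn z" using y W by auto
  have "sqn z \<in> model_corner I" using A.c_model[OF yU] y(2) by simp
  then show "z \<in> A.V" by (simp add: sqn_model_iff)
qed

text \<open>Matched coordinates carry the same lattice vector, so transporting their angles along
  the matching leaves the translation unchanged.\<close>

lemma comb_match:
  "comb b' (\<chi> j. if j \<in> J' then \<omega> $ m' j else 0) = comb b (\<chi> i. if i \<in> J then \<omega> $ i else 0)"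
proof -
  have "comb b' (\<chi> j. if j \<in> J' then \<omega> $ m' j else 0) = (\<Sum>j\<in>UNIV. if j \<in> J' then \<omega> $ m' j *\<^sub>R vec_of_int (b' j) else 0)"
    unfolding comb_def by (rule sum.cong) auto
  also have "\<dots> = (\<Sum>j\<in>J'. \<omega> $ m' j *\<^sub>R vec_of_int (b' j))"
    by (simp flip: sum.inter_restrict[of UNIV, simplified])
  also have "\<dots> = (\<Sum>i\<in>J. \<omega> $ i *\<^sub>R vec_of_int (b i))"
  proof (rule sum.reindex_bij_witness[of _ m m'])
    show "\<omega> $ m' j *\<^sub>R vec_of_int (b (m' j)) = \<omega> $ m' j *\<^sub>R vec_of_int (b' j)" if "j \<in> J'" for j
      using b[OF m(3)[OF that]] m(4)[OF that] by simp
  qed (use m in auto)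
  also have "\<dots> = (\<Sum>i\<in>UNIV. if i \<in> J then \<omega> $ i *\<^sub>R vec_of_int (b i) else 0)"
    by (simp flip: sum.inter_restrict[of UNIV, simplified])
  also have "\<dots> = comb b (\<chi> i. if i \<in> J then \<omega> $ i else 0)"
    unfolding comb_def by (rule sum.cong) auto
  finally show ?thesis .
qed

lemma comb_w: "comb b' (w \<theta>0 z) = comb b (free_angles \<theta>0 z) - u (base z)"
  by (simp add: w_def comb_coord[OF B.indep])

lemma z_polar:
  assumes z: "z \<in> dom \<theta>0"
  shows "z = polar (sqn z) (\<chi> i. if i \<in> J then angle_of z $ i else arg \<theta>0 i z)"
proof -
  have "z $ i = polar (sqn z) (\<chi> i. if i \<in> J then angle_of z $ i else arg \<theta>0 i z) $ i" for i
  proof (cases "i \<in> J")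
    case True
    have "polar (sqn z) (\<chi> i. if i \<in> J then angle_of z $ i else arg \<theta>0 i z) $ i = polar (sqn z) (angle_of z) $ i"
      using True by (simp add: polar_nth)
    then show ?thesis by (simp add: polar_sqn)
  next
    case False
    have "c (base z) $ i \<noteq> 0" by (rule J[OF base_simps(1)[OF z] False])
    then have "z $ i \<noteq> 0" unfolding base_simps(4)[OF z] by (simp add: sqn_eq_0_iff)
    from angle_branch[OF this, of "\<theta>0 $ i"] show ?thesis
      using False by (simp add: polar_nth sqn_nth arg_def)
  qed
  then show ?thesis by (simp only: vec_eq_iff) simp
qed

text \<open>The definition of \<open>h\<close> displays smoothness; this form, which uses the
  discontinuous \<open>angle_of\<close> on the matched coordinates, serves to compute the class that
  \<open>h\<close> represents.\<close>

lemma h_polar: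
  assumes z: "z \<in> dom \<theta>0"
  shows "h \<theta>0 z = polar (c' (base z)) (w \<theta>0 z + (\<chi> j. if j \<in> J' then angle_of z $ m' j else 0))"
proof -
  note y = base_simps[OF z]
  have "h \<theta>0 z $ j = polar (c' (base z)) (w \<theta>0 z + (\<chi> j. if j \<in> J' then angle_of z $ m' j else 0)) $ j" for j
  proof (cases "j \<in> J'")
    case True
    have "c' (base z) $ j = r (m' j) (base z) * sqn z $ m' j"
      using r(3)[OF m(3)[OF True] y(1)] m(4)[OF True] y(4) by simp
    then have s: "sqrt (c' (base z) $ j) = sqrt (r (m' j) (base z)) * sqrt (sqn z $ m' j)"
      by (simp add: real_sqrt_mult)
    have "z $ m' j = of_real (sqrt (sqn z $ m' j)) * cis (2 * pi * angle_of z $ m' j)"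
      using polar_nth[of "sqn z" "angle_of z" "m' j"] by (simp add: polar_sqn)
    then have "h \<theta>0 z $ j = of_real (sqrt (sqn z $ m' j)) * cis (2 * pi * angle_of z $ m' j) *
        of_real (sqrt (r (m' j) (base z))) * cis (2 * pi * w \<theta>0 z $ j)"
      using True by (simp add: h_def)
    also have "\<dots> = of_real (sqrt (c' (base z) $ j)) *
        (cis (2 * pi * w \<theta>0 z $ j) * cis (2 * pi * angle_of z $ m' j))"
      unfolding s by (simp add: mult_ac)
    also have "\<dots> = of_real (sqrt (c' (base z) $ j)) * cis (2 * pi * (w \<theta>0 z $ j + angle_of z $ m' j))"
      by (simp add: cis_mult distrib_left)
    finally show ?thesis using True by (simp add: polar_nth)
  next
    case False
    then show ?thesis by (simp add: polar_nth h_def)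
  qed
  then show ?thesis by (simp only: vec_eq_iff) simp
qed

lemma h_in_V:
  assumes z: "z \<in> dom \<theta>0"
  shows "h \<theta>0 z \<in> B.V"
  unfolding h_polar[OF z] by (rule B.polar_in_V[OF base_simps(3)[OF z]])

lemma sqn_h:
  assumes z: "z \<in> dom \<theta>0"
  shows "sqn (h \<theta>0 z) = c' (base z)"
  unfolding h_polar[OF z] by (rule sqn_polar[OF B.c_orthant[OF base_simps(3)[OF z]]])

text \<open>The new angles represent the old translation minus \<open>u\<close>, and the new section
  is the old one moved by \<open>u\<close>; the two corrections cancel.\<close>

lemma \<phi>_h:
  assumes z: "z \<in> dom \<theta>0"
  shows "B.\<phi> (h \<theta>0 z) = A.\<phi> z"
proof -
  note y = base_simps[OF z]
  let ?\<theta> = "\<chi> i. if i \<in> J then angle_of z $ i else arg \<theta>0 i z"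
  let ?\<theta>' = "w \<theta>0 z + (\<chi> j. if j \<in> J' then angle_of z $ m' j else 0)"
  have \<theta>: "?\<theta> = free_angles \<theta>0 z + (\<chi> i. if i \<in> J then angle_of z $ i else 0)"
    by (simp add: vec_eq_iff free_angles_def)
  have "comb b' ?\<theta>' = comb b (free_angles \<theta>0 z) - u (base z) + comb b (\<chi> i. if i \<in> J then angle_of z $ i else 0)"
    unfolding linear_add[OF linear_comb] comb_w comb_match ..
  also have "\<dots> = comb b ?\<theta> - u (base z)"
    unfolding \<theta> linear_add[OF linear_comb] by (simp add: algebra_simps)
  finally have c\<theta>: "comb b' ?\<theta>' = comb b ?\<theta> - u (base z)" .
  have sE: "\<sigma> (base z) \<in> topspace E" by (rule A.\<sigma>_simps(1)[OF y(2)])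
  have "B.\<phi> (h \<theta>0 z) = B.F (base z) ?\<theta>'"
    unfolding h_polar[OF z] by (rule B.\<phi>_polar[OF y(3)])
  also have "\<dots> = A.cls (act (tor (comb b ?\<theta> - u (base z))) (act (tor (u (base z))) (\<sigma> (base z))))"
    unfolding B.F_def c\<theta> u(2)[OF y(1)] ..
  also have "\<dots> = A.cls (act (tor (comb b ?\<theta>)) (\<sigma> (base z)))"
    using A.act_add[OF sE, of "comb b ?\<theta> - u (base z)" "u (base z)"] by simp
  also have "\<dots> = A.F (base z) ?\<theta>" by (simp only: A.F_def)
  also have "\<dots> = A.\<phi> (polar (c (base z)) ?\<theta>)" by (rule A.\<phi>_polar[OF y(2), symmetric])
  also have "\<dots> = A.\<phi> z" unfolding y(4) z_polar[OF z, symmetric] ..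
  finally show ?thesis .
qed

lemma smooth_on_sqn: "smooth_on D sqn" for D :: "(complex ^ 'n) set"
proof -
  have "smooth_on D (\<lambda>z :: complex ^ 'n. \<chi> i. (z $ i) \<bullet> (z $ i))"
    by (intro smooth_on_vec_lambda smooth_on_bilinear[OF bounded_bilinear_inner] smooth_on_vec_nth smooth_on_ident)
  then show ?thesis by (simp add: sqn_def[abs_def] power2_norm_eq_inner)
qed

lemma smooth_on_base:
  assumes "A.psmooth W f"
  shows "smooth_on (dom \<theta>0) (\<lambda>z. f (base z))"
proof -
  have "smooth_on (c ` (U \<inter> W)) (\<lambda>q. f (A.ci q))"
    by (rule A.psmoothD[OF assms A.smooth_chart])
  then have "smooth_on (c ` W) (\<lambda>q. f (A.ci q))" using W(2) by (simp add: Int_absorb1)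
  from smooth_on_compose[OF smooth_on_sqn this, of "dom \<theta>0"] show ?thesis
    by (auto simp: base_def dom_def)
qed

lemma smooth_on_arg:
  assumes "i \<notin> J"
  shows "smooth_on (dom \<theta>0) (arg \<theta>0 i)"
  unfolding arg_def[abs_def]
  by (rule smooth_on_compose[OF smooth_on_vec_nth[OF smooth_on_ident] angle_branch_smooth[of "\<theta>0 $ i"]])
    (use assms in \<open>auto simp: dom_def\<close>)

lemma smooth_on_w: "smooth_on (dom \<theta>0) (w \<theta>0)"
proof -
  have "smooth_on (dom \<theta>0) (\<lambda>z. if i \<in> J then 0 else arg \<theta>0 i z)" for i
    by (cases "i \<in> J") (simp_all add: smooth_on_const smooth_on_arg)
  then have "smooth_on (dom \<theta>0) (free_angles \<theta>0)"
    unfolding free_angles_def[abs_def] by (rule smooth_on_vec_lambda)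
  then have "smooth_on (dom \<theta>0) (\<lambda>z. comb b (free_angles \<theta>0 z) - u (base z))"
    by (intro smooth_on_diff smooth_on_base[OF u(1)] smooth_on_bounded_linear[OF linear_conv_bounded_linear[THEN iffD1, OF linear_comb]])
  then show ?thesis
    unfolding w_def[abs_def]
    by (rule smooth_on_bounded_linear[OF linear_conv_bounded_linear[THEN iffD1, OF linear_coord[OF B.indep]]])
qed

lemma smooth_on_h: "smooth_on (dom \<theta>0) (h \<theta>0)"
  unfolding h_def[abs_def]
proof (intro smooth_on_vec_lambda smooth_on_mult smooth_on_cis smooth_on_const smooth_on_vec_nth[OF smooth_on_w])
  fix j
  show "smooth_on (dom \<theta>0) (\<lambda>z. if j \<in> J' then z $ m' j * of_real (sqrt (r (m' j) (base z)))
      else complex_of_real (sqrt (c' (base z) $ j)))"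
  proof (cases "j \<in> J'")
    case True
    have "smooth_on (dom \<theta>0) (\<lambda>z. z $ m' j * complex_of_real (sqrt (r (m' j) (base z))))"
    proof (intro smooth_on_mult smooth_on_vec_nth[OF smooth_on_ident] smooth_on_bounded_linear[OF bounded_linear_of_real] smooth_on_sqrt)
      show "smooth_on (dom \<theta>0) (\<lambda>z. r (m' j) (base z))" by (rule smooth_on_base[OF r(1)[OF m(3)[OF True]]])
      show "0 < r (m' j) (base z)" if "z \<in> dom \<theta>0" for z
        by (rule r(2)[OF m(3)[OF True] base_simps(1)[OF that]])
    qed
    then show ?thesis using True by simp
  next
    case False
    have "A.psmooth W c'" by (rule A.psmooth_subset[OF A.psmooth_chart[OF B.smooth_chart] W(3)])
    then have "smooth_on (dom \<theta>0) (\<lambda>z. c' (base z) $ j)" by (intro smooth_on_vec_nth smooth_on_base)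
    moreover have "0 < c' (base z) $ j" if z: "z \<in> dom \<theta>0" for z
      using B.c_orthant[OF base_simps(3)[OF z]] J'[OF base_simps(1)[OF z] False] by (simp add: orthant_def less_le)
    ultimately have "smooth_on (dom \<theta>0) (\<lambda>z. complex_of_real (sqrt (c' (base z) $ j)))"
      by (intro smooth_on_bounded_linear[OF bounded_linear_of_real] smooth_on_sqrt)
    then show ?thesis using False by simp
  qed
qed

lemma open_dom: "open (dom \<theta>0)"
proof -
  obtain O' where O: "open O'" "c ` W = orthant \<inter> O'"
    using A.smooth_chart_open_image[OF A.smooth_chart W(1,2)] by (auto simp: openin_open)
  have o: "open {z. z * cis (- (2 * pi * \<theta>0 $ i)) \<notin> \<real>\<^sub>\<le>\<^sub>0}" for i
  proof -
    have "open ((\<lambda>z. z * cis (- (2 * pi * \<theta>0 $ i))) -` (- \<real>\<^sub>\<le>\<^sub>0))"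
      by (rule continuous_open_vimage) (auto intro!: continuous_intros simp: open_Compl)
    then show ?thesis by (simp add: vimage_def)
  qed
  have "open (sqn -` O')"
    by (rule open_vimage[OF O(1) continuous_on_sqn])
  moreover have "open (\<Inter>i\<in>-J. (\<lambda>z :: complex ^ 'n. z $ i) -` {z. z * cis (- (2 * pi * \<theta>0 $ i)) \<notin> \<real>\<^sub>\<le>\<^sub>0})"
    by (intro open_INT ballI finite continuous_open_vimage o) (auto intro!: continuous_intros)
  ultimately have "open (sqn -` O' \<inter> (\<Inter>i\<in>-J. (\<lambda>z :: complex ^ 'n. z $ i) -` {z. z * cis (- (2 * pi * \<theta>0 $ i)) \<notin> \<real>\<^sub>\<le>\<^sub>0}))"
    by (rule open_Int)
  moreover have "sqn -` O' \<inter> (\<Inter>i\<in>-J. (\<lambda>z :: complex ^ 'n. z $ i) -` {z. z * cis (- (2 * pi * \<theta>0 $ i)) \<notin> \<real>\<^sub>\<le>\<^sub>0}) = dom \<theta>0"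
    using sqn_orthant by (auto simp: dom_def O(2))
  ultimately show ?thesis by simp
qed

lemma angle_of_in_dom:
  assumes "z \<in> A.V" "A.ci (sqn z) \<in> W"
  shows "z \<in> dom (angle_of z)"
proof -
  have q: "c (A.ci (sqn z)) = sqn z" using assms(1) by (simp add: A.c_ci sqn_model_iff)
  have "z $ i * cis (- (2 * pi * angle_of z $ i)) \<notin> \<real>\<^sub>\<le>\<^sub>0" if "i \<notin> J" for i
  proof -
    have "z $ i \<noteq> 0" using J[OF assms(2) that] unfolding q by (simp add: sqn_eq_0_iff)
    then have n: "0 < norm (z $ i)" by simp
    have "z $ i = of_real (norm (z $ i)) * cis (2 * pi * angle_of z $ i)"
      using polar_nth[of "sqn z" "angle_of z" i] by (simp add: polar_sqn sqn_nth)
    then show ?thesis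
      using angle_branch_dom[OF n, of "angle_of z $ i" "angle_of z $ i"] by simp
  qed
  moreover have "sqn z \<in> c ` W" using q assms(2) by (metis image_eqI)
  ultimately show ?thesis by (simp add: dom_def)
qed

text \<open>With the branches of the angles chosen to match at one point, exchanging the two charts gives the
  inverse of the lift.\<close>

lemma h_inverse:
  assumes z: "z \<in> dom \<theta>0" and near: "\<forall>j. \<bar>w \<theta>0 z $ j - \<kappa> $ j\<bar> < 1/2"
  shows "h \<theta>0 z \<in> quotient_chart_pair.dom c' W J' \<kappa>"
    "quotient_chart_pair.h U' c' b' c b (\<lambda>y. - u y) J' J m (\<lambda>j y. inverse (r (m' j) y)) \<kappa> (h \<theta>0 z) = z"
proof -
  interpret sw: quotient_chart_pair P \<A> E act \<mu> S U' c' I' \<sigma>' b' U c I \<sigma> b W "\<lambda>y. - u y" J' J m' m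
    "\<lambda>j y. inverse (r (m' j) y)" by (rule swap)
  note y = base_simps[OF z]
  let ?y = "base z" and ?h = "h \<theta>0 z"
  have c'pos: "0 < c' ?y $ j" if "j \<notin> J'" for j
    using B.c_orthant[OF y(3)] J'[OF y(1) that] by (simp add: orthant_def less_le)
  have hj: "?h $ j = of_real (sqrt (c' ?y $ j)) * cis (2 * pi * w \<theta>0 z $ j)" if "j \<notin> J'" for j
    using that by (simp add: h_def)
  show dom: "?h \<in> sw.dom \<kappa>"
    unfolding sw.dom_def
  proof (intro CollectI conjI ballI)
    show "sqn ?h \<in> c' ` W" unfolding sqn_h[OF z] using y(1) by (rule imageI)
    fix j assume "j \<in> - J'"
    then have j: "j \<notin> J'" by simp
    show "?h $ j * cis (- (2 * pi * \<kappa> $ j)) \<notin> \<real>\<^sub>\<le>\<^sub>0"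
      unfolding hj[OF j] using angle_branch_dom[of "sqrt (c' ?y $ j)" "w \<theta>0 z $ j" "\<kappa> $ j"] c'pos[OF j] near
      by simp
  qed
  have base': "sw.base ?h = ?y"
    by (simp add: sw.base_def sqn_h[OF z] B.ci_c[OF y(3)])
  have arg': "sw.arg \<kappa> j ?h = w \<theta>0 z $ j" if j: "j \<notin> J'" for j
    unfolding sw.arg_def hj[OF j]
    using angle_branch_cis[of "sqrt (c' ?y $ j)" "w \<theta>0 z $ j" "\<kappa> $ j"] c'pos[OF j] near by simp
  \<comment> \<open>The components of \<open>w\<close> in \<open>J'\<close> are not among the free
    angles of the exchanged charts. By \<open>comb_match\<close> their absence appears as the angles
    \<open>- \<omega>\<close> on \<open>J\<close>, which undo the rotation that \<open>h\<close>
    applied to the matched coordinates.\<close>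
  define \<omega> where "\<omega> = (\<chi> i. w \<theta>0 z $ m i)"
  have "sw.free_angles \<kappa> ?h = w \<theta>0 z - (\<chi> j. if j \<in> J' then \<omega> $ m' j else 0)"
    using arg' m(4) by (simp add: vec_eq_iff sw.free_angles_def \<omega>_def)
  then have "comb b' (sw.free_angles \<kappa> ?h) = comb b (free_angles \<theta>0 z) - u ?y - comb b (\<chi> i. if i \<in> J then \<omega> $ i else 0)"
    by (simp only: linear_diff[OF linear_comb] comb_w comb_match)
  then have "comb b' (sw.free_angles \<kappa> ?h) - - u (sw.base ?h) =
      comb b (free_angles \<theta>0 z - (\<chi> i. if i \<in> J then \<omega> $ i else 0))"
    by (simp add: base' linear_diff[OF linear_comb])
  then have w': "sw.w \<kappa> ?h = free_angles \<theta>0 z - (\<chi> i. if i \<in> J then \<omega> $ i else 0)"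
    by (simp only: sw.w_def coord_comb[OF A.indep])
  have "sw.h \<kappa> ?h $ i = z $ i" for i
  proof (cases "i \<in> J")
    case True
    have mi: "m i \<in> J'" "m' (m i) = i" using m(1,2)[OF True] by auto
    have rp: "0 < r i ?y" by (rule r(2)[OF True y(1)])
    have "sw.h \<kappa> ?h $ i = ?h $ m i * of_real (sqrt (inverse (r i ?y))) * cis (2 * pi * - w \<theta>0 z $ m i)"
      using True mi by (simp add: sw.h_def base' w' free_angles_def \<omega>_def)
    also have "?h $ m i = z $ i * of_real (sqrt (r i ?y)) * cis (2 * pi * w \<theta>0 z $ m i)"
      using mi by (simp add: h_def)
    also have "z $ i * of_real (sqrt (r i ?y)) * cis (2 * pi * w \<theta>0 z $ m i) * of_real (sqrt (inverse (r i ?y))) *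
        cis (2 * pi * - w \<theta>0 z $ m i) =
        z $ i * of_real (sqrt (r i ?y) * sqrt (inverse (r i ?y))) * (cis (2 * pi * w \<theta>0 z $ m i) * cis (2 * pi * - w \<theta>0 z $ m i))"
      by (simp only: of_real_mult mult_ac)
    also have "sqrt (r i ?y) * sqrt (inverse (r i ?y)) = 1"
      using rp by (simp flip: real_sqrt_mult)
    also have "cis (2 * pi * w \<theta>0 z $ m i) * cis (2 * pi * - w \<theta>0 z $ m i) = 1"
      by (simp add: cis_mult)
    finally show ?thesis by simp
  next
    case False
    have "sw.h \<kappa> ?h $ i = of_real (sqrt (sqn z $ i)) * cis (2 * pi * arg \<theta>0 i z)"
      using False by (simp add: sw.h_def base' w' free_angles_def y(4))
    also have "\<dots> = polar (sqn z) (\<chi> i. if i \<in> J then angle_of z $ i else arg \<theta>0 i z) $ i"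
      using False by (simp add: polar_nth)
    finally show ?thesis using z_polar[OF z] by simp
  qed
  then show "sw.h \<kappa> ?h = z" by (simp add: vec_eq_iff)
qed

text \<open>The common refinement is a stabilizer ball about \<open>z0\<close> in the first chart,
  embedded there by the identity and in the second chart by \<open>h\<close>. Invariance of domain
  gives an open image, and the map of the exchanged pair gives a smooth inverse.\<close>

lemma compatible_at:
  assumes z0: "z0 \<in> A.V" "A.ci (sqn z0) \<in> W"
  shows "\<exists>\<omega> f f'. orbifold_chart A.X \<omega> \<and> A.\<phi> z0 \<in> orbi_chart_range \<omega> \<and>
    orbi_chart_range \<omega> \<subseteq> orbi_chart_range (A.V, A.chart_group, A.\<phi>) \<inter> orbi_chart_range (B.V, B.chart_group, B.\<phi>) \<and>
    orbifold_embedding \<omega> (A.V, A.chart_group, A.\<phi>) f \<and> orbifold_embedding \<omega> (B.V, B.chart_group, B.\<phi>) f'"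
proof -
  interpret sw: quotient_chart_pair P \<A> E act \<mu> S U' c' I' \<sigma>' b' U c I \<sigma> b W "\<lambda>y. - u y" J' J m' m
    "\<lambda>j y. inverse (r (m' j) y)" by (rule swap)
  let ?\<theta> = "angle_of z0"
  \<comment> \<open>The branches for the inverse are centred at the new angles of \<open>z0\<close>
    itself; they are the right ones as long as the new angles move by less than half a turn, which
    bounds the size of the ball.\<close>
  let ?\<kappa> = "w ?\<theta> z0"
  have z0d: "z0 \<in> dom ?\<theta>" by (rule angle_of_in_dom[OF z0])
  let ?B = "{x. \<forall>j. \<bar>x $ j - ?\<kappa> $ j\<bar> < 1/2}"
  have "?B = (\<Inter>j. {x. \<bar>x $ j - ?\<kappa> $ j\<bar> < 1/2})" by auto
  then have oB: "open ?B" by (auto intro!: open_INT open_Collect_less continuous_intros)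
  have "open (dom ?\<theta> \<inter> w ?\<theta> -` ?B)"
    by (rule continuous_open_preimage[OF smooth_on_imp_continuous_on[OF smooth_on_w] open_dom oB])
  moreover have "z0 \<in> dom ?\<theta> \<inter> w ?\<theta> -` ?B" using z0d by simp
  ultimately obtain e where e: "0 < e" "ball z0 e \<subseteq> dom ?\<theta> \<inter> w ?\<theta> -` ?B"
    using open_contains_ball by blast
  obtain \<epsilon> G' where G': "0 < \<epsilon>" "\<epsilon> \<le> e" "ball z0 \<epsilon> \<subseteq> A.V" "orbifold_chart A.X (ball z0 \<epsilon>, G', A.\<phi>)"
    by (rule stabilizer_chart[OF A.orbifold_chart_\<phi> A.isometric_\<phi> z0(1) e(1)])
  let ?D = "ball z0 \<epsilon>" and ?k = "sw.h ?\<kappa>" and ?h = "h ?\<theta>"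
  have D: "z \<in> dom ?\<theta>" "\<forall>j. \<bar>w ?\<theta> z $ j - ?\<kappa> $ j\<bar> < 1/2" if z: "z \<in> ?D" for z
  proof -
    have "z \<in> dom ?\<theta> \<inter> w ?\<theta> -` ?B"
      by (rule subsetD[OF e(2) subsetD[OF subset_ball[OF G'(2)] z]])
    then show "z \<in> dom ?\<theta>" "\<forall>j. \<bar>w ?\<theta> z $ j - ?\<kappa> $ j\<bar> < 1/2" by simp_all
  qed
  have kh: "?h z \<in> sw.dom ?\<kappa>" "?k (?h z) = z" if "z \<in> ?D" for z
    using h_inverse[OF D[OF that]] by simp_all
  have smh: "smooth_on ?D ?h" by (rule smooth_on_subset[OF smooth_on_h]) (use D(1) in auto)
  have inj: "inj_on ?h ?D" by (rule inj_on_inverseI[of _ ?k]) (rule kh(2))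
  have oh: "open (?h ` ?D)"
    by (rule invariance_of_domain[OF smooth_on_imp_continuous_on[OF smh] open_ball inj])
  have "smooth_on (?h ` ?D) ?k"
    by (rule smooth_on_subset[OF sw.smooth_on_h]) (use kh(1) in auto)
  then have inv: "smooth_on (?h ` ?D) (the_inv_into ?D ?h)"
    by (rule smooth_on_cong) (use kh(2) the_inv_into_f_f[OF inj] in auto)
  have idinv: "smooth_on ?D (the_inv_into ?D (\<lambda>z. z))"
    by (rule smooth_on_cong[OF smooth_on_ident]) (use the_inv_into_f_f[of "\<lambda>z. z" ?D] in auto)
  have 1: "orbifold_embedding (?D, G', A.\<phi>) (A.V, A.chart_group, A.\<phi>) (\<lambda>z. z)"
    using G'(3) idinv by (simp add: orbifold_embedding_def diffeomorphism_on_def smooth_on_ident bij_betw_def)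
  have "?h ` ?D \<subseteq> B.V"
  proof safe
    fix z assume "z \<in> ?D"
    then show "?h z \<in> B.V" by (rule h_in_V[OF D(1)])
  qed
  then have 2: "orbifold_embedding (?D, G', A.\<phi>) (B.V, B.chart_group, B.\<phi>) ?h"
    using oh smh inv inj \<phi>_h D(1) by (simp add: orbifold_embedding_def diffeomorphism_on_def bij_betw_def)
  have "A.\<phi> ` ?D \<subseteq> B.\<phi> ` B.V"
  proof
    fix C assume "C \<in> A.\<phi> ` ?D"
    then obtain z where z: "z \<in> ?D" "C = A.\<phi> z" by blast
    then have "C = B.\<phi> (?h z)" using \<phi>_h[OF D(1)] by simp
    then show "C \<in> B.\<phi> ` B.V" using h_in_V[OF D(1)[OF z(1)]] by (rule image_eqI)
  qed
  then have 3: "orbi_chart_range (?D, G', A.\<phi>) \<subseteq> orbi_chart_range (A.V, A.chart_group, A.\<phi>) \<inter>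
      orbi_chart_range (B.V, B.chart_group, B.\<phi>)"
    using G'(3) by (auto simp: orbi_chart_range_def)
  have 4: "A.\<phi> z0 \<in> orbi_chart_range (?D, G', A.\<phi>)"
    using G'(1) by (simp add: orbi_chart_range_def)
  show ?thesis
    using G'(4) 1 2 3 4 by (intro exI[of _ "(?D, G', A.\<phi>)"] exI[of _ "\<lambda>z. z"] exI[of _ ?h]) simp
qed

end

section \<open>The orbifold of a characteristic pair\<close>

locale characteristic_bundle = compact_torus_bundle P \<A> E act \<mu>
  for P :: "'p topology" and \<A> :: "('p, 'n::finite) corner_chart set"
    and E :: "'e topology" and act :: "(real ^ 'n) set \<Rightarrow> 'e \<Rightarrow> 'e" and \<mu> :: "'e \<Rightarrow> 'p" +
  fixes \<xi> :: "'p set \<Rightarrow> int ^ 'n"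
  assumes nice: "nice P \<A>" and characteristic: "rational_characteristic P \<A> \<xi>"
begin

text \<open>The Lie algebra of the subtorus of the face whose relative interior contains
  \<open>p\<close>, described by the facets through \<open>p\<close> so that it makes sense without
  naming the face. \<open>face_module_eq\<close> gives the agreement.\<close>

definition isotropy :: "'p \<Rightarrow> (real ^ 'n) set" where
  "isotropy p = span (vec_of_int ` \<xi> ` facets_at p)"

sublocale torus_quotient P E act \<mu> isotropy
  by unfold_locales (simp add: isotropy_def)

lemma finite_facets:
  assumes "p \<in> topspace P"
  shows "finite (facets_at p)"
proof -
  obtain k where "p \<in> stratum P \<A> k" using assms by (rule stratum_covers)
  then show ?thesis by (rule finite_facets_at(1)[OF nice])
qed

lemma face_module_eq:
  assumes "F \<in> faces P \<A> k" "p \<in> face_interior P \<A> k F"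
  shows "face_module P \<A> \<xi> k F = generate (additive_group UNIV) (\<xi> ` facets_at p)"
    "real_span (face_module P \<A> \<xi> k F) = isotropy p"
    "face_torus P \<A> \<xi> k F = tor ` isotropy p"
proof -
  show 1: "face_module P \<A> \<xi> k F = generate (additive_group UNIV) (\<xi> ` facets_at p)"
    unfolding face_module_def face_facets_eq[OF nice assms] ..
  have "p \<in> topspace P" using assms(2) by (simp add: face_interior_def stratum_def)
  then have "finite (\<xi> ` facets_at p)" using finite_facets by simp
  from real_span_generate[OF this]
  show 2: "real_span (face_module P \<A> \<xi> k F) = isotropy p"
    unfolding 1 isotropy_def .
  have sub: "submodule_of_ints (face_module P \<A> \<xi> k F)"
    unfolding 1 by (rule submodule_of_ints_generate)
  show "face_torus P \<A> \<xi> k F = tor ` isotropy p"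
    unfolding face_torus_def Let_def image_torus_eq[OF sub] 2 ..
qed

lemma face_exists:
  assumes "p \<in> topspace P"
  obtains k F where "F \<in> faces P \<A> k" "p \<in> face_interior P \<A> k F"
proof -
  obtain k where k: "p \<in> stratum P \<A> k" using assms by (rule stratum_covers)
  obtain F where "F \<in> faces P \<A> k" "p \<in> face_interior P \<A> k F"
    using k by (rule face_at)
  then show thesis by (rule that)
qed

section \<open>Identification with the collapsed space of the construction\<close>

lemma X_class_eq:
  assumes x: "x \<in> topspace E"
  shows "X_class P \<A> \<xi> E act \<mu> x = cls x"
proof (intro equalityI subsetI)
  fix y assume "y \<in> X_class P \<A> \<xi> E act \<mu> x"
  then obtain k F t where y: "y \<in> topspace E" "\<mu> x = \<mu> y" and F: "F \<in> faces P \<A> k" "\<mu> x \<in> face_interior P \<A> k F"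
    and t: "t \<in> face_torus P \<A> \<xi> k F" "x = act t y"
    by (auto simp: X_class_def X_rel_def)
  obtain v where v: "v \<in> isotropy (\<mu> x)" "t = tor v" using t(1) face_module_eq(3)[OF F] by auto
  have "act (tor (- v)) x = y" using act_minus_cancel[OF y(1), of v] t(2) v(2) by simp
  moreover have "- v \<in> isotropy (\<mu> x)" using v(1) by (simp add: isotropy_def span_neg)
  ultimately show "y \<in> cls x" unfolding cls_def by (metis image_eqI)
next
  fix y assume "y \<in> cls x"
  then obtain v where v: "v \<in> isotropy (\<mu> x)" "y = act (tor v) x" by (auto simp: cls_def)
  obtain k F where F: "F \<in> faces P \<A> k" "\<mu> x \<in> face_interior P \<A> k F"
    using \<mu>_closed[OF x] by (rule face_exists)
  have "tor (- v) \<in> face_torus P \<A> \<xi> k F"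
    unfolding face_module_eq(3)[OF F] using v(1) by (intro imageI) (simp add: isotropy_def span_neg)
  moreover have "x = act (tor (- v)) y" using act_minus_cancel[OF x, of v] v(2) by simp
  ultimately have "\<exists>k F t. F \<in> faces P \<A> k \<and> \<mu> x \<in> face_interior P \<A> k F \<and> t \<in> face_torus P \<A> \<xi> k F \<and> x = act t y"
    using F by (intro exI[of _ k] exI[of _ F] exI[of _ "tor (- v)"]) simp
  then show "y \<in> X_class P \<A> \<xi> E act \<mu> x"
    using x v(2) by (simp add: X_class_def X_rel_def)
qed

lemma X_space_eq: "X_space P \<A> \<xi> E act \<mu> = X"
proof -
  have "openin (quotient_topology E (X_class P \<A> \<xi> E act \<mu>)) U = openin (quotient_topology E cls) U" for U
  proof -
    have "X_class P \<A> \<xi> E act \<mu> ` topspace E = cls ` topspace E"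
      by (rule image_cong) (simp_all add: X_class_eq)
    moreover have "{x \<in> topspace E. X_class P \<A> \<xi> E act \<mu> x \<in> U} = {x \<in> topspace E. cls x \<in> U}"
      using X_class_eq by auto
    ultimately show ?thesis by (simp add: openin_quotient_topology)
  qed
  then show ?thesis unfolding X_space_def X_def by (simp add: topology_eq)
qed

lemma X_act_eq: "X_act P \<A> \<xi> E act \<mu> = Xact"
  by (simp add: X_act_def[abs_def] Xact_def[abs_def] X_space_eq)

subsection \<open>Adapted charts\<close>

text \<open>The labelling \<open>H\<close> of coordinates by facets is kept along with the chart:
  coordinate indices of different charts are unrelated, and the labels are what allows them to be
  matched.\<close>

definition adapted where
  "adapted U c I \<sigma> b H \<longleftrightarrow> quotient_chart P \<A> E act \<mu> isotropy U c I \<sigma> b \<and> inj_on H I \<and>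
    (\<forall>i\<in>I. \<forall>p\<in>U. p \<in> H i \<longleftrightarrow> c p $ i = 0) \<and> (\<forall>p\<in>U. facets_at p = H ` {i. c p $ i = 0}) \<and>
    (\<forall>i\<in>I. b i = \<xi> (H i))"

abbreviation chart_of where
  "chart_of U c I \<sigma> b \<equiv> (model_domain I, quotient_chart.chart_group I b, quotient_chart.\<phi> act \<mu> isotropy U c \<sigma> b)"

lemma characteristic_lin_indep:
  fixes H :: "'n \<Rightarrow> 'p set"
  assumes p: "p \<in> topspace P" and H: "inj_on H I" "finite I" "H ` I \<subseteq> facets_at p"
  shows "lin_indep I (\<lambda>i. \<xi> (H i))"
proof (rule lin_indepI[OF H(2)])
  fix a :: "'n \<Rightarrow> int" assume a: "(\<Sum>i\<in>I. a i *s \<xi> (H i)) = 0"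
  define a' where "a' F = a (the_inv_into I H F)" for F
  have "(\<Sum>F\<in>H ` I. a' F *s \<xi> F) = (\<Sum>i\<in>I. a i *s \<xi> (H i))"
    unfolding a'_def by (simp add: sum.reindex[OF H(1)] the_inv_into_f_f[OF H(1)])
  then have 0: "(\<Sum>F\<in>H ` I. a' F *s \<xi> F) = 0" using a by simp
  have "H ` I \<subseteq> facets P \<A>" "finite (H ` I)" "p \<in> \<Inter>(H ` I)"
    using H by (auto simp: facets_at_def)
  then have "\<forall>F\<in>H ` I. a' F = 0"
    using characteristic 0 unfolding rational_characteristic_def by blast
  then show "\<forall>i\<in>I. a i = 0" by (simp add: a'_def the_inv_into_f_f[OF H(1)])
qed

lemma isotropy_model:
  assumes H: "inj_on H I" "facets_at p = H ` {i. c p $ i = 0}" "{i. c p $ i = 0} \<subseteq> I" "\<forall>i\<in>I. b i = \<xi> (H i)"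
  shows "isotropy p = comb b ` {\<theta> :: real ^ 'n. \<forall>i. \<theta> $ i \<noteq> 0 \<longrightarrow> c p $ i = 0}"
proof -
  let ?Z = "{i. c p $ i = 0}"
  have "vec_of_int ` \<xi> ` facets_at p = (\<lambda>i. vec_of_int (b i)) ` ?Z"
    unfolding H(2) image_image by (rule image_cong) (use H(3,4) in auto)
  then have "isotropy p = range (\<lambda>r. \<Sum>i\<in>?Z. r i *\<^sub>R vec_of_int (b i))"
    by (simp add: isotropy_def span_image_eq_combinations)
  also have "\<dots> = comb b ` {\<theta>. \<forall>i. \<theta> $ i \<noteq> 0 \<longrightarrow> c p $ i = 0}"
  proof (intro equalityI subsetI)
    fix v assume "v \<in> range (\<lambda>r. \<Sum>i\<in>?Z. r i *\<^sub>R vec_of_int (b i))"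
    then obtain r where v: "v = (\<Sum>i\<in>?Z. r i *\<^sub>R vec_of_int (b i))" by blast
    have "v = comb b (\<chi> i. if c p $ i = 0 then r i else 0)"
      unfolding v comb_def by (rule sum.mono_neutral_cong_left) auto
    then show "v \<in> comb b ` {\<theta>. \<forall>i. \<theta> $ i \<noteq> 0 \<longrightarrow> c p $ i = 0}" by (rule image_eqI) simp
  next
    fix v assume "v \<in> comb b ` {\<theta>. \<forall>i. \<theta> $ i \<noteq> 0 \<longrightarrow> c p $ i = 0}"
    then obtain \<theta> where \<theta>: "v = comb b \<theta>" "\<forall>i. \<theta> $ i \<noteq> 0 \<longrightarrow> c p $ i = 0" by blast
    have "v = (\<Sum>i\<in>?Z. \<theta> $ i *\<^sub>R vec_of_int (b i))"
      unfolding \<theta>(1) comb_def using \<theta>(2) by (intro sum.mono_neutral_cong_right) auto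
    then show "v \<in> range (\<lambda>r. \<Sum>i\<in>?Z. r i *\<^sub>R vec_of_int (b i))"
      by (rule range_eqI[of _ _ "\<lambda>i. \<theta> $ i"])
  qed
  finally show ?thesis .
qed

text \<open>In a model chart centred at \<open>\<mu> x\<close> the index set \<open>I\<close>
  consists of the coordinates vanishing there. Their characteristic vectors are independent, as the
  facets have the point in common, and \<open>lattice_basis_extend\<close> completes them. The
  completion property yields both the \<open>split\<close> condition and the unique decomposition
  demanded by \<open>X_chart\<close>.\<close>

lemma adapted_chart_exists:
  assumes x: "x \<in> topspace E" and \<sigma>: "section_on N \<sigma>" and xN: "\<mu> x \<in> N"
  obtains U c I b H where "U \<subseteq> N" "\<mu> x \<in> U" "adapted U c I \<sigma> b H"
    "X_chart P \<A> \<xi> E act \<mu> x (chart_of U c I \<sigma> b)"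
proof -
  define p where "p = \<mu> x"
  have p: "p \<in> topspace P" "p \<in> N" using \<mu>_closed[OF x] xN by (simp_all add: p_def)
  obtain U c where U: "model_chart U c {i. c p $ i = 0}" "p \<in> U" "U \<subseteq> N"
    by (rule model_chart_at[OF section_onD(1)[OF \<sigma>] p(2)])
  define I where "I = {i. c p $ i = 0}"
  have ch: "model_chart U c I" using U(1) by (simp add: I_def)
  note chD = model_chartD[OF ch]
  obtain H where H: "inj_on H I" "\<forall>i\<in>I. \<forall>p\<in>U. p \<in> H i \<longleftrightarrow> c p $ i = 0"
    "\<forall>p\<in>U. facets_at p = H ` {i. c p $ i = 0}"
    by (rule model_chart_facets[OF nice ch])
  have HI: "facets_at p = H ` I" using H(3) U(2) by (simp add: I_def)
  have "lin_indep I (\<lambda>i. \<xi> (H i))"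
    by (rule characteristic_lin_indep[OF p(1) H(1)]) (simp_all add: HI)
  then obtain b where b: "\<forall>i\<in>I. b i = \<xi> (H i)" "lin_indep UNIV b"
    and ext: "\<And>m. \<exists>a :: int ^ 'n. (\<forall>i\<in>I. a $ i = 0) \<and>
       vec_of_int (m - (\<Sum>i\<in>-I. a $ i *s b i)) \<in> span ((\<lambda>i. vec_of_int (\<xi> (H i))) ` I)"
    by (rule lattice_basis_extend) blast
  have span_eq: "span ((\<lambda>i. vec_of_int (\<xi> (H i))) ` I) = isotropy p"
    by (simp add: isotropy_def HI image_image)
  have iso: "isotropy q = comb b ` {\<theta>. \<forall>i. \<theta> $ i \<noteq> 0 \<longrightarrow> c q $ i = 0}" if q: "q \<in> U" for q
  proof -
    have "facets_at q = H ` {i. c q $ i = 0}" using H(3) q by (rule bspec)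
    from isotropy_model[where H = H and I = I and c = c and p = q and b = b, OF H(1) this chD(3)[OF q] b(1)]
    show ?thesis .
  qed
  have isop: "isotropy p = comb b ` {\<theta>. \<forall>i. \<theta> $ i \<noteq> 0 \<longrightarrow> i \<in> I}" using iso[OF U(2)] by (simp add: I_def)
  have ext_comb: "comb b (vec_of_int a) = vec_of_int (\<Sum>i\<in>-I. a $ i *s b i)" if "\<forall>i\<in>I. a $ i = 0" for a :: "int ^ 'n"
  proof -
    have "(\<Sum>i\<in>UNIV. a $ i *s b i) = (\<Sum>i\<in>-I. a $ i *s b i)"
      by (rule sum.mono_neutral_right) (use that in auto)
    then show ?thesis by (simp only: comb_vec_of_int)
  qed
  have secU: "section_on U \<sigma>"
    by (rule section_on_subset[OF \<sigma> smooth_chartD(1)[OF chD(1)] U(3)])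
  have "quotient_chart P \<A> E act \<mu> isotropy U c I \<sigma> b"
  proof unfold_locales
    fix \<theta> i assume \<theta>: "comb b \<theta> \<in> range vec_of_int" and i: "i \<notin> I"
    obtain m where m: "comb b \<theta> = vec_of_int m" using \<theta> by blast
    obtain a :: "int ^ 'n" where a: "\<forall>i\<in>I. a $ i = 0"
      "vec_of_int (m - (\<Sum>i\<in>-I. a $ i *s b i)) \<in> span ((\<lambda>i. vec_of_int (\<xi> (H i))) ` I)"
      using ext[of m] by (elim exE conjE)
    obtain \<eta> where \<eta>: "vec_of_int (m - (\<Sum>i\<in>-I. a $ i *s b i)) = comb b \<eta>" "\<forall>i. \<eta> $ i \<noteq> 0 \<longrightarrow> i \<in> I"
      using a(2) unfolding span_eq isop by (elim imageE) simp
    \<comment> \<open>The lattice vector is an integral combination \<open>a\<close> of the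
      complementary vectors plus something supported on \<open>I\<close>. Uniqueness of coordinates
      then identifies the entries of \<open>\<theta>\<close> outside \<open>I\<close> with those of
      \<open>a\<close>.\<close>
    have "comb b \<theta> = comb b (vec_of_int a + \<eta>)"
      unfolding linear_add[OF linear_comb] ext_comb[OF a(1)] \<eta>(1)[symmetric] m
      by (simp add: vec_of_int_simps)
    then have "\<theta> = vec_of_int a + \<eta>" using inj_comb[OF b(2)] by (simp add: inj_eq)
    moreover have "\<eta> $ i = 0" using \<eta>(2) i by blast
    ultimately have "\<theta> $ i = of_int (a $ i)" by (simp add: vec_of_int_def)
    then show "\<theta> $ i \<in> \<int>" by simp
  qed (use ch secU iso b(2) in simp_all)
  then interpret Q: quotient_chart P \<A> E act \<mu> isotropy U c I \<sigma> b .
  have ad: "adapted U c I \<sigma> b H"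
    unfolding adapted_def using Q.quotient_chart_axioms H b(1) by (simp add: Q.quotient_chart_axioms)
  obtain k F where F: "F \<in> faces P \<A> k" "p \<in> face_interior P \<A> k F"
    using p(1) by (rule face_exists)
  note fm = face_module_eq[OF F]
  let ?K = "face_module P \<A> \<xi> k F"
  have subK: "submodule_of_ints ?K" unfolding fm(1) by (rule submodule_of_ints_generate)
  have satK: "m \<in> saturation ?K \<longleftrightarrow> vec_of_int m \<in> isotropy p" for m
    by (simp add: saturation_def fm(2))
  have cardI: "card I = k"
    using in_stratum_iff[OF chD(1) U(2)] F(2) by (simp add: I_def face_interior_def)
  have c_img: "c ` U = {q. (\<forall>i\<in>I. 0 \<le> q $ i) \<and> (\<forall>i\<in>-I. 0 < q $ i)}"
    using chD(2) by (simp add: model_corner_def)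
  have bij: "bij_betw H I (face_facets P \<A> k F)"
    using H(1) HI face_facets_eq[OF nice F] by (simp add: bij_betw_def)
  have uniq: "\<exists>!a :: int ^ 'n. (\<forall>i\<in>I. a $ i = 0) \<and> m - (\<Sum>i\<in>-I. a $ i *s b i) \<in> saturation ?K" for m
  proof (rule ex_ex1I)
    show "\<exists>a :: int ^ 'n. (\<forall>i\<in>I. a $ i = 0) \<and> m - (\<Sum>i\<in>-I. a $ i *s b i) \<in> saturation ?K"
      using ext[of m] unfolding satK span_eq .
    fix a a' :: "int ^ 'n"
    assume a: "(\<forall>i\<in>I. a $ i = 0) \<and> m - (\<Sum>i\<in>-I. a $ i *s b i) \<in> saturation ?K"
      and a': "(\<forall>i\<in>I. a' $ i = 0) \<and> m - (\<Sum>i\<in>-I. a' $ i *s b i) \<in> saturation ?K"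
    obtain \<eta> where \<eta>: "vec_of_int (m - (\<Sum>i\<in>-I. a $ i *s b i)) = comb b \<eta>" "\<forall>i. \<eta> $ i \<noteq> 0 \<longrightarrow> i \<in> I"
      using a unfolding satK isop by (elim conjE imageE) simp
    obtain \<eta>' where \<eta>': "vec_of_int (m - (\<Sum>i\<in>-I. a' $ i *s b i)) = comb b \<eta>'" "\<forall>i. \<eta>' $ i \<noteq> 0 \<longrightarrow> i \<in> I"
      using a' unfolding satK isop by (elim conjE imageE) simp
    have a0: "\<forall>i\<in>I. a $ i = 0" "\<forall>i\<in>I. a' $ i = 0" using a a' by simp_all
    have "comb b (vec_of_int a + \<eta>) = vec_of_int m" "comb b (vec_of_int a' + \<eta>') = vec_of_int m"
      unfolding linear_add[OF linear_comb] ext_comb[OF a0(1)] ext_comb[OF a0(2)] \<eta>(1)[symmetric] \<eta>'(1)[symmetric]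
      by (simp_all add: vec_of_int_simps)
    then have "comb b (vec_of_int a + \<eta>) = comb b (vec_of_int a' + \<eta>')" by simp
    then have e: "vec_of_int a + \<eta> = vec_of_int a' + \<eta>'" using inj_comb[OF b(2)] by (simp add: inj_eq)
    have "a $ i = a' $ i" for i
    proof (cases "i \<in> I")
      case False
      then have "\<eta> $ i = 0" "\<eta>' $ i = 0" using \<eta>(2) \<eta>'(2) by blast+
      then show ?thesis using arg_cong[OF e, of "\<lambda>v. v $ i"] by (simp add: vec_of_int_def)
    qed (use a0 in simp)
    then show "a = a'" by (simp add: vec_eq_iff)
  qed
  have comb_I: "(\<Sum>i\<in>I. \<theta> $ i *\<^sub>R vec_of_int (b i)) = comb b \<theta>" if "\<forall>i\<in>-I. \<theta> $ i = 0" for \<theta> :: "real ^ 'n"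
    unfolding comb_def by (rule sum.mono_neutral_left) (use that in auto)
  \<comment> \<open>For angles supported on \<open>I\<close> the combination lies in the real span
    of the face module, so that being in its saturation just means being a lattice vector. This
    identifies the group built from all of \<open>b\<close> with the kernel of
    \<open>zeta ?K\<close>.\<close>
  have ker: "lattice_coset ?K (\<Sum>i\<in>I. \<theta> $ i *\<^sub>R vec_of_int (b i)) \<in> kernel (torus ?K) (torus (saturation ?K)) (zeta ?K)
      \<longleftrightarrow> comb b \<theta> \<in> range vec_of_int" if \<theta>: "\<forall>i\<in>-I. \<theta> $ i = 0" for \<theta> :: "real ^ 'n"
  proof -
    have "comb b \<theta> \<in> isotropy p" unfolding isop using \<theta> by (intro imageI) auto
    then have "comb b \<theta> \<in> vec_of_int ` saturation ?K \<longleftrightarrow> comb b \<theta> \<in> range vec_of_int"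
      using satK by auto
    then show ?thesis unfolding coset_in_kernel_zeta_iff[OF subK] comb_I[OF \<theta>] .
  qed
  have grp: "Q.chart_group = {(\<lambda>z\<in>model_domain I. cis_vec \<theta> * z) | \<theta>. (\<forall>i\<in>-I. \<theta> $ i = 0) \<and>
      lattice_coset ?K (\<Sum>i\<in>I. \<theta> $ i *\<^sub>R vec_of_int (b i)) \<in> kernel (torus ?K) (torus (saturation ?K)) (zeta ?K)}"
    unfolding Q.chart_group_def using ker by (intro Collect_cong ex_cong1 conj_cong refl) simp_all
  have \<phi>_eq: "Q.\<phi> ((\<chi> i. of_real (sqrt (c q $ i))) * cis_vec \<theta>) =
      X_class P \<A> \<xi> E act \<mu> (act (tor (\<Sum>i\<in>UNIV. \<theta> $ i *\<^sub>R vec_of_int (b i))) (\<sigma> q))" if q: "q \<in> U" for q \<theta>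
  proof -
    have "Q.\<phi> (polar (c q) \<theta>) = cls (act (tor (comb b \<theta>)) (\<sigma> q))"
      using Q.\<phi>_polar[OF q] by (simp add: Q.F_def)
    also have "\<dots> = X_class P \<A> \<xi> E act \<mu> (act (tor (comb b \<theta>)) (\<sigma> q))"
      by (rule X_class_eq[symmetric]) (use Q.\<sigma>_simps(1)[OF q] in simp)
    finally show ?thesis by (simp only: polar_def comb_def)
  qed
  have "X_chart P \<A> \<xi> E act \<mu> x (chart_of U c I \<sigma> b)"
    unfolding X_chart_def prod.case Let_def
  proof (rule exI[of _ k], rule exI[of _ F], rule exI[of _ U], rule exI[of _ c], rule exI[of _ \<sigma>],
      rule exI[of _ I], rule exI[of _ H], rule exI[of _ b], intro conjI)
    show "F \<in> faces P \<A> k" by (rule F(1))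
    show "\<mu> x \<in> face_interior P \<A> k F" using F(2) by (simp add: p_def)
    show "smooth_corner_chart P \<A> (U, c)" by (rule chD(1))
    show "\<mu> x \<in> U" using U(2) by (simp add: p_def)
    show "continuous_map (subtopology P U) E \<sigma>" by (rule section_onD(2)[OF secU])
    show "\<forall>p\<in>U. \<mu> (\<sigma> p) = p" using section_onD(3)[OF secU] by simp
    show "\<forall>i\<in>I. \<forall>p\<in>U. (p \<in> H i) = (c p $ i = 0)" using H(2) by simp
    show "\<forall>m. \<exists>!a :: int ^ 'n. (\<forall>i\<in>I. a $ i = 0) \<and> m - (\<Sum>i\<in>-I. a $ i *s b i) \<in> saturation ?K" using uniq by blast
    show "\<forall>\<theta>. \<forall>p\<in>U. Q.\<phi> ((\<chi> i. of_real (sqrt (c p $ i))) * cis_vec \<theta>) =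
      X_class P \<A> \<xi> E act \<mu> (act (tor (\<Sum>i\<in>UNIV. \<theta> $ i *\<^sub>R vec_of_int (b i))) (\<sigma> p))" using \<phi>_eq by simp
  qed (use cardI c_img bij b(1) grp in \<open>simp_all add: model_domain_def\<close>)
  then show thesis using that[OF U(3) _ ad] U(2) by (simp add: p_def)
qed

section \<open>Compatibility of adapted charts\<close>

lemma coordinate_ratio:
  assumes U: "smooth_corner_chart P \<A> (U, c)" and U': "smooth_corner_chart P \<A> (U', c')"
    and p: "p \<in> U" "p \<in> U'" "c p $ i = 0"
    and zero: "\<forall>y\<in>U \<inter> U'. c y $ i = 0 \<longleftrightarrow> c' y $ j = 0"
  shows "\<exists>W (r :: 'p \<Rightarrow> real). openin P W \<and> p \<in> W \<and> W \<subseteq> U \<inter> U' \<and> psmooth W r \<and>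
    (\<forall>y\<in>W. 0 < r y \<and> c' y $ j = r y * c y $ i)"
proof -
  let ?N = "U \<inter> U'"
  have oN: "openin P ?N" using smooth_chartD(1)[OF U] smooth_chartD(1)[OF U'] by (rule openin_Int)
  let ?\<tau> = "\<lambda>q. c' (the_inv_into U c q)" and ?\<tau>' = "\<lambda>q. c (the_inv_into U' c' q)"
  have A: "openin (top_of_set orthant) (c ` ?N)" by (rule smooth_chart_open_image[OF U oN]) simp
  have A': "openin (top_of_set orthant) (c' ` ?N)" by (rule smooth_chart_open_image[OF U' oN]) simp
  have \<tau>: "smooth_on (c ` ?N) ?\<tau>" by (rule smooth_transition[OF U U'])
  have \<tau>': "smooth_on (c' ` ?N) ?\<tau>'" using smooth_transition[OF U' U] by (simp add: Int_commute)
  have img: "?\<tau> ` c ` ?N \<subseteq> c' ` ?N" "?\<tau>' ` c' ` ?N \<subseteq> c ` ?N"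
    using inv_chart[OF U] inv_chart[OF U'] by auto
  have inv: "?\<tau>' (?\<tau> q) = q" if "q \<in> c ` ?N" for q using that inv_chart[OF U] inv_chart[OF U'] by auto
  have inv': "?\<tau> (?\<tau>' q) = q" if "q \<in> c' ` ?N" for q using that inv_chart[OF U] inv_chart[OF U'] by auto
  have z: "q $ i = 0 \<longleftrightarrow> ?\<tau> q $ j = 0" if "q \<in> c ` ?N" for q
    using that zero inv_chart[OF U] by auto
  have q0: "c p \<in> c ` ?N" using p by simp
  obtain O' h where h: "open O'" "c p \<in> O'" "smooth_on O' h" "\<forall>q\<in>O'. 0 < h q"
      "\<forall>q \<in> c ` ?N \<inter> O'. ?\<tau> q $ j = q $ i * h q"
    by (rule transition_factor[OF A A' \<tau> img(1) \<tau>' img(2) inv inv' z q0 p(3)])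
  let ?W = "?N \<inter> {y \<in> U. c y \<in> O'}"
  have "openin P ?W" using oN smooth_chart_open_preimage[OF U h(1)] by (rule openin_Int)
  moreover have "p \<in> ?W" using p h(2) by simp
  moreover have "psmooth ?W (\<lambda>y. h (c y))"
    unfolding psmooth_def
  proof (intro allI impI)
    fix V d assume V: "smooth_corner_chart P \<A> (V, d)"
    have "smooth_on (d ` (V \<inter> U)) (\<lambda>q. c (the_inv_into V d q))" by (rule psmoothD[OF psmooth_chart[OF U] V])
    then have "smooth_on (d ` (V \<inter> ?W)) (\<lambda>q. c (the_inv_into V d q))" by (rule smooth_on_subset) auto
    then show "smooth_on (d ` (V \<inter> ?W)) (\<lambda>q. h (c (the_inv_into V d q)))"
      by (rule smooth_on_compose[OF _ h(3)]) (use inv_chart[OF V] in auto)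
  qed
  moreover have "0 < h (c y) \<and> c' y $ j = h (c y) * c y $ i" if y: "y \<in> ?W" for y
  proof -
    have "c y \<in> c ` ?N \<inter> O'" using y by simp
    then have "?\<tau> (c y) $ j = c y $ i * h (c y)" using h(5) by blast
    moreover have "the_inv_into U c (c y) = y" by (rule inv_chart[OF U]) (use y in simp)
    ultimately show ?thesis using y h(4) by (simp add: mult.commute)
  qed
  moreover have "?W \<subseteq> ?N" by blast
  ultimately show ?thesis by (intro exI[of _ ?W] exI[of _ "\<lambda>y. h (c y)"]) simp
qed

lemma nonzero_coordinates_open:
  assumes U: "smooth_corner_chart P \<A> (U, c)" and p: "p \<in> U"
  shows "\<exists>W. openin P W \<and> p \<in> W \<and> W \<subseteq> U \<and> (\<forall>y\<in>W. \<forall>i. c p $ i \<noteq> 0 \<longrightarrow> c y $ i \<noteq> 0)"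
proof -
  let ?J = "{i. c p $ i \<noteq> 0}"
  have orth: "c y $ i \<ge> 0" if "y \<in> U" for y i
    using that openin_imp_subset[OF smooth_chartD(2)[OF U]] by (auto simp: orthant_def)
  let ?W = "{y \<in> U. c y \<in> {q. \<forall>i\<in>?J. 0 < q $ i}}"
  have "openin P ?W" by (rule smooth_chart_open_preimage[OF U open_positive_coords])
  moreover have "p \<in> ?W" using p orth by (auto simp: less_le)
  moreover have "\<forall>y\<in>?W. \<forall>i. c p $ i \<noteq> 0 \<longrightarrow> c y $ i \<noteq> 0" by (simp add: less_le)
  moreover have "?W \<subseteq> U" by blast
  ultimately show ?thesis by (intro exI[of _ ?W] conjI)
qed

text \<open>At a common base point \<open>p\<close> the coordinates vanishing in either chart are in
  bijection with the facets through \<open>p\<close>. Sending a coordinate to the one on the same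
  facet defines \<open>m\<close>; matched coordinates have the same characteristic vector and the
  same zero set in the overlap, so their ratio is smooth and positive near \<open>p\<close>. The
  centres of the two charts may lie on other faces than \<open>p\<close>.\<close>

lemma adapted_compatible:
  assumes ad: "adapted U c I \<sigma> b H" and ad': "adapted U' c' I' \<sigma>' b' H'"
    and trans: "\<And>p. p \<in> U \<inter> U' \<Longrightarrow> \<exists>W u. openin P W \<and> p \<in> W \<and> psmooth W u \<and> (\<forall>y\<in>W. \<sigma>' y = act (tor (u y)) (\<sigma> y))"
  shows "orbi_compatible X (chart_of U c I \<sigma> b) (chart_of U' c' I' \<sigma>' b')"
  unfolding orbi_compatible_def
proof
  interpret A: quotient_chart P \<A> E act \<mu> isotropy U c I \<sigma> b using ad by (simp add: adapted_def)
  interpret B: quotient_chart P \<A> E act \<mu> isotropy U' c' I' \<sigma>' b' using ad' by (simp add: adapted_def)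
  have H: "inj_on H I" "\<forall>i\<in>I. \<forall>p\<in>U. p \<in> H i \<longleftrightarrow> c p $ i = 0" "\<forall>p\<in>U. facets_at p = H ` {i. c p $ i = 0}" "\<forall>i\<in>I. b i = \<xi> (H i)"
    using ad by (simp_all add: adapted_def)
  have H': "inj_on H' I'" "\<forall>i\<in>I'. \<forall>p\<in>U'. p \<in> H' i \<longleftrightarrow> c' p $ i = 0" "\<forall>p\<in>U'. facets_at p = H' ` {i. c' p $ i = 0}" "\<forall>i\<in>I'. b' i = \<xi> (H' i)"
    using ad' by (simp_all add: adapted_def)
  fix C assume C: "C \<in> orbi_chart_range (chart_of U c I \<sigma> b) \<inter> orbi_chart_range (chart_of U' c' I' \<sigma>' b')"
  then have CA: "C \<in> A.\<phi> ` A.V" and CB: "C \<in> B.\<phi> ` B.V" by (auto simp: orbi_chart_range_def)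
  obtain z0 where z0: "z0 \<in> A.V" "C = A.\<phi> z0" using CA by blast
  define p where "p = A.ci (sqn z0)"
  have sq: "sqn z0 \<in> model_corner I" using z0(1) by (simp add: sqn_model_iff)
  have pU: "p \<in> U" unfolding p_def by (rule A.ci_in[OF sq])
  have "\<pi> C = p"
    using A.\<sigma>_simps[OF pU] unfolding z0(2) A.\<phi>_def p_def[symmetric] by (simp add: A.F_def \<pi>_cls)
  then have pU': "p \<in> U'" using CB unfolding B.\<phi>_image by simp
  define J where "J = {i. c p $ i = 0}"
  define J' where "J' = {j. c' p $ j = 0}"
  have JI: "J \<subseteq> I" unfolding J_def by (rule model_chartD(3)[OF A.chart pU])
  have JI': "J' \<subseteq> I'" unfolding J'_def by (rule model_chartD(3)[OF B.chart pU'])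
  have HJ1: "H ` J = facets_at p" using H(3) pU by (simp add: J_def)
  have HJ2: "H' ` J' = facets_at p" using H'(3) pU' by (simp add: J'_def)
  note HJ = HJ1 HJ2
  have injJ: "inj_on H J" "inj_on H' J'"
    using inj_on_subset[OF H(1) JI] inj_on_subset[OF H'(1) JI'] by simp_all
  define m where "m i = inv_into J' H' (H i)" for i
  define m' where "m' j = inv_into J H (H' j)" for j
  have m1: "m i \<in> J'" "H' (m i) = H i" if "i \<in> J" for i
  proof -
    have "H i \<in> H' ` J'" unfolding HJ(2) HJ(1)[symmetric] using that by (rule imageI)
    then show "m i \<in> J'" "H' (m i) = H i" unfolding m_def by (rule inv_into_into, rule f_inv_into_f)
  qed
  have m2: "m' j \<in> J" "H (m' j) = H' j" if "j \<in> J'" for j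
  proof -
    have "H' j \<in> H ` J" unfolding HJ(1) HJ(2)[symmetric] using that by (rule imageI)
    then show "m' j \<in> J" "H (m' j) = H' j" unfolding m'_def by (rule inv_into_into, rule f_inv_into_f)
  qed
  have m3: "m' (m i) = i" if i: "i \<in> J" for i
    by (rule inj_onD[OF injJ(1) _ m2(1)[OF m1(1)[OF i]] i]) (simp add: m2(2)[OF m1(1)[OF i]] m1(2)[OF i])
  have m4: "m (m' j) = j" if j: "j \<in> J'" for j
    by (rule inj_onD[OF injJ(2) _ m1(1)[OF m2(1)[OF j]] j]) (simp add: m1(2)[OF m2(1)[OF j]] m2(2)[OF j])
  have "\<forall>i\<in>J. \<exists>Wr. openin P (fst Wr) \<and> p \<in> fst Wr \<and> fst Wr \<subseteq> U \<inter> U' \<and> psmooth (fst Wr) (snd Wr :: 'p \<Rightarrow> real) \<and>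
    (\<forall>y\<in>fst Wr. 0 < snd Wr y \<and> c' y $ m i = snd Wr y * c y $ i)"
  proof
    fix i assume i: "i \<in> J"
    have iI: "i \<in> I" "m i \<in> I'" using i m1(1) JI JI' by auto
    have zero: "\<forall>y\<in>U \<inter> U'. c y $ i = 0 \<longleftrightarrow> c' y $ m i = 0"
    proof
      fix y assume "y \<in> U \<inter> U'"
      then have "c y $ i = 0 \<longleftrightarrow> y \<in> H i" "c' y $ m i = 0 \<longleftrightarrow> y \<in> H' (m i)" using H(2) H'(2) iI by blast+
      then show "c y $ i = 0 \<longleftrightarrow> c' y $ m i = 0" by (simp add: m1(2)[OF i])
    qed
    have ci0: "c p $ i = 0" using i by (simp add: J_def)
    from coordinate_ratio[OF A.smooth_chart B.smooth_chart pU pU' ci0 zero]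
    show "\<exists>Wr. openin P (fst Wr) \<and> p \<in> fst Wr \<and> fst Wr \<subseteq> U \<inter> U' \<and> psmooth (fst Wr) (snd Wr :: 'p \<Rightarrow> real) \<and>
      (\<forall>y\<in>fst Wr. 0 < snd Wr y \<and> c' y $ m i = snd Wr y * c y $ i)"
      by (simp add: split_paired_Ex)
  qed
  from bchoice[OF this] obtain Wr where Wr: "\<forall>i\<in>J. openin P (fst (Wr i)) \<and> p \<in> fst (Wr i) \<and> fst (Wr i) \<subseteq> U \<inter> U' \<and>
    psmooth (fst (Wr i)) (snd (Wr i) :: 'p \<Rightarrow> real) \<and>
    (\<forall>y\<in>fst (Wr i). 0 < snd (Wr i) y \<and> c' y $ m i = snd (Wr i) y * c y $ i)" ..
  obtain W0 u where W0: "openin P W0" "p \<in> W0" "psmooth W0 u" "\<forall>y\<in>W0. \<sigma>' y = act (tor (u y)) (\<sigma> y)"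
    using trans[of p] pU pU' by (elim meta_impE exE conjE) simp_all
  obtain W1 where W1: "openin P W1" "p \<in> W1" "W1 \<subseteq> U" "\<forall>y\<in>W1. \<forall>i. c p $ i \<noteq> 0 \<longrightarrow> c y $ i \<noteq> 0"
    using nonzero_coordinates_open[OF A.smooth_chart pU] by (elim exE conjE)
  obtain W2 where W2: "openin P W2" "p \<in> W2" "W2 \<subseteq> U'" "\<forall>y\<in>W2. \<forall>i. c' p $ i \<noteq> 0 \<longrightarrow> c' y $ i \<noteq> 0"
    using nonzero_coordinates_open[OF B.smooth_chart pU'] by (elim exE conjE)
  \<comment> \<open>\<open>topspace P\<close> is inserted to keep the family nonempty when
    \<open>p\<close> is an interior point and \<open>J\<close> is empty.\<close>
  define W where "W = (W0 \<inter> (W1 \<inter> W2)) \<inter> \<Inter>(insert (topspace P) ((\<lambda>i. fst (Wr i)) ` J))"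
  have oW: "openin P W"
    unfolding W_def using W0(1) W1(1) W2(1) Wr by (intro openin_Int openin_Inter) auto
  have pW: "p \<in> W" using W0(2) W1(2) W2(2) Wr openin_subset[OF W0(1)] by (auto simp: W_def)
  have WW: "W \<subseteq> W0" "W \<subseteq> W1" "W \<subseteq> W2" "\<And>i. i \<in> J \<Longrightarrow> W \<subseteq> fst (Wr i)" by (auto simp: W_def)
  interpret pair: quotient_chart_pair P \<A> E act \<mu> isotropy U c I \<sigma> b U' c' I' \<sigma>' b' W u J J' m m' "\<lambda>i. snd (Wr i)"
  proof unfold_locales
    show "openin P W" by (rule oW)
    show "W \<subseteq> U" "W \<subseteq> U'" using WW(2,3) W1(3) W2(3) by blast+
    show "psmooth W u" by (rule psmooth_subset[OF W0(3) WW(1)])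
    show "\<sigma>' y = act (tor (u y)) (\<sigma> y)" if "y \<in> W" for y using W0(4) WW(1) that by blast
    show "c y $ i \<noteq> 0" if "y \<in> W" "i \<notin> J" for y i using W1(4) WW(2) that by (auto simp: J_def)
    show "c' y $ j \<noteq> 0" if "y \<in> W" "j \<notin> J'" for y j using W2(4) WW(3) that by (auto simp: J'_def)
    show "m i \<in> J'" if "i \<in> J" for i by (rule m1(1)[OF that])
    show "m' (m i) = i" if "i \<in> J" for i by (rule m3[OF that])
    show "m' j \<in> J" if "j \<in> J'" for j by (rule m2(1)[OF that])
    show "m (m' j) = j" if "j \<in> J'" for j by (rule m4[OF that])
    show "b' (m i) = b i" if i: "i \<in> J" for i
    proof -
      have "m i \<in> I'" "i \<in> I" using m1(1)[OF i] i JI JI' by blast+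
      then have "b' (m i) = \<xi> (H' (m i))" "b i = \<xi> (H i)" using H(4) H'(4) by simp_all
      then show ?thesis using m1(2)[OF i] by simp
    qed
    show "psmooth W (snd (Wr i))" if i: "i \<in> J" for i
      by (rule psmooth_subset[OF _ WW(4)[OF i]]) (use Wr i in blast)
    show "0 < snd (Wr i) y" if "i \<in> J" "y \<in> W" for i y using Wr WW(4)[OF that(1)] that by blast
    show "c' y $ m i = snd (Wr i) y * c y $ i" if "i \<in> J" "y \<in> W" for i y using Wr WW(4)[OF that(1)] that by blast
  qed
  have "A.ci (sqn z0) \<in> W" using pW by (simp add: p_def)
  from pair.compatible_at[OF z0(1) this]
  show "\<exists>\<omega> f f'. orbifold_chart X \<omega> \<and> C \<in> orbi_chart_range \<omega> \<and>
    orbi_chart_range \<omega> \<subseteq> orbi_chart_range (chart_of U c I \<sigma> b) \<inter> orbi_chart_range (chart_of U' c' I' \<sigma>' b') \<and>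
    orbifold_embedding \<omega> (chart_of U c I \<sigma> b) f \<and> orbifold_embedding \<omega> (chart_of U' c' I' \<sigma>' b') f'"
    unfolding z0(2) .
qed

section \<open>The atlas and the properties of the orbifold\<close>

lemma isotropy_trivial_point:
  assumes "topspace P \<noteq> {}"
  obtains p where "p \<in> topspace P" "isotropy p = {0}"
proof -
  obtain q where q: "q \<in> topspace P" using assms by blast
  obtain U c where U: "model_chart U c {i. c q $ i = 0}" "q \<in> U" "U \<subseteq> topspace P"
    by (rule model_chart_at[OF openin_topspace q])
  obtain p where p: "p \<in> piece U c {}"
    by (rule piece_nonempty[OF U(1), of "{}"]) auto
  have pU: "p \<in> U" "{i. c p $ i = 0} = {}" using p by (auto simp: piece_def)
  have "p \<in> stratum P \<A> 0" using piece_subset_stratum[OF model_chartD(1)[OF U(1)], of "{}"] p by auto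
  then have "facets_at p = {}" using finite_facets_at[OF nice, of p 0] by simp
  then have "isotropy p = {0}" by (simp add: isotropy_def)
  then show thesis using that pU(1) U(3) by blast
qed

theorem torus_orbifold:
  assumes conn: "connected_space P" and ne: "topspace P \<noteq> {}"
  obtains \<O> where "\<forall>\<kappa>\<in>\<O>. \<exists>x\<in>topspace E. X_chart P \<A> \<xi> E act \<mu> x \<kappa>"
    "\<forall>x\<in>topspace E. \<exists>\<kappa>\<in>\<O>. X_chart P \<A> \<xi> E act \<mu> x \<kappa>" "locally_standard_torus_orbifold X Xact \<O>"
proof -
  obtain \<S> :: "('p set \<times> ('p \<Rightarrow> 'e)) set" where S: "\<forall>(N, \<sigma>)\<in>\<S>. section_on N \<sigma>"
    "\<forall>p\<in>topspace P. \<exists>(N, \<sigma>)\<in>\<S>. p \<in> N"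
    "\<forall>(N, \<sigma>)\<in>\<S>. \<forall>(N', \<sigma>')\<in>\<S>. \<forall>p\<in>N \<inter> N'. \<exists>W u. openin P W \<and> p \<in> W \<and> W \<subseteq> N \<inter> N' \<and> psmooth W u \<and>
       (\<forall>y\<in>W. \<sigma>' y = act (tor (u y)) (\<sigma> y))"
    by (rule smooth_sections)
  \<comment> \<open>Besides being an \<open>X_chart\<close>, a member must arise from adapted data
    over a section in the family \<open>\<S>\<close>: only for these sections are smooth transition
    lifts available.\<close>
  define \<O> where "\<O> = {\<kappa>. (\<exists>x\<in>topspace E. X_chart P \<A> \<xi> E act \<mu> x \<kappa>) \<and>
    (\<exists>N U c I \<sigma> b H. (N, \<sigma>) \<in> \<S> \<and> U \<subseteq> N \<and> adapted U c I \<sigma> b H \<and> \<kappa> = chart_of U c I \<sigma> b)}"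
  have O: thesis' if "\<kappa> \<in> \<O>" "\<And>N U c I \<sigma> b H. (N, \<sigma>) \<in> \<S> \<Longrightarrow> U \<subseteq> N \<Longrightarrow> adapted U c I \<sigma> b H \<Longrightarrow> \<kappa> = chart_of U c I \<sigma> b \<Longrightarrow> thesis'"
    for \<kappa> thesis'
    using that(1) unfolding \<O>_def by (elim CollectE conjE exE) (rule that(2))
  have at: "\<exists>\<kappa>\<in>\<O>. X_chart P \<A> \<xi> E act \<mu> x \<kappa> \<and> (\<exists>U c I \<sigma> b H. adapted U c I \<sigma> b H \<and> \<mu> x \<in> U \<and> \<kappa> = chart_of U c I \<sigma> b)"
    if x: "x \<in> topspace E" for x
  proof -
    obtain N \<sigma> where N: "(N, \<sigma>) \<in> \<S>" "\<mu> x \<in> N" using S(2) \<mu>_closed[OF x] by fastforce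
    have sec: "section_on N \<sigma>" using S(1) N(1) by blast
    obtain U c I b H where U: "U \<subseteq> N" "\<mu> x \<in> U" "adapted U c I \<sigma> b H"
      "X_chart P \<A> \<xi> E act \<mu> x (chart_of U c I \<sigma> b)"
      by (rule adapted_chart_exists[OF x sec N(2)])
    have "\<exists>x\<in>topspace E. X_chart P \<A> \<xi> E act \<mu> x (chart_of U c I \<sigma> b)"
      by (rule bexI[where x = x]) (rule U(4), rule x)
    then have "chart_of U c I \<sigma> b \<in> \<O>"
      unfolding \<O>_def
      by (intro CollectI conjI exI[of _ N] exI[of _ U] exI[of _ c] exI[of _ I] exI[of _ \<sigma>]
          exI[of _ b] exI[of _ H] N(1) U(1,3) refl)
    then show ?thesis
      using U by (intro bexI[of _ "chart_of U c I \<sigma> b"] conjI exI[of _ U] exI[of _ c] exI[of _ I] exI[of _ \<sigma>]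
          exI[of _ b] exI[of _ H]) simp_all
  qed
  have chart: "orbifold_chart X \<kappa>" "isometric_chart \<kappa>" "standard_orbi_chart Xact \<kappa>"
    "\<forall>t\<in>carrier (torus UNIV). Xact t ` orbi_chart_range \<kappa> \<subseteq> orbi_chart_range \<kappa>"
    if ad: "adapted U c I \<sigma> b H" "\<kappa> = chart_of U c I \<sigma> b" for \<kappa> U c I \<sigma> b H
  proof -
    interpret Q: quotient_chart P \<A> E act \<mu> isotropy U c I \<sigma> b using ad(1) by (simp add: adapted_def)
    show "orbifold_chart X \<kappa>" "isometric_chart \<kappa>" "standard_orbi_chart Xact \<kappa>"
      unfolding ad(2) by (rule Q.orbifold_chart_\<phi> Q.isometric_\<phi> Q.standard_\<phi>)+
    show "\<forall>t\<in>carrier (torus UNIV). Xact t ` orbi_chart_range \<kappa> \<subseteq> orbi_chart_range \<kappa>"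
      using Q.invariant_\<phi> by (auto simp: ad(2) orbi_chart_range_def carrier_torus_UNIV)
  qed
  have range: "orbi_chart_range (chart_of U c I \<sigma> b) = {C \<in> topspace X. \<pi> C \<in> U}" if "adapted U c I \<sigma> b H" for U c I \<sigma> b H
  proof -
    interpret Q: quotient_chart P \<A> E act \<mu> isotropy U c I \<sigma> b using that by (simp add: adapted_def)
    show ?thesis using Q.\<phi>_image by (simp add: orbi_chart_range_def)
  qed
  have openU: "openin P U" if "adapted U c I \<sigma> b H" for U c I \<sigma> b H
  proof -
    interpret Q: quotient_chart P \<A> E act \<mu> isotropy U c I \<sigma> b using that by (simp add: adapted_def)
    show ?thesis by (rule section_onD(1)[OF Q.sec])
  qed
  have O_chart: "orbifold_chart X \<kappa>" if "\<kappa> \<in> \<O>" for \<kappa>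
    using that by (rule O) (rule chart(1))
  have cover: "\<exists>\<kappa>\<in>\<O>. C \<in> orbi_chart_range \<kappa>" if C: "C \<in> topspace X" for C
  proof -
    obtain x where x: "x \<in> topspace E" "C = cls x" using C by (auto simp: topspace_X)
    obtain \<kappa> U c I \<sigma> b H where \<kappa>: "\<kappa> \<in> \<O>" "adapted U c I \<sigma> b H" "\<mu> x \<in> U" "\<kappa> = chart_of U c I \<sigma> b"
      using at[OF x(1)] by (elim bexE conjE exE)
    have "C \<in> orbi_chart_range \<kappa>" unfolding \<kappa>(4) range[OF \<kappa>(2)] using x \<kappa>(3) C by (simp add: \<pi>_cls)
    then show ?thesis using \<kappa>(1) by blast
  qed
  have O_open: "openin X (orbi_chart_range \<kappa>)" if "\<kappa> \<in> \<O>" for \<kappa>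
    using orbifold_chartD(7)[of X "fst \<kappa>" "fst (snd \<kappa>)" "snd (snd \<kappa>)"] O_chart[OF that]
    by (simp add: orbi_chart_range_def split_beta)
  have compactX: "compact_space X" by (rule compact_space_X[OF compact regular])
  \<comment> \<open>Classes over different base points are separated in \<open>P\<close>. Classes
    over the same base point lie in a common chart, because a chart range is the full preimage of
    its domain in \<open>P\<close>, and there the finite isometric group separates them.\<close>
  have haus: "Hausdorff_space X"
    unfolding Hausdorff_space_def
  proof (intro allI impI)
    fix C D assume CD: "C \<in> topspace X \<and> D \<in> topspace X \<and> C \<noteq> D"
    then have C: "C \<in> topspace X" "D \<in> topspace X" "C \<noteq> D" by simp_all
    show "\<exists>A B. openin X A \<and> openin X B \<and> C \<in> A \<and> D \<in> B \<and> disjnt A B"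
    proof (cases "\<pi> C = \<pi> D")
      case False
      have "\<pi> C \<in> topspace P" "\<pi> D \<in> topspace P"
        using continuous_map_image_subset_topspace[OF continuous_\<pi>] C by blast+
      then obtain A B where AB: "openin P A" "openin P B" "\<pi> C \<in> A" "\<pi> D \<in> B" "disjnt A B"
        using Hausdorff False unfolding Hausdorff_space_def by meson
      have "openin X {x \<in> topspace X. \<pi> x \<in> A}" "openin X {x \<in> topspace X. \<pi> x \<in> B}"
        by (rule openin_continuous_map_preimage[OF continuous_\<pi> AB(1)],
            rule openin_continuous_map_preimage[OF continuous_\<pi> AB(2)])
      moreover have "disjnt {x \<in> topspace X. \<pi> x \<in> A} {x \<in> topspace X. \<pi> x \<in> B}"
        using AB(5) by (auto simp: disjnt_iff)
      ultimately show ?thesis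
        using C AB by (intro exI[of _ "{x \<in> topspace X. \<pi> x \<in> A}"] exI[of _ "{x \<in> topspace X. \<pi> x \<in> B}"]) simp
    next
      case True
      obtain x where x: "x \<in> topspace E" "C = cls x" using C by (auto simp: topspace_X)
      obtain \<kappa> U c I \<sigma> b H where \<kappa>: "adapted U c I \<sigma> b H" "\<mu> x \<in> U" "\<kappa> = chart_of U c I \<sigma> b"
        using at[OF x(1)] by (elim bexE conjE exE)
      obtain V G \<phi> where k: "\<kappa> = (V, G, \<phi>)" by (cases \<kappa>)
      have "C \<in> orbi_chart_range \<kappa>" "D \<in> orbi_chart_range \<kappa>"
        unfolding \<kappa>(3) range[OF \<kappa>(1)] using x \<kappa>(2) C True by (simp_all add: \<pi>_cls)
      then have "C \<in> \<phi> ` V" "D \<in> \<phi> ` V" by (simp_all add: k orbi_chart_range_def)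
      then obtain u v where uv: "u \<in> V" "v \<in> V" "C = \<phi> u" "D = \<phi> v" by (elim imageE)
      have ne: "\<phi> u \<noteq> \<phi> v" using C(3) uv by simp
      obtain A B where "openin X A" "openin X B" "\<phi> u \<in> A" "\<phi> v \<in> B" "A \<inter> B = {}"
        by (rule isometric_chart_separates[OF chart(1)[OF \<kappa>(1,3), unfolded k] chart(2)[OF \<kappa>(1,3), unfolded k] uv(1,2) ne])
      then show ?thesis using uv by (intro exI[of _ A] exI[of _ B]) (simp add: disjnt_def)
    qed
  qed
  \<comment> \<open>By compactness finitely many chart ranges cover, and images of a countable basis
    of the model space under these charts form a countable basis.\<close>
  have second: "second_countable X"
  proof -
    have "\<forall>W\<in>orbi_chart_range ` \<O>. openin X W" using O_open by simp
    moreover have "topspace X \<subseteq> \<Union>(orbi_chart_range ` \<O>)" using cover by blast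
    ultimately obtain \<F> where F: "finite \<F>" "\<F> \<subseteq> orbi_chart_range ` \<O>" "topspace X \<subseteq> \<Union>\<F>"
      using compactX unfolding compact_space_alt by meson
    obtain \<K> where K: "\<K> \<subseteq> \<O>" "finite \<K>" "\<F> = orbi_chart_range ` \<K>"
      using finite_subset_image[OF F(1,2)] by auto
    show ?thesis
      by (rule second_countable_from_charts[OF K(2)]) (use O_chart K F(3) in auto)
  qed
  have compat: "orbi_compatible X \<kappa> \<kappa>'" if k: "\<kappa> \<in> \<O>" "\<kappa>' \<in> \<O>" for \<kappa> \<kappa>'
  proof (rule O[OF k(1)], rule O[OF k(2)])
    fix N U c I \<sigma> b H N' U' c' I' \<sigma>' b' H'
    assume *: "(N, \<sigma>) \<in> \<S>" "U \<subseteq> N" "adapted U c I \<sigma> b H" "\<kappa> = chart_of U c I \<sigma> b"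
      "(N', \<sigma>') \<in> \<S>" "U' \<subseteq> N'" "adapted U' c' I' \<sigma>' b' H'" "\<kappa>' = chart_of U' c' I' \<sigma>' b'"
    show "orbi_compatible X \<kappa> \<kappa>'"
      unfolding *(4,8)
    proof (rule adapted_compatible[OF *(3,7)])
      fix p assume "p \<in> U \<inter> U'"
      then have "p \<in> N \<inter> N'" using *(2,6) by blast
      moreover have "\<forall>p\<in>N \<inter> N'. \<exists>W u. openin P W \<and> p \<in> W \<and> W \<subseteq> N \<inter> N' \<and> psmooth W u \<and>
          (\<forall>y\<in>W. \<sigma>' y = act (tor (u y)) (\<sigma> y))"
        by (rule bspec[OF bspec[OF S(3) *(1), unfolded prod.case] *(5), unfolded prod.case])
      ultimately have "\<exists>W u. openin P W \<and> p \<in> W \<and> W \<subseteq> N \<inter> N' \<and> psmooth W u \<and>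
          (\<forall>y\<in>W. \<sigma>' y = act (tor (u y)) (\<sigma> y))" by (rule bspec[rotated])
      then obtain W u where "openin P W" "p \<in> W" "psmooth W u" "\<forall>y\<in>W. \<sigma>' y = act (tor (u y)) (\<sigma> y)"
        by (elim exE conjE)
      then show "\<exists>W u. openin P W \<and> p \<in> W \<and> psmooth W u \<and> (\<forall>y\<in>W. \<sigma>' y = act (tor (u y)) (\<sigma> y))"
        by (intro exI[of _ W] exI[of _ u]) simp
    qed
  qed
  have orb: "orbifold X \<O>"
    unfolding orbifold_def
  proof (intro conjI ballI haus second)
    show "\<Union>(orbi_chart_range ` \<O>) = topspace X"
    proof
      show "\<Union>(orbi_chart_range ` \<O>) \<subseteq> topspace X" using O_open openin_subset by blast
      show "topspace X \<subseteq> \<Union>(orbi_chart_range ` \<O>)" using cover by blast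
    qed
  qed (simp_all add: O_chart compat)
  \<comment> \<open>Effectiveness of the action is read off from the fibre over an interior point of
    \<open>P\<close>, where nothing is collapsed.\<close>
  obtain p0 where p0: "p0 \<in> topspace P" "isotropy p0 = {0}" using ne by (rule isotropy_trivial_point)
  have "locally_standard_torus_orbifold X Xact \<O>"
    unfolding locally_standard_torus_orbifold_def
  proof (intro conjI ballI orb compactX connected_space_X[OF conn] faithful_action_X[OF p0] continuous_Xact)
    have "topspace E \<noteq> {}" using p0(1) quotient_imp_surjective_map[OF quotient_map_\<mu>] by auto
    then show "topspace X \<noteq> {}" by (simp add: topspace_X)
    fix C assume C: "C \<in> topspace X"
    then obtain x where x: "x \<in> topspace E" "C = cls x" by (auto simp: topspace_X)
    obtain \<kappa> U c I \<sigma> b H where \<kappa>: "\<kappa> \<in> \<O>" "adapted U c I \<sigma> b H" "\<mu> x \<in> U" "\<kappa> = chart_of U c I \<sigma> b"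
      using at[OF x(1)] by (elim bexE conjE exE)
    have "C \<in> orbi_chart_range \<kappa>" unfolding \<kappa>(4) range[OF \<kappa>(2)] using x \<kappa>(3) C by (simp add: \<pi>_cls)
    moreover have "smooth_orbi_chart X \<O> \<kappa>"
      unfolding smooth_orbi_chart_def using O_chart[OF \<kappa>(1)] compat[OF \<kappa>(1)] by simp
    ultimately show "\<exists>\<kappa>. smooth_orbi_chart X \<O> \<kappa> \<and> C \<in> orbi_chart_range \<kappa> \<and>
      (\<forall>t\<in>carrier (torus UNIV). Xact t ` orbi_chart_range \<kappa> \<subseteq> orbi_chart_range \<kappa>) \<and> standard_orbi_chart Xact \<kappa>"
      using chart(3,4)[OF \<kappa>(2,4)] by (intro exI[of _ \<kappa>]) simp
  qed
  moreover have "\<forall>\<kappa>\<in>\<O>. \<exists>x\<in>topspace E. X_chart P \<A> \<xi> E act \<mu> x \<kappa>" by (simp add: \<O>_def)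
  moreover have "\<forall>x\<in>topspace E. \<exists>\<kappa>\<in>\<O>. X_chart P \<A> \<xi> E act \<mu> x \<kappa>"
  proof
    fix x assume "x \<in> topspace E"
    from at[OF this] show "\<exists>\<kappa>\<in>\<O>. X_chart P \<A> \<xi> E act \<mu> x \<kappa>" by (elim bexE conjE) (rule bexI)
  qed
  ultimately show thesis by (intro that)
qed

end

theorem lemma3p9:
  fixes P :: "'p topology" and \<A> :: "('p, 'n::finite) corner_chart set"
    and E :: "'e topology" and \<B> :: "('e, 'd::finite) corner_chart set"
    and \<xi> :: "'p set \<Rightarrow> int ^ 'n"
    and act :: "(real ^ 'n) set \<Rightarrow> 'e \<Rightarrow> 'e"
    and \<mu> :: "'e \<Rightarrow> 'p"
  assumes "manifold_with_corners P \<A>" and "nice P \<A>" and "orientable P \<A>"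
    and "compact_space P" and "connected_space P" and "topspace P \<noteq> {}"
    and "rational_characteristic P \<A> \<xi>"
    and "manifold_with_corners E \<B>" and "nice E \<B>" and "orientable E \<B>"
    and "principal_torus_bundle E act P \<mu>"
    and "preserves_faces E \<B> P \<A> \<mu>"
  shows "\<exists>\<O> \<pi>.
    (\<forall>\<kappa>\<in>\<O>. \<exists>x\<in>topspace E. X_chart P \<A> \<xi> E act \<mu> x \<kappa>) \<and>
    (\<forall>x\<in>topspace E. \<exists>\<kappa>\<in>\<O>. X_chart P \<A> \<xi> E act \<mu> x \<kappa>) \<and>
    locally_standard_torus_orbifold (X_space P \<A> \<xi> E act \<mu>) (X_act P \<A> \<xi> E act \<mu>) \<O> \<and>
    (\<forall>x\<in>topspace E. \<pi> (X_class P \<A> \<xi> E act \<mu> x) = \<mu> x) \<and>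
    orbit_map (X_space P \<A> \<xi> E act \<mu>) (X_act P \<A> \<xi> E act \<mu>) P \<pi>"
proof -
  interpret characteristic_bundle P \<A> E act \<mu> \<xi>
    by unfold_locales (fact assms)+
  obtain \<O> where O: "\<forall>\<kappa>\<in>\<O>. \<exists>x\<in>topspace E. X_chart P \<A> \<xi> E act \<mu> x \<kappa>"
    "\<forall>x\<in>topspace E. \<exists>\<kappa>\<in>\<O>. X_chart P \<A> \<xi> E act \<mu> x \<kappa>" "locally_standard_torus_orbifold X Xact \<O>"
    using assms(5,6) by (rule torus_orbifold)
  have "\<forall>x\<in>topspace E. \<pi> (X_class P \<A> \<xi> E act \<mu> x) = \<mu> x"
    by (simp add: X_class_eq \<pi>_cls)
  then show ?thesis
    unfolding X_space_eq X_act_eq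
    using O orbit_map_\<pi> by (intro exI[of _ \<O>] exI[of _ \<pi>] conjI)
qed

end
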